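(* Let $m,n\in\mathbb{N}$, $d=m+n$, and fix norms $\|\cdot\|_\mu,\|\cdot\|_\nu$. For every $\varepsilon>0$ there is $\delta>0$, depending only on $\varepsilon,m,n,\|\cdot\|_\mu,\|\cdot\|_\nu$, such that the following holds. Let $\Lambda\subset\mathbb{R}^d$ be a unimodular lattice, let $1\le Q_1\le Q_2$, and let $\psi:[Q_1,Q_2]\to(0,\infty)$ be such that $q\mapsto\psi(q)/q^{-n/m}$ is nonincreasing. If \[ Q_1\ge \mathrm{Irr}(\Lambda)/\delta,\qquad \phi(Q_1)\le\delta F_\psi(Q_1,Q_2),\qquad F_\psi(Q_1,Q_2)\le\delta, \] then \[ \Big|\lambda\big(\mathcal K\cap W_{\psi,\Lambda}(Q_1,Q_2)\big)-\eta_{\mu,\nu}F_\psi(Q_1,Q_2)\Big|\le\varepsilon\,\eta_{\mu,\nu}F_\psi(Q_1,Q_2). \]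
   Context: $M$ denotes real $m\times n$ matrices, identified with $\mathbb{R}^{mn}$; $\mathcal K\subset M$ is the set of matrices with all entries in $[0,1]$ and $\lambda$ is Lebesgue measure on $\mathbb{R}^{mn}$. Vectors $\mathbf r\in\mathbb{R}^d$ are written $\mathbf r=(\mathbf p,\mathbf q)$ with $\mathbf p\in\mathbb{R}^m,\mathbf q\in\mathbb{R}^n$, and $\|\mathbf r\|=\|\mathbf p\|_\mu\vee\|\mathbf q\|_\nu$. A lattice is unimodular if it has covolume 1. $\lambda_1(\Lambda)=\min_{\mathbf r\in\Lambda\setminus\{\mathbf 0\}}\|\mathbf r\|$ and $\mathrm{Irr}(\Lambda)=\lambda_1(\Lambda)^{-(2d-1)}$. $\Delta_\psi(\mathbf p,\mathbf q)=\{A\in M:\|A\mathbf q-\mathbf p\|_\mu\le\psi(\|\mathbf q\|_\nu)\}$ and $W_{\psi,\Lambda}(Q_1,Q_2)=\bigcup\{\Delta_\psi(\mathbf r):\mathbf r\in\Lambda,\ Q_1\le\|\mathbf q\|_\nu\le Q_2\}$. $\phi(q)=q^n\psi^m(q)$, $F_\psi(Q_1,Q_2)=\int_{Q_1}^{Q_2}q^{n-1}\psi^m(q)\,dq$, and $\eta_{\mu,\nu}=\frac{nV_\mu V_\nu}{2\zeta(d)}$, where $V_\mu,V_\nu$ are Lebesgue volumes of the closed unit balls of $\|\cdot\|_\mu,\|\cdot\|_\nu$. *)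

theory Defs
  imports "HOL-Analysis.Analysis"
begin

text \<open>
  Vectors of the two factors are \<open>real ^ 'm\<close> and \<open>real ^ 'n\<close>, so that the dimensions
  \<open>m = CARD('m)\<close> and \<open>n = CARD('n)\<close> are arbitrary positive integers. The space of
  \<open>m \<times> n\<close> matrices is \<open>real ^ 'n ^ 'm\<close>, whose Lebesgue measure is the one on
  \<open>m n\<close>-dimensional Euclidean space, and \<open>d\<close>-dimensional space is the product
  \<open>(real ^ 'm) \<times> (real ^ 'n)\<close>, with \<open>r = (p, q)\<close>.
\<close>

definition is_norm :: "('a::real_vector \<Rightarrow> real) \<Rightarrow> bool" where
  "is_norm N \<longleftrightarrow>
     (\<forall>x. 0 \<le> N x) \<and> (\<forall>x. N x = 0 \<longleftrightarrow> x = 0) \<and>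
     (\<forall>c x. N (c *\<^sub>R x) = \<bar>c\<bar> * N x) \<and> (\<forall>x y. N (x + y) \<le> N x + N y)"

definition max_norm :: "('a \<Rightarrow> real) \<Rightarrow> ('b \<Rightarrow> real) \<Rightarrow> 'a \<times> 'b \<Rightarrow> real" where
  "max_norm N\<mu> N\<nu> r = max (N\<mu> (fst r)) (N\<nu> (snd r))"

definition lattice_basis :: "'a::euclidean_space set \<Rightarrow> 'a set \<Rightarrow> bool" where
  "lattice_basis B \<Lambda> \<longleftrightarrow>
     independent B \<and> span B = UNIV \<and>
     \<Lambda> = {\<Sum>b\<in>B. of_int (c b) *\<^sub>R b | c :: 'a \<Rightarrow> int. True}"

definition fundamental_parallelepiped :: "'a::euclidean_space set \<Rightarrow> 'a set" where
  "fundamental_parallelepiped B =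
     {\<Sum>b\<in>B. t b *\<^sub>R b | t :: 'a \<Rightarrow> real. \<forall>b\<in>B. 0 \<le> t b \<and> t b < 1}"

text \<open>
  A (full-rank) lattice is the set of integer combinations of a basis of the space. Its
  covolume is the volume of the fundamental parallelepiped spanned by such a basis; this
  volume is the same for all bases of a given lattice, so it makes no difference below
  that one basis is chosen existentially.
\<close>

definition unimodular_lattice :: "'a::euclidean_space set \<Rightarrow> bool" where
  "unimodular_lattice \<Lambda> \<longleftrightarrow>
     (\<exists>B. lattice_basis B \<Lambda> \<and> measure lebesgue (fundamental_parallelepiped B) = 1)"

text \<open>The infimum is attained when \<open>\<Lambda>\<close> is a lattice and \<open>N\<close> is a norm.\<close>

definition lambda1 :: "('a::euclidean_space \<Rightarrow> real) \<Rightarrow> 'a set \<Rightarrow> real" where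
  "lambda1 N \<Lambda> = (INF r\<in>\<Lambda> - {0}. N r)"

definition Irr :: "('a::euclidean_space \<Rightarrow> real) \<Rightarrow> 'a set \<Rightarrow> real" where
  "Irr N \<Lambda> = 1 / lambda1 N \<Lambda> ^ (2 * DIM('a) - 1)"

definition unit_matrices :: "(real ^ 'n ^ 'm) set" where
  "unit_matrices = {A. \<forall>i j. A $ i $ j \<in> {0..1}}"

definition Delta ::
  "(real ^ 'm \<Rightarrow> real) \<Rightarrow> (real ^ 'n \<Rightarrow> real) \<Rightarrow> (real \<Rightarrow> real) \<Rightarrow>
   (real ^ 'm) \<times> (real ^ 'n) \<Rightarrow> (real ^ 'n ^ 'm) set" where
  "Delta N\<mu> N\<nu> \<psi> r = {A. N\<mu> (A *v snd r - fst r) \<le> \<psi> (N\<nu> (snd r))}"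

definition W ::
  "(real ^ 'm \<Rightarrow> real) \<Rightarrow> (real ^ 'n \<Rightarrow> real) \<Rightarrow> (real \<Rightarrow> real) \<Rightarrow>
   ((real ^ 'm) \<times> (real ^ 'n)) set \<Rightarrow> real \<Rightarrow> real \<Rightarrow> (real ^ 'n ^ 'm) set" where
  "W N\<mu> N\<nu> \<psi> \<Lambda> Q1 Q2 =
     (\<Union>r \<in> {r \<in> \<Lambda>. Q1 \<le> N\<nu> (snd r) \<and> N\<nu> (snd r) \<le> Q2}. Delta N\<mu> N\<nu> \<psi> r)"

definition phi :: "nat \<Rightarrow> nat \<Rightarrow> (real \<Rightarrow> real) \<Rightarrow> real \<Rightarrow> real" where
  "phi m n \<psi> q = q ^ n * \<psi> q ^ m"

definition F :: "nat \<Rightarrow> nat \<Rightarrow> (real \<Rightarrow> real) \<Rightarrow> real \<Rightarrow> real \<Rightarrow> real" where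
  "F m n \<psi> Q1 Q2 = integral {Q1..Q2} (\<lambda>q. q ^ (n - 1) * \<psi> q ^ m)"

text \<open>The Riemann zeta function at integers \<open>s \<ge> 2\<close>.\<close>

definition zeta_nat :: "nat \<Rightarrow> real" where
  "zeta_nat s = (\<Sum>k. 1 / real (Suc k) ^ s)"

definition unit_ball_volume :: "('a::euclidean_space \<Rightarrow> real) \<Rightarrow> real" where
  "unit_ball_volume N = measure lebesgue {x. N x \<le> 1}"

definition eta :: "(real ^ 'm \<Rightarrow> real) \<Rightarrow> (real ^ 'n \<Rightarrow> real) \<Rightarrow> real" where
  "eta N\<mu> N\<nu> =
     real CARD('n) * unit_ball_volume N\<mu> * unit_ball_volume N\<nu> /
     (2 * zeta_nat (CARD('m) + CARD('n)))"

end

theory Submission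
  imports Defs "HOL-Computational_Algebra.Squarefree"
begin

text \<open>
  Cut the range of denominators into shells \<open>T < N\<nu> (snd r) \<le> (1 + \<tau>) T\<close> and keep only primitive
  \<open>r\<close>; the other vectors matter only near \<open>Q1\<close>. Averaging over rank-one perturbations of the matrix
  replaces the thin set \<open>{A. N\<mu> (A *v snd r - fst r) \<le> c}\<close> by a thick one, so that the sum of the
  measures over a shell becomes a count of primitive lattice vectors in a nice region, which Moebius
  inversion evaluates up to the error allowed by the irregularity of \<open>\<Lambda>\<close>. As \<open>r\<close> and \<open>- r\<close> give
  the same set, half of this sum bounds the measure of the union from above.

  For the lower bound the overlaps must be summed. Two sets overlap about as much as independent
  ones, unless \<open>r\<close> and \<open>s\<close> span a parallelogram of small area. Discarding the few \<open>s\<close> for which this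
  happens, the balls of a fixed radius about the remaining lattice points of the relevant tube around
  the line of \<open>s\<close> are disjoint, and the sum of the overlaps is \<open>O (F\<^sup>2)\<close>, hence negligible for small \<open>F\<close>.
\<close>

subsection \<open>Unimodular lattices and fundamental domains\<close>

text \<open>Everything has to be uniform in \<open>\<Lambda>\<close>, which may be very skew. Its
  shape enters only through a lower bound \<open>a\<close> for the lengths of nonzero vectors and
  through the last successive minimum \<open>last_min\<close>, which is O(a^(1 - d)) and controls
  the covering radius. Primitive vectors up to height T are counted with an error governed by
  last_min / T and by last_min^d / (a T^(d - 1)); both are small once T a^(2 d - 1) is large, and
  this is the hypothesis on \<open>Irr\<close>. The threshold D for small areas satisfies D^(d - 1)
  = \<kappa> T^(d - 2). Then a proportion O(\<kappa>) of the shell at height T is discarded, up to a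
  negligible number, while the overlaps of the rest sum to O(F^2 / \<kappa>). So \<kappa> is fixed
  first, in terms of \<epsilon>, and F is taken small afterwards. The hypothesis on phi(Q1) pays
  twice: for the multiples of primitive vectors with denominator below Q1, and for the gap between
  the two Riemann sums of F given by the radii at the inner and at the outer ends of the shells.
  Together with the bound on F it also makes \<psi> small.\<close>

locale unimodular =
  fixes \<Lambda> :: "'a::euclidean_space set"
  assumes unimod: "unimodular_lattice \<Lambda>"
begin

text \<open>The half-open parallelepiped serves: subtracting the floors of the coordinates moves a
  point into it, and two of its points whose coordinates differ by integers have coordinate
  differences below 1, hence 0.\<close>

lemma fundamental_domain:
  obtains D where "D \<in> sets borel" "bounded D" "measure lebesgue D = 1"
    "\<And>x. \<exists>r\<in>\<Lambda>. x - r \<in> D"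
    "\<And>x y. x \<in> D \<Longrightarrow> y \<in> D \<Longrightarrow> x - y \<in> \<Lambda> \<Longrightarrow> x = y"
proof -
  obtain B where B: "lattice_basis B \<Lambda>" and m1: "measure lebesgue (fundamental_parallelepiped B) = 1"
    using unimod by (auto simp: unimodular_lattice_def)
  let ?D = "fundamental_parallelepiped B"
  have ind: "independent B" and sp: "span B = UNIV"
    and L: "\<Lambda> = {\<Sum>b\<in>B. of_int (c b) *\<^sub>R b | c. True}"
    using B by (auto simp: lattice_basis_def)
  have fin: "finite B" using ind by (rule finiteI_independent)
  define f where "f b x = representation B x b" for b x
  have f_sum: "(\<Sum>b\<in>B. f b x *\<^sub>R b) = x" for x
    unfolding f_def using sum_representation_eq[OF ind _ fin subset_refl] sp by auto
  have f_eq: "f b (\<Sum>b\<in>B. t b *\<^sub>R b) = t b" if "b \<in> B" for b t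
  proof -
    have "representation B (\<Sum>b\<in>B. t b *\<^sub>R b) = (\<lambda>b. if b \<in> B then t b else 0)"
    proof (rule representation_eqI[OF ind])
      show "(\<Sum>b\<in>B. t b *\<^sub>R b) \<in> span B" using sp by simp
      show "finite {b. (if b \<in> B then t b else 0) \<noteq> 0}"
        by (rule finite_subset[OF _ fin]) auto
      have "(\<Sum>b | (if b \<in> B then t b else 0) \<noteq> 0. (if b \<in> B then t b else 0) *\<^sub>R b)
          = (\<Sum>b\<in>B. (if b \<in> B then t b else 0) *\<^sub>R b)"
        by (rule sum.mono_neutral_left) (use fin in \<open>auto split: if_splits\<close>)
      then show "(\<Sum>b | (if b \<in> B then t b else 0) \<noteq> 0. (if b \<in> B then t b else 0) *\<^sub>R b)
          = (\<Sum>b\<in>B. t b *\<^sub>R b)" by simp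
    qed (auto split: if_splits)
    then show ?thesis using that by (simp add: f_def)
  qed
  have lin: "linear (f b)" for b
    unfolding f_def using ind sp
    by (intro linearI) (simp_all add: representation_add representation_scale)
  have D_iff: "x \<in> ?D \<longleftrightarrow> (\<forall>b\<in>B. 0 \<le> f b x \<and> f b x < 1)" for x
  proof
    assume "x \<in> ?D"
    then obtain t where "x = (\<Sum>b\<in>B. t b *\<^sub>R b)" "\<forall>b\<in>B. 0 \<le> t b \<and> t b < 1"
      by (auto simp: fundamental_parallelepiped_def)
    then show "\<forall>b\<in>B. 0 \<le> f b x \<and> f b x < 1" using f_eq by auto
  next
    assume "\<forall>b\<in>B. 0 \<le> f b x \<and> f b x < 1"
    then show "x \<in> ?D" unfolding fundamental_parallelepiped_def
      by (intro CollectI exI[of _ "\<lambda>b. f b x"]) (simp add: f_sum)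
  qed
  have "?D = (\<Inter>b\<in>B. f b -` {0..<1})" using D_iff by auto
  moreover have "f b -` {0..<1} \<in> sets borel" for b
  proof -
    have "f b \<in> borel_measurable borel"
      using lin[of b] linear_continuous_on[of "f b" UNIV] linear_linear
      by (intro borel_measurable_continuous_onI) blast
    then show ?thesis using measurable_sets[of "f b" borel borel "{0..<1}"] by simp
  qed
  ultimately have meas: "?D \<in> sets borel"
    using fin by (cases "B = {}") (auto intro!: sets.finite_INT)
  have bdd: "bounded ?D"
  proof (rule boundedI)
    fix x assume "x \<in> ?D"
    then have *: "\<forall>b\<in>B. 0 \<le> f b x \<and> f b x < 1" by (simp add: D_iff)
    have "norm x = norm (\<Sum>b\<in>B. f b x *\<^sub>R b)" by (simp add: f_sum)
    also have "\<dots> \<le> (\<Sum>b\<in>B. norm b)"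
      using * by (intro order_trans[OF norm_sum] sum_mono) (auto intro!: mult_left_le_one_le intro: less_imp_le)
    finally show "norm x \<le> (\<Sum>b\<in>B. norm b)" .
  qed
  show ?thesis
  proof (rule that[OF meas bdd m1])
    fix x
    let ?r = "\<Sum>b\<in>B. of_int \<lfloor>f b x\<rfloor> *\<^sub>R b"
    have "x - ?r = (\<Sum>b\<in>B. (f b x - of_int \<lfloor>f b x\<rfloor>) *\<^sub>R b)"
      by (simp add: f_sum scaleR_left_diff_distrib sum_subtractf)
    also have "\<dots> \<in> ?D" unfolding fundamental_parallelepiped_def
      by (auto intro!: exI[of _ "\<lambda>b. f b x - of_int \<lfloor>f b x\<rfloor>"]) linarith
    finally show "\<exists>r\<in>\<Lambda>. x - r \<in> ?D" using L by auto
  next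
    fix x y assume x: "x \<in> ?D" and y: "y \<in> ?D" and "x - y \<in> \<Lambda>"
    then obtain c where c: "x - y = (\<Sum>b\<in>B. of_int (c b) *\<^sub>R b)" using L by auto
    have "f b x = f b y" if b: "b \<in> B" for b
    proof -
      have "f b x - f b y = of_int (c b)"
        using f_eq[OF b, of "\<lambda>b. of_int (c b)"] lin[of b] by (simp add: c[symmetric] linear_diff)
      moreover have "\<bar>f b x - f b y\<bar> < 1" using x y b by (force simp: D_iff)
      ultimately have "real_of_int \<bar>c b\<bar> < 1" by simp
      then have "\<bar>c b\<bar> < 1" by (simp only: of_int_less_1_iff)
      then have "c b = 0" by simp
      then show ?thesis using \<open>f b x - f b y = of_int (c b)\<close> by simp
    qed
    then have "(\<Sum>b\<in>B. f b x *\<^sub>R b) = (\<Sum>b\<in>B. f b y *\<^sub>R b)" by simp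
    then show "x = y" by (simp add: f_sum)
  qed
qed

lemma diff_mem:
  assumes "x \<in> \<Lambda>" "y \<in> \<Lambda>" shows "x - y \<in> \<Lambda>"
proof -
  obtain B where L: "\<Lambda> = {\<Sum>b\<in>B. of_int (c b) *\<^sub>R b | c. True}"
    using unimod by (auto simp: unimodular_lattice_def lattice_basis_def)
  with assms obtain c e where "x = (\<Sum>b\<in>B. of_int (c b) *\<^sub>R b)" "y = (\<Sum>b\<in>B. of_int (e b) *\<^sub>R b)"
    by auto
  then have "x - y = (\<Sum>b\<in>B. of_int (c b - e b) *\<^sub>R b)"
    by (simp add: scaleR_left_diff_distrib sum_subtractf)
  then show "x - y \<in> \<Lambda>" unfolding L by (intro CollectI exI[of _ "\<lambda>b. c b - e b"]) simp
qed

lemma zero_mem: "0 \<in> \<Lambda>"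
proof -
  obtain B where L: "\<Lambda> = {\<Sum>b\<in>B. of_int (c b) *\<^sub>R b | c. True}"
    using unimod by (auto simp: unimodular_lattice_def lattice_basis_def)
  have "(0::'a) = (\<Sum>b\<in>B. of_int 0 *\<^sub>R b)" by simp
  then show ?thesis unfolding L by (intro CollectI exI[of _ "\<lambda>_. 0"]) simp
qed

lemma minus_mem: "x \<in> \<Lambda> \<Longrightarrow> - x \<in> \<Lambda>"
  using diff_mem[OF zero_mem] by simp

lemma add_mem: "x \<in> \<Lambda> \<Longrightarrow> y \<in> \<Lambda> \<Longrightarrow> x + y \<in> \<Lambda>"
  using diff_mem[of x "- y"] minus_mem[of y] by simp

lemma of_nat_scale_mem: "x \<in> \<Lambda> \<Longrightarrow> of_nat k *\<^sub>R x \<in> \<Lambda>"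
  by (induction k) (auto simp: zero_mem scaleR_left_distrib intro: add_mem)

lemma of_int_scale_mem: "x \<in> \<Lambda> \<Longrightarrow> of_int k *\<^sub>R x \<in> \<Lambda>"
  using of_nat_scale_mem[of x "nat k"] minus_mem[OF of_nat_scale_mem[of x "nat (-k)"]]
  by (cases "k \<ge> 0") auto

text \<open>Coordinates with respect to a lattice basis are linear, hence bounded on
  \<open>S\<close>, and on the lattice they are integers.\<close>

lemma finite_bounded:
  assumes "bounded S" shows "finite (\<Lambda> \<inter> S)"
proof -
  obtain B where ind: "independent B" and L: "\<Lambda> = {\<Sum>b\<in>B. of_int (c b) *\<^sub>R b | c. True}"
    and sp: "span B = UNIV"
    using unimod by (auto simp: unimodular_lattice_def lattice_basis_def)
  have fin: "finite B" using ind by (rule finiteI_independent)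
  obtain K where K: "\<And>b x. b \<in> B \<Longrightarrow> \<bar>representation B x b\<bar> \<le> K * norm x"
  proof -
    have "\<exists>K. \<forall>x. \<bar>representation B x b\<bar> \<le> K * norm x" for b
    proof -
      have "linear (\<lambda>x. representation B x b)" using ind sp
        by (intro linearI) (simp_all add: representation_add representation_scale)
      from linear_bounded[OF this] show ?thesis by (auto simp: mult.commute)
    qed
    then obtain K where K: "\<And>b x. \<bar>representation B x b\<bar> \<le> K b * norm x" by metis
    have "\<bar>representation B x b\<bar> \<le> (\<Sum>b\<in>B. \<bar>K b\<bar>) * norm x" if "b \<in> B" for b x
    proof -
      have "K b \<le> (\<Sum>b\<in>B. \<bar>K b\<bar>)" using member_le_sum[of b B "\<lambda>b. \<bar>K b\<bar>"] that fin by auto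
      then show ?thesis using K[of x b] mult_right_mono[of "K b" _ "norm x"] norm_ge_zero
        by (meson order_trans)
    qed
    then show ?thesis using that by blast
  qed
  obtain R where R: "\<And>x. x \<in> S \<Longrightarrow> norm x \<le> R" using assms by (auto simp: bounded_iff)
  define N where "N = \<lceil>\<bar>K\<bar> * \<bar>R\<bar>\<rceil>"
  have "\<Lambda> \<inter> S \<subseteq> (\<lambda>c. \<Sum>b\<in>B. of_int (c b) *\<^sub>R b) ` (PiE B (\<lambda>_. {-N..N}))"
  proof
    fix x assume x: "x \<in> \<Lambda> \<inter> S"
    then obtain c where c: "x = (\<Sum>b\<in>B. of_int (c b) *\<^sub>R b)" using L by auto
    have "c b \<in> {-N..N}" if "b \<in> B" for b
    proof -
      have "representation B x b = (\<Sum>b'\<in>B. of_int (c b') * representation B b' b)"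
        unfolding c using ind sp by (simp add: representation_sum representation_scale)
      also have "\<dots> = (\<Sum>b'\<in>B. if b' = b then of_int (c b') else 0)"
        by (intro sum.cong refl) (simp add: representation_basis[OF ind])
      also have "\<dots> = of_int (c b)" using that fin by simp
      finally have "\<bar>of_int (c b) :: real\<bar> \<le> K * norm x" using K[OF that, of x] by simp
      also have "\<dots> \<le> \<bar>K\<bar> * \<bar>R\<bar>" using R[of x] x
        by (intro mult_mono) auto
      finally show ?thesis unfolding N_def by (auto simp: abs_le_iff) linarith+
    qed
    then show "x \<in> (\<lambda>c. \<Sum>b\<in>B. of_int (c b) *\<^sub>R b) ` (PiE B (\<lambda>_. {-N..N}))"
      by (intro image_eqI[of _ _ "restrict c B"]) (auto simp: c)
  qed
  moreover have "finite (PiE B (\<lambda>_. {-N..N}))" using fin by (intro finite_PiE) auto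
  ultimately show ?thesis by (meson finite_subset finite_imageI)
qed

text \<open>\<open>U\<close> is the disjoint union of its pieces in the translates of a fundamental
  domain \<open>D\<close>, and moving a piece back into \<open>D\<close> keeps its measure. As
  \<open>D\<close> has measure 1, the volume of \<open>U\<close> is thereby the mean over
  \<open>x\<close> in \<open>D\<close> of the number of lattice vectors \<open>r\<close> with
  \<open>x + r\<close> in \<open>U\<close>; \<open>integral_count\<close> carries out this last
  step.\<close>

lemma unfolding_integral:
  assumes U: "U \<in> lmeasurable" "bounded U"
  obtains D Y where "D \<in> lmeasurable" "measure lebesgue D = 1" "finite Y" "Y \<subseteq> \<Lambda>"
    "\<And>x r. x \<in> D \<Longrightarrow> r \<in> \<Lambda> \<Longrightarrow> x + r \<in> U \<Longrightarrow> r \<in> Y"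
    "\<And>r. (+) (- r) ` U \<inter> D \<in> lmeasurable"
    "measure lebesgue U = (\<Sum>r\<in>Y. measure lebesgue ((+) (- r) ` U \<inter> D))"
    "\<And>x y. x \<in> D \<Longrightarrow> y \<in> D \<Longrightarrow> x - y \<in> \<Lambda> \<Longrightarrow> x = y"
proof -
  obtain D where D: "D \<in> sets borel" "bounded D" "measure lebesgue D = 1"
    and cov: "\<And>x. \<exists>r\<in>\<Lambda>. x - r \<in> D"
    and inj: "\<And>x y. x \<in> D \<Longrightarrow> y \<in> D \<Longrightarrow> x - y \<in> \<Lambda> \<Longrightarrow> x = y"
    by (rule fundamental_domain) (rule that)
  have Dm: "D \<in> lmeasurable" by (intro bounded_set_imp_lmeasurable D(2) sets_completionI_sets) (simp add: D(1))
  define Y where "Y = {r \<in> \<Lambda>. \<exists>x\<in>D. x + r \<in> U}"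
  obtain R where R: "\<And>x. x \<in> U \<Longrightarrow> norm x \<le> R" using U(2) by (auto simp: bounded_iff)
  obtain R' where R': "\<And>x. x \<in> D \<Longrightarrow> norm x \<le> R'" using D(2) by (auto simp: bounded_iff)
  have "Y \<subseteq> \<Lambda> \<inter> cball 0 (R + R')"
  proof
    fix r assume "r \<in> Y"
    then obtain x where x: "r \<in> \<Lambda>" "x \<in> D" "x + r \<in> U" by (auto simp: Y_def)
    have "norm r \<le> norm (x + r) + norm x"
      using norm_triangle_ineq4[of "x + r" x] by simp
    then show "r \<in> \<Lambda> \<inter> cball 0 (R + R')"
      using x R[of "x + r"] R'[of x] by simp
  qed
  then have Y: "finite Y" using finite_bounded[OF bounded_cball] finite_subset by blast
  have tr: "(+) (- r) ` U \<inter> D \<in> lmeasurable" for r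
    using Dm measurable_translation[OF U(1)] by (intro fmeasurable.Int)
  have tr2: "(+) r ` ((+) (- r) ` U \<inter> D) = U \<inter> (+) r ` D" for r
    by (subst image_Int) (simp_all add: image_image)
  have "U = (\<Union>r\<in>Y. U \<inter> (+) r ` D)"
  proof -
    have "\<exists>r\<in>Y. x \<in> (+) r ` D" if "x \<in> U" for x
    proof -
      obtain r where r: "r \<in> \<Lambda>" "x - r \<in> D" using cov by blast
      then have "r \<in> Y" using that by (auto simp: Y_def intro!: bexI[of _ "x - r"])
      then show ?thesis using r by (auto intro!: bexI[of _ r] image_eqI[of _ _ "x - r"])
    qed
    then show ?thesis by auto
  qed
  then have "measure lebesgue U = measure lebesgue (\<Union>r\<in>Y. U \<inter> (+) r ` D)" by simp
  also have "\<dots> = (\<Sum>r\<in>Y. measure lebesgue (U \<inter> (+) r ` D))"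
  proof (rule measure_UNION'[OF Y])
    show "U \<inter> (+) r ` D \<in> lmeasurable" for r
      using U measurable_translation[OF Dm] by (intro fmeasurable.Int)
    show "pairwise (\<lambda>i j. disjnt (U \<inter> (+) i ` D) (U \<inter> (+) j ` D)) Y"
    proof (rule pairwiseI)
      fix i j assume ij: "i \<in> Y" "j \<in> Y" "i \<noteq> j"
      have False if "x \<in> D" "y \<in> D" "i + x = j + y" for x y
      proof -
        have "x - y = j - i" using that by (simp add: algebra_simps)
        then have "x = y" using inj[OF that(1,2)] diff_mem ij Y_def by auto
        then show False using that ij by simp
      qed
      then show "disjnt (U \<inter> (+) i ` D) (U \<inter> (+) j ` D)" by (auto simp: disjnt_def)
    qed
  qed
  also have "\<dots> = (\<Sum>r\<in>Y. measure lebesgue ((+) (- r) ` U \<inter> D))"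
    by (simp add: tr2[symmetric] measure_translation)
  finally show ?thesis using that[OF Dm D(3) Y _ _ tr _ inj] Y_def by auto
qed

lemma integral_count:
  assumes "D \<in> lmeasurable" "finite Y" "\<And>r. (+) (- r) ` U \<inter> D \<in> lmeasurable"
  shows "integrable lebesgue (\<lambda>x. indicat_real D x * card {r \<in> Y. x + r \<in> U})"
    "(\<Sum>r\<in>Y. measure lebesgue ((+) (- r) ` U \<inter> D)) = (LINT x|lebesgue. indicat_real D x * card {r \<in> Y. x + r \<in> U})"
proof -
  have eq: "(\<lambda>x. indicat_real D x * card {r \<in> Y. x + r \<in> U})
      = (\<lambda>x. \<Sum>r\<in>Y. indicat_real ((+) (- r) ` U \<inter> D) x)"
  proof (rule ext)
    fix x
    have "real (card {r \<in> Y. x + r \<in> U}) = (\<Sum>r\<in>{r \<in> Y. x + r \<in> U}. 1)" by simp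
    also have "\<dots> = (\<Sum>r\<in>Y. if x + r \<in> U then 1 else 0)"
      by (rule sum.inter_filter[OF assms(2)])
    also have "\<dots> = (\<Sum>r\<in>Y. indicat_real U (x + r))"
      by (simp only: indicator_def of_bool_def)
    finally have "real (card {r \<in> Y. x + r \<in> U}) = (\<Sum>r\<in>Y. indicat_real U (x + r))" .
    moreover have "x \<in> (+) (- r) ` U \<longleftrightarrow> x + r \<in> U" for r
    proof
      assume "x + r \<in> U"
      then show "x \<in> (+) (- r) ` U" by (intro image_eqI[of _ _ "x + r"]) simp_all
    qed auto
    then have "indicat_real ((+) (- r) ` U \<inter> D) x = indicat_real D x * indicat_real U (x + r)" for r
      by (simp only: indicator_def of_bool_def Int_iff) simp
    ultimately show "indicat_real D x * card {r \<in> Y. x + r \<in> U}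
      = (\<Sum>r\<in>Y. indicat_real ((+) (- r) ` U \<inter> D) x)"
      by (simp only: sum_distrib_left)
  qed
  have int: "integrable lebesgue (indicat_real ((+) (- r) ` U \<inter> D))" for r
    using assms(3)[of r] by (simp only: lmeasurable_iff_integrable)
  show "integrable lebesgue (\<lambda>x. indicat_real D x * card {r \<in> Y. x + r \<in> U})"
    unfolding eq by (intro Bochner_Integration.integrable_sum int)
  show "(\<Sum>r\<in>Y. measure lebesgue ((+) (- r) ` U \<inter> D)) = (LINT x|lebesgue. indicat_real D x * card {r \<in> Y. x + r \<in> U})"
    unfolding eq by (simp only: Bochner_Integration.integral_sum[OF int] Bochner_Integration.integral_indicator space_completion space_lborel space_borel Int_UNIV_right)
qed

text \<open>A mean over a set of measure 1 is at least any pointwise lower bound. The finite witness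
  \<open>Z\<close> keeps the index set \<open>Y\<close> of the unfolding out of the
  hypothesis.\<close>

lemma volume_ge:
  assumes U: "U \<in> lmeasurable" "bounded U"
    and N: "\<And>x. \<exists>Z\<subseteq>\<Lambda>. finite Z \<and> N \<le> card Z \<and> (\<forall>z\<in>Z. x + z \<in> U)"
  shows "real N \<le> measure lebesgue U"
proof -
  obtain D Y where D: "D \<in> lmeasurable" "measure lebesgue D = 1" "finite Y" "Y \<subseteq> \<Lambda>"
    "\<And>x r. x \<in> D \<Longrightarrow> r \<in> \<Lambda> \<Longrightarrow> x + r \<in> U \<Longrightarrow> r \<in> Y"
    "\<And>r. (+) (- r) ` U \<inter> D \<in> lmeasurable"
    "measure lebesgue U = (\<Sum>r\<in>Y. measure lebesgue ((+) (- r) ` U \<inter> D))"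
    by (rule unfolding_integral[OF U]) (rule that)
  have "N \<le> card {r \<in> Y. x + r \<in> U}" if "x \<in> D" for x
  proof -
    obtain Z where Z: "Z \<subseteq> \<Lambda>" "finite Z" "N \<le> card Z" "\<forall>z\<in>Z. x + z \<in> U" using N[of x] by auto
    then have "Z \<subseteq> {r \<in> Y. x + r \<in> U}" using D(5)[OF that] by auto
    then show ?thesis using card_mono[of "{r \<in> Y. x + r \<in> U}" Z] D(3) Z(3) by simp
  qed
  then have le: "real N * indicat_real D x \<le> indicat_real D x * card {r \<in> Y. x + r \<in> U}" for x
    by (auto simp: indicator_def)
  have "real N = (LINT x|lebesgue. real N * indicat_real D x)" using D by simp
  also have "\<dots> \<le> (LINT x|lebesgue. indicat_real D x * card {r \<in> Y. x + r \<in> U})"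
    by (intro integral_mono integral_count le)
      (use D in \<open>simp_all add: lmeasurable_iff_integrable[symmetric]\<close>)
  finally show ?thesis using integral_count(2)[OF D(1,3,6)] D(7) by simp
qed

lemma volume_le:
  assumes U: "U \<in> lmeasurable" "bounded U"
    and N: "\<And>x Z. Z \<subseteq> \<Lambda> \<Longrightarrow> finite Z \<Longrightarrow> (\<forall>z\<in>Z. x + z \<in> U) \<Longrightarrow> card Z \<le> N"
  shows "measure lebesgue U \<le> real N"
proof -
  obtain D Y where D: "D \<in> lmeasurable" "measure lebesgue D = 1" "finite Y" "Y \<subseteq> \<Lambda>"
    "\<And>x r. x \<in> D \<Longrightarrow> r \<in> \<Lambda> \<Longrightarrow> x + r \<in> U \<Longrightarrow> r \<in> Y"
    "\<And>r. (+) (- r) ` U \<inter> D \<in> lmeasurable"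
    "measure lebesgue U = (\<Sum>r\<in>Y. measure lebesgue ((+) (- r) ` U \<inter> D))"
    by (rule unfolding_integral[OF U]) (rule that)
  have "card {r \<in> Y. x + r \<in> U} \<le> N" for x
    using D(3,4) by (intro N[of _ x]) auto
  then have le: "indicat_real D x * card {r \<in> Y. x + r \<in> U} \<le> real N * indicat_real D x" for x
    by (auto simp: indicator_def)
  have "(LINT x|lebesgue. indicat_real D x * card {r \<in> Y. x + r \<in> U})
      \<le> (LINT x|lebesgue. real N * indicat_real D x)"
    by (intro integral_mono integral_count le)
      (use D in \<open>simp_all add: lmeasurable_iff_integrable[symmetric]\<close>)
  also have "\<dots> = real N" using D by simp
  finally show ?thesis using integral_count(2)[OF D(1,3,6)] D(7) by simp
qed

text \<open>If no two points of \<open>U\<close> differed by a lattice vector, every translate of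
  the lattice would meet \<open>U\<close> at most once, and the mean number of points would be at
  most 1.\<close>

lemma blichfeldt:
  assumes U: "U \<in> lmeasurable" "bounded U" and "1 < measure lebesgue U"
  obtains x y where "x \<in> U" "y \<in> U" "x \<noteq> y" "x - y \<in> \<Lambda>"
proof -
  have "\<exists>x y. x \<in> U \<and> y \<in> U \<and> x \<noteq> y \<and> x - y \<in> \<Lambda>"
  proof (rule ccontr)
    assume no: "\<not> ?thesis"
    have "measure lebesgue U \<le> real 1"
    proof (rule volume_le[OF U])
      fix x Z assume Z: "Z \<subseteq> \<Lambda>" "finite Z" "\<forall>z\<in>Z. x + z \<in> U"
      have "z = z'" if "z \<in> Z" "z' \<in> Z" for z z'
        using no that Z diff_mem[of z z'] by (metis add_diff_cancel_left add_left_cancel subsetD)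
      then show "card Z \<le> 1" using Z(2) by (simp add: card_le_Suc0_iff_eq)
    qed
    then show False using assms by simp
  qed
  then show ?thesis using that by blast
qed

text \<open>\<open>P\<close> has to meet every coset of the lattice, but it may be much larger than
  a fundamental domain and its translates may overlap. For each \<open>x\<close>, one representative
  in \<open>P\<close> moves the whole of \<open>Y\<close> into \<open>U\<close>, so every translate
  of the lattice has at least \<open>card Y\<close> points in \<open>U\<close>.\<close>

lemma card_le_volume:
  assumes P: "\<And>x. \<exists>r\<in>\<Lambda>. x - r \<in> P"
    and Y: "finite Y" "Y \<subseteq> \<Lambda>" and U: "U \<in> lmeasurable" "bounded U"
    and YP: "\<And>y p. y \<in> Y \<Longrightarrow> p \<in> P \<Longrightarrow> y + p \<in> U"
  shows "real (card Y) \<le> measure lebesgue U"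
proof (rule volume_ge[OF U])
  fix x
  obtain r where r: "r \<in> \<Lambda>" "x - r \<in> P" using P by blast
  have "x + (y - r) \<in> U" if "y \<in> Y" for y
    using YP[OF that r(2)] by (simp add: algebra_simps)
  moreover have "card ((\<lambda>y. y - r) ` Y) = card Y" by (rule card_image) (auto simp: inj_on_def)
  ultimately show "\<exists>Z\<subseteq>\<Lambda>. finite Z \<and> card Y \<le> card Z \<and> (\<forall>z\<in>Z. x + z \<in> U)"
    using Y r diff_mem by (intro exI[of _ "(\<lambda>y. y - r) ` Y"]) auto
qed

lemma volume_le_card:
  assumes P: "\<And>x. \<exists>r\<in>\<Lambda>. x - r \<in> P"
    and Y: "finite (\<Lambda> \<inter> Y)" and U: "U \<in> lmeasurable" "bounded U"
    and UP: "\<And>u p. u \<in> U \<Longrightarrow> p \<in> P \<Longrightarrow> u - p \<in> Y"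
  shows "measure lebesgue U \<le> real (card (\<Lambda> \<inter> Y))"
proof (rule volume_le[OF U])
  fix x Z assume Z: "Z \<subseteq> \<Lambda>" "finite Z" "\<forall>z\<in>Z. x + z \<in> U"
  obtain r where r: "r \<in> \<Lambda>" "x - r \<in> P" using P by blast
  have "z + r \<in> \<Lambda> \<inter> Y" if "z \<in> Z" for z
    using UP[of "x + z" "x - r"] Z that r add_mem by (auto simp: algebra_simps)
  then have "(\<lambda>z. z + r) ` Z \<subseteq> \<Lambda> \<inter> Y" by auto
  then have "card ((\<lambda>z. z + r) ` Z) \<le> card (\<Lambda> \<inter> Y)" using Y by (rule card_mono[rotated])
  then show "card Z \<le> card (\<Lambda> \<inter> Y)" by (subst (asm) card_image) (auto simp: inj_on_def)
qed

text \<open>\<open>B\<close> is any finite spanning set of lattice vectors and need not generate the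
  lattice. This allows short vectors to be chosen, at the price of a parallelepiped whose volume may
  exceed 1.\<close>

lemma parallelepiped_cover:
  assumes B: "finite B" "B \<subseteq> \<Lambda>" "span B = UNIV"
  shows "\<exists>r\<in>\<Lambda>. x - r \<in> {\<Sum>b\<in>B. t b *\<^sub>R b | t. \<forall>b\<in>B. 0 \<le> t b \<and> t b < (1::real)}"
proof -
  obtain t where t: "x = (\<Sum>b\<in>B. t b *\<^sub>R b)"
    using B span_finite[OF B(1)] by (metis (no_types, lifting) UNIV_I imageE)
  let ?r = "\<Sum>b\<in>B. of_int \<lfloor>t b\<rfloor> *\<^sub>R b"
  have "?r \<in> \<Lambda>" using B(1,2)
  proof (induction B rule: finite_induct)
    case empty then show ?case by (simp add: zero_mem)
  next
    case (insert b B)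
    then show ?case using add_mem of_int_scale_mem by (simp add: sum.insert)
  qed
  moreover have "x - ?r = (\<Sum>b\<in>B. (t b - of_int \<lfloor>t b\<rfloor>) *\<^sub>R b)"
    by (simp add: t scaleR_left_diff_distrib sum_subtractf)
  moreover have "\<forall>b\<in>B. 0 \<le> t b - of_int \<lfloor>t b\<rfloor> \<and> t b - of_int \<lfloor>t b\<rfloor> < 1"
    by (auto simp: frac_lt_1 frac_def[symmetric])
  ultimately show ?thesis by (intro bexI[of _ ?r]) (auto intro!: exI[of _ "\<lambda>b. t b - of_int \<lfloor>t b\<rfloor>"])
qed

end

subsection \<open>Lattice points in balls and subspaces\<close>

text \<open>The annulus between Z / 2 and Z contributes at most 2^k C Z^(p - k). Because k < p,
  halving Z at least halves this amount, so all annuli together contribute at most twice the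
  first.\<close>

lemma dyadic_sum_annulus:
  fixes g :: "'b \<Rightarrow> real"
  assumes Y: "finite Y" and C: "0 \<le> C" and k: "k < p"
    and count: "\<And>x. 0 < x \<Longrightarrow> real (card {y\<in>Y. g y \<le> x}) \<le> C * x ^ p"
  shows "0 < Z \<Longrightarrow> (\<Sum>y | y \<in> Y \<and> Z / 2 ^ n < g y \<and> g y \<le> Z. 1 / g y ^ k) \<le> 2 ^ (k + 1) * C * Z ^ (p - k)"
proof (induction n arbitrary: Z)
  case 0
  have "{y. y \<in> Y \<and> Z / 2 ^ 0 < g y \<and> g y \<le> Z} = {}" by auto
  then show ?case using C 0 by (simp only: sum.empty) simp
next
  case (Suc n)
  let ?A = "{y. y \<in> Y \<and> Z / 2 < g y \<and> g y \<le> Z}"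
  let ?B = "{y. y \<in> Y \<and> Z / 2 / 2 ^ n < g y \<and> g y \<le> Z / 2}"
  have "(\<Sum>y | y \<in> Y \<and> Z / 2 ^ Suc n < g y \<and> g y \<le> Z. 1 / g y ^ k) \<le> (\<Sum>y\<in>?A \<union> ?B. 1 / g y ^ k)"
  proof (rule sum_mono2)
    have "0 < Z / 2 ^ n" "0 < Z / 2" using Suc.prems by simp_all
    then show "0 \<le> 1 / g b ^ k" if "b \<in> (?A \<union> ?B) - {y. y \<in> Y \<and> Z / 2 ^ Suc n < g y \<and> g y \<le> Z}" for b
    proof -
      have "0 < Z / 2 / 2 ^ n" using Suc.prems by simp
      then have "0 < g b" using that \<open>0 < Z / 2\<close> by (auto intro: less_trans)
      then show ?thesis by simp
    qed
  qed (use Y in auto)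
  also have "\<dots> = (\<Sum>y\<in>?A. 1 / g y ^ k) + (\<Sum>y\<in>?B. 1 / g y ^ k)"
    by (rule sum.union_disjoint) (use Y in auto)
  also have "(\<Sum>y\<in>?A. 1 / g y ^ k) \<le> (\<Sum>y\<in>?A. 1 / (Z / 2) ^ k)"
    using Suc.prems by (intro sum_mono divide_left_mono power_mono mult_pos_pos zero_less_power) auto
  also have "\<dots> = real (card ?A) * (1 / (Z / 2) ^ k)" by simp
  also have "\<dots> \<le> C * Z ^ p * (1 / (Z / 2) ^ k)"
  proof (rule mult_right_mono)
    have "card ?A \<le> card {y\<in>Y. g y \<le> Z}" by (rule card_mono) (use Y in auto)
    then show "real (card ?A) \<le> C * Z ^ p" using count[OF Suc.prems] by linarith
  qed (use Suc.prems in auto)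
  also have "\<dots> = 2 ^ k * C * Z ^ (p - k)"
    using Suc.prems k by (simp add: power_divide power_diff)
  also have "(\<Sum>y\<in>?B. 1 / g y ^ k) \<le> 2 ^ (k + 1) * C * (Z / 2) ^ (p - k)"
    using Suc.IH[of "Z / 2"] Suc.prems by simp
  also have "\<dots> \<le> 2 ^ k * C * Z ^ (p - k)"
  proof -
    have "(Z / 2) ^ (p - k) \<le> Z ^ (p - k) / 2"
    proof -
      have "(2::real) ^ 1 \<le> 2 ^ (p - k)" using k by (intro power_increasing) auto
      then have "Z ^ (p - k) / 2 ^ (p - k) \<le> Z ^ (p - k) / 2"
        using Suc.prems by (intro divide_left_mono) auto
      then show ?thesis by (simp add: power_divide)
    qed
    then have "2 ^ (k + 1) * C * (Z / 2) ^ (p - k) \<le> 2 ^ (k + 1) * C * (Z ^ (p - k) / 2)"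
      using C by (intro mult_left_mono) auto
    then show ?thesis by simp
  qed
  finally show ?case by (simp add: mult_ac)
qed

text \<open>At the critical exponent every annulus contributes the same amount, so the number
  \<open>n\<close> of annuli stays in the bound.\<close>

lemma dyadic_sum_annulus_critical:
  fixes g :: "'b \<Rightarrow> real"
  assumes Y: "finite Y" and C: "0 \<le> C"
    and count: "\<And>x. 0 < x \<Longrightarrow> real (card {y\<in>Y. g y \<le> x}) \<le> C * x ^ k"
  shows "0 < Z \<Longrightarrow> (\<Sum>y | y \<in> Y \<and> Z / 2 ^ n < g y \<and> g y \<le> Z. 1 / g y ^ k) \<le> real n * 2 ^ k * C"
proof (induction n arbitrary: Z)
  case 0
  have "{y. y \<in> Y \<and> Z / 2 ^ 0 < g y \<and> g y \<le> Z} = {}" by auto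
  then show ?case by (simp only: sum.empty)
next
  case (Suc n)
  let ?A = "{y. y \<in> Y \<and> Z / 2 < g y \<and> g y \<le> Z}"
  let ?B = "{y. y \<in> Y \<and> Z / 2 / 2 ^ n < g y \<and> g y \<le> Z / 2}"
  have "(\<Sum>y | y \<in> Y \<and> Z / 2 ^ Suc n < g y \<and> g y \<le> Z. 1 / g y ^ k) \<le> (\<Sum>y\<in>?A \<union> ?B. 1 / g y ^ k)"
  proof (rule sum_mono2)
    have "0 < Z / 2 ^ n" "0 < Z / 2" using Suc.prems by simp_all
    then show "0 \<le> 1 / g b ^ k" if "b \<in> (?A \<union> ?B) - {y. y \<in> Y \<and> Z / 2 ^ Suc n < g y \<and> g y \<le> Z}" for b
    proof -
      have "0 < Z / 2 / 2 ^ n" using Suc.prems by simp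
      then have "0 < g b" using that \<open>0 < Z / 2\<close> by (auto intro: less_trans)
      then show ?thesis by simp
    qed
  qed (use Y in auto)
  also have "\<dots> = (\<Sum>y\<in>?A. 1 / g y ^ k) + (\<Sum>y\<in>?B. 1 / g y ^ k)"
    by (rule sum.union_disjoint) (use Y in auto)
  also have "(\<Sum>y\<in>?A. 1 / g y ^ k) \<le> (\<Sum>y\<in>?A. 1 / (Z / 2) ^ k)"
    using Suc.prems by (intro sum_mono divide_left_mono power_mono mult_pos_pos zero_less_power) auto
  also have "\<dots> = real (card ?A) * (1 / (Z / 2) ^ k)" by simp
  also have "\<dots> \<le> C * Z ^ k * (1 / (Z / 2) ^ k)"
  proof (rule mult_right_mono)
    have "card ?A \<le> card {y\<in>Y. g y \<le> Z}" by (rule card_mono) (use Y in auto)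
    then show "real (card ?A) \<le> C * Z ^ k" using count[OF Suc.prems] by linarith
  qed (use Suc.prems in auto)
  also have "\<dots> = 2 ^ k * C" using Suc.prems by (simp add: power_divide)
  also have "(\<Sum>y\<in>?B. 1 / g y ^ k) \<le> real n * 2 ^ k * C"
    using Suc.IH[of "Z / 2"] Suc.prems by simp
  finally show ?case by (simp add: algebra_simps)
qed

lemma dyadic_sum:
  fixes g :: "'b \<Rightarrow> real"
  assumes Y: "finite Y" and C: "0 \<le> C" and k: "k < p"
    and pos: "\<And>y. y \<in> Y \<Longrightarrow> 0 < g y" and le: "\<And>y. y \<in> Y \<Longrightarrow> g y \<le> Z"
    and count: "\<And>x. 0 < x \<Longrightarrow> real (card {y\<in>Y. g y \<le> x}) \<le> C * x ^ p" and Z: "0 < Z"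
  shows "(\<Sum>y\<in>Y. 1 / g y ^ k) \<le> 2 ^ (k + 1) * C * Z ^ (p - k)"
proof -
  obtain n where n: "\<And>y. y \<in> Y \<Longrightarrow> Z / 2 ^ n < g y"
  proof (cases "Y = {}")
    case False
    define x where "x = Min (g ` Y)"
    have x: "0 < x" "\<And>y. y \<in> Y \<Longrightarrow> x \<le> g y" using Y False pos by (auto simp: x_def)
    obtain n where "Z / x < 2 ^ n" using real_arch_pow[of 2 "Z / x"] by auto
    then have "Z / 2 ^ n < x" using x(1) by (simp add: field_simps)
    then show ?thesis using that x(2) by (meson less_le_trans)
  qed (use that in auto)
  have "{y. y \<in> Y \<and> Z / 2 ^ n < g y \<and> g y \<le> Z} = Y" using n le by auto
  then show ?thesis using dyadic_sum_annulus[OF Y C k count Z, of n] by simp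
qed

text \<open>\<open>a\<close> is a lower bound for Euclidean lengths and not necessarily the minimum:
  the minimum of the theorem is taken in \<open>max_norm\<close>, and dividing it by
  \<open>nconst\<close> yields such an \<open>a\<close>.\<close>

locale lattice_min = unimodular \<Lambda> for \<Lambda> :: "'a::euclidean_space set" +
  fixes a :: real
  assumes a_pos: "0 < a" and a_le: "r \<in> \<Lambda> \<Longrightarrow> r \<noteq> 0 \<Longrightarrow> a \<le> norm r"
begin

text \<open>The last successive minimum of the lattice.\<close>

definition "last_min = (SOME M. span (\<Lambda> \<inter> cball 0 M) = UNIV \<and> span (\<Lambda> \<inter> ball 0 M) \<noteq> UNIV)"

lemma last_min: "span (\<Lambda> \<inter> cball 0 last_min) = UNIV" "span (\<Lambda> \<inter> ball 0 last_min) \<noteq> UNIV"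
proof -
  obtain B where ind: "independent B" and L: "\<Lambda> = {\<Sum>b\<in>B. of_int (c b) *\<^sub>R b | c. True}"
    and sp: "span B = UNIV"
    using unimod by (auto simp: unimodular_lattice_def lattice_basis_def)
  have fin: "finite B" using ind by (rule finiteI_independent)
  have BL: "b \<in> \<Lambda>" if "b \<in> B" for b
  proof -
    have "b = (\<Sum>b'\<in>B. (if b' = b then b' else 0))" using fin that by simp
    also have "\<dots> = (\<Sum>b'\<in>B. of_int (if b' = b then 1 else 0) *\<^sub>R b')"
      by (intro sum.cong) auto
    finally show ?thesis unfolding L
      by (intro CollectI exI[of _ "\<lambda>b'. if b' = b then 1 else 0"] conjI TrueI)
  qed
  have ne: "B \<noteq> {}"
  proof
    assume "B = {}"
    then have "(UNIV :: 'a set) = {0}" using sp by simp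
    then show False using nonempty_Basis nonzero_Basis by blast
  qed
  define X where "X = Max (norm ` B)"
  \<comment> \<open>Only lengths of lattice vectors are candidates, so a least one exists. If the
    lattice vectors strictly shorter than it still spanned the space, the largest of their lengths
    would be a smaller candidate.\<close>
  define S where "S = {x \<in> norm ` (\<Lambda> \<inter> cball 0 X). span (\<Lambda> \<inter> cball 0 x) = UNIV}"
  have finS: "finite S" unfolding S_def using finite_bounded[OF bounded_cball] by simp
  have "X \<in> norm ` B" unfolding X_def using fin ne by (intro Max_in) auto
  then have "X \<in> norm ` (\<Lambda> \<inter> cball 0 X)" using BL by force
  moreover have "B \<subseteq> \<Lambda> \<inter> cball 0 X" using BL fin by (auto simp: X_def)
  then have "span (\<Lambda> \<inter> cball 0 X) = UNIV" using sp span_mono by blast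
  ultimately have XS: "X \<in> S" by (simp add: S_def)
  define M where "M = Min S"
  have MS: "M \<in> S" unfolding M_def using finS XS by (intro Min_in) auto
  have MX: "M \<le> X" unfolding M_def using finS XS by simp
  have "span (\<Lambda> \<inter> ball 0 M) \<noteq> UNIV"
  proof
    assume sp': "span (\<Lambda> \<inter> ball 0 M) = UNIV"
    let ?T = "\<Lambda> \<inter> ball 0 M"
    have finT: "finite ?T" using finite_bounded[OF bounded_ball] .
    have neT: "?T \<noteq> {}"
    proof
      assume e: "?T = {}"
      have "(UNIV :: 'a set) = {0}" using sp' unfolding e by simp
      then show False using nonempty_Basis nonzero_Basis by blast
    qed
    define x where "x = Max (norm ` ?T)"
    have "x \<in> norm ` ?T" unfolding x_def using finT neT by (intro Max_in) auto
    then have xM: "x < M" and x2: "x \<in> norm ` (\<Lambda> \<inter> cball 0 X)" using MX by auto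
    have "?T \<subseteq> \<Lambda> \<inter> cball 0 x" unfolding x_def using finT by auto
    then have "span (\<Lambda> \<inter> cball 0 x) = UNIV" using sp' span_mono by blast
    then have "x \<in> S" using x2 by (simp add: S_def)
    then show False using xM finS unfolding M_def by (simp add: not_le[symmetric])
  qed
  then have "\<exists>M. span (\<Lambda> \<inter> cball 0 M) = UNIV \<and> span (\<Lambda> \<inter> ball 0 M) \<noteq> UNIV"
    using MS by (auto simp: S_def)
  from someI_ex[OF this] show "span (\<Lambda> \<inter> cball 0 last_min) = UNIV" "span (\<Lambda> \<inter> ball 0 last_min) \<noteq> UNIV"
    unfolding last_min_def by auto
qed

lemma a_le_last_min: "a \<le> last_min"
proof (rule ccontr)
  assume "\<not> ?thesis"
  then have "\<Lambda> \<inter> cball 0 last_min \<subseteq> {0}" using a_le by force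
  then have "span (\<Lambda> \<inter> cball 0 last_min) \<subseteq> {0}" using span_mono[of _ "{0}"] by (simp add: span_0)
  then have "(UNIV :: 'a set) = {0}" using last_min(1) by auto
  then show False using nonempty_Basis nonzero_Basis by blast
qed

lemma last_min_pos: "0 < last_min" using a_le_last_min a_pos by simp

text \<open>Choose a unit vector \<open>e\<close> orthogonal to all lattice vectors shorter than
  \<open>last_min\<close> and string about last_min / a balls of radius a / 2 along it. If their
  total volume exceeded 1, Blichfeldt's lemma would give two points of the string that differ by a
  nonzero lattice vector. That vector is shorter than \<open>last_min\<close>, hence orthogonal to
  \<open>e\<close>; so both points lie in the same ball and are closer than \<open>a\<close>, a
  contradiction.\<close>

lemma last_min_bound:
  "last_min * (unit_ball_vol (DIM('a)) * a ^ (DIM('a) - 1)) \<le> 2 ^ (DIM('a) + 1)"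
proof -
  obtain e0 :: 'a where e0: "e0 \<noteq> 0" "\<forall>x\<in>span (\<Lambda> \<inter> ball 0 last_min). e0 \<bullet> x = 0"
    using span_not_UNIV_orthogonal[OF last_min(2)] by auto
  define e where "e = e0 /\<^sub>R norm e0"
  have e: "norm e = 1" "\<And>x. x \<in> \<Lambda> \<Longrightarrow> norm x < last_min \<Longrightarrow> e \<bullet> x = 0"
    using e0 by (auto simp: e_def span_base)
  define J where "J = nat \<lfloor>last_min / a\<rfloor>"
  have Ma: "1 \<le> last_min / a" using a_le_last_min a_pos by simp
  have J1: "real J * a \<le> last_min" and J2: "last_min / a \<le> 2 * real J" and J0: "1 \<le> J"
  proof -
    have "real J \<le> last_min / a" "last_min / a < real J + 1" "1 \<le> J"
      using Ma unfolding J_def by (auto simp: of_nat_nat) linarith+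
    then show "real J * a \<le> last_min" "last_min / a \<le> 2 * real J" "1 \<le> J"
      using a_pos by (simp add: field_simps, linarith, simp)
  qed
  let ?c = "\<lambda>j::nat. (real j * a) *\<^sub>R e"
  define U where "U = (\<Union>j\<in>{..<J}. ball (?c j) (a / 2))"
  have dist_c: "dist (?c i) (?c j) = \<bar>real i - real j\<bar> * a" for i j
    using e(1) a_pos by (simp add: dist_norm scaleR_left_diff_distrib[symmetric] abs_mult left_diff_distrib[symmetric])
  have "measure lebesgue U = (\<Sum>j\<in>{..<J}. measure lebesgue (ball (?c j) (a / 2)))"
    unfolding U_def
  proof (rule measure_UNION')
    show "pairwise (\<lambda>i j. disjnt (ball (?c i) (a / 2)) (ball (?c j) (a / 2))) {..<J}"
    proof (rule pairwiseI)
      fix i j :: nat assume "i \<noteq> j"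
      then have "1 \<le> \<bar>real i - real j\<bar>" by linarith
      then have "a \<le> dist (?c i) (?c j)" unfolding dist_c using a_pos by simp
      then show "disjnt (ball (?c i) (a / 2)) (ball (?c j) (a / 2))"
        unfolding disjnt_def by (intro disjoint_ballI) simp
    qed
  qed auto
  also have "\<dots> = real J * (unit_ball_vol (DIM('a)) * (a / 2) ^ DIM('a))"
    using a_pos by (simp add: content_ball)
  finally have mU: "measure lebesgue U = real J * (unit_ball_vol (DIM('a)) * (a / 2) ^ DIM('a))" .
  have U: "U \<in> lmeasurable" "bounded U" unfolding U_def by (auto intro!: fmeasurable.finite_UN bounded_UN)
  have "measure lebesgue U \<le> 1"
  proof (rule ccontr)
    assume "\<not> measure lebesgue U \<le> 1"
    then obtain x y where xy: "x \<in> U" "y \<in> U" "x \<noteq> y" "x - y \<in> \<Lambda>"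
      using blichfeldt[OF U] by auto
    obtain i j where i: "i < J" "norm (x - ?c i) < a / 2" and j: "j < J" "norm (y - ?c j) < a / 2"
      using xy(1,2) by (auto simp: U_def dist_norm norm_minus_commute)
    define z where "z = (x - ?c i) - (y - ?c j)"
    have z: "norm z < a" unfolding z_def using i j norm_triangle_ineq4[of "x - ?c i" "y - ?c j"] by linarith
    have xyz: "x - y = z + (?c i - ?c j)" by (simp add: z_def)
    have "norm (x - y) \<le> norm z + dist (?c i) (?c j)"
      unfolding xyz dist_norm by (rule norm_triangle_ineq)
    also have "\<dots> < a + \<bar>real i - real j\<bar> * a" using z by (simp only: dist_c add_strict_right_mono)
    also have "\<dots> \<le> real J * a"
    proof -
      have "1 + \<bar>real i - real j\<bar> \<le> real J" using i(1) j(1) by linarith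
      from mult_right_mono[OF this, of a] show ?thesis using a_pos by (simp add: algebra_simps)
    qed
    finally have "norm (x - y) < last_min" using J1 by simp
    then have orth: "e \<bullet> (x - y) = 0" using e(2) xy(4) by blast
    have "e \<bullet> (?c i - ?c j) = (real i - real j) * a"
      using e(1) by (simp add: inner_diff_right algebra_simps norm_eq_1)
    then have "e \<bullet> z = - ((real i - real j) * a)" using orth unfolding xyz by (simp add: inner_add_right)
    moreover have "\<bar>e \<bullet> z\<bar> \<le> norm z" using Cauchy_Schwarz_ineq2[of e z] e(1) by simp
    moreover have "\<bar>- ((real i - real j) * a)\<bar> = \<bar>real i - real j\<bar> * a" using a_pos by (simp add: abs_mult)
    ultimately have "\<bar>real i - real j\<bar> * a < 1 * a" using z by linarith
    then have "\<bar>real i - real j\<bar> < 1" using a_pos by (simp only: mult_less_cancel_right_pos)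
    then have "i = j" by linarith
    then have "x - y = z" by (simp add: xyz)
    then show False using a_le[OF xy(4)] z xy(3) by force
  qed
  then have "real J * (unit_ball_vol (DIM('a)) * (a / 2) ^ DIM('a)) \<le> 1" using mU by simp
  moreover have "a ^ DIM('a) = a * a ^ (DIM('a) - 1)"
    using DIM_positive[where 'a='a] by (metis power_minus_mult mult.commute)
  ultimately have "real J * a * (unit_ball_vol (DIM('a)) * a ^ (DIM('a) - 1)) \<le> 2 ^ DIM('a)"
    by (simp add: power_divide field_simps)
  moreover have "last_min \<le> 2 * (real J * a)" using J2 a_pos by (simp add: field_simps)
  then have "last_min * (unit_ball_vol (DIM('a)) * a ^ (DIM('a) - 1))
      \<le> 2 * (real J * a) * (unit_ball_vol (DIM('a)) * a ^ (DIM('a) - 1))"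
    using a_pos by (intro mult_right_mono) auto
  ultimately have "last_min * (unit_ball_vol (DIM('a)) * a ^ (DIM('a) - 1)) \<le> 2 * 2 ^ DIM('a)"
    by linarith
  then show ?thesis by simp
qed

lemma norm_combination_le:
  assumes "finite B" "\<And>b. b \<in> B \<Longrightarrow> norm b \<le> V" "\<And>b. b \<in> B \<Longrightarrow> 0 \<le> t b \<and> t b < (1::real)"
  shows "norm (\<Sum>b\<in>B. t b *\<^sub>R b) \<le> real (card B) * V"
proof -
  have "norm (\<Sum>b\<in>B. t b *\<^sub>R b) \<le> (\<Sum>b\<in>B. V)"
  proof (intro order_trans[OF norm_sum] sum_mono)
    fix b assume b: "b \<in> B"
    have "norm (t b *\<^sub>R b) \<le> 1 * norm b" unfolding norm_scaleR using assms(3)[OF b] by (intro mult_right_mono) auto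
    then show "norm (t b *\<^sub>R b) \<le> V" using assms(2)[OF b] by simp
  qed
  then show ?thesis by simp
qed

text \<open>The last minimum controls the covering radius: the lattice vectors of length at most
  \<open>last_min\<close> contain a basis of the space, although this need not be a basis of the
  lattice.\<close>

lemma covering: "\<exists>r\<in>\<Lambda>. x - r \<in> cball 0 (real DIM('a) * last_min)"
proof -
  obtain B where B: "B \<subseteq> \<Lambda> \<inter> cball 0 last_min" "independent B" "\<Lambda> \<inter> cball 0 last_min \<subseteq> span B"
    using maximal_independent_subset by blast
  have fin: "finite B" using B(2) by (rule finiteI_independent)
  have "span B = UNIV" using last_min(1) B(3) span_minimal subspace_span by blast
  moreover have "card B \<le> DIM('a)" using B(2) independent_bound by blast
  moreover obtain r t where "r \<in> \<Lambda>" "x - r = (\<Sum>b\<in>B. t b *\<^sub>R b)" "\<forall>b\<in>B. 0 \<le> t b \<and> t b < (1::real)"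
    using parallelepiped_cover[OF fin _ \<open>span B = UNIV\<close>, of x] B(1) by auto
  moreover have "norm (\<Sum>b\<in>B. t b *\<^sub>R b) \<le> real (card B) * last_min"
    using B(1) calculation by (intro norm_combination_le[OF fin]) auto
  moreover have "real (card B) * last_min \<le> real DIM('a) * last_min"
    using \<open>card B \<le> DIM('a)\<close> last_min_pos by (intro mult_right_mono) auto
  ultimately show ?thesis by (intro bexI[of _ r]) auto
qed

lemma card_cball_le:
  fixes X :: real
  assumes X: "last_min \<le> X"
  shows "real (card (\<Lambda> \<inter> cball 0 X)) \<le> unit_ball_vol (DIM('a)) * ((1 + DIM('a)) * X) ^ DIM('a)"
proof -
  have X0: "0 < X" using X last_min_pos by simp
  have "real (card (\<Lambda> \<inter> cball 0 X)) \<le> measure lebesgue (cball (0::'a) ((1 + DIM('a)) * X))"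
  proof (rule card_le_volume[OF covering finite_bounded[OF bounded_cball]])
    fix y p :: 'a assume "y \<in> \<Lambda> \<inter> cball 0 X" "p \<in> cball 0 (real DIM('a) * last_min)"
    then have "norm y \<le> X" "norm p \<le> real DIM('a) * last_min" by auto
    moreover have "real DIM('a) * last_min \<le> real DIM('a) * X" using X by (intro mult_left_mono) auto
    moreover have "(1 + real DIM('a)) * X = X + real DIM('a) * X" by (simp add: algebra_simps)
    ultimately have "norm (y + p) \<le> (1 + real DIM('a)) * X"
      using norm_triangle_ineq[of y p] by linarith
    then show "y + p \<in> cball 0 ((1 + DIM('a)) * X)" by simp
  qed auto
  also have "\<dots> = unit_ball_vol (DIM('a)) * ((1 + DIM('a)) * X) ^ DIM('a)"
    using X0 by (simp add: content_cball)
  finally show ?thesis .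
qed

text \<open>The vectors of length at most \<open>V\<close> supply d - 1 short edges, and one more
  edge of length at most \<open>last_min\<close> completes a parallelepiped that covers all cosets.
  It is long in a single direction only, so its translates by the counted points stay inside about
  last_min / V balls of radius O(V) strung along the long edge.\<close>

lemma card_cball_hyperplane_le:
  assumes V: "0 < V" "V \<le> last_min" and dimV: "dim (\<Lambda> \<inter> cball 0 V) = DIM('a) - 1"
  shows "real (card (\<Lambda> \<inter> cball 0 V))
    \<le> 2 * unit_ball_vol (DIM('a)) * (DIM('a) + 1) ^ DIM('a) * V ^ (DIM('a) - 1) * last_min"
proof -
  let ?d = "DIM('a)"
  obtain B where B: "B \<subseteq> \<Lambda> \<inter> cball 0 V" "independent B" "\<Lambda> \<inter> cball 0 V \<subseteq> span B"
      "card B = ?d - 1"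
    using basis_exists[of "\<Lambda> \<inter> cball 0 V"] dimV by metis
  have fin: "finite B" using B(2) by (rule finiteI_independent)
  have "\<exists>b\<in>\<Lambda> \<inter> cball 0 last_min. b \<notin> span B"
  proof (rule ccontr)
    assume "\<not> ?thesis"
    then have "\<Lambda> \<inter> cball 0 last_min \<subseteq> span B" by auto
    then have "span B = UNIV" using last_min(1) span_minimal subspace_span by blast
    then have "card B = ?d" using B(2) by (metis dim_UNIV dim_eq_card dim_span)
    then show False using B(4) DIM_positive[where 'a='a] by linarith
  qed
  then obtain b where b: "b \<in> \<Lambda>" "norm b \<le> last_min" "b \<notin> span B" by auto
  have bB: "b \<notin> B" using b(3) span_base by blast
  have ind: "independent (insert b B)" using B(2) b(3) by (rule independent_insertI[rotated])
  have "card (insert b B) = ?d" using B(4) bB fin DIM_positive[where 'a='a] by simp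
  then have "span (insert b B) = UNIV"
    using ind by (metis dim_eq_card_independent dim_eq_full)
  note cov = parallelepiped_cover[OF _ _ this, simplified fin finite_insert, OF TrueI]
  define J where "J = nat \<lfloor>last_min / V\<rfloor>"
  have J: "real J \<le> last_min / V" "last_min / V < real J + 1"
    using V by (auto simp: J_def of_nat_nat)
  \<comment> \<open>Consecutive centres are at most \<open>V\<close> apart, because \<open>b\<close>
    is no longer than \<open>last_min\<close>.\<close>
  let ?c = "\<lambda>j::nat. (real j * V / last_min) *\<^sub>R b"
  define U where "U = (\<Union>j\<in>{..J}. cball (?c j) ((?d + 1) * V))"
  have "real (card (\<Lambda> \<inter> cball 0 V)) \<le> measure lebesgue U"
  proof (rule card_le_volume[OF cov finite_bounded[OF bounded_cball]])
    show "insert b B \<subseteq> \<Lambda>" using B(1) b(1) by auto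
    show "U \<in> lmeasurable" "bounded U" unfolding U_def by (auto intro!: fmeasurable.finite_UN bounded_UN)
    fix y p assume y: "y \<in> \<Lambda> \<inter> cball 0 V"
      and "p \<in> {\<Sum>b\<in>insert b B. t b *\<^sub>R b |t. \<forall>b\<in>insert b B. 0 \<le> t b \<and> t b < 1}"
    then obtain t where p: "p = (\<Sum>b\<in>insert b B. t b *\<^sub>R b)" and t: "\<forall>b\<in>insert b B. 0 \<le> t b \<and> t b < 1"
      by auto
    have p': "p = t b *\<^sub>R b + (\<Sum>b\<in>B. t b *\<^sub>R b)" unfolding p using fin bB by simp
    define j where "j = nat \<lfloor>t b * last_min / V\<rfloor>"
    have t0: "0 \<le> t b * last_min / V" using t V by simp
    have j: "real j \<le> t b * last_min / V" "t b * last_min / V < real j + 1"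
      using t0 unfolding j_def by (auto simp: of_nat_nat)
    have "t b * last_min / V \<le> 1 * last_min / V"
      using t V by (intro divide_right_mono mult_right_mono) auto
    then have jJ: "j \<le> J" unfolding j_def J_def by (intro nat_mono floor_mono) simp
    have "norm (t b *\<^sub>R b - ?c j) \<le> V"
    proof -
      have eq: "t b *\<^sub>R b - ?c j = (t b - real j * V / last_min) *\<^sub>R b"
        by (simp add: scaleR_left_diff_distrib)
      have M: "0 < last_min" using last_min_pos .
      have "0 \<le> t b - real j * V / last_min" "t b - real j * V / last_min \<le> V / last_min"
      proof -
        have "real j * V \<le> t b * last_min" "t b * last_min < real j * V + V"
          using j V by (simp_all add: field_simps)
        then have "real j * V / last_min \<le> t b" "t b < (real j * V + V) / last_min"
          using M by (simp_all add: pos_divide_le_eq pos_less_divide_eq)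
        then show "0 \<le> t b - real j * V / last_min" "t b - real j * V / last_min \<le> V / last_min"
          by (simp_all add: add_divide_distrib)
      qed
      then have "norm (t b *\<^sub>R b - ?c j) \<le> V / last_min * last_min"
        unfolding eq norm_scaleR using b(2) by (intro mult_mono) auto
      then show ?thesis using M by simp
    qed
    moreover have "norm (\<Sum>b\<in>B. t b *\<^sub>R b) \<le> real (card B) * V"
      using B(1) t by (intro norm_combination_le[OF fin]) auto
    moreover have "y + p - ?c j = y + (t b *\<^sub>R b - ?c j) + (\<Sum>b\<in>B. t b *\<^sub>R b)"
      by (simp add: p')
    moreover have "norm (y + (t b *\<^sub>R b - ?c j) + (\<Sum>b\<in>B. t b *\<^sub>R b))
       \<le> norm y + norm (t b *\<^sub>R b - ?c j) + norm (\<Sum>b\<in>B. t b *\<^sub>R b)"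
      by (intro norm_triangle_le add_right_mono norm_triangle_ineq)
    moreover have "real (card B) = real ?d - 1" using B(4) DIM_positive[where 'a='a] by simp
    ultimately have "norm (y + p - ?c j) \<le> (?d + 1) * V" using y by (simp add: algebra_simps)
    then show "y + p \<in> U" unfolding U_def using jJ by (auto simp: dist_norm norm_minus_commute)
  qed simp
  also have "\<dots> \<le> (\<Sum>j\<in>{..J}. measure lebesgue (cball (?c j) ((?d + 1) * V)))"
    unfolding U_def by (intro measure_UNION_le) auto
  also have "\<dots> = (real J + 1) * (unit_ball_vol ?d * ((?d + 1) * V) ^ ?d)"
    using V by (simp add: content_cball)
  also have "\<dots> \<le> (2 * last_min / V) * (unit_ball_vol ?d * ((?d + 1) * V) ^ ?d)"
  proof (rule mult_right_mono)
    have "1 \<le> last_min / V" using V by simp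
    then show "real J + 1 \<le> 2 * last_min / V" using J(1) by simp
  qed (use V in auto)
  also have "\<dots> = 2 * unit_ball_vol ?d * (?d + 1) ^ ?d * V ^ (?d - 1) * last_min"
  proof -
    have "V ^ ?d = V * V ^ (?d - 1)" using DIM_positive[where 'a='a] by (metis power_minus_mult mult.commute)
    then have *: "((real ?d + 1) * V) ^ ?d = (real ?d + 1) ^ ?d * (V * V ^ (?d - 1))"
      by (metis power_mult_distrib)
    show ?thesis unfolding of_nat_add of_nat_1 * using V by (simp add: add.commute)
  qed
  finally show ?thesis .
qed

text \<open>Round the coordinates in an orthonormal basis of the subspace to multiples of a / d. Two
  lattice points with the same rounding are closer than \<open>a\<close> and therefore
  equal.\<close>

lemma card_subspace_le:
  fixes X :: real
  assumes S0: "subspace S0" "dim S0 \<le> k" and S: "S \<subseteq> \<Lambda> \<inter> S0" "S \<subseteq> cball 0 X" and X: "a \<le> X"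
  shows "real (card S) \<le> (4 * DIM('a) * X / a) ^ k"
proof -
  let ?d = "DIM('a)"
  obtain B where B: "B \<subseteq> S0" "pairwise orthogonal B" "\<And>x. x \<in> B \<Longrightarrow> norm x = 1" "independent B"
      "card B = dim S0" "span B = S0"
    using orthonormal_basis_subspace[OF S0(1)] by metis
  have fin: "finite B" using B(4) by (rule finiteI_independent)
  define Y where "Y = X * ?d / a"
  have d1: "1 \<le> real ?d" using DIM_positive[where 'a='a] by (simp add: Suc_leI)
  have "a * 1 \<le> X * ?d" using X a_pos d1 by (intro mult_mono) auto
  then have Y1: "1 \<le> Y" unfolding Y_def using a_pos by simp
  let ?g = "\<lambda>v. restrict (\<lambda>e. \<lfloor>(v \<bullet> e) * ?d / a\<rfloor>) B"
  let ?I = "{-\<lceil>Y\<rceil>..\<lfloor>Y\<rfloor>}"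
  have inj: "inj_on ?g S"
  proof (rule inj_onI)
    fix v w assume v: "v \<in> S" and w: "w \<in> S" and eq: "?g v = ?g w"
    define z where "z = v - w"
    have zL: "z \<in> \<Lambda>" using v w S diff_mem by (auto simp: z_def)
    have "z \<in> S0" using v w S S0(1) by (auto simp: z_def intro: subspace_diff)
    then have zs: "(\<Sum>e\<in>B. (z \<bullet> e) *\<^sub>R e) = z"
      using B fin by (intro orthonormal_basis_expand) auto
    have small: "\<bar>z \<bullet> e\<bar> < a / ?d" if "e \<in> B" for e
    proof -
      have "\<lfloor>(v \<bullet> e) * ?d / a\<rfloor> = \<lfloor>(w \<bullet> e) * ?d / a\<rfloor>" using fun_cong[OF eq, of e] that by simp
      then have "\<bar>(v \<bullet> e) * ?d / a - (w \<bullet> e) * ?d / a\<bar> < 1" by linarith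
      moreover have "(v \<bullet> e) * ?d / a - (w \<bullet> e) * ?d / a = (z \<bullet> e) * (?d / a)"
        by (simp add: z_def inner_diff_left diff_divide_distrib left_diff_distrib)
      ultimately have "\<bar>z \<bullet> e\<bar> * (?d / a) < 1" using a_pos d1 by (simp add: abs_mult)
      then show ?thesis using a_pos d1 by (simp add: field_simps)
    qed
    have "norm z < a"
    proof (cases "B = {}")
      case True
      then show ?thesis using zs a_pos by auto
    next
      case False
      have "norm z \<le> (\<Sum>e\<in>B. \<bar>z \<bullet> e\<bar>)"
        using norm_sum[of "\<lambda>e. (z \<bullet> e) *\<^sub>R e" B] B(3) by (simp add: zs)
      also have "\<dots> < (\<Sum>e\<in>B. a / ?d)" using small False fin by (intro sum_strict_mono) auto
      also have "\<dots> = real (card B) * (a / ?d)" by simp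
      also have "\<dots> \<le> real ?d * (a / ?d)"
        using B(5) dim_subset_UNIV[of S0] a_pos by (intro mult_right_mono) auto
      finally show ?thesis using d1 by simp
    qed
    then have "z = 0" using a_le[OF zL] by (meson not_le)
    then show "v = w" by (simp add: z_def)
  qed
  have "?g ` S \<subseteq> PiE B (\<lambda>_. ?I)"
  proof
    fix h assume "h \<in> ?g ` S"
    then obtain v where v: "v \<in> S" "h = ?g v" by auto
    have "\<lfloor>(v \<bullet> e) * ?d / a\<rfloor> \<in> ?I" if "e \<in> B" for e
    proof -
      have "\<bar>v \<bullet> e\<bar> \<le> X" using Cauchy_Schwarz_ineq2[of v e] B(3)[OF that] v S by auto
      then have "\<bar>v \<bullet> e\<bar> * (?d / a) \<le> X * (?d / a)" using a_pos by (intro mult_right_mono) auto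
      then have "\<bar>(v \<bullet> e) * ?d / a\<bar> \<le> Y" using a_pos unfolding Y_def by (simp add: abs_mult)
      then have "(v \<bullet> e) * ?d / a \<le> Y" "- Y \<le> (v \<bullet> e) * ?d / a" by linarith+
      then show ?thesis unfolding atLeastAtMost_iff by linarith
    qed
    then show "h \<in> PiE B (\<lambda>_. ?I)" using v by auto
  qed
  then have "card (?g ` S) \<le> card (PiE B (\<lambda>_. ?I))"
    using fin by (intro card_mono finite_PiE) auto
  then have "card S \<le> card ?I ^ card B" using card_image[OF inj] fin by (simp add: card_PiE)
  then have "real (card S) \<le> real (card ?I) ^ card B" by (metis of_nat_le_iff of_nat_power)
  also have "\<dots> \<le> (4 * Y) ^ card B"
  proof (rule power_mono)
    have "real_of_int (\<lfloor>Y\<rfloor> + \<lceil>Y\<rceil> + 1) \<le> Y + (Y + 1) + 1" by linarith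
    then show "real (card ?I) \<le> 4 * Y" using Y1 by simp
  qed simp
  also have "\<dots> \<le> (4 * Y) ^ k" using Y1 S0(2) B(5) by (intro power_increasing) auto
  finally show ?thesis by (simp add: Y_def mult_ac)
qed

end

subsection \<open>Planes spanned by short lattice vectors\<close>

text \<open>The Gram determinant of two vectors, that is, the squared area of the parallelogram that
  they span.\<close>

definition gram :: "'a::real_inner \<Rightarrow> 'a \<Rightarrow> real" where
  "gram x y = (norm x)\<^sup>2 * (norm y)\<^sup>2 - (x \<bullet> y)\<^sup>2"

lemma gram_commute: "gram x y = gram y x"
  by (simp add: gram_def inner_commute mult.commute)

lemma gram_add_multiple: "gram x (y + c *\<^sub>R x) = gram x y"
proof -
  have *: "gram x z = (x \<bullet> x) * (z \<bullet> z) - (x \<bullet> z) * (x \<bullet> z)" for z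
    by (simp add: gram_def power2_norm_eq_inner power2_eq_square[of "x \<bullet> z"])
  show ?thesis unfolding *
    by (simp add: inner_add_left inner_add_right inner_commute[of y x] algebra_simps)
qed

lemma gram_pos: 
  assumes "x \<noteq> 0" "y \<notin> span {x}" shows "0 < gram x y"
proof -
  have "\<bar>x \<bullet> y\<bar> \<noteq> norm x * norm y"
  proof
    assume "\<bar>x \<bullet> y\<bar> = norm x * norm y"
    then have "norm x *\<^sub>R y = norm y *\<^sub>R x \<or> norm x *\<^sub>R y = - norm y *\<^sub>R x"
      using norm_cauchy_schwarz_abs_eq[of x y] by simp
    then have "\<exists>c. norm x *\<^sub>R y = c *\<^sub>R x" by blast
    then obtain c where "norm x *\<^sub>R y = c *\<^sub>R x" by blast
    then have "inverse (norm x) *\<^sub>R (norm x *\<^sub>R y) = inverse (norm x) *\<^sub>R (c *\<^sub>R x)" by simp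
    then have "y = (inverse (norm x) * c) *\<^sub>R x" using assms(1) by simp
    then have "y \<in> span {x}" by (metis span_base span_scale insertI1)
    then show False using assms by simp
  qed
  then have "\<bar>x \<bullet> y\<bar> < norm x * norm y" using Cauchy_Schwarz_ineq2[of x y] by linarith
  then have "\<bar>x \<bullet> y\<bar>\<^sup>2 < (norm x * norm y)\<^sup>2" by (intro power_strict_mono) auto
  then show ?thesis by (simp add: gram_def power_mult_distrib)
qed

lemma gram_pos_imp:
  assumes "0 < gram x y" shows "x \<noteq> 0" "y \<notin> span {x}"
proof -
  show "x \<noteq> 0" using assms by (auto simp: gram_def)
  show "y \<notin> span {x}"
  proof
    assume "y \<in> span {x}"
    then obtain c where "y = c *\<^sub>R x" by (auto simp: span_singleton)
    then have "gram x y = 0" by (simp add: gram_def power2_norm_eq_inner power_mult_distrib) (simp add: power2_eq_square)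
    then show False using assms by simp
  qed
qed

section \<open>Reduced pairs in lattice planes\<close>

context unimodular
begin

definition primitive :: "'a \<Rightarrow> bool" where
  "primitive r \<longleftrightarrow> r \<in> \<Lambda> \<and> r \<noteq> 0 \<and> (\<forall>k::nat. 2 \<le> k \<longrightarrow> (1 / real k) *\<^sub>R r \<notin> \<Lambda>)"

text \<open>Gauss reduction, with a half-open condition on the inner product. That condition leaves
  at most one \<open>u\<close> in each class modulo integer multiples of \<open>v\<close>, which
  makes the lattice vectors in \<open>sum_inverse_second_le\<close> distinct.\<close>

definition reduced_pair :: "'a \<Rightarrow> 'a \<Rightarrow> bool" where
  "reduced_pair v u \<longleftrightarrow> v \<in> \<Lambda> \<and> u \<in> \<Lambda> \<and> v \<noteq> 0 \<and> u \<notin> span {v} \<and>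
     (\<forall>z\<in>\<Lambda> \<inter> span {v, u}. z \<noteq> 0 \<longrightarrow> norm v \<le> norm z) \<and>
     (\<forall>z\<in>\<Lambda> \<inter> span {v, u}. z \<notin> span {v} \<longrightarrow> norm u \<le> norm z) \<and>
     - (norm v)\<^sup>2 < 2 * (u \<bullet> v) \<and> 2 * (u \<bullet> v) \<le> (norm v)\<^sup>2"

lemma norm_minimizer:
  assumes S: "S \<subseteq> \<Lambda>" "S \<noteq> {}"
  obtains x where "x \<in> S" "\<And>y. y \<in> S \<Longrightarrow> norm x \<le> norm y"
proof -
  obtain s where s: "s \<in> S" using S(2) by auto
  let ?T = "S \<inter> cball 0 (norm s)"
  have "?T \<subseteq> \<Lambda> \<inter> cball 0 (norm s)" using S by auto
  then have fin: "finite ?T" using finite_bounded[OF bounded_cball] finite_subset by blast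
  have "?T \<noteq> {}" using s by auto
  then obtain x where x: "x \<in> ?T" "\<forall>y\<in>?T. norm x \<le> norm y"
    using fin by (metis arg_min_if_finite(1) arg_min_least)
  show ?thesis
  proof (rule that[of x])
    show "norm x \<le> norm y" if "y \<in> S" for y
    proof -
      have "norm x \<le> norm s" using x by simp
      then show ?thesis using x that by (cases "norm y \<le> norm s") auto
    qed
  qed (use x in auto)
qed

text \<open>Take a pair of least total length among the independent pairs whose Gram determinant is
  at most that of \<open>r\<close> and \<open>s\<close>. Adding \<open>x\<close> to \<open>y\<close>
  or subtracting it keeps the determinant, so it cannot shorten \<open>y\<close>. This is Lagrange's
  condition 2 |x \<bullet> y| <= |x|^2, which bounds the product of the lengths by the area. The
  bound on the total length in \<open>P\<close> makes the set of candidates finite.\<close>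

lemma reduced_gram_pair:
  assumes rs: "r \<in> \<Lambda>" "s \<in> \<Lambda>" "0 < gram r s"
  obtains x y where "x \<in> \<Lambda> \<inter> span {r, s}" "y \<in> \<Lambda> \<inter> span {r, s}" "0 < gram x y"
    "norm x \<le> norm y" "3 * ((norm x)\<^sup>2 * (norm y)\<^sup>2) \<le> 4 * gram r s"
proof -
  let ?L = "\<Lambda> \<inter> span {r, s}"
  define P where "P = {(x, y). x \<in> ?L \<and> y \<in> ?L \<and> 0 < gram x y \<and> gram x y \<le> gram r s \<and> norm x + norm y \<le> norm r + norm s}"
  have "P \<subseteq> (\<Lambda> \<inter> cball 0 (norm r + norm s)) \<times> (\<Lambda> \<inter> cball 0 (norm r + norm s))"
  proof
    fix z assume "z \<in> P"
    then obtain x y where "z = (x, y)" "x \<in> \<Lambda>" "y \<in> \<Lambda>" "norm x + norm y \<le> norm r + norm s"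
      by (auto simp: P_def)
    moreover from this have "norm x \<le> norm r + norm s" "norm y \<le> norm r + norm s"
      using norm_ge_zero[of x] norm_ge_zero[of y] by linarith+
    ultimately show "z \<in> (\<Lambda> \<inter> cball 0 (norm r + norm s)) \<times> (\<Lambda> \<inter> cball 0 (norm r + norm s))" by auto
  qed
  then have fin: "finite P" 
    by (rule finite_subset[OF _ finite_cartesian_product[OF finite_bounded[OF bounded_cball] finite_bounded[OF bounded_cball]]])
  have "(r, s) \<in> P" using rs by (auto simp: P_def span_base)
  then have ne: "P \<noteq> {}" by auto
  obtain z where z: "z \<in> P" "\<And>z'. z' \<in> P \<Longrightarrow> norm (fst z) + norm (snd z) \<le> norm (fst z') + norm (snd z')"
  proof (rule that[of "arg_min_on (\<lambda>z. norm (fst z) + norm (snd z)) P"])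
    show "arg_min_on (\<lambda>z. norm (fst z) + norm (snd z)) P \<in> P"
      by (rule arg_min_if_finite(1)[OF fin ne])
  qed (rule arg_min_least[OF fin ne])
  have sym: "(y, x) \<in> P" if "(x, y) \<in> P" for x y
    using that by (auto simp: P_def gram_commute add.commute)
  obtain x y where xy: "(x, y) \<in> P" "norm x \<le> norm y"
     "\<And>x' y'. (x', y') \<in> P \<Longrightarrow> norm x + norm y \<le> norm x' + norm y'"
  proof (cases "norm (fst z) \<le> norm (snd z)")
    case True
    show ?thesis by (rule that[of "fst z" "snd z"]) (use z True in \<open>auto\<close>)
  next
    case False
    show ?thesis by (rule that[of "snd z" "fst z"]) (use z False sym[of "fst z" "snd z"] in \<open>auto simp: add.commute\<close>)
  qed
  have step: "norm y \<le> norm (y + c *\<^sub>R x)" if c: "c = 1 \<or> c = - 1" for c :: real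
  proof (rule ccontr)
    assume n: "\<not> ?thesis"
    have "y + c *\<^sub>R x \<in> \<Lambda>" using c xy(1) add_mem diff_mem by (auto simp: P_def)
    moreover have "y + c *\<^sub>R x \<in> span {r, s}" using xy(1) by (auto simp: P_def intro: span_add span_scale)
    ultimately have "(x, y + c *\<^sub>R x) \<in> P" using xy(1) n by (auto simp: P_def gram_add_multiple)
    from xy(3)[OF this] n show False by simp
  qed
  have sq: "(norm y)\<^sup>2 \<le> (norm (y + c *\<^sub>R x))\<^sup>2" if c: "c = 1 \<or> c = - 1" for c :: real
    using step[OF c] by (intro power_mono) auto
  have "2 * \<bar>x \<bullet> y\<bar> \<le> (norm x)\<^sup>2"
    using sq[of 1] sq[of "- 1"]
    by (simp add: power2_norm_eq_inner inner_add_left inner_add_right inner_commute inner_diff_left inner_diff_right)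
  then have "(2 * \<bar>x \<bullet> y\<bar>)\<^sup>2 \<le> ((norm x)\<^sup>2)\<^sup>2" by (intro power_mono) auto
  also have "\<dots> \<le> (norm x)\<^sup>2 * (norm y)\<^sup>2"
    unfolding power2_eq_square[of "(norm x)\<^sup>2"] by (intro mult_left_mono power_mono xy(2)) auto
  finally have "4 * (x \<bullet> y)\<^sup>2 \<le> (norm x)\<^sup>2 * (norm y)\<^sup>2" by (simp add: power_mult_distrib)
  then have "3 * ((norm x)\<^sup>2 * (norm y)\<^sup>2) \<le> 4 * gram x y" by (simp add: gram_def)
  moreover have "gram x y \<le> gram r s" using xy(1) by (simp add: P_def)
  ultimately have "3 * ((norm x)\<^sup>2 * (norm y)\<^sup>2) \<le> 4 * gram r s" by linarith
  then show ?thesis using that xy(1,2) by (auto simp: P_def)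
qed

lemma reduced_pair_exists:
  assumes rs: "r \<in> \<Lambda>" "s \<in> \<Lambda>" "0 < gram r s" and D: "gram r s \<le> D\<^sup>2" "0 < D"
  obtains v u where "reduced_pair v u" "span {v, u} = span {r, s}" "norm v * norm u \<le> 2 * D"
proof -
  let ?L = "\<Lambda> \<inter> span {r, s}"
  obtain x y where xy: "x \<in> ?L" "y \<in> ?L" "0 < gram x y" "norm x \<le> norm y"
    "3 * ((norm x)\<^sup>2 * (norm y)\<^sup>2) \<le> 4 * gram r s"
    by (rule reduced_gram_pair[OF rs])
  have "(norm x * norm y)\<^sup>2 \<le> (2 * D)\<^sup>2"
    using xy(5) D by (simp add: power_mult_distrib) (smt (verit) zero_le_power2 mult_nonneg_nonneg)
  then have xyD: "norm x * norm y \<le> 2 * D" using D(2) by (meson power2_le_imp_le less_imp_le mult_pos_pos zero_less_numeral)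
  have x0: "x \<noteq> 0" and yx: "y \<notin> span {x}" using gram_pos_imp[OF xy(3)] .
  obtain v where v: "v \<in> ?L - {0}" "\<And>z. z \<in> ?L - {0} \<Longrightarrow> norm v \<le> norm z"
    by (rule norm_minimizer[of "?L - {0}"]) (use xy(1) x0 in auto)
  have v0: "v \<noteq> 0" using v by auto
  have "x \<notin> span {v} \<or> y \<notin> span {v}"
  proof (rule ccontr)
    assume "\<not> ?thesis"
    then obtain c e where c: "x = c *\<^sub>R v" "y = e *\<^sub>R v" by (auto simp: span_singleton)
    then have "c \<noteq> 0" using x0 by auto
    then have "y = (e / c) *\<^sub>R x" using c by simp
    then show False using yx by (metis span_base span_scale insertI1)
  qed
  then obtain y' where y': "y' \<in> ?L - span {v}" "norm y' \<le> norm y" using xy by auto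
  obtain u0 where u0: "u0 \<in> ?L - span {v}" "\<And>z. z \<in> ?L - span {v} \<Longrightarrow> norm u0 \<le> norm z"
    by (rule norm_minimizer[of "?L - span {v}"]) (use y' in auto)
  have vs: "v \<in> span {v}" by (simp add: span_base)
  have shift: "u0 + c *\<^sub>R v \<in> ?L - span {v}" if c: "c = 1 \<or> c = - 1" for c :: real
  proof -
    have "u0 + c *\<^sub>R v \<in> \<Lambda>" using c u0(1) v(1) add_mem diff_mem by auto
    moreover have "u0 + c *\<^sub>R v \<in> span {r, s}" using u0(1) v(1) by (auto intro: span_add span_scale)
    moreover have "u0 + c *\<^sub>R v \<notin> span {v}"
    proof
      assume "u0 + c *\<^sub>R v \<in> span {v}"
      then have "u0 + c *\<^sub>R v - c *\<^sub>R v \<in> span {v}" using vs by (intro span_diff span_scale)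
      then show False using u0(1) by simp
    qed
    ultimately show ?thesis by simp
  qed
  have sq: "(norm u0)\<^sup>2 \<le> (norm (u0 + c *\<^sub>R v))\<^sup>2" if c: "c = 1 \<or> c = - 1" for c :: real
    using u0(2)[OF shift[OF c]] by (intro power_mono) auto
  have ineq: "- (norm v)\<^sup>2 \<le> 2 * (u0 \<bullet> v)" "2 * (u0 \<bullet> v) \<le> (norm v)\<^sup>2"
    using sq[of 1] sq[of "- 1"]
    by (simp_all add: power2_norm_eq_inner inner_add_left inner_add_right inner_commute inner_diff_left inner_diff_right)
  \<comment> \<open>In the boundary case \<open>u0\<close> is replaced by its mirror image in the
    hyperplane orthogonal to \<open>v\<close>, which is \<open>u0 + v\<close>; it has the same
    length and satisfies the strict inequality.\<close>
  define u where "u = (if - (norm v)\<^sup>2 = 2 * (u0 \<bullet> v) then u0 + 1 *\<^sub>R v else u0)"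
  have uL: "u \<in> ?L - span {v}" using shift[of 1] u0(1) by (auto simp: u_def)
  have "(norm u)\<^sup>2 = (norm u0)\<^sup>2"
    by (simp add: u_def power2_norm_eq_inner inner_add_left inner_add_right inner_commute)
  then have nu: "norm u = norm u0" by (simp add: power2_eq_iff_nonneg)
  have uv: "- (norm v)\<^sup>2 < 2 * (u \<bullet> v)" "2 * (u \<bullet> v) \<le> (norm v)\<^sup>2"
    using ineq v0 by (auto simp: u_def inner_add_left power2_norm_eq_inner)
  have sp: "span {v, u} = span {r, s}"
  proof
    show "span {v, u} \<subseteq> span {r, s}" using uL v(1) by (intro span_minimal) auto
    have ind: "independent {v, u}"
    proof -
      have "independent {v}" using v0 by simp
      then have "independent (insert u {v})" using uL by (intro independent_insertI[of u "{v}"]) simp_all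
      then show ?thesis by (rule back_subst[where P = "\<lambda>X. independent X"]) auto
    qed
    have "v \<noteq> u" using uL vs by auto
    moreover have "dim (span {r, s}) \<le> card {r, s}" by (rule dim_le_card) simp_all
    moreover have "card {r, s} \<le> 2" by (simp add: card_insert_if)
    ultimately have "dim {r, s} \<le> card {v, u}" by simp
    then have "dim (span {r, s}) \<le> card {v, u}" by (simp only: dim_span)
    then show "span {r, s} \<subseteq> span {v, u}"
      by (intro card_ge_dim_independent[OF _ ind]) (use uL v(1) in blast)
  qed
  have "reduced_pair v u" unfolding reduced_pair_def sp
    using v uL u0 nu uv v0 by auto
  \<comment> \<open>\<open>v\<close> is no longer than \<open>x\<close>, and \<open>u\<close> is no
    longer than whichever of \<open>x\<close> and \<open>y\<close> lies off the line of
    \<open>v\<close>, hence no longer than \<open>y\<close>.\<close>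
  moreover have "norm v * norm u \<le> norm x * norm y"
    using v(2)[of x] u0(2)[OF y'(1)] y'(2) nu xy(1) x0 by (intro mult_mono) auto
  ultimately show ?thesis using that sp xyD by auto
qed

lemma reduced_pair_norm_le: "reduced_pair v u \<Longrightarrow> norm v \<le> norm u"
  unfolding reduced_pair_def using span_zero[of "{v}"] by (metis IntI insertI1 insert_commute span_base)

text \<open>Cut the plane into cells of width |v| along \<open>v\<close> and |u| / 2 along the
  component \<open>w\<close> of \<open>u\<close> orthogonal to \<open>v\<close>. A cell contains at
  most one lattice point: a difference on the line of \<open>v\<close> would be shorter than
  \<open>v\<close>, and any other difference, after subtracting the nearest multiple of
  \<open>v\<close>, would be shorter than |v| / 2 + |u| / 2 <= |u| and still off that line.\<close>

lemma reduced_pair_card_le: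
  assumes red: "reduced_pair v u" and S: "norm u \<le> S"
  shows "real (card (\<Lambda> \<inter> span {v, u} \<inter> cball 0 S)) \<le> 24 * S\<^sup>2 / (norm v * norm u)"
proof -
  let ?L = "\<Lambda> \<inter> span {v, u}"
  have v0: "v \<noteq> 0" and uv: "u \<notin> span {v}" and vL: "v \<in> \<Lambda>"
    and vmin: "\<And>z. z \<in> ?L \<Longrightarrow> z \<noteq> 0 \<Longrightarrow> norm v \<le> norm z"
    and umin: "\<And>z. z \<in> ?L \<Longrightarrow> z \<notin> span {v} \<Longrightarrow> norm u \<le> norm z"
    using red by (auto simp: reduced_pair_def)
  have vu: "norm v \<le> norm u" by (rule reduced_pair_norm_le[OF red])
  have nv: "0 < norm v" using v0 by simp
  have nu: "0 < norm u" using nv vu by linarith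
  define w where "w = u - ((u \<bullet> v) / (norm v)\<^sup>2) *\<^sub>R v"
  have vv: "v \<bullet> v = (norm v)\<^sup>2" by (simp add: power2_norm_eq_inner)
  have wv: "w \<bullet> v = 0" using nv by (simp add: w_def inner_diff_left vv)
  then have vw: "v \<bullet> w = 0" by (simp add: inner_commute)
  have "w \<noteq> 0"
  proof
    assume "w = 0"
    then have "u = ((u \<bullet> v) / (norm v)\<^sup>2) *\<^sub>R v" by (simp add: w_def)
    then show False using uv by (metis span_base span_scale insertI1)
  qed
  then have nw: "0 < norm w" by simp
  let ?g = "\<lambda>z. (\<lfloor>(z \<bullet> v) / (norm v)\<^sup>2\<rfloor>, \<lfloor>2 * (z \<bullet> w) / (norm w * norm u)\<rfloor>)"
  let ?I = "{-\<lceil>S / norm v\<rceil>..\<lfloor>S / norm v\<rfloor>} \<times> {-\<lceil>2 * S / norm u\<rceil>..\<lfloor>2 * S / norm u\<rfloor>}"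
  have inj: "inj_on ?g (?L \<inter> cball 0 S)"
  proof (rule inj_onI)
    fix z1 z2 assume z1: "z1 \<in> ?L \<inter> cball 0 S" and z2: "z2 \<in> ?L \<inter> cball 0 S" and eq: "?g z1 = ?g z2"
    define z where "z = z1 - z2"
    have zL: "z \<in> ?L" using z1 z2 diff_mem by (auto simp: z_def intro: span_diff)
    have "\<bar>(z1 \<bullet> v) / (norm v)\<^sup>2 - (z2 \<bullet> v) / (norm v)\<^sup>2\<bar> < 1"
      "\<bar>2 * (z1 \<bullet> w) / (norm w * norm u) - 2 * (z2 \<bullet> w) / (norm w * norm u)\<bar> < 1"
      using eq unfolding prod.inject by linarith+
    then have "\<bar>(z \<bullet> v) / (norm v)\<^sup>2\<bar> < 1" "\<bar>2 * (z \<bullet> w) / (norm w * norm u)\<bar> < 1"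
      by (simp_all add: z_def inner_diff_left diff_divide_distrib right_diff_distrib)
    then have zv: "\<bar>(z \<bullet> v) / (norm v)\<^sup>2\<bar> < 1" and zw: "\<bar>2 * (z \<bullet> w) / norm w\<bar> < norm u"
      using nw nu by (simp_all add: abs_mult field_simps)
    obtain k l where "z = k *\<^sub>R v + l *\<^sub>R u"
      using zL by (auto simp: span_insert[of v] span_insert[of u] span_empty algebra_simps)
    then have zkl: "z = (k + l * ((u \<bullet> v) / (norm v)\<^sup>2)) *\<^sub>R v + l *\<^sub>R w"
      by (simp add: w_def algebra_simps)
    define \<alpha> where "\<alpha> = k + l * ((u \<bullet> v) / (norm v)\<^sup>2)"
    have z\<alpha>: "z = \<alpha> *\<^sub>R v + l *\<^sub>R w" using zkl by (simp add: \<alpha>_def)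
    have "z \<bullet> v = \<alpha> * (norm v)\<^sup>2" "z \<bullet> w = l * (norm w)\<^sup>2"
      by (simp_all only: z\<alpha> inner_add_left inner_scaleR_left vv vw wv power2_norm_eq_inner[of w])
    then have \<alpha>1: "\<bar>\<alpha>\<bar> < 1" and l1: "\<bar>2 * l\<bar> * norm w < norm u"
      using zv zw nv nw by (simp_all add: abs_mult power2_eq_square)
    show "z1 = z2"
    proof (cases "l = 0")
      case True
      then have "norm z < norm v" using \<alpha>1 nv by (simp add: z\<alpha>)
      then have "z = 0" using vmin[OF zL] by force
      then show ?thesis by (simp add: z_def)
    next
      case False
      define i where "i = round \<alpha>"
      have i: "\<bar>\<alpha> - of_int i\<bar> \<le> 1 / 2" unfolding i_def using of_int_round_abs_le[of \<alpha>] by linarith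
      define z' where "z' = z - of_int i *\<^sub>R v"
      have "of_int i *\<^sub>R v \<in> ?L" using vL of_int_scale_mem by (auto intro: span_scale span_base)
      then have z'L: "z' \<in> ?L" using zL diff_mem by (auto simp: z'_def intro: span_diff)
      have z'2: "z' = (\<alpha> - of_int i) *\<^sub>R v + l *\<^sub>R w" by (simp add: z'_def z\<alpha> algebra_simps)
      have "z' \<notin> span {v}"
      proof
        assume "z' \<in> span {v}"
        then obtain c where "z' = c *\<^sub>R v" by (auto simp: span_singleton)
        then have "z' \<bullet> w = 0" using wv by (simp add: inner_commute)
        moreover have "z' \<bullet> w = l * (norm w)\<^sup>2"
          by (simp only: z'2 inner_add_left inner_scaleR_left vw power2_norm_eq_inner)
        ultimately show False using False nw by simp
      qed
      then have "norm u \<le> norm z'" using umin z'L by auto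
      moreover have "norm z' \<le> \<bar>\<alpha> - of_int i\<bar> * norm v + \<bar>l\<bar> * norm w"
        unfolding z'2 by (metis norm_triangle_ineq norm_scaleR)
      moreover have "\<bar>\<alpha> - of_int i\<bar> * norm v \<le> 1 / 2 * norm v" using i by (intro mult_right_mono) auto
      moreover have "\<bar>l\<bar> * norm w < norm u / 2" using l1 by (simp add: abs_mult)
      ultimately show ?thesis using vu by linarith
    qed
  qed
  have "?g ` (?L \<inter> cball 0 S) \<subseteq> ?I"
  proof
    fix h assume "h \<in> ?g ` (?L \<inter> cball 0 S)"
    then obtain z where z: "norm z \<le> S" "h = ?g z" by auto
    have "\<bar>z \<bullet> v\<bar> \<le> S * norm v" "\<bar>z \<bullet> w\<bar> \<le> S * norm w"
      using Cauchy_Schwarz_ineq2[of z v] Cauchy_Schwarz_ineq2[of z w] z(1)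
      by (meson mult_right_mono norm_ge_zero order_trans)+
    then have "\<bar>(z \<bullet> v) / (norm v)\<^sup>2\<bar> \<le> S / norm v" "\<bar>2 * (z \<bullet> w) / (norm w * norm u)\<bar> \<le> 2 * S / norm u"
      using nv nw nu by (simp_all add: abs_mult power2_eq_square field_simps)
    then have "(z \<bullet> v) / (norm v)\<^sup>2 \<le> S / norm v" "- (S / norm v) \<le> (z \<bullet> v) / (norm v)\<^sup>2"
       "2 * (z \<bullet> w) / (norm w * norm u) \<le> 2 * S / norm u" "- (2 * S / norm u) \<le> 2 * (z \<bullet> w) / (norm w * norm u)"
      by linarith+
    then show "h \<in> ?I" unfolding z(2) mem_Times_iff fst_conv snd_conv atLeastAtMost_iff by linarith
  qed
  then have "card (?g ` (?L \<inter> cball 0 S)) \<le> card ?I" by (intro card_mono) auto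
  then have "real (card (?L \<inter> cball 0 S)) \<le> real (card ?I)" by (simp only: card_image[OF inj] of_nat_le_iff)
  also have "\<dots> \<le> (4 * S / norm v) * (6 * S / norm u)"
  proof -
    have 1: "1 \<le> S / norm v" "1 \<le> S / norm u" using S vu nv nu by auto
    have a: "real_of_int (\<lfloor>S / norm v\<rfloor> + \<lceil>S / norm v\<rceil> + 1) \<le> 4 * S / norm v"
      using 1(1) by linarith
    have b: "real_of_int (\<lfloor>2 * S / norm u\<rfloor> + \<lceil>2 * S / norm u\<rceil> + 1) \<le> 6 * S / norm u"
      using 1(2) by linarith
    have ca: "real (card {-\<lceil>S / norm v\<rceil>..\<lfloor>S / norm v\<rfloor>}) \<le> 4 * S / norm v" using a 1 by simp
    have cb: "real (card {-\<lceil>2 * S / norm u\<rceil>..\<lfloor>2 * S / norm u\<rfloor>}) \<le> 6 * S / norm u" using b 1 by simp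
    show ?thesis unfolding card_cartesian_product of_nat_mult using ca cb by (intro mult_mono) (use 1 in auto)
  qed
  finally show ?thesis by (simp add: power2_eq_square)
qed

lemma primitive_in_span_shortest:
  assumes s: "primitive s" and v: "v \<in> \<Lambda>" "v \<noteq> 0" and sv: "s \<in> span {v}"
    and min: "\<And>z. z \<in> \<Lambda> \<inter> span {v} \<Longrightarrow> z \<noteq> 0 \<Longrightarrow> norm v \<le> norm z"
  shows "norm s = norm v"
proof -
  obtain c where c: "s = c *\<^sub>R v" using sv by (auto simp: span_singleton)
  have "s - of_int \<lfloor>c\<rfloor> *\<^sub>R v \<in> \<Lambda>" using s v of_int_scale_mem diff_mem by (auto simp: primitive_def)
  moreover have "s - of_int \<lfloor>c\<rfloor> *\<^sub>R v = frac c *\<^sub>R v" by (simp add: c frac_def algebra_simps)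
  moreover have "norm (frac c *\<^sub>R v) < norm v" using frac_lt_1[of c] frac_ge_0[of c] v(2) by simp
  ultimately have "frac c *\<^sub>R v = 0" using min[of "frac c *\<^sub>R v"] by (force intro: span_scale span_base)
  then have "frac c = 0" using v by simp
  then obtain k :: int where k: "c = of_int k" by (metis Ints_cases frac_eq_0_iff)
  have "k \<noteq> 0" using s c k by (auto simp: primitive_def)
  moreover have "\<not> 2 \<le> nat \<bar>k\<bar>"
  proof
    assume 2: "2 \<le> nat \<bar>k\<bar>"
    have "(1 / real (nat \<bar>k\<bar>)) *\<^sub>R s = of_int (sgn k) *\<^sub>R v"
      using \<open>k \<noteq> 0\<close> by (simp add: c k sgn_if)
    then have "(1 / real (nat \<bar>k\<bar>)) *\<^sub>R s \<in> \<Lambda>" using v(1) of_int_scale_mem by metis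
    then show False using s 2 by (auto simp: primitive_def)
  qed
  ultimately have "\<bar>k\<bar> = 1" by linarith
  then have "\<bar>c\<bar> = 1" using k by (metis of_int_1 of_int_abs)
  then show ?thesis by (simp add: c)
qed

end

definition plane_const :: "nat \<Rightarrow> real" where
  "plane_const d = unit_ball_vol d * (real d + 1) ^ d"

definition last_min_const :: "nat \<Rightarrow> real" where
  "last_min_const d = max 1 (2 ^ (d + 1) / unit_ball_vol d)"

text \<open>One summand for each of the classes \<open>V1\<close>, \<open>V2\<close> and
  \<open>V3\<close> in \<open>sum_inverse_shortest_le\<close>.\<close>

definition short_sum_const :: "nat \<Rightarrow> real" where
  "short_sum_const d = 2 ^ d * plane_const d + 2 ^ (d + 1) * plane_const d +
     (2 * real d + 2) * last_min_const d * 2 ^ (d - 2) * (4 * real d) ^ (d - 2)"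

definition bad_const :: "nat \<Rightarrow> real" where
  "bad_const d = 24 * (32 * plane_const d * 4 ^ (d - 2)) * short_sum_const d"

lemma plane_const_pos: "0 < plane_const d"
  by (simp add: plane_const_def)

lemma last_min_const_ge_1: "1 \<le> last_min_const d"
  by (simp add: last_min_const_def)

lemma short_sum_const_nonneg: "0 \<le> short_sum_const d"
  using plane_const_pos[of d] last_min_const_ge_1[of d] by (simp add: short_sum_const_def)

lemma bad_const_nonneg: "0 \<le> bad_const d"
  using plane_const_pos[of d] short_sum_const_nonneg[of d] by (simp add: bad_const_def)

section \<open>Sums over reduced pairs of small area\<close>

context lattice_min
begin

lemma last_min_le: "last_min \<le> last_min_const DIM('a) / a ^ (DIM('a) - 1)"
proof -
  let ?\<beta> = "unit_ball_vol (DIM('a))"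
  have \<beta>: "0 < ?\<beta>" by simp
  have "last_min \<le> (2 ^ (DIM('a) + 1) / ?\<beta>) / a ^ (DIM('a) - 1)"
    using last_min_bound \<beta> a_pos by (simp add: field_simps)
  also have "\<dots> \<le> last_min_const DIM('a) / a ^ (DIM('a) - 1)"
    using a_pos by (intro divide_right_mono) (auto simp: last_min_const_def)
  finally show ?thesis .
qed

lemma last_min_div_le: "last_min / a \<le> (last_min_const DIM('a) / a) ^ DIM('a)"
proof -
  let ?K = "last_min_const DIM('a)"
  have pw: "a ^ DIM('a) = a ^ (DIM('a) - 1) * a"
    using DIM_positive[where 'a='a] by (metis power_minus_mult)
  have "last_min / a \<le> ?K / a ^ (DIM('a) - 1) / a"
    using last_min_le a_pos by (intro divide_right_mono) auto
  also have "\<dots> = ?K / a ^ DIM('a)" by (simp add: pw)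
  also have "\<dots> \<le> ?K ^ DIM('a) / a ^ DIM('a)"
    using last_min_const_ge_1[of "DIM('a)"] a_pos DIM_positive[where 'a='a]
    by (intro divide_right_mono self_le_power) auto
  finally show ?thesis by (simp add: power_divide)
qed

lemma a_le_const: "a \<le> last_min_const DIM('a)"
proof (rule ccontr)
  let ?K = "last_min_const DIM('a)"
  assume "\<not> ?thesis"
  then have "?K / a < 1" using a_pos by simp
  then have "(?K / a) ^ DIM('a) < 1"
    using power_strict_mono[of "?K / a" 1 "DIM('a)"] last_min_const_ge_1[of "DIM('a)"] a_pos
    by simp
  moreover have "1 \<le> last_min / a" using a_le_last_min a_pos by simp
  ultimately show False using last_min_div_le by linarith
qed

text \<open>Counting the vectors \<open>u\<close> alone loses too much. Each \<open>u\<close> is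
  replaced by the roughly |u| / |v| lattice vectors z = u + j v of length comparable to |u|; then 1
  / |u| is at most |v| times a sum of 4 / |z|^2 over them. These z are distinct by the half-open
  condition in \<open>reduced_pair\<close>, and they are at least \<open>last_min\<close> long by
  minimality of \<open>u\<close>. So the count of lattice points in balls applies, and
  \<open>dyadic_sum\<close> with exponent 2 gains the factor |v| in place of one power of D /
  |v|.\<close>

lemma sum_inverse_second_le:
  assumes d: "3 \<le> DIM('a)" and v: "v \<in> \<Lambda>" "v \<noteq> 0" and D: "0 < D"
    and U: "finite U" "\<And>u. u \<in> U \<Longrightarrow> reduced_pair v u \<and> last_min \<le> norm u \<and> norm u \<le> 2 * D / norm v"
  shows "(\<Sum>u\<in>U. 1 / norm u) \<le> 32 * plane_const DIM('a) * norm v * (4 * D / norm v) ^ (DIM('a) - 2)"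
proof -
  let ?d = "DIM('a)"
  have nv: "0 < norm v" using v by simp
  define J where "J u = nat \<lfloor>norm u / norm v\<rfloor>" for u :: 'a
  let ?P = "Sigma U (\<lambda>u. {..J u})"
  let ?f = "\<lambda>(u, j::nat). u + real j *\<^sub>R v"
  have finP: "finite ?P" using U(1) by auto
  have nu: "0 < norm u" if "u \<in> U" for u using U(2)[OF that] last_min_pos by linarith
  have J: "real (J u) \<le> norm u / norm v" "norm u / norm v < real (J u) + 1" for u
    using nv by (auto simp: J_def of_nat_nat)
  have inj: "inj_on ?f ?P"
  proof (rule inj_onI)
    fix p p' assume p: "p \<in> ?P" and p': "p' \<in> ?P" and eq: "?f p = ?f p'"
    obtain u j u' j' where uj: "p = (u, j)" "p' = (u', j')" by (cases p, cases p') auto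
    have u: "u \<in> U" "u' \<in> U" using p p' uj by auto
    have e: "u - u' = (real j' - real j) *\<^sub>R v" using eq by (simp add: uj algebra_simps)
    then have "(u - u') \<bullet> v = (real j' - real j) * (norm v)\<^sup>2" by (simp add: power2_norm_eq_inner)
    then have "u \<bullet> v - u' \<bullet> v = (real j' - real j) * (norm v)\<^sup>2" by (simp add: inner_diff_left)
    moreover have "\<bar>u \<bullet> v - u' \<bullet> v\<bar> < (norm v)\<^sup>2"
      using U(2)[OF u(1)] U(2)[OF u(2)] unfolding reduced_pair_def by linarith
    ultimately have "\<bar>real j' - real j\<bar> * (norm v)\<^sup>2 < 1 * (norm v)\<^sup>2" by (simp add: abs_mult)
    then have "\<bar>real j' - real j\<bar> < 1" using nv by (simp only: mult_less_cancel_right_pos zero_less_power)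
    then have "j' = j" by linarith
    then show "p = p'" using e uj by simp
  qed
  have f: "?f p \<in> \<Lambda>" "norm (fst p) \<le> norm (?f p)" "norm (?f p) \<le> 2 * norm (fst p)" if p: "p \<in> ?P" for p
  proof -
    obtain u j where uj: "p = (u, j)" "u \<in> U" "j \<le> J u" using p by auto
    have red: "reduced_pair v u" using U(2)[OF uj(2)] by simp
    then have uL: "u \<in> \<Lambda>" "u \<notin> span {v}" by (auto simp: reduced_pair_def)
    show L: "?f p \<in> \<Lambda>" using uL v of_nat_scale_mem add_mem by (simp add: uj)
    have "u + real j *\<^sub>R v \<in> span {v, u}" by (intro span_add span_scale) (auto simp: span_base)
    moreover have "u + real j *\<^sub>R v \<notin> span {v}"
    proof
      assume "u + real j *\<^sub>R v \<in> span {v}"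
      then have "u + real j *\<^sub>R v - real j *\<^sub>R v \<in> span {v}"
        by (rule span_diff) (simp add: span_scale span_base)
      then show False using uL by simp
    qed
    ultimately show "norm (fst p) \<le> norm (?f p)" using red L by (auto simp: reduced_pair_def uj)
    have "real j * norm v \<le> norm u"
    proof -
      have "real j \<le> norm u / norm v" using uj(3) J(1)[of u] by linarith
      then show ?thesis using nv by (simp add: pos_le_divide_eq)
    qed
    then show "norm (?f p) \<le> 2 * norm (fst p)"
      using norm_triangle_ineq[of u "real j *\<^sub>R v"] by (simp add: uj)
  qed
  have "(\<Sum>u\<in>U. 1 / norm u) \<le> (\<Sum>u\<in>U. \<Sum>j\<le>J u. norm v * (4 / (norm (?f (u, j)))\<^sup>2))"
  proof (rule sum_mono)
    fix u assume u: "u \<in> U"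
    have "1 / norm u = (norm u / norm v) * (norm v / (norm u)\<^sup>2)"
      using nu[OF u] nv by (simp add: power2_eq_square)
    also have "\<dots> \<le> (real (J u) + 1) * (norm v / (norm u)\<^sup>2)"
      using J(2)[of u] by (intro mult_right_mono) auto
    also have "\<dots> = (\<Sum>j\<le>J u. norm v / (norm u)\<^sup>2)" by simp
    also have "\<dots> \<le> (\<Sum>j\<le>J u. norm v * (4 / (norm (?f (u, j)))\<^sup>2))"
    proof (rule sum_mono)
      fix j assume "j \<in> {..J u}"
      then have p: "(u, j) \<in> ?P" using u by auto
      have "norm u \<le> norm (?f (u, j))" "norm (?f (u, j)) \<le> 2 * norm u" using f[OF p] by auto
      then have "0 < norm (?f (u, j))" "(norm (?f (u, j)))\<^sup>2 \<le> (2 * norm u)\<^sup>2"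
        using nu[OF u] by (linarith, intro power_mono) simp_all
      then have "1 / (norm u)\<^sup>2 \<le> 4 / (norm (?f (u, j)))\<^sup>2"
        using nu[OF u] by (simp add: field_simps)
      then have "norm v * (1 / (norm u)\<^sup>2) \<le> norm v * (4 / (norm (?f (u, j)))\<^sup>2)"
        by (rule mult_left_mono) simp
      then show "norm v / (norm u)\<^sup>2 \<le> norm v * (4 / (norm (?f (u, j)))\<^sup>2)" by simp
    qed
    finally show "1 / norm u \<le> (\<Sum>j\<le>J u. norm v * (4 / (norm (?f (u, j)))\<^sup>2))" .
  qed
  also have "\<dots> = (\<Sum>p\<in>?P. norm v * (4 / (norm (?f p))\<^sup>2))"
    using U(1) by (subst sum.Sigma) (auto intro!: sum.cong)
  also have "\<dots> = (\<Sum>p\<in>?P. 4 * norm v * (1 / (norm (?f p))\<^sup>2))" by (intro sum.cong refl) simp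
  also have "\<dots> = 4 * norm v * (\<Sum>p\<in>?P. 1 / (norm (?f p))\<^sup>2)" by (simp only: sum_distrib_left)
  also have "(\<Sum>p\<in>?P. 1 / (norm (?f p))\<^sup>2) = (\<Sum>z\<in>?f ` ?P. 1 / (norm z)\<^sup>2)"
    by (subst sum.reindex[OF inj]) (simp add: comp_def)
  also have "\<dots> \<le> 2 ^ (2 + 1) * plane_const ?d * (4 * D / norm v) ^ (?d - 2)"
  proof (rule dyadic_sum)
    show "finite (?f ` ?P)" using finP by blast
    show "0 \<le> plane_const ?d" using plane_const_pos[of ?d] by simp
    show "2 < ?d" using d by simp
    fix z assume "z \<in> ?f ` ?P"
    then obtain p where p: "p \<in> ?P" "z = ?f p" by auto
    then have u: "fst p \<in> U" by auto
    show "0 < norm z" using f(2)[OF p(1)] nu[OF u] unfolding p(2) by linarith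
    have "norm (fst p) \<le> 2 * D / norm v" using U(2)[OF u] by blast
    then show "norm z \<le> 4 * D / norm v" using f(3)[OF p(1)] p(2) by simp
  next
    fix x :: real assume x: "0 < x"
    show "real (card {z \<in> ?f ` ?P. norm z \<le> x}) \<le> plane_const ?d * x ^ ?d"
    proof (cases "last_min \<le> x")
      case True
      have "{z \<in> ?f ` ?P. norm z \<le> x} \<subseteq> \<Lambda> \<inter> cball 0 x" using f(1) by auto
      then have "card {z \<in> ?f ` ?P. norm z \<le> x} \<le> card (\<Lambda> \<inter> cball 0 x)"
        by (intro card_mono finite_bounded) auto
      then show ?thesis using card_cball_le[OF True] by (simp add: plane_const_def power_mult_distrib mult.assoc add.commute)
    next
      case False
      have "\<not> norm z \<le> x" if z: "z \<in> ?f ` ?P" for z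
      proof -
        obtain p where p: "p \<in> ?P" "z = ?f p" using z by auto
        then have "last_min \<le> norm (fst p)" using U(2) by auto
        then show ?thesis using f(2)[OF p(1)] p(2) False by simp
      qed
      then have "{z \<in> ?f ` ?P. norm z \<le> x} = {}" by blast
      then show ?thesis using plane_const_pos[of ?d] x by (simp only: card.empty) simp
    qed
  qed (use D nv in auto)
  finally show ?thesis using nv by (simp add: mult_ac)
qed

text \<open>The number of vectors of length at most x in the three classes is O(x^d) beyond
  \<open>last_min\<close>, O(last_min x^(d - 1)) where the vectors that are no longer span a
  hyperplane, and O((x / a)^(d - 2)) where they span less. Against the weight |v|^(2 - d) the first
  two are sums of geometric type, and the two upper bounds on |v| turn them into O(D). The third is
  critical and leaves the number of dyadic scales between \<open>a\<close> and
  \<open>last_min\<close>.\<close>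

lemma sum_inverse_shortest_le:
  assumes d: "3 \<le> DIM('a)" and D: "0 < D" "1 \<le> D * a ^ (DIM('a) - 1)"
    and V: "finite V" "V \<subseteq> \<Lambda> - {0}" "\<And>v. v \<in> V \<Longrightarrow> (norm v)\<^sup>2 \<le> 2 * D"
       "\<And>v. v \<in> V \<Longrightarrow> norm v * last_min \<le> 2 * D"
  shows "(\<Sum>v\<in>V. 1 / norm v ^ (DIM('a) - 2)) \<le> short_sum_const DIM('a) * D"
proof -
  let ?d = "DIM('a)"
  let ?C = "plane_const ?d"
  have C: "0 < ?C" by (rule plane_const_pos)
  define V1 where "V1 = {v\<in>V. last_min \<le> norm v}"
  define V2 where "V2 = {v\<in>V. norm v < last_min \<and> dim (\<Lambda> \<inter> cball 0 (norm v)) = ?d - 1}"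
  define V3 where "V3 = {v\<in>V. norm v < last_min \<and> dim (\<Lambda> \<inter> cball 0 (norm v)) \<le> ?d - 2}"
  have VV: "V = V1 \<union> V2 \<union> V3"
  proof -
    have dimb: "dim (\<Lambda> \<inter> cball 0 (norm v)) \<le> ?d - 1" if "norm v < last_min" for v
    proof -
      have "\<Lambda> \<inter> cball 0 (norm v) \<subseteq> \<Lambda> \<inter> ball 0 last_min" using that by auto
      then have "dim (\<Lambda> \<inter> cball 0 (norm v)) \<le> dim (\<Lambda> \<inter> ball 0 last_min)" by (rule dim_subset)
      moreover have "dim (\<Lambda> \<inter> ball 0 last_min) \<noteq> ?d" using last_min(2) dim_eq_full by blast
      moreover have "dim (\<Lambda> \<inter> ball 0 last_min) \<le> ?d" by (rule dim_subset_UNIV)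
      ultimately show ?thesis by linarith
    qed
    then have "v \<in> V1 \<union> V2 \<union> V3" if "v \<in> V" for v
    proof (cases "last_min \<le> norm v")
      case False
      then have "dim (\<Lambda> \<inter> cball 0 (norm v)) \<le> ?d - 1" by (intro dimb) simp
      then have "dim (\<Lambda> \<inter> cball 0 (norm v)) = ?d - 1 \<or> dim (\<Lambda> \<inter> cball 0 (norm v)) \<le> ?d - 2" by linarith
      then show ?thesis using that False by (auto simp: V2_def V3_def)
    qed (use that in \<open>simp add: V1_def\<close>)
    then show ?thesis unfolding V1_def V2_def V3_def by blast
  qed
  have fin: "finite V1" "finite V2" "finite V3" using V(1) by (auto simp: V1_def V2_def V3_def)
  have V0: "0 < norm v" "v \<in> \<Lambda>" if "v \<in> V" for v using V(2) that by auto
  have s1: "(\<Sum>v\<in>V1. 1 / norm v ^ (?d - 2)) \<le> 2 ^ d0 * ?C * (2 * D)" if "d0 = ?d - 2 + 1" for d0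
  proof -
    have "(\<Sum>v\<in>V1. 1 / norm v ^ (?d - 2)) \<le> 2 ^ (?d - 2 + 1) * ?C * (sqrt (2 * D)) ^ (?d - (?d - 2))"
    proof (rule dyadic_sum[OF fin(1)])
      show "0 \<le> ?C" using C by simp
      show "?d - 2 < ?d" using d by simp
      show "0 < norm v" if "v \<in> V1" for v using that V0 by (auto simp: V1_def)
      show "norm v \<le> sqrt (2 * D)" if "v \<in> V1" for v using that V(3) by (auto simp: V1_def real_le_rsqrt)
      show "0 < sqrt (2 * D)" using D by simp
      fix x :: real assume x: "0 < x"
      show "real (card {v \<in> V1. norm v \<le> x}) \<le> ?C * x ^ ?d"
      proof (cases "last_min \<le> x")
        case True
        have "card {v \<in> V1. norm v \<le> x} \<le> card (\<Lambda> \<inter> cball 0 x)"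
          using V0 by (intro card_mono finite_bounded) (auto simp: V1_def)
        then show ?thesis using card_cball_le[OF True] by (simp add: plane_const_def power_mult_distrib mult.assoc add.commute)
      next
        case False
        then have "{v \<in> V1. norm v \<le> x} = {}" by (auto simp: V1_def)
        then show ?thesis using C x by (simp only: card.empty) simp
      qed
    qed
    also have "?d - (?d - 2) = 2" using d by simp
    also have "(sqrt (2 * D))\<^sup>2 = 2 * D" using D by simp
    finally show ?thesis using that by simp
  qed
  have s2: "(\<Sum>v\<in>V2. 1 / norm v ^ (?d - 2)) \<le> 2 ^ d0 * (2 * ?C * last_min) * (2 * D / last_min)" if "d0 = ?d - 2 + 1" for d0
  proof -
    have "(\<Sum>v\<in>V2. 1 / norm v ^ (?d - 2)) \<le> 2 ^ (?d - 2 + 1) * (2 * ?C * last_min) * (2 * D / last_min) ^ (?d - 1 - (?d - 2))"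
    proof (rule dyadic_sum[OF fin(2)])
      show "0 \<le> 2 * ?C * last_min" using C last_min_pos by simp
      show "?d - 2 < ?d - 1" using d by simp
      show "0 < norm v" if "v \<in> V2" for v using that V0 by (auto simp: V2_def)
      show "norm v \<le> 2 * D / last_min" if "v \<in> V2" for v
        using that V(4) last_min_pos by (auto simp: V2_def pos_le_divide_eq)
      show "0 < 2 * D / last_min" using D last_min_pos by simp
      fix x :: real assume x: "0 < x"
      let ?T = "{v \<in> V2. norm v \<le> x}"
      show "real (card ?T) \<le> 2 * ?C * last_min * x ^ (?d - 1)"
      proof (cases "?T = {}")
        case True
        then show ?thesis using C x last_min_pos by (simp only: card.empty) simp
      next
        case False
        have finT: "finite ?T" using fin by simp
        have "Max (norm ` ?T) \<in> norm ` ?T" using False finT by (intro Max_in) auto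
        then obtain y where y: "y \<in> ?T" "norm y = Max (norm ` ?T)" by auto
        have le: "norm v \<le> norm y" if "v \<in> ?T" for v unfolding y(2) using finT that by (intro Max_ge) auto
        have "card ?T \<le> card (\<Lambda> \<inter> cball 0 (norm y))"
          using V0 le by (intro card_mono finite_bounded) (auto simp: V2_def)
        also have "real (card (\<Lambda> \<inter> cball 0 (norm y))) \<le> 2 * ?C * last_min * norm y ^ (?d - 1)"
          using card_cball_hyperplane_le[of "norm y"] y(1) V0
          by (auto simp: V2_def plane_const_def mult_ac add.commute)
        also have "\<dots> \<le> 2 * ?C * last_min * x ^ (?d - 1)"
          using y(1) C last_min_pos by (intro mult_left_mono power_mono) auto
        finally show ?thesis by simp
      qed
    qed
    also have "?d - 1 - (?d - 2) = 1" using d by simp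
    finally show ?thesis using that by simp
  qed
  let ?K = "last_min_const ?d"
  \<comment> \<open>Enough halvings to bring \<open>last_min\<close> below \<open>a\<close>. By
    \<open>last_min_div_le\<close> the number needed is logarithmic in 1 / a; bounding the logarithm
    linearly costs a single factor 1 / a, and the resulting a^(1 - d) is at most
    \<open>D\<close>.\<close>
  define n where "n = nat \<lceil>2 * real ?d * ?K / a\<rceil>"
  have K1: "1 \<le> ?K" by (rule last_min_const_ge_1)
  have n1: "2 * real ?d * ?K / a \<le> real n" unfolding n_def using K1 a_pos by simp
  have n2: "real n \<le> (2 * real ?d + 2) * ?K / a"
  proof -
    have "real n \<le> 2 * real ?d * ?K / a + 1" unfolding n_def using K1 a_pos by simp
    also have "1 \<le> 2 * ?K / a" using a_le_const a_pos K1 by simp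
    finally show ?thesis by (simp add: add_divide_distrib algebra_simps)
  qed
  have n3: "last_min / 2 ^ n < a"
  proof -
    have "ln (last_min / a) \<le> ln ((?K / a) ^ ?d)"
      using last_min_div_le last_min_pos a_pos by (subst ln_le_cancel_iff) (use K1 in auto)
    also have "\<dots> = real ?d * ln (?K / a)" using K1 a_pos by (simp add: ln_realpow)
    also have "\<dots> \<le> real ?d * (?K / a - 1)"
      using K1 a_pos by (intro mult_left_mono ln_le_minus_one) auto
    also have "\<dots> < real ?d * (?K / a)" by (intro mult_strict_left_mono) auto
    also have "\<dots> \<le> real n * (1 / 2)" using n1 by (simp add: mult_ac)
    also have "\<dots> \<le> real n * ln 2" using ln2_ge_two_thirds by (intro mult_left_mono) auto
    also have "\<dots> = ln (2 ^ n)" by (simp add: ln_realpow)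
    finally have "last_min / a < 2 ^ n" using last_min_pos a_pos by (subst (asm) ln_less_cancel_iff) auto
    then show ?thesis using a_pos by (simp add: field_simps)
  qed
  have s3: "(\<Sum>v\<in>V3. 1 / norm v ^ (?d - 2)) \<le> real n * 2 ^ (?d - 2) * (4 * real ?d / a) ^ (?d - 2)"
  proof -
    have "V3 = {v. v \<in> V3 \<and> last_min / 2 ^ n < norm v \<and> norm v \<le> last_min}"
    proof -
      have "a \<le> norm v" if "v \<in> V3" for v using a_le[of v] V(2) that by (auto simp: V3_def)
      then show ?thesis using n3 by (force simp: V3_def)
    qed
    moreover have "(\<Sum>v | v \<in> V3 \<and> last_min / 2 ^ n < norm v \<and> norm v \<le> last_min. 1 / norm v ^ (?d - 2))
       \<le> real n * 2 ^ (?d - 2) * (4 * real ?d / a) ^ (?d - 2)"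
    proof (rule dyadic_sum_annulus_critical[OF fin(3) _ _ last_min_pos])
      show "0 \<le> (4 * real ?d / a) ^ (?d - 2)" using a_pos by simp
      fix x :: real assume x: "0 < x"
      let ?T = "{v \<in> V3. norm v \<le> x}"
      show "real (card ?T) \<le> (4 * real ?d / a) ^ (?d - 2) * x ^ (?d - 2)"
      proof (cases "?T = {}")
        case True
        then show ?thesis using x a_pos by (simp only: card.empty) simp
      next
        case False
        have finT: "finite ?T" using fin by simp
        have "Max (norm ` ?T) \<in> norm ` ?T" using False finT by (intro Max_in) auto
        then obtain y where y: "y \<in> ?T" "norm y = Max (norm ` ?T)" by auto
        have le: "norm v \<le> norm y" if "v \<in> ?T" for v unfolding y(2) using finT that by (intro Max_ge) auto
        have "real (card ?T) \<le> (real (4 * ?d) * norm y / a) ^ (?d - 2)"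
        proof (rule card_subspace_le[where ?S0.0 = "span (\<Lambda> \<inter> cball 0 (norm y))"])
          show "dim (span (\<Lambda> \<inter> cball 0 (norm y))) \<le> ?d - 2" using y(1) by (simp add: V3_def)
          show "?T \<subseteq> \<Lambda> \<inter> span (\<Lambda> \<inter> cball 0 (norm y))"
            using V0 le by (auto simp: V3_def intro!: span_base)
          show "?T \<subseteq> cball 0 (norm y)" using le by auto
          show "a \<le> norm y" using a_le[of y] V(2) y(1) by (auto simp: V3_def)
        qed simp
        also have "\<dots> \<le> (real (4 * ?d) * x / a) ^ (?d - 2)"
          using y(1) a_pos by (intro power_mono divide_right_mono mult_left_mono) auto
        also have "\<dots> = (4 * real ?d / a) ^ (?d - 2) * x ^ (?d - 2)"
          by (simp add: power_mult_distrib[symmetric])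
        finally show ?thesis .
      qed
    qed
    ultimately show ?thesis by simp
  qed
  have s3': "(\<Sum>v\<in>V3. 1 / norm v ^ (?d - 2)) \<le> (2 * real ?d + 2) * ?K * 2 ^ (?d - 2) * (4 * real ?d) ^ (?d - 2) * D"
  proof -
    have "real n * 2 ^ (?d - 2) * (4 * real ?d / a) ^ (?d - 2)
       \<le> (2 * real ?d + 2) * ?K / a * 2 ^ (?d - 2) * (4 * real ?d / a) ^ (?d - 2)"
      using n2 a_pos by (intro mult_right_mono) auto
    also have "\<dots> = (2 * real ?d + 2) * ?K * 2 ^ (?d - 2) * (4 * real ?d) ^ (?d - 2) * (1 / (a * a ^ (?d - 2)))"
      by (simp add: power_divide)
    also have "a * a ^ (?d - 2) = a ^ (?d - 1)"
    proof -
      have "?d - 1 = Suc (?d - 2)" using d by simp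
      then show ?thesis by (simp only: power_Suc)
    qed
    also have "(2 * real ?d + 2) * ?K * 2 ^ (?d - 2) * (4 * real ?d) ^ (?d - 2) * (1 / a ^ (?d - 1))
        \<le> (2 * real ?d + 2) * ?K * 2 ^ (?d - 2) * (4 * real ?d) ^ (?d - 2) * D"
      using K1 D(2) a_pos by (intro mult_left_mono) (auto simp: pos_divide_le_eq)
    finally show ?thesis using s3 by linarith
  qed
  have "(\<Sum>v\<in>V. 1 / norm v ^ (?d - 2)) \<le> (\<Sum>v\<in>V1. 1 / norm v ^ (?d - 2)) + (\<Sum>v\<in>V2. 1 / norm v ^ (?d - 2)) + (\<Sum>v\<in>V3. 1 / norm v ^ (?d - 2))"
  proof -
    have disj: "V1 \<inter> V2 = {}" "(V1 \<union> V2) \<inter> V3 = {}" using d by (auto simp: V1_def V2_def V3_def)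
    have "(\<Sum>v\<in>V. 1 / norm v ^ (?d - 2)) = (\<Sum>v\<in>(V1 \<union> V2) \<union> V3. 1 / norm v ^ (?d - 2))" using VV by simp
    also have "\<dots> = (\<Sum>v\<in>V1. 1 / norm v ^ (?d - 2)) + (\<Sum>v\<in>V2. 1 / norm v ^ (?d - 2)) + (\<Sum>v\<in>V3. 1 / norm v ^ (?d - 2))"
      using fin disj by (subst sum.union_disjoint) (simp_all add: sum.union_disjoint)
    finally show ?thesis by simp
  qed
  also have "\<dots> \<le> 2 ^ (?d - 1) * ?C * (2 * D) + 2 ^ (?d - 1) * (2 * ?C * last_min) * (2 * D / last_min)
      + (2 * real ?d + 2) * ?K * 2 ^ (?d - 2) * (4 * real ?d) ^ (?d - 2) * D"
    using d by (intro add_mono s1 s2 s3') auto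
  also have "\<dots> = short_sum_const ?d * D"
  proof -
    have "(2::real) ^ ?d = 2 * 2 ^ (?d - 1)" using DIM_positive[where 'a='a] by (metis power_minus_mult mult.commute)
    then show ?thesis unfolding short_sum_const_def using last_min_pos by (simp add: algebra_simps)
  qed
  finally show ?thesis .
qed

text \<open>In dimension 2 the only plane is the whole space, of covolume 1, so the product of the
  lengths is bounded below. For small \<open>D\<close> this excludes every pair, and it stands in
  for the summation over planes, which requires dimension at least 3.\<close>

lemma reduced_pair_planar_bound:
  assumes d: "DIM('a) = 2" and red: "reduced_pair v u" and u: "last_min \<le> norm u"
  shows "1 \<le> plane_const DIM('a) * (norm v * norm u)"
proof -
  let ?P = "plane_const DIM('a)"
  have P: "0 < ?P" by (rule plane_const_pos)
  have v: "v \<in> \<Lambda>" "v \<noteq> 0" using red by (auto simp: reduced_pair_def)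
  have nv: "0 < norm v" using v by simp
  have vc: "v \<in> \<Lambda> \<inter> cball 0 (norm v)" using v by simp
  have fin: "finite (\<Lambda> \<inter> cball 0 X)" for X by (intro finite_bounded) auto
  show ?thesis
  proof (cases "norm v < last_min")
    case True
    have "\<Lambda> \<inter> cball 0 (norm v) \<subseteq> \<Lambda> \<inter> ball 0 last_min" using True by auto
    then have "dim (\<Lambda> \<inter> cball 0 (norm v)) \<le> dim (\<Lambda> \<inter> ball 0 last_min)" by (rule dim_subset)
    moreover have "dim (\<Lambda> \<inter> ball 0 last_min) \<noteq> DIM('a)" using last_min(2) dim_eq_full by blast
    moreover have "dim (\<Lambda> \<inter> ball 0 last_min) \<le> DIM('a)" by (rule dim_subset_UNIV)
    moreover have "dim {v} \<le> dim (\<Lambda> \<inter> cball 0 (norm v))" using vc by (intro dim_subset) auto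
    moreover have "dim {v} = 1" using v(2) by (simp add: dim_singleton)
    ultimately have "dim (\<Lambda> \<inter> cball 0 (norm v)) = DIM('a) - 1" using d by linarith
    from card_cball_hyperplane_le[OF nv _ this] True
    have "real (card (\<Lambda> \<inter> cball 0 (norm v))) \<le> 2 * ?P * norm v * last_min"
      using d by (simp add: plane_const_def mult_ac add.commute)
    moreover have "2 \<le> card (\<Lambda> \<inter> cball 0 (norm v))"
    proof -
      have "card {0, v} \<le> card (\<Lambda> \<inter> cball 0 (norm v))" using vc zero_mem by (intro card_mono fin) auto
      then show ?thesis using v(2) by simp
    qed
    moreover have "2 * ?P * norm v * last_min \<le> 2 * ?P * norm v * norm u"
      using u P by (intro mult_left_mono) auto
    ultimately show ?thesis by simp
  next
    case False
    have "1 \<le> card (\<Lambda> \<inter> cball 0 last_min)"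
    proof -
      have "card {0::'a} \<le> card (\<Lambda> \<inter> cball 0 last_min)" using zero_mem last_min_pos by (intro card_mono fin) auto
      then show ?thesis by simp
    qed
    also have "real (card (\<Lambda> \<inter> cball 0 last_min)) \<le> ?P * last_min ^ 2"
      using card_cball_le[OF order_refl] d by (simp add: plane_const_def power_mult_distrib mult_ac add.commute)
    also have "\<dots> \<le> ?P * (norm v * norm u)"
      unfolding power2_eq_square using False u P last_min_pos by (intro mult_left_mono mult_mono) auto
    finally show ?thesis by simp
  qed
qed

text \<open>A vector \<open>s\<close> that spans a parallelogram of small area with another lattice vector overlaps
  too many other resonant sets. Such \<open>s\<close> are counted plane by plane, a plane being given by a
  reduced pair \<open>(v, u)\<close> with \<open>norm v * norm u \<le> 2 * D\<close>.\<close>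

lemma bad_card_le:
  assumes d: "2 \<le> DIM('a)" and D: "0 < D" "3 \<le> DIM('a) \<Longrightarrow> 1 \<le> D * a ^ (DIM('a) - 1)"
    and small: "3 \<le> DIM('a) \<or> 2 * plane_const DIM('a) * D < 1" and S: "a \<le> S"
  shows "real (card {s. primitive s \<and> norm s \<le> S \<and> 2 * D < (norm s)\<^sup>2 \<and> (\<exists>r\<in>\<Lambda>. 0 < gram r s \<and> gram r s \<le> D\<^sup>2)})
     \<le> (4 * real DIM('a) * S / a) ^ (DIM('a) - 1) + bad_const DIM('a) * S\<^sup>2 * D ^ (DIM('a) - 1)"
proof -
  let ?d = "DIM('a)"
  let ?bad = "{s. primitive s \<and> norm s \<le> S \<and> 2 * D < (norm s)\<^sup>2 \<and> (\<exists>r\<in>\<Lambda>. 0 < gram r s \<and> gram r s \<le> D\<^sup>2)}"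
  let ?\<Pi> = "\<Lambda> \<inter> span (\<Lambda> \<inter> ball 0 last_min) \<inter> cball 0 S"
  let ?Q = "\<lambda>(v, u). \<Lambda> \<inter> span {v, u} \<inter> cball 0 S"
  define T where "T = {(v, u). reduced_pair v u \<and> norm v * norm u \<le> 2 * D \<and> last_min \<le> norm u \<and> norm u \<le> S}"
  have S0: "0 < S" using S a_pos by simp
  have finS: "finite (\<Lambda> \<inter> cball 0 S)" by (intro finite_bounded) auto
  have "T \<subseteq> (\<Lambda> \<inter> cball 0 S) \<times> (\<Lambda> \<inter> cball 0 S)"
  proof
    fix p assume "p \<in> T"
    then obtain v u where p: "p = (v, u)" "reduced_pair v u" "norm u \<le> S" by (auto simp: T_def)
    then show "p \<in> (\<Lambda> \<inter> cball 0 S) \<times> (\<Lambda> \<inter> cball 0 S)"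
      using reduced_pair_norm_le[OF p(2)] by (auto simp: reduced_pair_def)
  qed
  then have finT: "finite T" using finS finite_subset finite_SigmaI by blast
  have sub: "?bad \<subseteq> ?\<Pi> \<union> (\<Union>p\<in>T. ?Q p)"
  proof
    fix s assume s: "s \<in> ?bad"
    then obtain r where r: "r \<in> \<Lambda>" "0 < gram r s" "gram r s \<le> D\<^sup>2" by auto
    have sL: "s \<in> \<Lambda>" "norm s \<le> S" using s by (auto simp: primitive_def)
    obtain v u where vu: "reduced_pair v u" "span {v, u} = span {r, s}" "norm v * norm u \<le> 2 * D"
      by (rule reduced_pair_exists[OF r(1) sL(1) r(2,3) D(1)])
    have sp: "s \<in> span {v, u}" unfolding vu(2) by (simp add: span_base)
    have le: "norm v \<le> norm u" by (rule reduced_pair_norm_le[OF vu(1)])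
    \<comment> \<open>Otherwise \<open>s\<close>, being primitive, would be exactly as long as
      \<open>v\<close>, and its squared length would be at most |v| |u| <= 2 D.\<close>
    have "s \<notin> span {v}"
    proof
      assume sv: "s \<in> span {v}"
      have "span {v} \<subseteq> span {v, u}" by (rule span_mono) auto
      then have "norm s = norm v" using s vu(1) sv
        by (intro primitive_in_span_shortest) (auto simp: reduced_pair_def)
      then have "(norm s)\<^sup>2 \<le> norm v * norm u" using le by (simp add: power2_eq_square mult_left_mono)
      then show False using vu(3) s by simp
    qed
    then have uS: "norm u \<le> S" using vu(1) sp sL unfolding reduced_pair_def by fastforce
    show "s \<in> ?\<Pi> \<union> (\<Union>p\<in>T. ?Q p)"
    proof (cases "last_min \<le> norm u")
      case True
      then have "(v, u) \<in> T" using vu uS by (simp add: T_def)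
      then show ?thesis using sp sL by (intro UnI2 UN_I[of "(v, u)"]) auto
    next
      \<comment> \<open>Planes spanned by vectors shorter than \<open>last_min\<close> all lie in
        one proper subspace, so their points are counted together, however many such planes there
        are.\<close>
      case False
      have "{v, u} \<subseteq> \<Lambda> \<inter> ball 0 last_min" using vu(1) le False by (auto simp: reduced_pair_def)
      then have "span {v, u} \<subseteq> span (\<Lambda> \<inter> ball 0 last_min)" by (rule span_mono)
      then show ?thesis using sp sL by auto
    qed
  qed
  have "card ?bad \<le> card (?\<Pi> \<union> (\<Union>p\<in>T. ?Q p))"
    using finS finT by (intro card_mono[OF _ sub]) (auto intro: finite_subset[OF _ finS])
  also have "\<dots> \<le> card ?\<Pi> + card (\<Union>p\<in>T. ?Q p)" by (rule card_Un_le)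
  also have "card (\<Union>p\<in>T. ?Q p) \<le> (\<Sum>p\<in>T. card (?Q p))" by (rule card_UN_le[OF finT])
  finally have "real (card ?bad) \<le> real (card ?\<Pi>) + (\<Sum>p\<in>T. real (card (?Q p)))"
    by (simp flip: of_nat_sum of_nat_add)
  moreover have "real (card ?\<Pi>) \<le> (real (4 * ?d) * S / a) ^ (?d - 1)"
  proof (rule card_subspace_le[where ?S0.0 = "span (\<Lambda> \<inter> ball 0 last_min)"])
    have "dim (\<Lambda> \<inter> ball 0 last_min) \<noteq> ?d" using last_min(2) dim_eq_full by blast
    moreover have "dim (\<Lambda> \<inter> ball 0 last_min) \<le> ?d" by (rule dim_subset_UNIV)
    ultimately show "dim (span (\<Lambda> \<inter> ball 0 last_min)) \<le> ?d - 1" by simp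
  qed (use S in auto)
  moreover have "(\<Sum>p\<in>T. real (card (?Q p))) \<le> bad_const ?d * S\<^sup>2 * D ^ (?d - 1)"
  proof (cases "3 \<le> ?d")
    case False
    then have d2: "?d = 2" using d by simp
    have "T = {}"
    proof (rule equals0I)
      fix p assume "p \<in> T"
      then obtain v u where vu: "reduced_pair v u" "norm v * norm u \<le> 2 * D" "last_min \<le> norm u"
        by (auto simp: T_def)
      have "1 \<le> plane_const ?d * (norm v * norm u)" by (rule reduced_pair_planar_bound[OF d2 vu(1,3)])
      also have "\<dots> \<le> plane_const ?d * (2 * D)" using vu(2) plane_const_pos[of ?d] by (intro mult_left_mono) auto
      finally show False using small False by simp
    qed
    then show ?thesis using bad_const_nonneg[of ?d] D by simp
  next
    case d3: True
    let ?V = "fst ` T"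
    let ?U = "\<lambda>v. {u. (v, u) \<in> T}"
    let ?C = "32 * plane_const ?d * 4 ^ (?d - 2) * D ^ (?d - 2)"
    have TS: "T = Sigma ?V ?U" by force
    have finU: "finite (?U v)" for v
      by (rule finite_subset[of _ "snd ` T"]) (use finT in force)+
    have V: "v \<in> \<Lambda>" "v \<noteq> 0" "(norm v)\<^sup>2 \<le> 2 * D" "norm v * last_min \<le> 2 * D" if "v \<in> ?V" for v
    proof -
      obtain u where u: "reduced_pair v u" "norm v * norm u \<le> 2 * D" "last_min \<le> norm u"
        using \<open>v \<in> ?V\<close> by (auto simp: T_def)
      show "v \<in> \<Lambda>" "v \<noteq> 0" using u by (auto simp: reduced_pair_def)
      have "(norm v)\<^sup>2 \<le> norm v * norm u"
        using reduced_pair_norm_le[OF u(1)] by (simp add: power2_eq_square mult_left_mono)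
      then show "(norm v)\<^sup>2 \<le> 2 * D" using u(2) by simp
      have "norm v * last_min \<le> norm v * norm u" using u(3) by (intro mult_left_mono) auto
      then show "norm v * last_min \<le> 2 * D" using u(2) by simp
    qed
    have "(\<Sum>p\<in>T. 1 / norm (fst p) * (1 / norm (snd p))) = (\<Sum>v\<in>?V. \<Sum>u\<in>?U v. 1 / norm v * (1 / norm u))"
      by (subst TS, subst sum.Sigma) (use finT finU in \<open>auto intro!: sum.cong simp: split_beta\<close>)
    also have "\<dots> = (\<Sum>v\<in>?V. 1 / norm v * (\<Sum>u\<in>?U v. 1 / norm u))"
      by (simp only: sum_distrib_left)
    also have "\<dots> \<le> (\<Sum>v\<in>?V. ?C * (1 / norm v ^ (?d - 2)))"
    proof (rule sum_mono)
      fix v assume v: "v \<in> ?V"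
      have nv: "0 < norm v" using V[OF v] by simp
      have "(\<Sum>u\<in>?U v. 1 / norm u) \<le> 32 * plane_const ?d * norm v * (4 * D / norm v) ^ (?d - 2)"
        using V[OF v] nv by (intro sum_inverse_second_le[OF d3 _ _ D(1) finU])
          (auto simp: T_def pos_le_divide_eq mult.commute)
      then have "1 / norm v * (\<Sum>u\<in>?U v. 1 / norm u) \<le> 1 / norm v * (32 * plane_const ?d * norm v * (4 * D / norm v) ^ (?d - 2))"
        by (rule mult_left_mono) simp
      also have "\<dots> = ?C * (1 / norm v ^ (?d - 2))"
        using nv by (simp add: power_divide power_mult_distrib)
      finally show "1 / norm v * (\<Sum>u\<in>?U v. 1 / norm u) \<le> ?C * (1 / norm v ^ (?d - 2))" .
    qed
    also have "\<dots> = ?C * (\<Sum>v\<in>?V. 1 / norm v ^ (?d - 2))" by (simp only: sum_distrib_left)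
    also have "\<dots> \<le> ?C * (short_sum_const ?d * D)"
      using V finT plane_const_pos[of ?d] D
      by (intro mult_left_mono sum_inverse_shortest_le[OF d3 D(1) D(2)[OF d3]]) auto
    finally have inv: "(\<Sum>p\<in>T. 1 / norm (fst p) * (1 / norm (snd p))) \<le> ?C * (short_sum_const ?d * D)" .
    have "(\<Sum>p\<in>T. real (card (?Q p))) \<le> (\<Sum>p\<in>T. 24 * S\<^sup>2 * (1 / norm (fst p) * (1 / norm (snd p))))"
    proof (rule sum_mono)
      fix p assume "p \<in> T"
      then obtain v u where "p = (v, u)" "reduced_pair v u" "norm u \<le> S" by (auto simp: T_def)
      then show "real (card (?Q p)) \<le> 24 * S\<^sup>2 * (1 / norm (fst p) * (1 / norm (snd p)))"
        using reduced_pair_card_le[of v u S] by simp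
    qed
    also have "\<dots> = 24 * S\<^sup>2 * (\<Sum>p\<in>T. 1 / norm (fst p) * (1 / norm (snd p)))"
      by (simp only: sum_distrib_left)
    also have "\<dots> \<le> 24 * S\<^sup>2 * (?C * (short_sum_const ?d * D))"
      by (intro mult_left_mono inv) simp
    also have "\<dots> = bad_const ?d * S\<^sup>2 * (D * D ^ (?d - 2))"
      by (simp add: bad_const_def)
    also have "D * D ^ (?d - 2) = D ^ (?d - 1)"
    proof -
      have "?d - 1 = Suc (?d - 2)" using d by simp
      then show ?thesis by (simp only: power_Suc)
    qed
    finally show ?thesis by simp
  qed
  ultimately show ?thesis by simp
qed

end

subsection \<open>Counting primitive vectors\<close>

text \<open>The Moebius function with real values. It vanishes at 0, so sums of \<open>mob k\<close>
  divided by a power of k may start at k = 0.\<close>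

definition mob :: "nat \<Rightarrow> real" where
  "mob n = (if squarefree n then (- 1) ^ card (prime_factors n) else 0)"

lemma mob_0 [simp]: "mob 0 = 0" and mob_1 [simp]: "mob (Suc 0) = 1"
  by (simp_all add: mob_def)

lemma abs_mob_le: "\<bar>mob n\<bar> \<le> 1"
  by (simp add: mob_def power_abs)

lemma mob_prime_mult:
  assumes p: "prime p" and n: "n \<noteq> 0"
  shows "mob (p * n) = (if p dvd n then 0 else - mob n)"
proof (cases "p dvd n")
  case True
  then have "p\<^sup>2 dvd p * n" by (simp add: power2_eq_square mult_dvd_mono)
  then have "\<not> squarefree (p * n)"
    by (rule not_squarefreeI) (use p in \<open>auto simp: prime_nat_iff\<close>)
  then show ?thesis using True by (simp add: mob_def)
next
  case False
  have cop: "coprime p n" using p False by (rule prime_imp_coprime)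
  have "squarefree (p * n) \<longleftrightarrow> squarefree n"
    using squarefree_mult_coprime[OF cop squarefree_prime[OF p]] squarefree_multD[of p n] by blast
  moreover have "prime_factors (p * n) = insert p (prime_factors n)"
    using p n by (simp add: prime_factors_product prime_prime_factors)
  moreover have "p \<notin> prime_factors n" using False by auto
  ultimately show ?thesis using False by (simp add: mob_def)
qed

text \<open>For a prime p dividing n, the divisors j prime to p cancel against the divisors p j, and
  the divisors that contain p twice contribute 0.\<close>

lemma sum_mob_divisors:
  assumes "n \<noteq> 0"
  shows "(\<Sum>k | k dvd n. mob k) = (if n = 1 then 1 else 0)"
proof (cases "n = 1")
  case False
  obtain p where p: "prime p" "p dvd n" using False prime_factor_nat by blast
  have fin: "finite {k. k dvd n}" using assms by simp
  let ?A = "{k. k dvd n \<and> \<not> p dvd k}" and ?B = "{k. k dvd n \<and> p dvd k}"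
  let ?B' = "{k. k dvd n \<and> p dvd k \<and> \<not> p dvd (k div p)}"
  have p0: "0 < p" using p(1) prime_gt_0_nat by blast
  have "(\<Sum>k | k dvd n. mob k) = (\<Sum>k\<in>?A \<union> ?B. mob k)" by (intro sum.cong) auto
  also have "\<dots> = (\<Sum>k\<in>?A. mob k) + (\<Sum>k\<in>?B. mob k)"
    using fin by (intro sum.union_disjoint) auto
  also have "(\<Sum>k\<in>?B. mob k) = (\<Sum>k\<in>(*) p ` ?A. mob k)"
  proof (rule sum.mono_neutral_right)
    show "finite ?B" using fin by auto
    show "(*) p ` ?A \<subseteq> ?B"
    proof
      fix k assume "k \<in> (*) p ` ?A"
      then obtain j where j: "k = p * j" "j dvd n" "\<not> p dvd j" by auto
      then have "coprime p j" using p(1) by (intro prime_imp_coprime)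
      then have "p * j dvd n" using p(2) j(2) by (rule divides_mult[rotated 2])
      then show "k \<in> ?B" using j by simp
    qed
    show "\<forall>i\<in>?B - (*) p ` ?A. mob i = 0"
    proof
      fix i assume i: "i \<in> ?B - (*) p ` ?A"
      then obtain j where j: "i = p * j" by (auto simp: dvd_def)
      have "i \<noteq> 0" using i assms by auto
      then have j0: "j \<noteq> 0" using j by auto
      have "j dvd n" using i j by (auto intro: dvd_trans)
      then have "p dvd j" using i j by auto
      then show "mob i = 0" using mob_prime_mult[OF p(1) j0] j by simp
    qed
  qed
  also have "\<dots> = (\<Sum>j\<in>?A. mob (p * j))" using p0 by (subst sum.reindex) (auto simp: inj_on_def)
  also have "\<dots> = (\<Sum>j\<in>?A. - mob j)"
    using assms by (intro sum.cong) (auto simp: mob_prime_mult[OF p(1)] intro!: mob_prime_mult[OF p(1)])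
  finally show ?thesis using False by (simp add: sum_negf)
qed simp

lemma summable_zeta_nat:
  assumes "2 \<le> s" shows "summable (\<lambda>k. 1 / real k ^ s)"
  using inverse_power_summable[of s, where 'a = real] assms by (simp add: field_simps)

lemma zeta_nat_has_sum:
  assumes "2 \<le> s" shows "((\<lambda>k. 1 / real k ^ s) has_sum zeta_nat s) {1..}"
proof -
  have "(\<lambda>k. 1 / real (Suc k) ^ s) sums zeta_nat s"
    unfolding zeta_nat_def using summable_zeta_nat[OF assms]
    by (intro summable_sums) (subst summable_Suc_iff)
  then have "((\<lambda>k. 1 / real (Suc k) ^ s) has_sum zeta_nat s) UNIV"
    using summable_zeta_nat[OF assms]
    by (intro norm_summable_imp_has_sum) (simp_all add: summable_Suc_iff[of "\<lambda>k. 1 / real k ^ s", simplified])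
  then have "((\<lambda>k. 1 / real k ^ s) has_sum zeta_nat s) (Suc ` UNIV)"
    by (subst has_sum_reindex) (auto simp: comp_def)
  also have "Suc ` UNIV = {1..}" by (auto simp: image_iff Suc_le_eq gr0_conv_Suc)
  finally show ?thesis .
qed

lemma zeta_nat_ge_1: assumes "2 \<le> s" shows "1 \<le> zeta_nat s"
proof -
  have "(\<lambda>k. 1 / real (Suc k) ^ s) sums zeta_nat s"
    unfolding zeta_nat_def using summable_zeta_nat[OF assms]
    by (intro summable_sums) (subst summable_Suc_iff)
  from sum_le_suminf[OF sums_summable[OF this], of "{0}"] sums_unique[OF this]
  show ?thesis by simp
qed

text \<open>The absolutely convergent double series over (k, j) is the product of the Moebius series
  and zeta. Regrouped by n = k j it consists of divisor sums of \<open>mob\<close>, of which only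
  the one for n = 1 survives.\<close>

lemma sum_mob_zeta:
  assumes s: "2 \<le> s"
  shows "(\<lambda>n. \<Sum>k<n. mob k / real k ^ s) \<longlonglongrightarrow> 1 / zeta_nat s"
proof -
  let ?f = "\<lambda>k::nat. 1 / real k ^ s"
  let ?N = "{1::nat..}"
  define h where "h = (\<lambda>(k::nat, j::nat). mob k * ?f k * ?f j)"
  note fs = zeta_nat_has_sum[OF s]
  have f_abs: "(\<lambda>k. norm (?f k)) summable_on ?N" using fs by (auto simp: summable_on_def)
  have mf_abs: "(\<lambda>k. norm (mob k * ?f k)) summable_on ?N"
  proof (rule Infinite_Sum.abs_summable_on_comparison_test[OF f_abs])
    show "norm (mob k * ?f k) \<le> norm (?f k)" for k
      using mult_right_mono[OF abs_mob_le[of k], of "?f k"] by (simp add: abs_mult)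
  qed
  have h_abs: "(\<lambda>p. norm (h p)) summable_on (Sigma ?N (\<lambda>_. ?N))"
  proof (subst Infinite_Sum.abs_summable_on_Sigma_iff, intro conjI ballI)
    show "(\<lambda>j. norm (h (k, j))) summable_on ?N" for k
    proof -
      have "(\<lambda>j. norm (mob k * ?f k) * norm (?f j)) summable_on ?N"
        by (intro summable_on_cmult_right f_abs)
      then show ?thesis by (simp only: h_def prod.case norm_mult)
    qed
    have "infsum (\<lambda>j. norm (h (k, j))) ?N = norm (mob k * ?f k) * zeta_nat s" for k
    proof -
      have "infsum (\<lambda>j. norm (h (k, j))) ?N = infsum (\<lambda>j. norm (mob k * ?f k) * ?f j) ?N"
        by (intro infsum_cong) (auto simp: h_def abs_mult)
      then show ?thesis using infsumI[OF fs] by (simp only: infsum_cmult_right')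
    qed
    moreover have "norm (norm (mob k * ?f k) * zeta_nat s) = norm (mob k * ?f k) * zeta_nat s" for k
      using zeta_nat_ge_1[OF s] by simp
    ultimately have "norm (infsum (\<lambda>j. norm (h (k, j))) ?N) = norm (mob k * ?f k) * zeta_nat s" for k
      by (simp only:)
    moreover have "(\<lambda>k. norm (mob k * ?f k) * zeta_nat s) summable_on ?N"
      by (intro summable_on_cmult_left mf_abs)
    ultimately show "(\<lambda>k. norm (infsum (\<lambda>j. norm (h (k, j))) ?N)) summable_on ?N"
      by (simp only:)
  qed
  then have h_sum: "h summable_on (Sigma ?N (\<lambda>_. ?N))" by (rule abs_summable_summable)
  have 1: "infsum h (Sigma ?N (\<lambda>_. ?N)) = infsum (\<lambda>k. mob k * ?f k) ?N * zeta_nat s"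
  proof -
    have "infsum h (Sigma ?N (\<lambda>_. ?N)) = infsum (\<lambda>k. infsum (\<lambda>j. h (k, j)) ?N) ?N"
      by (rule infsum_Sigma_banach[OF h_sum, symmetric])
    also have "\<dots> = infsum (\<lambda>k. (mob k * ?f k) * zeta_nat s) ?N"
      unfolding h_def prod.case using infsumI[OF fs] by (simp only: infsum_cmult_right')
    finally show ?thesis by (simp only: infsum_cmult_left')
  qed
  let ?S = "Sigma ?N (\<lambda>n. {k. k dvd n})"
  let ?g = "\<lambda>(n::nat, k::nat). (k, n div k)"
  have bij: "bij_betw ?g ?S (Sigma ?N (\<lambda>_. ?N))"
  proof (rule bij_betwI[where g = "\<lambda>(k, j). (k * j, k)"])
    show "?g \<in> ?S \<rightarrow> Sigma ?N (\<lambda>_. ?N)"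
      by (auto simp: Suc_le_eq dvd_imp_le div_greater_zero_iff intro: dvd_pos_nat)
    show "(\<lambda>(k, j). (k * j, k)) \<in> Sigma ?N (\<lambda>_. ?N) \<rightarrow> ?S" by auto
  qed auto
  have hg: "h (?g p) = (\<lambda>(n, k). mob k * ?f n) p" if "p \<in> ?S" for p
  proof -
    obtain n k where p: "p = (n, k)" "k dvd n" "1 \<le> n" using \<open>p \<in> ?S\<close> by auto
    then obtain j where j: "n = k * j" by (auto simp: dvd_def)
    then have "0 < k" using p by (cases k) auto
    then show ?thesis using j by (simp add: p(1) h_def power_mult_distrib)
  qed
  have "(\<lambda>p. h (?g p)) summable_on ?S" using h_sum summable_on_reindex_bij_betw[OF bij, of h] by simp
  then have sS: "(\<lambda>(n, k). mob k * ?f n) summable_on ?S"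
    by (rule summable_on_cong[THEN iffD1, rotated]) (rule hg)
  have "infsum h (Sigma ?N (\<lambda>_. ?N)) = infsum (\<lambda>p. h (?g p)) ?S"
    by (rule infsum_reindex_bij_betw[OF bij, symmetric])
  also have "\<dots> = infsum (\<lambda>(n, k). mob k * ?f n) ?S" by (rule infsum_cong) (rule hg)
  also have "\<dots> = infsum (\<lambda>n. infsum (\<lambda>k. mob k * ?f n) {k. k dvd n}) ?N"
    using infsum_Sigma_banach[OF sS] by simp
  also have "\<dots> = infsum (\<lambda>n. if n = 1 then 1 else 0) ?N"
  proof (rule infsum_cong)
    fix n :: nat assume "n \<in> ?N"
    then have n: "n \<noteq> 0" by auto
    have "infsum (\<lambda>k. mob k * ?f n) {k. k dvd n} = (\<Sum>k | k dvd n. mob k * ?f n)" using n by simp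
    also have "\<dots> = (\<Sum>k | k dvd n. mob k) * ?f n" by (simp only: sum_distrib_right)
    also have "\<dots> = (if n = 1 then 1 else 0)" by (simp add: sum_mob_divisors[OF n])
    finally show "infsum (\<lambda>k. mob k * ?f n) {k. k dvd n} = (if n = 1 then 1 else 0)" .
  qed
  also have "\<dots> = infsum (\<lambda>n. if n = 1 then 1 else 0) {1::nat}"
    by (rule infsum_cong_neutral) auto
  finally have "infsum (\<lambda>k. mob k * ?f k) ?N * zeta_nat s = 1" using 1 by simp
  then have val: "infsum (\<lambda>k. mob k * ?f k) ?N = 1 / zeta_nat s"
    using zeta_nat_ge_1[OF s] by (simp add: field_simps)
  have "((\<lambda>k. mob k * ?f k) has_sum 1 / zeta_nat s) ?N"
    using abs_summable_summable[OF mf_abs] val by (metis has_sum_infsum)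
  then have "((\<lambda>k. mob k * ?f k) has_sum 1 / zeta_nat s) UNIV"
    by (rule has_sum_cong_neutral[THEN iffD1, rotated -1]) (auto simp: not_less_eq_eq)
  then have "(\<lambda>k. mob k * ?f k) sums (1 / zeta_nat s)" by (rule has_sum_imp_sums)
  then show ?thesis by (simp add: sums_def)
qed

section \<open>Moebius inversion over the lattice\<close>

context lattice_min
begin

text \<open>If u k + v l = gcd k l, then 1 / lcm k l = u / l + v / k. Consequently the k for which r
  / k is a lattice vector are exactly the divisors of the largest one, which is what
  \<open>sum_mob_content\<close> needs.\<close>

lemma scale_divisor_lcm:
  assumes r: "(1 / real k) *\<^sub>R r \<in> \<Lambda>" "(1 / real l) *\<^sub>R r \<in> \<Lambda>" and kl: "0 < k" "0 < l"
  shows "(1 / real (lcm k l)) *\<^sub>R r \<in> \<Lambda>"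
proof -
  obtain u v where uv: "u * int k + v * int l = gcd (int k) (int l)" using bezout_int by blast
  have g: "real_of_int u * real k + real_of_int v * real l = real (gcd k l)"
    using uv by (metis gcd_int_int_eq of_int_add of_int_mult of_int_of_nat_eq)
  have "real (lcm k l) * real (gcd k l) = real k * real l"
    by (metis of_nat_mult prod_gcd_lcm_nat mult.commute)
  moreover have "0 < real (lcm k l)" "0 < real k" "0 < real l" using kl by (auto simp: lcm_pos_nat)
  ultimately have "1 / real (lcm k l) = real (gcd k l) / (real k * real l)" by (simp add: field_simps)
  also have "\<dots> = real_of_int u * (1 / real l) + real_of_int v * (1 / real k)"
    using kl by (simp add: g[symmetric] field_simps)
  finally have "(1 / real (lcm k l)) *\<^sub>R r
    = of_int u *\<^sub>R ((1 / real l) *\<^sub>R r) + of_int v *\<^sub>R ((1 / real k) *\<^sub>R r)"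
    by (simp add: scaleR_left_distrib)
  then show ?thesis using r of_int_scale_mem add_mem by metis
qed

lemma sum_mob_content:
  assumes r: "r \<in> \<Lambda>" "r \<noteq> 0" and N: "norm r \<le> a * real N"
  shows "(\<Sum>k | k \<in> {1..N} \<and> (1 / real k) *\<^sub>R r \<in> \<Lambda>. mob k) = (if primitive r then 1 else 0)"
proof -
  let ?S = "{k. k \<in> {1..N} \<and> (1 / real k) *\<^sub>R r \<in> \<Lambda>}"
  have bound: "k \<le> N" if k: "0 < k" "(1 / real k) *\<^sub>R r \<in> \<Lambda>" for k
  proof -
    have "a \<le> norm ((1 / real k) *\<^sub>R r)" using a_le[OF k(2)] r k by simp
    then have "real k * a \<le> norm r" using k by (simp add: field_simps)
    then have "real k * a \<le> real N * a" using N by (simp add: mult.commute)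
    then show ?thesis using a_pos by simp
  qed
  have N1: "1 \<le> N" using bound[of 1] r by simp
  define c where "c = Max ?S"
  have finS: "finite ?S" by simp
  have "1 \<in> ?S" using r N1 by simp
  then have cS: "c \<in> ?S" unfolding c_def using Max_in[OF finS] by blast
  have cmax: "k \<le> c" if "k \<in> ?S" for k
    unfolding c_def by (rule Max_ge[OF finS that])
  have c: "0 < c" "(1 / real c) *\<^sub>R r \<in> \<Lambda>" using cS by auto
  have eq: "?S = {k. k dvd c}"
  proof (intro equalityI subsetI)
    fix k assume k: "k \<in> ?S"
    then have k0: "0 < k" by auto
    have "(1 / real (lcm k c)) *\<^sub>R r \<in> \<Lambda>" using k c by (intro scale_divisor_lcm) auto
    moreover have l0: "0 < lcm k c" using k0 c by (simp add: lcm_pos_nat)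
    ultimately have "lcm k c \<in> ?S" using bound by auto
    then have "lcm k c \<le> c" by (rule cmax)
    moreover have "c \<le> lcm k c" using l0 by (intro dvd_imp_le) auto
    ultimately have "lcm k c = c" by simp
    then show "k \<in> {k. k dvd c}" by (metis dvd_lcm1 mem_Collect_eq)
  next
    fix k assume "k \<in> {k. k dvd c}"
    then obtain j where j: "c = k * j" by (auto simp: dvd_def)
    then have "0 < k" "0 < j" using c by auto
    have "(1 / real k) *\<^sub>R r = of_nat j *\<^sub>R ((1 / real c) *\<^sub>R r)" using j \<open>0 < j\<close> by simp
    then have "(1 / real k) *\<^sub>R r \<in> \<Lambda>" using c(2) of_nat_scale_mem by metis
    then show "k \<in> ?S" using \<open>0 < k\<close> bound by auto
  qed
  have "primitive r \<longleftrightarrow> c = 1"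
  proof
    assume p: "primitive r"
    then have "\<not> 2 \<le> c" using c(2) by (auto simp: primitive_def)
    then show "c = 1" using c(1) by linarith
  next
    assume c1: "c = 1"
    have "(1 / real k) *\<^sub>R r \<notin> \<Lambda>" if "2 \<le> k" for k
    proof
      assume "(1 / real k) *\<^sub>R r \<in> \<Lambda>"
      then have "k \<in> ?S" using that bound by auto
      from cmax[OF this] show False using c1 that by simp
    qed
    then show "primitive r" using r by (simp add: primitive_def)
  qed
  then show ?thesis unfolding eq using sum_mob_divisors[of c] c(1) by simp
qed

lemma card_primitive_eq:
  assumes Y: "Y \<subseteq> cball 0 R" and N: "R \<le> a * real N"
  shows "real (card {r \<in> Y. primitive r}) = (\<Sum>k=1..N. mob k * real (card {r \<in> \<Lambda> - {0}. real k *\<^sub>R r \<in> Y}))"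
proof -
  let ?Z = "(\<Lambda> - {0}) \<inter> Y"
  have finZ: "finite ?Z"
    by (rule finite_subset[OF _ finite_bounded[OF bounded_cball[of 0 R]]]) (use Y in auto)
  have "{r \<in> Y. primitive r} = {r \<in> ?Z. primitive r}" by (auto simp: primitive_def)
  then have "real (card {r \<in> Y. primitive r}) = (\<Sum>r\<in>{r \<in> ?Z. primitive r}. 1)" by simp
  also have "\<dots> = (\<Sum>r\<in>?Z. if primitive r then 1 else 0)" by (rule sum.inter_filter[OF finZ])
  also have "\<dots> = (\<Sum>r\<in>?Z. \<Sum>k | k \<in> {1..N} \<and> (1 / real k) *\<^sub>R r \<in> \<Lambda>. mob k)"
  proof (rule sum.cong[OF refl])
    fix r assume r: "r \<in> ?Z"
    then have "norm r \<le> R" using Y by auto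
    then show "(if primitive r then 1 else 0) = (\<Sum>k | k \<in> {1..N} \<and> (1 / real k) *\<^sub>R r \<in> \<Lambda>. mob k)"
      using r N by (subst sum_mob_content) auto
  qed
  also have "\<dots> = (\<Sum>r\<in>?Z. \<Sum>k\<in>{1..N}. if (1 / real k) *\<^sub>R r \<in> \<Lambda> then mob k else 0)"
    by (intro sum.cong refl sum.inter_filter) simp
  also have "\<dots> = (\<Sum>k\<in>{1..N}. \<Sum>r\<in>?Z. if (1 / real k) *\<^sub>R r \<in> \<Lambda> then mob k else 0)"
    by (rule sum.swap)
  also have "\<dots> = (\<Sum>k=1..N. mob k * real (card {r \<in> \<Lambda> - {0}. real k *\<^sub>R r \<in> Y}))"
  proof (rule sum.cong[OF refl])
    fix k assume "k \<in> {1..N}"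
    then have k: "0 < real k" by simp
    have img: "{r \<in> ?Z. (1 / real k) *\<^sub>R r \<in> \<Lambda>} = (\<lambda>r. real k *\<^sub>R r) ` {r \<in> \<Lambda> - {0}. real k *\<^sub>R r \<in> Y}"
    proof (intro equalityI subsetI)
      fix r assume "r \<in> {r \<in> ?Z. (1 / real k) *\<^sub>R r \<in> \<Lambda>}"
      then show "r \<in> (\<lambda>r. real k *\<^sub>R r) ` {r \<in> \<Lambda> - {0}. real k *\<^sub>R r \<in> Y}"
        using k by (intro image_eqI[of _ _ "(1 / real k) *\<^sub>R r"]) auto
    qed (use k of_nat_scale_mem in auto)
    have "(\<Sum>r\<in>?Z. if (1 / real k) *\<^sub>R r \<in> \<Lambda> then mob k else 0) = (\<Sum>r\<in>{r \<in> ?Z. (1 / real k) *\<^sub>R r \<in> \<Lambda>}. mob k)"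
      by (rule sum.inter_filter[OF finZ, symmetric])
    also have "\<dots> = mob k * real (card {r \<in> ?Z. (1 / real k) *\<^sub>R r \<in> \<Lambda>})" by simp
    also have "card {r \<in> ?Z. (1 / real k) *\<^sub>R r \<in> \<Lambda>} = card {r \<in> \<Lambda> - {0}. real k *\<^sub>R r \<in> Y}"
      unfolding img using k by (intro card_image) (auto simp: inj_on_def)
    finally show "(\<Sum>r\<in>?Z. if (1 / real k) *\<^sub>R r \<in> \<Lambda> then mob k else 0)
      = mob k * real (card {r \<in> \<Lambda> - {0}. real k *\<^sub>R r \<in> Y})" .
  qed
  finally show ?thesis .
qed

lemma card_scaled_le:
  assumes Y: "Y \<subseteq> cball 0 R" and k: "0 < k" and R: "0 < R"
  shows "real (card {r \<in> \<Lambda> - {0}. real k *\<^sub>R r \<in> Y})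
     \<le> plane_const DIM('a) * R ^ DIM('a) * (1 / real k ^ DIM('a)) + plane_const DIM('a) * last_min ^ DIM('a)"
proof -
  let ?d = "DIM('a)"
  let ?X = "max last_min (R / real k)"
  have "{r \<in> \<Lambda> - {0}. real k *\<^sub>R r \<in> Y} \<subseteq> \<Lambda> \<inter> cball 0 ?X"
  proof
    fix r assume r: "r \<in> {r \<in> \<Lambda> - {0}. real k *\<^sub>R r \<in> Y}"
    then have "real k *\<^sub>R r \<in> cball 0 R" using Y by auto
    then have "norm r \<le> R / real k" using k by (simp add: field_simps)
    then show "r \<in> \<Lambda> \<inter> cball 0 ?X" using r by simp
  qed
  then have "card {r \<in> \<Lambda> - {0}. real k *\<^sub>R r \<in> Y} \<le> card (\<Lambda> \<inter> cball 0 ?X)"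
    by (intro card_mono finite_bounded) auto
  also have "real (card (\<Lambda> \<inter> cball 0 ?X)) \<le> plane_const ?d * ?X ^ ?d"
    using card_cball_le[of ?X] by (simp add: plane_const_def power_mult_distrib mult_ac add.commute)
  also have "\<dots> \<le> plane_const ?d * ((R / real k) ^ ?d + last_min ^ ?d)"
  proof (rule mult_left_mono)
    show "?X ^ ?d \<le> (R / real k) ^ ?d + last_min ^ ?d"
      using R last_min_pos by (simp add: max_def)
  qed (use plane_const_pos[of ?d] in simp)
  finally show ?thesis by (simp add: algebra_simps power_divide)
qed

text \<open>The Moebius sum is cut at a fixed \<open>K\<close>. Below \<open>K\<close> the counts
  follow the volume up to \<open>E\<close>. Above it only the crude bound
  \<open>card_scaled_le\<close> is used; its part proportional to k^(-d) has a small tail, and its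
  constant part is incurred for at most 2 R / a values of k, since for larger k no nonzero lattice
  vector is left.\<close>

lemma card_primitive_approx:
  assumes d: "2 \<le> DIM('a)" and Y: "Y \<subseteq> cball 0 R" and R: "a \<le> R" and v: "0 \<le> v"
    and main: "\<And>k. 1 \<le> k \<Longrightarrow> k < K \<Longrightarrow>
       \<bar>real (card {r \<in> \<Lambda> - {0}. real k *\<^sub>R r \<in> Y}) - v / real k ^ DIM('a)\<bar> \<le> E"
    and E: "0 \<le> E" and K: "\<bar>(\<Sum>k<K. mob k / real k ^ DIM('a)) - 1 / zeta_nat DIM('a)\<bar> \<le> \<theta>"
      "\<And>n. (\<Sum>k=K..<n. 1 / real k ^ DIM('a)) \<le> \<theta>" "1 \<le> K"
  shows "\<bar>real (card {r \<in> Y. primitive r}) - v / zeta_nat DIM('a)\<bar>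
    \<le> real K * E + plane_const DIM('a) * (R ^ DIM('a) * \<theta> + 2 * R * last_min ^ DIM('a) / a) + v * \<theta>"
proof -
  let ?d = "DIM('a)"
  let ?P = "plane_const ?d"
  let ?c = "\<lambda>k. real (card {r \<in> \<Lambda> - {0}. real k *\<^sub>R r \<in> Y})"
  have P: "0 < ?P" by (rule plane_const_pos)
  have R0: "0 < R" using R a_pos by simp
  define N where "N = nat \<lceil>R / a\<rceil>"
  have N: "R \<le> a * real N" "real N \<le> 2 * R / a"
  proof -
    have "1 \<le> R / a" using R a_pos by simp
    then have "R / a \<le> real N" "real N \<le> R / a + 1" unfolding N_def by auto
    then show "R \<le> a * real N" using a_pos by (simp add: pos_divide_le_eq mult.commute)
    have "real N \<le> 2 * (R / a)" using \<open>real N \<le> R / a + 1\<close> \<open>1 \<le> R / a\<close> by linarith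
    then show "real N \<le> 2 * R / a" by simp
  qed
  define N' where "N' = max (Suc N) K"
  have bigk: "?c k = 0" if "N < k" for k
  proof -
    have "{r \<in> \<Lambda> - {0}. real k *\<^sub>R r \<in> Y} = {}"
    proof (rule equals0I)
      fix r assume r: "r \<in> {r \<in> \<Lambda> - {0}. real k *\<^sub>R r \<in> Y}"
      then have "real k *\<^sub>R r \<in> cball 0 R" using Y by auto
      then have "real k * norm r \<le> R" by simp
      moreover have "a \<le> norm r" using r a_le by auto
      then have "real k * a \<le> real k * norm r" by (intro mult_left_mono) auto
      ultimately have "a * real k \<le> a * real N" using N(1) by (simp add: mult.commute)
      then show False using a_pos that by simp
    qed
    then show ?thesis by (simp only: card.empty of_nat_0)
  qed
  have "real (card {r \<in> Y. primitive r}) = (\<Sum>k=1..N. mob k * ?c k)" by (rule card_primitive_eq[OF Y N(1)])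
  also have "\<dots> = (\<Sum>k\<in>{0..<N'}. mob k * ?c k)"
  proof (rule sum.mono_neutral_left)
    show "\<forall>i\<in>{0..<N'} - {1..N}. mob i * ?c i = 0"
    proof
      fix i assume "i \<in> {0..<N'} - {1..N}"
      then have "i = 0 \<or> N < i" by auto
      then show "mob i * ?c i = 0" using bigk[of i] by (auto simp del: of_nat_eq_0_iff)
    qed
  qed (auto simp: N'_def)
  also have "\<dots> = (\<Sum>k\<in>{0..<K}. mob k * ?c k) + (\<Sum>k\<in>{K..<N'}. mob k * ?c k)"
    by (rule sum.atLeastLessThan_concat[symmetric]) (auto simp: N'_def)
  finally have split: "real (card {r \<in> Y. primitive r}) = (\<Sum>k<K. mob k * ?c k) + (\<Sum>k\<in>{K..<N'}. mob k * ?c k)"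
    by (simp add: atLeast0LessThan)
  have "\<bar>(\<Sum>k<K. mob k * ?c k) - (\<Sum>k<K. mob k * (v / real k ^ ?d))\<bar> \<le> real K * E"
  proof -
    have "(\<Sum>k<K. mob k * ?c k) - (\<Sum>k<K. mob k * (v / real k ^ ?d)) = (\<Sum>k<K. mob k * (?c k - v / real k ^ ?d))"
      by (simp only: sum_subtractf right_diff_distrib)
    also have "\<bar>\<dots>\<bar> \<le> (\<Sum>k<K. E)"
    proof (rule order_trans[OF sum_abs sum_mono])
      fix k assume k: "k \<in> {..<K}"
      show "\<bar>mob k * (?c k - v / real k ^ ?d)\<bar> \<le> E"
      proof (cases "k = 0")
        case True
        then show ?thesis using E by simp
      next
        case False
        then have "\<bar>?c k - v / real k ^ ?d\<bar> \<le> E" using main[of k] k by simp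
        moreover have "\<bar>mob k * (?c k - v / real k ^ ?d)\<bar> \<le> 1 * \<bar>?c k - v / real k ^ ?d\<bar>"
          unfolding abs_mult using abs_mob_le[of k] by (intro mult_right_mono) auto
        ultimately show ?thesis by simp
      qed
    qed
    finally show ?thesis by simp
  qed
  moreover have "\<bar>(\<Sum>k\<in>{K..<N'}. mob k * ?c k)\<bar> \<le> ?P * (R ^ ?d * \<theta> + 2 * R * last_min ^ ?d / a)"
  proof -
    have "\<bar>(\<Sum>k\<in>{K..<N'}. mob k * ?c k)\<bar> \<le> (\<Sum>k\<in>{K..<N'}. ?c k)"
    proof (rule order_trans[OF sum_abs sum_mono])
      show "\<bar>mob k * ?c k\<bar> \<le> ?c k" for k
        using mult_right_mono[OF abs_mob_le[of k], of "?c k"] by (simp add: abs_mult)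
    qed
    also have "\<dots> = (\<Sum>k\<in>{K..<N'} \<inter> {..N}. ?c k)"
    proof (rule sum.mono_neutral_right)
      show "\<forall>i\<in>{K..<N'} - {K..<N'} \<inter> {..N}. ?c i = 0"
      proof
        fix i assume "i \<in> {K..<N'} - {K..<N'} \<inter> {..N}"
        then have "N < i" by auto
        then show "?c i = 0" by (rule bigk)
      qed
    qed auto
    also have "\<dots> \<le> (\<Sum>k\<in>{K..<N'} \<inter> {..N}. ?P * R ^ ?d * (1 / real k ^ ?d) + ?P * last_min ^ ?d)"
      using K(3) by (intro sum_mono card_scaled_le[OF Y _ R0]) auto
    also have "\<dots> = ?P * R ^ ?d * (\<Sum>k\<in>{K..<N'} \<inter> {..N}. 1 / real k ^ ?d) + real (card ({K..<N'} \<inter> {..N})) * (?P * last_min ^ ?d)"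
      by (simp add: sum.distrib sum_distrib_left)
    also have "\<dots> \<le> ?P * R ^ ?d * \<theta> + (2 * R / a) * (?P * last_min ^ ?d)"
    proof (intro add_mono mult_left_mono mult_right_mono)
      have "(\<Sum>k\<in>{K..<N'} \<inter> {..N}. 1 / real k ^ ?d) \<le> (\<Sum>k\<in>{K..<N'}. 1 / real k ^ ?d)"
        by (rule sum_mono2) auto
      then show "(\<Sum>k\<in>{K..<N'} \<inter> {..N}. 1 / real k ^ ?d) \<le> \<theta>" using K(2)[of N'] by linarith
      have "card ({K..<N'} \<inter> {..N}) \<le> card {1..N}" using K(3) by (intro card_mono) auto
      then show "real (card ({K..<N'} \<inter> {..N})) \<le> 2 * R / a" using N(2) by simp
    qed (use P R0 last_min_pos in auto)
    also have "\<dots> = ?P * (R ^ ?d * \<theta> + 2 * R * last_min ^ ?d / a)" by (simp add: algebra_simps)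
    finally show ?thesis .
  qed
  moreover have "\<bar>(\<Sum>k<K. mob k * (v / real k ^ ?d)) - v / zeta_nat ?d\<bar> \<le> v * \<theta>"
  proof -
    have "(\<Sum>k<K. mob k * (v / real k ^ ?d)) - v / zeta_nat ?d = v * ((\<Sum>k<K. mob k / real k ^ ?d) - 1 / zeta_nat ?d)"
      by (simp add: sum_distrib_left right_diff_distrib mult_ac)
    then show ?thesis using K(1) v by (simp add: abs_mult mult_left_mono)
  qed
  ultimately show ?thesis unfolding split by linarith
qed

end

subsection \<open>Boxes of matrices and pairs of norms\<close>

lemma is_norm_nonneg: "is_norm N \<Longrightarrow> 0 \<le> N x"
  and is_norm_zero: "is_norm N \<Longrightarrow> N 0 = 0"
  and is_norm_eq_0: "is_norm N \<Longrightarrow> N x = 0 \<longleftrightarrow> x = 0"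
  and is_norm_scale: "is_norm N \<Longrightarrow> N (c *\<^sub>R x) = \<bar>c\<bar> * N x"
  and is_norm_triangle: "is_norm N \<Longrightarrow> N (x + y) \<le> N x + N y"
  by (auto simp: is_norm_def)

lemma is_norm_minus: "is_norm N \<Longrightarrow> N (- x) = N x"
  using is_norm_scale[of N "- 1" x] by simp

lemma is_norm_diff_commute: "is_norm N \<Longrightarrow> N (x - y) = N (y - x)"
  using is_norm_minus[of N "x - y"] by simp

lemma is_norm_sum: "is_norm N \<Longrightarrow> N (\<Sum>i\<in>I. f i) \<le> (\<Sum>i\<in>I. N (f i))"
proof (induction I rule: infinite_finite_induct)
  case (insert i I)
  then show ?case using is_norm_triangle[of N "f i" "\<Sum>i\<in>I. f i"] by simp
qed (simp_all add: is_norm_zero)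

lemma is_norm_upper:
  fixes N :: "'a::euclidean_space \<Rightarrow> real"
  assumes "is_norm N" shows "N x \<le> (\<Sum>b\<in>Basis. N b) * norm x"
proof -
  have "N x = N (\<Sum>b\<in>Basis. (x \<bullet> b) *\<^sub>R b)" by (simp add: euclidean_representation)
  also have "\<dots> \<le> (\<Sum>b\<in>Basis. \<bar>x \<bullet> b\<bar> * N b)"
    using is_norm_sum[OF assms, of "\<lambda>b. (x \<bullet> b) *\<^sub>R b" Basis] by (simp add: is_norm_scale[OF assms])
  also have "\<dots> \<le> (\<Sum>b\<in>Basis. norm x * N b)"
    by (intro sum_mono mult_right_mono Basis_le_norm is_norm_nonneg[OF assms])
  finally show ?thesis by (simp add: sum_distrib_left mult.commute)
qed

lemma is_norm_continuous:
  fixes N :: "'a::euclidean_space \<Rightarrow> real"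
  assumes "is_norm N" shows "continuous_on S N"
proof (rule continuous_on_subset[OF _ subset_UNIV])
  let ?C = "\<Sum>b\<in>Basis. N b"
  have C: "0 \<le> ?C" by (intro sum_nonneg is_norm_nonneg[OF assms])
  have "\<bar>N x - N y\<bar> \<le> ?C * norm (x - y)" for x y
    using is_norm_triangle[OF assms, of "x - y" y] is_norm_triangle[OF assms, of "y - x" x]
      is_norm_diff_commute[OF assms, of x y] is_norm_upper[OF assms, of "x - y"] by simp
  then have "?C-lipschitz_on UNIV N" using C by (intro lipschitz_onI) (auto simp: dist_norm)
  then show "continuous_on UNIV N" by (rule lipschitz_on_continuous_on)
qed

lemma is_norm_lower:
  fixes N :: "'a::euclidean_space \<Rightarrow> real"
  assumes "is_norm N" obtains c where "0 < c" "\<And>x. c * norm x \<le> N x"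
proof -
  have ne: "sphere (0::'a) 1 \<noteq> {}" by (metis nonempty_Basis norm_Basis ex_in_conv mem_sphere_0)
  obtain z where z: "z \<in> sphere (0::'a) 1" "\<And>y. y \<in> sphere 0 1 \<Longrightarrow> N z \<le> N y"
    using continuous_attains_inf[OF compact_sphere ne is_norm_continuous[OF assms]] by blast
  have "z \<noteq> 0" using z(1) by auto
  then have Nz: "0 < N z" using is_norm_nonneg[OF assms, of z] is_norm_eq_0[OF assms, of z] by linarith
  have "N z * norm x \<le> N x" for x
  proof (cases "x = 0")
    case False
    then have "N z \<le> N ((1 / norm x) *\<^sub>R x)" by (intro z(2)) simp
    also have "\<dots> = N x / norm x" by (simp add: is_norm_scale[OF assms])
    finally show ?thesis using False by (simp add: field_simps)
  qed (simp add: is_norm_zero[OF assms])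
  then show ?thesis using Nz that by blast
qed

lemma is_norm_closed_ball:
  fixes N :: "'a::euclidean_space \<Rightarrow> real"
  assumes "is_norm N"
  shows "closed {x. N (x - p) \<le> \<rho>}" "bounded {x. N (x - p) \<le> \<rho>}" "{x. N (x - p) \<le> \<rho>} \<in> lmeasurable"
proof -
  obtain c where c: "0 < c" "\<And>x. c * norm x \<le> N x" by (rule is_norm_lower[OF assms]) (rule that)
  have "continuous_on UNIV (\<lambda>x. N (x - p))"
    by (intro continuous_on_compose2[OF is_norm_continuous[OF assms, of UNIV]] continuous_intros) auto
  then show cl: "closed {x. N (x - p) \<le> \<rho>}"
    by (intro closed_Collect_le continuous_intros)
  have "norm x \<le> norm p + \<rho> / c" if "N (x - p) \<le> \<rho>" for x
  proof -
    have "norm (x - p) \<le> \<rho> / c" using c(1) c(2)[of "x - p"] that by (simp add: field_simps)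
    then show ?thesis using norm_triangle_ineq[of p "x - p"] by simp
  qed
  then show bd: "bounded {x. N (x - p) \<le> \<rho>}" by (auto simp: bounded_iff)
  show "{x. N (x - p) \<le> \<rho>} \<in> lmeasurable" using bd cl by (simp add: lmeasurable_compact compact_eq_bounded_closed)
qed

lemma unit_ball_volume_pos:
  fixes N :: "'a::euclidean_space \<Rightarrow> real"
  assumes "is_norm N" shows "0 < unit_ball_volume N"
proof -
  let ?C = "(\<Sum>b\<in>Basis. N b) + 1"
  have C: "0 < ?C" using sum_nonneg[of Basis N] is_norm_nonneg[OF assms] by (simp add: add_nonneg_pos)
  have "cball 0 (1 / ?C) \<subseteq> {x. N (x - 0) \<le> 1}"
  proof
    fix x :: 'a assume "x \<in> cball 0 (1 / ?C)"
    then have "norm x \<le> 1 / ?C" by simp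
    then have "norm x * ?C \<le> 1" using C by (simp only: pos_le_divide_eq)
    then have "(\<Sum>b\<in>Basis. N b) * norm x + norm x \<le> 1" by (simp add: algebra_simps)
    then have "N x \<le> 1" using is_norm_upper[OF assms, of x] norm_ge_zero[of x] by linarith
    then show "x \<in> {x. N (x - 0) \<le> 1}" by simp
  qed
  then have "measure lebesgue (cball (0::'a) (1 / ?C)) \<le> measure lebesgue {x. N (x - 0) \<le> 1}"
    by (intro measure_mono_fmeasurable is_norm_closed_ball[OF assms]) auto
  moreover have "0 < measure lebesgue (cball (0::'a) (1 / ?C))"
    using C by (simp add: content_cball)
  ultimately have "0 < measure lebesgue {x. N (x - 0) \<le> 1}" by linarith
  then show ?thesis by (simp add: unit_ball_volume_def)
qed

lemma measure_norm_ball: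
  fixes N :: "'a::euclidean_space \<Rightarrow> real"
  assumes N: "is_norm N" and \<rho>: "0 \<le> \<rho>"
  shows "measure lebesgue {x. N (x - p) \<le> \<rho>} = unit_ball_volume N * \<rho> ^ DIM('a)"
proof (cases "\<rho> = 0")
  case True
  have "{x. N (x - p) \<le> 0} = {p}"
  proof -
    have "N (x - p) \<le> 0 \<longleftrightarrow> x = p" for x
      using is_norm_nonneg[OF N, of "x - p"] is_norm_eq_0[OF N, of "x - p"] by auto
    then show ?thesis by auto
  qed
  then show ?thesis using True by simp
next
  case False
  then have r: "0 < \<rho>" using \<rho> by simp
  have "{x. N (x - p) \<le> \<rho>} = (\<lambda>x. \<rho> *\<^sub>R x + p) ` {x. N x \<le> 1}"
  proof (intro equalityI subsetI)
    fix x assume x: "x \<in> {x. N (x - p) \<le> \<rho>}"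
    have "N ((1 / \<rho>) *\<^sub>R (x - p)) = N (x - p) / \<rho>" using r is_norm_scale[OF N, of "1 / \<rho>" "x - p"] by simp
    then have "N ((1 / \<rho>) *\<^sub>R (x - p)) \<le> 1" using x r by simp
    moreover have "x = \<rho> *\<^sub>R ((1 / \<rho>) *\<^sub>R (x - p)) + p" using r by simp
    ultimately show "x \<in> (\<lambda>x. \<rho> *\<^sub>R x + p) ` {x. N x \<le> 1}" by blast
  next
    fix x assume "x \<in> (\<lambda>x. \<rho> *\<^sub>R x + p) ` {x. N x \<le> 1}"
    then obtain y where "x = \<rho> *\<^sub>R y + p" "N y \<le> 1" by auto
    then show "x \<in> {x. N (x - p) \<le> \<rho>}" using r is_norm_scale[OF N, of \<rho> y] by simp
  qed
  then show ?thesis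
    using r measure_lebesgue_affine[of \<rho> p "{x. N x \<le> 1}"] by (simp add: unit_ball_volume_def)
qed

lemma emeasure_norm_ball:
  fixes N :: "'a::euclidean_space \<Rightarrow> real"
  assumes N: "is_norm N" and \<rho>: "0 \<le> \<rho>"
  shows "emeasure lborel {x. N (x - p) \<le> \<rho>} = ennreal (unit_ball_volume N * \<rho> ^ DIM('a))"
proof -
  have "emeasure lborel {x. N (x - p) \<le> \<rho>} = emeasure lebesgue {x. N (x - p) \<le> \<rho>}"
    using is_norm_closed_ball(1)[OF N, of p \<rho>] by simp
  also have "\<dots> = ennreal (measure lebesgue {x. N (x - p) \<le> \<rho>})"
    using is_norm_closed_ball(3)[OF N, of p \<rho>] by (simp add: emeasure_eq_measure2)
  finally show ?thesis by (simp add: measure_norm_ball[OF N \<rho>])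
qed

definition box_matrices :: "real \<Rightarrow> (real ^ 'n ^ 'm) set" where
  "box_matrices s = {A. \<forall>i j. - s \<le> A $ i $ j \<and> A $ i $ j \<le> 1 + s}"

lemma unit_matrices_eq: "unit_matrices = box_matrices 0"
  by (simp add: unit_matrices_def box_matrices_def)

lemma box_matrices_mono: "s \<le> t \<Longrightarrow> box_matrices s \<subseteq> box_matrices t"
  unfolding box_matrices_def by (auto intro: order_trans[of _ "- s"] order_trans[of _ "1 + s"])

lemma box_matrices_cbox:
  "(box_matrices s :: (real ^ 'n ^ 'm) set) = cbox (\<chi> i j. - s) (\<chi> i j. 1 + s)"
  by (auto simp: box_matrices_def cbox_def Basis_vec_def inner_axis)

lemma lmeasurable_box_matrices [simp]: "box_matrices s \<in> lmeasurable"
  by (simp add: box_matrices_cbox)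

lemma measure_box_matrices:
  assumes "- 1 / 2 \<le> s"
  shows "measure lebesgue (box_matrices s :: (real ^ 'n ^ 'm) set) = (1 + 2 * s) ^ (CARD('m) * CARD('n))"
proof -
  let ?a = "(\<chi> i j. - s) :: real ^ 'n ^ 'm" and ?b = "(\<chi> i j. 1 + s) :: real ^ 'n ^ 'm"
  have val: "?a \<bullet> b = - s \<and> ?b \<bullet> b = 1 + s" if "b \<in> Basis" for b
    using that by (auto simp: Basis_vec_def inner_axis)
  have "measure lborel (cbox ?a ?b) = (\<Prod>b\<in>(Basis :: (real ^ 'n ^ 'm) set). ?b \<bullet> b - ?a \<bullet> b)"
    using assms val by (intro content_cbox) auto
  also have "\<dots> = (\<Prod>b\<in>(Basis :: (real ^ 'n ^ 'm) set). 1 + 2 * s)"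
    using val by (intro prod.cong) auto
  also have "\<dots> = (1 + 2 * s) ^ (CARD('m) * CARD('n))" by simp
  finally show ?thesis by (simp add: box_matrices_cbox)
qed

lemma norm_box_matrix_mult_le:
  fixes A :: "real ^ 'n ^ 'm"
  assumes "A \<in> box_matrices 1"
  shows "norm (A *v x) \<le> 2 * CARD('m) * CARD('n) * norm x"
proof -
  have "\<bar>(A *v x) $ i\<bar> \<le> 2 * CARD('n) * norm x" for i
  proof -
    have "\<bar>(A *v x) $ i\<bar> \<le> (\<Sum>j\<in>UNIV. \<bar>A $ i $ j * x $ j\<bar>)"
      unfolding matrix_vector_mult_def by (simp add: sum_abs)
    also have "\<dots> \<le> (\<Sum>j\<in>(UNIV :: 'n set). 2 * norm x)"
    proof (rule sum_mono)
      fix j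
      have "\<bar>A $ i $ j\<bar> \<le> 2" using assms by (auto simp: box_matrices_def abs_le_iff intro: order_trans[of _ 1])
      then show "\<bar>A $ i $ j * x $ j\<bar> \<le> 2 * norm x"
        unfolding abs_mult by (intro mult_mono component_le_norm_cart) auto
    qed
    finally show ?thesis by simp
  qed
  then have "norm (A *v x) \<le> (\<Sum>i\<in>(UNIV :: 'm set). 2 * CARD('n) * norm x)"
    by (intro order_trans[OF norm_le_l1_cart] sum_mono)
  then show ?thesis by (simp add: mult_ac)
qed

section \<open>Regions defined by the two norms\<close>

locale two_norms =
  fixes N\<mu> :: "real ^ 'm \<Rightarrow> real" and N\<nu> :: "real ^ 'n \<Rightarrow> real"
  assumes N\<mu>: "is_norm N\<mu>" and N\<nu>: "is_norm N\<nu>"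
begin

abbreviation "V\<mu> \<equiv> unit_ball_volume N\<mu>"
abbreviation "V\<nu> \<equiv> unit_ball_volume N\<nu>"

lemma volumes_pos: "0 < V\<mu>" "0 < V\<nu>"
  using unit_ball_volume_pos[OF N\<mu>] unit_ball_volume_pos[OF N\<nu>] by auto

definition "nconst = (SOME c. 1 \<le> c \<and> (\<forall>x. N\<mu> x \<le> c * norm x \<and> norm x \<le> c * N\<mu> x) \<and>
   (\<forall>x. N\<nu> x \<le> c * norm x \<and> norm x \<le> c * N\<nu> x))"

lemma nconst: "1 \<le> nconst" "N\<mu> x \<le> nconst * norm x" "norm x \<le> nconst * N\<mu> x"
   "N\<nu> y \<le> nconst * norm y" "norm y \<le> nconst * N\<nu> y"
proof -
  obtain c1 where c1: "0 < c1" "\<And>x. c1 * norm x \<le> N\<mu> x" using is_norm_lower[OF N\<mu>] by metis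
  obtain c2 where c2: "0 < c2" "\<And>x. c2 * norm x \<le> N\<nu> x" using is_norm_lower[OF N\<nu>] by metis
  let ?S1 = "\<Sum>b\<in>Basis. N\<mu> b" and ?S2 = "\<Sum>b\<in>Basis. N\<nu> b"
  define c where "c = 1 + \<bar>?S1\<bar> + \<bar>?S2\<bar> + 1 / c1 + 1 / c2"
  have cc: "1 \<le> c" "?S1 \<le> c" "?S2 \<le> c" "1 / c1 \<le> c" "1 / c2 \<le> c"
    using c1 c2 abs_ge_self[of ?S1] abs_ge_self[of ?S2] zero_less_divide_1_iff[of c1] zero_less_divide_1_iff[of c2]
    unfolding c_def by linarith+
  have "N\<mu> x \<le> c * norm x" for x
    using is_norm_upper[OF N\<mu>, of x] mult_right_mono[OF cc(2), of "norm x"] by simp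
  moreover have "N\<nu> x \<le> c * norm x" for x
    using is_norm_upper[OF N\<nu>, of x] mult_right_mono[OF cc(3), of "norm x"] by simp
  moreover have "norm x \<le> c * N\<mu> x" for x
  proof -
    have "norm x \<le> (1 / c1) * N\<mu> x" using c1(1) c1(2)[of x] by (simp add: field_simps)
    then show ?thesis using mult_right_mono[OF cc(4) is_norm_nonneg[OF N\<mu>, of x]] by linarith
  qed
  moreover have "norm x \<le> c * N\<nu> x" for x
  proof -
    have "norm x \<le> (1 / c2) * N\<nu> x" using c2(1) c2(2)[of x] by (simp add: field_simps)
    then show ?thesis using mult_right_mono[OF cc(5) is_norm_nonneg[OF N\<nu>, of x]] by linarith
  qed
  ultimately have "\<exists>c. 1 \<le> c \<and> (\<forall>x. N\<mu> x \<le> c * norm x \<and> norm x \<le> c * N\<mu> x) \<and>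
   (\<forall>x. N\<nu> x \<le> c * norm x \<and> norm x \<le> c * N\<nu> x)" using cc(1) by blast
  from someI_ex[OF this] show "1 \<le> nconst" "N\<mu> x \<le> nconst * norm x" "norm x \<le> nconst * N\<mu> x"
   "N\<nu> y \<le> nconst * norm y" "norm y \<le> nconst * N\<nu> y"
    unfolding nconst_def by auto
qed

text \<open>A sheared product of two norm balls. The shear preserves volume, so the volume is
  independent of \<open>A\<close>; bounded entries of \<open>A\<close> keep the region inside a ball
  of radius O(T) as long as \<rho> <= 2 T.\<close>

definition region :: "real ^ 'n ^ 'm \<Rightarrow> real \<Rightarrow> real \<Rightarrow> ((real ^ 'm) \<times> (real ^ 'n)) set" where
  "region A \<rho> T = {r. N\<nu> (snd r) \<le> T \<and> N\<mu> (A *v snd r - fst r) \<le> \<rho>}"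

lemma closed_region: "closed (region A \<rho> T)"
proof -
  have "continuous_on UNIV (\<lambda>r :: (real ^ 'm) \<times> (real ^ 'n). N\<nu> (snd r))"
    by (intro continuous_on_compose2[OF is_norm_continuous[OF N\<nu>, of UNIV]] continuous_intros) auto
  moreover have "continuous_on UNIV (\<lambda>r :: (real ^ 'm) \<times> (real ^ 'n). N\<mu> (A *v snd r - fst r))"
    by (intro continuous_on_compose2[OF is_norm_continuous[OF N\<mu>, of UNIV]]
        continuous_on_diff continuous_on_fst continuous_on_id
        continuous_on_compose2[OF linear_continuous_on[OF matrix_vector_mul_bounded_linear[of A], of UNIV]]
        continuous_on_snd) auto
  ultimately show ?thesis unfolding region_def
    by (intro closed_Collect_conj closed_Collect_le continuous_on_const)
qed

lemma region_subset_cball: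
  assumes A: "A \<in> box_matrices 1" and \<rho>: "\<rho> \<le> 2 * T"
  shows "region A \<rho> T \<subseteq> cball 0 (nconst * (2 * CARD('m) * CARD('n) + 3) * T)"
proof
  fix r assume r: "r \<in> region A \<rho> T"
  have c0: "0 \<le> nconst" using nconst(1) by simp
  have q: "norm (snd r) \<le> nconst * T"
    by (rule order_trans[OF nconst(5) mult_left_mono[OF _ c0]]) (use r in \<open>simp add: region_def\<close>)
  have "norm (A *v snd r) \<le> 2 * CARD('m) * CARD('n) * (nconst * T)"
    by (rule order_trans[OF norm_box_matrix_mult_le[OF A] mult_left_mono[OF q]]) simp
  moreover have "norm (A *v snd r - fst r) \<le> nconst * (2 * T)"
  proof -
    have "N\<mu> (A *v snd r - fst r) \<le> 2 * T" using r \<rho> by (simp add: region_def)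
    then show ?thesis using nconst(3)[of "A *v snd r - fst r"] c0 by (meson mult_left_mono order_trans)
  qed
  moreover have "norm (fst r) \<le> norm (A *v snd r) + norm (A *v snd r - fst r)"
    using norm_triangle_ineq4[of "A *v snd r" "A *v snd r - fst r"] by simp
  moreover have "norm r \<le> norm (fst r) + norm (snd r)"
    using norm_Pair_le[of "fst r" "snd r"] by simp
  ultimately have "norm r \<le> 2 * CARD('m) * CARD('n) * (nconst * T) + nconst * (2 * T) + nconst * T"
    using q by linarith
  then show "r \<in> cball 0 (nconst * (2 * CARD('m) * CARD('n) + 3) * T)" by (simp add: algebra_simps)
qed

lemma measure_region:
  assumes \<rho>: "0 \<le> \<rho>" and T: "0 \<le> T"
  shows "emeasure lborel (region A \<rho> T) = ennreal (V\<mu> * V\<nu> * \<rho> ^ CARD('m) * T ^ CARD('n))"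
    "measure lebesgue (region A \<rho> T) = V\<mu> * V\<nu> * \<rho> ^ CARD('m) * T ^ CARD('n)"
proof -
  have cl: "region A \<rho> T \<in> sets borel" using closed_region by (rule borel_closed)
  then have S: "region A \<rho> T \<in> sets (lborel \<Otimes>\<^sub>M lborel)" by (simp only: lborel_prod sets_lborel)
  have "emeasure lborel (region A \<rho> T) = emeasure (lborel \<Otimes>\<^sub>M lborel) (region A \<rho> T)"
    by (simp only: lborel_prod)
  also have "\<dots> = (\<integral>\<^sup>+q. emeasure lborel ((\<lambda>p. (p, q)) -` region A \<rho> T) \<partial>lborel)"
    by (rule lborel_pair.emeasure_pair_measure_alt2[OF S])
  also have "\<dots> = (\<integral>\<^sup>+q. ennreal (V\<mu> * \<rho> ^ CARD('m)) * indicator {q. N\<nu> (q - 0) \<le> T} q \<partial>lborel)"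
  proof (rule nn_integral_cong)
    fix q :: "real ^ 'n"
    have "(\<lambda>p. (p, q)) -` region A \<rho> T = (if N\<nu> q \<le> T then {p. N\<mu> (p - A *v q) \<le> \<rho>} else {})"
      by (auto simp: region_def is_norm_diff_commute[OF N\<mu>, of "A *v q"])
    then show "emeasure lborel ((\<lambda>p. (p, q)) -` region A \<rho> T)
        = ennreal (V\<mu> * \<rho> ^ CARD('m)) * indicator {q. N\<nu> (q - 0) \<le> T} q"
      by (simp add: emeasure_norm_ball[OF N\<mu> \<rho>])
  qed
  also have "\<dots> = ennreal (V\<mu> * \<rho> ^ CARD('m)) * emeasure lborel {q. N\<nu> (q - 0) \<le> T}"
    using is_norm_closed_ball(1)[OF N\<nu>, of 0 T] by (intro nn_integral_cmult_indicator) simp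
  also have "\<dots> = ennreal (V\<mu> * \<rho> ^ CARD('m)) * ennreal (V\<nu> * T ^ CARD('n))"
    by (subst emeasure_norm_ball[OF N\<nu> T]) simp
  also have "\<dots> = ennreal (V\<mu> * V\<nu> * \<rho> ^ CARD('m) * T ^ CARD('n))"
    using \<rho> T volumes_pos by (simp add: ennreal_mult[symmetric] mult_ac)
  finally show *: "emeasure lborel (region A \<rho> T) = ennreal (V\<mu> * V\<nu> * \<rho> ^ CARD('m) * T ^ CARD('n))" .
  have "measure lebesgue (region A \<rho> T) = measure lborel (region A \<rho> T)" using cl by simp
  also have "\<dots> = V\<mu> * V\<nu> * \<rho> ^ CARD('m) * T ^ CARD('n)"
    using * \<rho> T volumes_pos by (simp add: measure_def)
  finally show "measure lebesgue (region A \<rho> T) = V\<mu> * V\<nu> * \<rho> ^ CARD('m) * T ^ CARD('n)" .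
qed

definition "shift_const = nconst * (2 * CARD('m) * CARD('n) + 1)"

lemma shift_const_ge_1: "1 \<le> shift_const"
proof -
  have "1 * 1 \<le> nconst * (2 * CARD('m) * CARD('n) + 1)" using nconst(1) by (intro mult_mono) auto
  then show ?thesis by (simp add: shift_const_def)
qed

lemma region_shift:
  assumes A: "A \<in> box_matrices 1" and r: "r \<in> region A \<rho> T" and x: "norm x \<le> h"
  shows "r + x \<in> region A (\<rho> + shift_const * h) (T + shift_const * h)"
proof -
  have c0: "0 \<le> nconst" using nconst(1) by simp
  have sx: "norm (snd x) \<le> h" "norm (fst x) \<le> h"
    using x norm_fst_le[of "fst x" "snd x"] norm_snd_le[of "snd x" "fst x"] by auto
  have h: "0 \<le> h" using x norm_ge_zero order_trans by blast
  have "N\<nu> (snd x) \<le> nconst * h" using nconst(4)[of "snd x"] sx c0 by (meson mult_left_mono order_trans)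
  also have "\<dots> \<le> shift_const * h"
    using c0 h by (intro mult_right_mono) (auto simp: shift_const_def algebra_simps)
  finally have 1: "N\<nu> (snd x) \<le> shift_const * h" .
  have "norm (A *v snd x - fst x) \<le> norm (A *v snd x) + norm (fst x)" by (rule norm_triangle_ineq4)
  also have "\<dots> \<le> 2 * CARD('m) * CARD('n) * h + h"
    using sx by (intro add_mono order_trans[OF norm_box_matrix_mult_le[OF A] mult_left_mono]) simp_all
  also have "\<dots> = (2 * CARD('m) * CARD('n) + 1) * h" by (simp add: algebra_simps)
  finally have "N\<mu> (A *v snd x - fst x) \<le> nconst * ((2 * CARD('m) * CARD('n) + 1) * h)"
    using nconst(2)[of "A *v snd x - fst x"] c0 by (meson mult_left_mono order_trans)
  then have 2: "N\<mu> (A *v snd x - fst x) \<le> shift_const * h" by (simp add: shift_const_def mult.assoc)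
  have "A *v snd (r + x) - fst (r + x) = (A *v snd r - fst r) + (A *v snd x - fst x)"
    by (simp add: matrix_vector_right_distrib)
  then have "N\<mu> (A *v snd (r + x) - fst (r + x)) \<le> N\<mu> (A *v snd r - fst r) + N\<mu> (A *v snd x - fst x)"
    by (simp only: is_norm_triangle[OF N\<mu>])
  moreover have "N\<nu> (snd (r + x)) \<le> N\<nu> (snd r) + N\<nu> (snd x)"
    by (simp add: is_norm_triangle[OF N\<nu>])
  moreover have "N\<nu> (snd r) \<le> T" "N\<mu> (A *v snd r - fst r) \<le> \<rho>" using r by (simp_all add: region_def)
  ultimately show ?thesis using 1 2 unfolding region_def mem_Collect_eq by linarith
qed

lemma lmeasurable_region:
  assumes "A \<in> box_matrices 1"
  shows "region A \<rho> T \<in> lmeasurable" "bounded (region A \<rho> T)"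
proof -
  let ?T = "max T (\<rho> / 2)"
  have "region A \<rho> T \<subseteq> region A \<rho> ?T" by (auto simp: region_def)
  also have "\<dots> \<subseteq> cball 0 (nconst * (2 * CARD('m) * CARD('n) + 3) * ?T)"
    by (rule region_subset_cball[OF assms]) simp
  finally show b: "bounded (region A \<rho> T)" by (rule bounded_subset[OF bounded_cball])
  show "region A \<rho> T \<in> lmeasurable"
    using b closed_region by (simp add: lmeasurable_compact compact_eq_bounded_closed)
qed

end

lemma abs_power_mult_diff_le:
  fixes x y x' y' L :: real
  assumes L: "0 < L" and x: "0 \<le> x" "x \<le> L" and y: "0 \<le> y" "y \<le> L"
    and x': "0 \<le> x'" "x' \<le> L" and y': "0 \<le> y'" "y' \<le> L"
  shows "\<bar>x ^ m * y ^ n - x' ^ m * y' ^ n\<bar> \<le> L ^ (m + n) * (real m * (\<bar>x - x'\<bar> / L) + real n * (\<bar>y - y'\<bar> / L))"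
proof -
  define a b a' b' where ab: "a = x / L" "b = y / L" "a' = x' / L" "b' = y' / L"
  have n: "0 \<le> a" "a \<le> 1" "0 \<le> b" "b \<le> 1" "0 \<le> a'" "a' \<le> 1" "0 \<le> b'" "b' \<le> 1"
    using assms by (auto simp: ab)
  have eq: "x ^ m * y ^ n - x' ^ m * y' ^ n = L ^ (m + n) * (a ^ m * b ^ n - a' ^ m * b' ^ n)"
    using L by (simp add: ab power_divide power_add right_diff_distrib)
  have "a ^ m * b ^ n - a' ^ m * b' ^ n = (a ^ m - a' ^ m) * b ^ n + a' ^ m * (b ^ n - b' ^ n)"
    by (simp add: algebra_simps)
  also have "\<bar>\<dots>\<bar> \<le> \<bar>a ^ m - a' ^ m\<bar> * b ^ n + a' ^ m * \<bar>b ^ n - b' ^ n\<bar>"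
    using n abs_triangle_ineq[of "(a ^ m - a' ^ m) * b ^ n" "a' ^ m * (b ^ n - b' ^ n)"] by (simp add: abs_mult)
  also have "\<dots> \<le> \<bar>a ^ m - a' ^ m\<bar> * 1 + 1 * \<bar>b ^ n - b' ^ n\<bar>"
    using n by (intro add_mono mult_mono) (auto simp: power_le_one)
  also have "\<dots> \<le> real m * \<bar>a - a'\<bar> + real n * \<bar>b - b'\<bar>"
    using norm_power_diff[of a a' m] norm_power_diff[of b b' n] n by simp
  finally have le: "\<bar>a ^ m * b ^ n - a' ^ m * b' ^ n\<bar> \<le> real m * \<bar>a - a'\<bar> + real n * \<bar>b - b'\<bar>" .
  have "\<bar>a - a'\<bar> = \<bar>x - x'\<bar> / L" "\<bar>b - b'\<bar> = \<bar>y - y'\<bar> / L"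
    using L by (simp_all add: ab diff_divide_distrib[symmetric])
  then show ?thesis unfolding eq abs_mult using le L by (simp add: mult_left_mono)
qed

section \<open>Consequences of large height relative to the irregularity\<close>

context lattice_min
begin

text \<open>\<open>last_min_le\<close> turns both error quantities into negative powers of
  \<open>a\<close>, which the power a^(2 d - 1) supplied by the hypothesis outweighs. Surplus powers
  of \<open>a\<close> are bounded by means of \<open>a_le_const\<close>. In the second bound the
  surplus exponent is k^2 + 2 k with d = k + 2, so for d = 2 nothing is left over.\<close>

lemma scale_bounds:
  assumes d: "2 \<le> DIM('a)" and B: "1 \<le> B" "B \<le> T * a ^ (2 * DIM('a) - 1)"
  defines "K1 \<equiv> last_min_const DIM('a) ^ (DIM('a) * DIM('a) + 2 * DIM('a))"
  shows "last_min \<le> K1 / B * T" "last_min ^ DIM('a) / a \<le> K1 / B * T ^ (DIM('a) - 1)"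
    "1 \<le> K1 / B * T" "a \<le> K1 / B * T" "0 < T"
proof -
  let ?K = "last_min_const DIM('a)"
  obtain k where "DIM('a) = 2 + k" using le_Suc_ex[OF d] by blast
  then have k: "DIM('a) = Suc (Suc k)" by simp
  have K1: "1 \<le> ?K" by (rule last_min_const_ge_1)
  have aK: "a \<le> ?K" by (rule a_le_const)
  have B0: "0 < B" using B by simp
  have e: "2 * DIM('a) - 1 = 2 * k + 3" "DIM('a) - 1 = Suc k" using k by auto
  have BT: "B \<le> T * a ^ (2 * k + 3)" using B(2) unfolding e .
  show T0: "0 < T"
  proof (rule ccontr)
    assume "\<not> 0 < T"
    then have "T * a ^ (2 * k + 3) \<le> 0" using a_pos by (intro mult_nonpos_nonneg) auto
    then show False using BT B0 by simp
  qed
  have K1def: "K1 = ?K ^ (Suc (Suc k) * Suc (Suc k) + 2 * Suc (Suc k))" by (simp add: K1_def k)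
  have pw: "?K ^ j \<le> K1" if "j \<le> Suc (Suc k) * Suc (Suc k) + 2 * Suc (Suc k)" for j
    unfolding K1def using K1 that by (rule power_increasing[rotated])
  have apw: "a ^ j \<le> ?K ^ j" for j using aK a_pos by (intro power_mono) auto
  have one: "1 \<le> T / B * a ^ (2 * k + 3)" using BT B0 by (simp add: field_simps)
  have M: "last_min \<le> ?K / a ^ Suc k" using last_min_le unfolding e .
  have M0: "0 < last_min" by (rule last_min_pos)
  have TB: "0 < T / B" using T0 B0 by simp
  have "last_min * 1 \<le> ?K / a ^ Suc k * (T / B * a ^ (2 * k + 3))"
    using M one M0 K1 a_pos by (intro mult_mono) auto
  also have "\<dots> = ?K * a ^ (k + 2) * (T / B)"
  proof -
    have "a ^ (2 * k + 3) = a ^ Suc k * a ^ (k + 2)" 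
      unfolding power_add[symmetric] by (rule arg_cong[where f = "\<lambda>j. a ^ j"]) simp
    then show ?thesis using a_pos by simp
  qed
  also have "\<dots> \<le> ?K ^ Suc (k + 2) * (T / B)"
    unfolding power_Suc using mult_left_mono[OF apw[of "k + 2"], of ?K] K1 TB by (intro mult_right_mono) linarith+
  also have "\<dots> \<le> K1 * (T / B)" using TB by (intro mult_right_mono pw) auto
  finally show "last_min \<le> K1 / B * T" by simp
  then show "a \<le> K1 / B * T" using a_le_last_min by simp
  have "1 \<le> T / B * a ^ (2 * k + 3)" by (rule one)
  also have "\<dots> \<le> T / B * ?K ^ (2 * k + 3)" using TB by (intro mult_left_mono apw) auto
  also have "\<dots> \<le> T / B * K1" using TB by (intro mult_left_mono pw) auto
  finally show "1 \<le> K1 / B * T" by (simp add: mult.commute)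
  have "last_min ^ Suc (Suc k) \<le> (?K / a ^ Suc k) ^ Suc (Suc k)" using M M0 by (intro power_mono) auto
  then have "last_min ^ Suc (Suc k) / a * 1 \<le> (?K / a ^ Suc k) ^ Suc (Suc k) / a * (T / B * a ^ (2 * k + 3)) ^ Suc k"
    using one a_pos M0 K1 by (intro mult_mono divide_right_mono one_le_power) auto
  also have "\<dots> = ?K ^ Suc (Suc k) * (a ^ (k * k + 2 * k) * (T / B) ^ Suc k)"
  proof -
    have e1: "(a ^ (2 * k + 3)) ^ Suc k = (a ^ Suc k) ^ Suc (Suc k) * a * a ^ (k * k + 2 * k)"
      unfolding power_mult[symmetric] power_Suc2[symmetric] power_add[symmetric]
      by (rule arg_cong[where f = "\<lambda>j. a ^ j"]) (simp add: algebra_simps)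
    have "(?K / a ^ Suc k) ^ Suc (Suc k) / a * (T / B * a ^ (2 * k + 3)) ^ Suc k
      = ?K ^ Suc (Suc k) / ((a ^ Suc k) ^ Suc (Suc k) * a) * ((T / B) ^ Suc k * (a ^ (2 * k + 3)) ^ Suc k)"
      by (simp only: power_divide power_mult_distrib divide_divide_eq_left)
    also have "\<dots> = ?K ^ Suc (Suc k) * (a ^ (k * k + 2 * k) * (T / B) ^ Suc k)"
      unfolding e1 using a_pos by (simp only: times_divide_eq_left) simp
    finally show ?thesis .
  qed
  also have "\<dots> \<le> ?K ^ Suc (Suc k) * (?K ^ (k * k + 2 * k) * (T / B) ^ Suc k)"
    using K1 TB zero_le_power[OF less_imp_le[OF TB], of "Suc k"]
    by (intro mult_left_mono mult_right_mono apw) simp_all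
  also have "\<dots> = ?K ^ (Suc (Suc k) + (k * k + 2 * k)) * (T / B) ^ Suc k" by (simp only: power_add mult.assoc)
  also have "\<dots> \<le> K1 * (T ^ Suc k / B)"
  proof (rule mult_mono)
    show "?K ^ (Suc (Suc k) + (k * k + 2 * k)) \<le> K1" by (rule pw) simp
    show "0 \<le> K1" using K1 by (simp add: K1def)
    show "0 \<le> (T / B) ^ Suc k" using TB by (intro zero_le_power) simp
    have "B ^ 1 \<le> B ^ Suc k" using B(1) by (intro power_increasing) auto
    then show "(T / B) ^ Suc k \<le> T ^ Suc k / B" using T0 B0 by (simp only: power_divide) (intro divide_left_mono, auto)
  qed
  finally show "last_min ^ DIM('a) / a \<le> K1 / B * T ^ (DIM('a) - 1)" unfolding e k by simp
qed

end

lemma DIM_pair_cart: "DIM((real ^ 'm) \<times> (real ^ 'n)) = CARD('m) + CARD('n)"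
  by simp

lemma two_le_CARD_sum: "2 \<le> CARD('m::finite) + CARD('n::finite)"
proof -
  have "0 < CARD('m)" "0 < CARD('n)" by simp_all
  then show ?thesis by linarith
qed

context two_norms
begin

text \<open>Moving a point by at most the covering radius changes both defining inequalities of the
  region by at most \<open>g\<close>. The count therefore lies between the volumes of the regions
  whose two parameters are decreased or increased by \<open>g\<close>.\<close>

lemma card_region_approx:
  assumes "lattice_min \<Lambda> a"
  assumes A: "A \<in> box_matrices 1" and \<rho>: "0 \<le> \<rho>" "\<rho> \<le> 2 * T" and T: "0 < T"
  defines "g \<equiv> shift_const * (real (CARD('m) + CARD('n)) * lattice_min.last_min \<Lambda>)"
  assumes gT: "g \<le> T"
  shows "\<bar>real (card (\<Lambda> \<inter> region A \<rho> T)) - V\<mu> * V\<nu> * \<rho> ^ CARD('m) * T ^ CARD('n)\<bar>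
     \<le> V\<mu> * V\<nu> * (real (CARD('m) + CARD('n)) * g * (4 * T) ^ ((CARD('m) + CARD('n)) - 1))"
proof -
  interpret lattice_min \<Lambda> a by fact
  let ?h = "real (CARD('m) + CARD('n)) * last_min"
  let ?v = "\<lambda>x y. x ^ CARD('m) * y ^ CARD('n)"
  have g: "g = shift_const * ?h" by (simp add: g_def)
  have g0: "0 \<le> g" using shift_const_ge_1 last_min_pos by (simp add: g)
  note cov = covering[unfolded DIM_pair_cart]
  have err: "\<bar>?v x y - ?v \<rho> T\<bar> \<le> real (CARD('m) + CARD('n)) * g * (4 * T) ^ ((CARD('m) + CARD('n)) - 1)"
    if x: "0 \<le> x" "\<bar>x - \<rho>\<bar> \<le> g" and y: "0 \<le> y" "\<bar>y - T\<bar> \<le> g" for x y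
  proof -
    have "\<bar>?v x y - ?v \<rho> T\<bar> \<le> (4 * T) ^ (CARD('m) + CARD('n)) * (real CARD('m) * (\<bar>x - \<rho>\<bar> / (4 * T)) + real CARD('n) * (\<bar>y - T\<bar> / (4 * T)))"
      using x y gT T \<rho> by (intro abs_power_mult_diff_le) auto
    also have "\<dots> \<le> (4 * T) ^ (CARD('m) + CARD('n)) * (real CARD('m) * (g / (4 * T)) + real CARD('n) * (g / (4 * T)))"
      using x y T by (intro mult_left_mono add_mono divide_right_mono) auto
    also have "\<dots> = real (CARD('m) + CARD('n)) * g * ((4 * T) ^ (CARD('m) + CARD('n)) / (4 * T))"
      by (simp add: algebra_simps add_divide_distrib)
    also have "(4 * T) ^ (CARD('m) + CARD('n)) / (4 * T) = (4 * T) ^ ((CARD('m) + CARD('n)) - 1)"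
      using T power_minus_mult[of "CARD('m) + CARD('n)" "4 * T"] by (simp add: field_simps)
    finally show ?thesis .
  qed
  have fin: "finite (\<Lambda> \<inter> region A \<rho> T)" by (rule finite_bounded[OF lmeasurable_region(2)[OF A]])
  have VV: "0 < V\<mu> * V\<nu>" using volumes_pos by simp
  have "real (card (\<Lambda> \<inter> region A \<rho> T)) \<le> measure lebesgue (region A (\<rho> + g) (T + g))"
  proof (rule card_le_volume[OF cov fin])
    fix y p :: "(real ^ 'm) \<times> (real ^ 'n)" assume "y \<in> \<Lambda> \<inter> region A \<rho> T" "p \<in> cball 0 ?h"
    then show "y + p \<in> region A (\<rho> + g) (T + g)" unfolding g by (intro region_shift[OF A]) auto
  qed (use lmeasurable_region[OF A] in auto)
  also have "\<dots> = V\<mu> * V\<nu> * ?v (\<rho> + g) (T + g)" using \<rho> T g0 by (subst measure_region) auto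
  also have "\<dots> \<le> V\<mu> * V\<nu> * (?v \<rho> T + real (CARD('m) + CARD('n)) * g * (4 * T) ^ ((CARD('m) + CARD('n)) - 1))"
    using err[of "\<rho> + g" "T + g"] \<rho> T g0 VV by (intro mult_left_mono) auto
  finally have up: "real (card (\<Lambda> \<inter> region A \<rho> T)) \<le> V\<mu> * V\<nu> * ?v \<rho> T + V\<mu> * V\<nu> * (real (CARD('m) + CARD('n)) * g * (4 * T) ^ ((CARD('m) + CARD('n)) - 1))"
    by (simp add: algebra_simps)
  have "V\<mu> * V\<nu> * ?v (max 0 (\<rho> - g)) (T - g) \<le> real (card (\<Lambda> \<inter> region A \<rho> T))"
  proof (cases "g \<le> \<rho>")
    case True
    have "measure lebesgue (region A (\<rho> - g) (T - g)) \<le> real (card (\<Lambda> \<inter> region A \<rho> T))"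
    proof (rule volume_le_card[OF cov fin])
      fix u p :: "(real ^ 'm) \<times> (real ^ 'n)" assume "u \<in> region A (\<rho> - g) (T - g)" "p \<in> cball 0 ?h"
      then have "u + (- p) \<in> region A (\<rho> - g + shift_const * ?h) (T - g + shift_const * ?h)"
        by (intro region_shift[OF A]) auto
      then show "u - p \<in> region A \<rho> T" by (simp add: g)
    qed (use lmeasurable_region[OF A] in auto)
    then show ?thesis using True gT by (subst (asm) measure_region) (auto simp: max_def mult.assoc)
  next
    case False
    then show ?thesis by (simp add: max_def zero_power)
  qed
  moreover have "V\<mu> * V\<nu> * (?v \<rho> T - real (CARD('m) + CARD('n)) * g * (4 * T) ^ ((CARD('m) + CARD('n)) - 1)) \<le> V\<mu> * V\<nu> * ?v (max 0 (\<rho> - g)) (T - g)"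
    using err[of "max 0 (\<rho> - g)" "T - g"] \<rho> gT g0 VV by (intro mult_left_mono) (auto simp: max_def split: if_splits)
  ultimately have "V\<mu> * V\<nu> * ?v \<rho> T - V\<mu> * V\<nu> * (real (CARD('m) + CARD('n)) * g * (4 * T) ^ ((CARD('m) + CARD('n)) - 1)) \<le> real (card (\<Lambda> \<inter> region A \<rho> T))"
    by (simp add: algebra_simps)
  with up show ?thesis unfolding mult.assoc[of "V\<mu> * V\<nu>"] by linarith
qed

text \<open>The error is measured against T^d and not against the main term, so the estimate is
  accurate only for \<rho> comparable to T. This is why the thin resonant sets have to be thickened
  before anything is counted.\<close>

lemma card_primitive_region:
  assumes \<epsilon>: "0 < (\<epsilon>::real)"
  shows "\<exists>B\<ge>1. \<forall>\<Lambda> a A \<rho> T. lattice_min \<Lambda> a \<longrightarrow> A \<in> box_matrices 1 \<longrightarrow> 1 \<le> T \<longrightarrow>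
     B \<le> T * a ^ (2 * (CARD('m) + CARD('n)) - 1) \<longrightarrow> 0 \<le> \<rho> \<longrightarrow> \<rho> \<le> 2 * T \<longrightarrow>
     \<bar>real (card {r \<in> region A \<rho> T. unimodular.primitive \<Lambda> r}) - V\<mu> * V\<nu> * \<rho> ^ CARD('m) * T ^ CARD('n) / zeta_nat (CARD('m) + CARD('n))\<bar>
       \<le> \<epsilon> * T ^ (CARD('m) + CARD('n))"
proof -
  let ?d = "CARD('m) + CARD('n)"
  let ?C2 = "nconst * (2 * CARD('m) * CARD('n) + 3)"
  let ?P = "plane_const ?d"
  let ?V = "V\<mu> * V\<nu> * 2 ^ CARD('m)"
  let ?K1 = "last_min_const ?d ^ (?d * ?d + 2 * ?d)"
  have d: "2 \<le> ?d" by (rule two_le_CARD_sum)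
  have C2: "1 \<le> ?C2"
  proof -
    have "1 * 1 \<le> ?C2" using nconst(1) by (intro mult_mono) auto
    then show ?thesis by simp
  qed
  have P: "0 < ?P" by (rule plane_const_pos)
  have V: "0 < ?V" using volumes_pos by simp
  have VV: "0 < V\<mu> * V\<nu>" using volumes_pos by simp
  have K1: "1 \<le> ?K1" using last_min_const_ge_1 by (rule one_le_power)
  have S: "1 \<le> shift_const" by (rule shift_const_ge_1)
  define \<theta> where "\<theta> = \<epsilon> / (4 * (?V + ?P * ?C2 ^ ?d))"
  have den: "0 < ?V + ?P * ?C2 ^ ?d" 
  proof -
    have "0 < ?C2" using C2 by linarith
    then have "0 < ?P * ?C2 ^ ?d" by (rule mult_pos_pos[OF P zero_less_power])
    then show ?thesis using V by linarith
  qed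
  have \<theta>: "0 < \<theta>" using \<epsilon> den by (simp add: \<theta>_def)
  obtain Ka where Ka: "\<And>n. Ka \<le> n \<Longrightarrow> \<bar>(\<Sum>k<n. mob k / real k ^ ?d) - 1 / zeta_nat ?d\<bar> < \<theta>"
    using LIMSEQ_D[OF sum_mob_zeta[OF d] \<theta>] by auto
  obtain Kb where Kb: "\<And>m n. Kb \<le> m \<Longrightarrow> norm (\<Sum>k=m..<n. 1 / real k ^ ?d) < \<theta>"
    using summable_zeta_nat[OF d] \<theta> unfolding summable_Cauchy by meson
  define K where "K = max 1 (max Ka Kb)"
  have K: "\<bar>(\<Sum>k<K. mob k / real k ^ ?d) - 1 / zeta_nat ?d\<bar> \<le> \<theta>"
      "\<And>n. (\<Sum>k=K..<n. 1 / real k ^ ?d) \<le> \<theta>" "1 \<le> K"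
  proof -
    have "Ka \<le> K" "Kb \<le> K" by (auto simp: K_def)
    from Ka[OF this(1)] show "\<bar>(\<Sum>k<K. mob k / real k ^ ?d) - 1 / zeta_nat ?d\<bar> \<le> \<theta>" by simp
    show "(\<Sum>k=K..<n. 1 / real k ^ ?d) \<le> \<theta>" for n
      using Kb[OF \<open>Kb \<le> K\<close>, of n] by (simp only: real_norm_def)
  qed (simp add: K_def)
  \<comment> \<open>With B = K1 Z the bounds of \<open>scale_bounds\<close> hold with the factor 1 /
    Z. \<open>Z1\<close> guarantees g <= T / k for all k < K, \<open>Z2\<close> controls the errors
    of the K counts below the cut, and \<open>Z3\<close> the constant part of the tail.\<close>
  define Z1 where "Z1 = real K * shift_const * ?d"
  define Z2 where "Z2 = real K * (V\<mu> * V\<nu> * (?d * (shift_const * ?d) * 4 ^ (?d - 1)) + 1)"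
  define Z3 where "Z3 = 2 * ?P * ?C2"
  define Z where "Z = 1 + Z1 + (4 / \<epsilon>) * (Z2 + Z3)"
  have Z123: "0 \<le> Z1" "0 \<le> Z2" "0 \<le> Z3"
    using S VV P C2 by (auto simp: Z1_def Z2_def Z3_def)
  have Z: "1 \<le> Z" "Z1 \<le> Z" "(4 / \<epsilon>) * (Z2 + Z3) \<le> Z" using Z123 \<epsilon> by (auto simp: Z_def)
  define B where "B = ?K1 * Z"
  have B1: "1 \<le> B" unfolding B_def using mult_mono[OF K1 Z(1)] K1 by simp
  have KB: "?K1 / B = 1 / Z" unfolding B_def using K1 by (intro nonzero_divide_mult_cancel_left) linarith
  show ?thesis
  proof (intro exI[of _ B] conjI B1 allI impI)
    fix \<Lambda> :: "((real ^ 'm) \<times> (real ^ 'n)) set" and a \<rho> T :: real and A :: "real ^ 'n ^ 'm"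
    assume L: "lattice_min \<Lambda> a" and A: "A \<in> box_matrices 1" and T1: "1 \<le> T"
      and BT: "B \<le> T * a ^ (2 * ?d - 1)" and \<rho>: "0 \<le> \<rho>" "\<rho> \<le> 2 * T"
    interpret lattice_min \<Lambda> a by fact
    have T0: "0 < T" using T1 by simp
    note sb = scale_bounds[unfolded DIM_pair_cart, OF d B1 BT, unfolded KB]
    let ?v = "V\<mu> * V\<nu> * \<rho> ^ CARD('m) * T ^ CARD('n)"
    let ?R = "?C2 * T"
    define g where "g = shift_const * (real ?d * last_min)"
    define E where "E = V\<mu> * V\<nu> * (real ?d * g * (4 * T) ^ (?d - 1)) + 1"
    have g0: "0 \<le> g" using S last_min_pos by (simp add: g_def)
    have E0: "0 \<le> E" using VV g0 T0 by (auto simp: E_def intro!: add_nonneg_nonneg mult_nonneg_nonneg)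
    have v0: "0 \<le> ?v" using VV \<rho> T0 by simp
    have KgT: "real K * g \<le> T"
    proof -
      have "real K * g = Z1 * last_min" by (simp add: Z1_def g_def)
      also have "\<dots> \<le> Z * (1 / Z * T)" using sb(1) Z Z123 last_min_pos by (intro mult_mono) auto
      finally show ?thesis using Z by simp
    qed
    have main: "\<bar>real (card {r \<in> \<Lambda> - {0}. real k *\<^sub>R r \<in> region A \<rho> T}) - ?v / real k ^ ?d\<bar> \<le> E"
      if k: "1 \<le> k" "k < K" for k
    proof -
      have k0: "0 < real k" using k by simp
      have Tk: "0 < T / k" "T / k \<le> T" "0 \<le> \<rho> / k" "\<rho> / k \<le> 2 * (T / k)"
        using T0 k \<rho> by (auto simp: divide_le_eq field_simps)
      have "real k * g \<le> real K * g" using k g0 by (intro mult_right_mono) auto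
      then have gk: "g \<le> T / k" using KgT k0 by (simp add: field_simps)
      have mem: "real k *\<^sub>R r \<in> region A \<rho> T \<longleftrightarrow> r \<in> region A (\<rho> / k) (T / k)" for r
      proof -
        have "A *v (real k *\<^sub>R snd r) - real k *\<^sub>R fst r = real k *\<^sub>R (A *v snd r - fst r)"
          by (simp add: matrix_vector_mult_scaleR scaleR_right_diff_distrib)
        then show ?thesis using k0
          by (simp add: region_def is_norm_scale[OF N\<mu>] is_norm_scale[OF N\<nu>] pos_le_divide_eq mult.commute)
      qed
      have "{r \<in> \<Lambda> - {0}. real k *\<^sub>R r \<in> region A \<rho> T} = \<Lambda> \<inter> region A (\<rho> / k) (T / k) - {0}"
        using mem by auto
      \<comment> \<open>The origin lies in the region but is left out of the count, whence the extra
        1 in \<open>E\<close>.\<close>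
      moreover have "0 \<in> \<Lambda> \<inter> region A (\<rho> / k) (T / k)"
        using zero_mem Tk by (auto simp: region_def is_norm_zero[OF N\<mu>] is_norm_zero[OF N\<nu>])
      moreover have "finite (\<Lambda> \<inter> region A (\<rho> / k) (T / k))" by (rule finite_bounded[OF lmeasurable_region(2)[OF A]])
      ultimately have "card (\<Lambda> \<inter> region A (\<rho> / k) (T / k)) = Suc (card {r \<in> \<Lambda> - {0}. real k *\<^sub>R r \<in> region A \<rho> T})"
        by (simp only: card.remove)
      then have "real (card {r \<in> \<Lambda> - {0}. real k *\<^sub>R r \<in> region A \<rho> T}) = real (card (\<Lambda> \<inter> region A (\<rho> / k) (T / k))) - 1"
        by simp
      moreover have "\<bar>real (card (\<Lambda> \<inter> region A (\<rho> / k) (T / k))) - V\<mu> * V\<nu> * (\<rho> / k) ^ CARD('m) * (T / k) ^ CARD('n)\<bar>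
         \<le> V\<mu> * V\<nu> * (real ?d * g * (4 * (T / k)) ^ (?d - 1))"
        using card_region_approx[OF L A Tk(3,4,1)] gk by (simp add: g_def)
      moreover have "V\<mu> * V\<nu> * (real ?d * g * (4 * (T / k)) ^ (?d - 1)) \<le> V\<mu> * V\<nu> * (real ?d * g * (4 * T) ^ (?d - 1))"
        using VV g0 Tk by (intro mult_left_mono power_mono) auto
      moreover have "V\<mu> * V\<nu> * (\<rho> / k) ^ CARD('m) * (T / k) ^ CARD('n) = ?v / real k ^ ?d"
        by (simp add: power_divide power_add)
      ultimately show ?thesis unfolding E_def by linarith
    qed
    have aR: "a \<le> ?R"
    proof -
      have "a \<le> 1 * T" 
      proof -
        have "a \<le> 1 / Z * T" by (rule sb(4))
        also have "\<dots> \<le> 1 * T" using Z(1) T0 by (intro mult_right_mono) auto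
        finally show ?thesis .
      qed
      also have "\<dots> \<le> ?R" using C2 T0 by (intro mult_right_mono) auto
      finally show ?thesis .
    qed
    have "\<bar>real (card {r \<in> region A \<rho> T. primitive r}) - ?v / zeta_nat ?d\<bar>
       \<le> real K * E + ?P * (?R ^ ?d * \<theta> + 2 * ?R * last_min ^ ?d / a) + ?v * \<theta>"
      using card_primitive_approx[unfolded DIM_pair_cart, OF d region_subset_cball[OF A \<rho>(2)] aR v0 main E0 K] by simp
    also have "\<dots> \<le> \<epsilon> * T ^ ?d"
    proof -
      have Td: "T ^ ?d = T * T ^ (?d - 1)" using d by (metis power_minus_mult mult.commute less_le_trans pos2)
      have Tp: "0 < T ^ (?d - 1)" "1 \<le> T ^ (?d - 1)" using T1 by auto
      have "real K * E \<le> Z2 * (1 / Z * T ^ ?d)"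
      proof -
        have "g \<le> shift_const * (?d * (1 / Z * T))" using sb(1) S unfolding g_def by (intro mult_left_mono) auto
        then have "V\<mu> * V\<nu> * (real ?d * g * (4 * T) ^ (?d - 1)) \<le> V\<mu> * V\<nu> * (real ?d * (shift_const * (?d * (1 / Z * T))) * (4 * T) ^ (?d - 1))"
          using VV T0 by (intro mult_left_mono mult_right_mono) auto
        also have "\<dots> = V\<mu> * V\<nu> * (?d * (shift_const * ?d) * 4 ^ (?d - 1)) * (1 / Z * T ^ ?d)"
          unfolding Td by (simp add: power_mult_distrib)
        finally have 1: "V\<mu> * V\<nu> * (real ?d * g * (4 * T) ^ (?d - 1)) \<le> V\<mu> * V\<nu> * (?d * (shift_const * ?d) * 4 ^ (?d - 1)) * (1 / Z * T ^ ?d)" .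
        have "1 * 1 \<le> (1 / Z * T) * T ^ (?d - 1)" using sb(3) Tp Z T0 by (intro mult_mono) auto
        then have "1 \<le> 1 / Z * T ^ ?d" unfolding Td by simp
        with 1 have "E \<le> (V\<mu> * V\<nu> * (?d * (shift_const * ?d) * 4 ^ (?d - 1)) + 1) * (1 / Z * T ^ ?d)"
          unfolding E_def by (simp only: distrib_right)
        then have "real K * E \<le> real K * ((V\<mu> * V\<nu> * (?d * (shift_const * ?d) * 4 ^ (?d - 1)) + 1) * (1 / Z * T ^ ?d))"
          by (rule mult_left_mono) simp
        then show ?thesis by (simp only: Z2_def mult.assoc)
      qed
      moreover have "?P * (2 * ?R * last_min ^ ?d / a) \<le> Z3 * (1 / Z * T ^ ?d)"
      proof -
        have "?P * (2 * ?R * last_min ^ ?d / a) = Z3 * T * (last_min ^ ?d / a)" by (simp add: Z3_def)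
        also have "\<dots> \<le> Z3 * T * (1 / Z * T ^ (?d - 1))" using sb(2) Z123 T0 by (intro mult_left_mono) auto
        finally show ?thesis unfolding Td by simp
      qed
      moreover have "?P * (?R ^ ?d * \<theta>) + ?v * \<theta> \<le> \<epsilon> / 4 * T ^ ?d"
      proof -
        have "\<rho> ^ CARD('m) \<le> (2 * T) ^ CARD('m)" using \<rho> by (intro power_mono) auto
        then have "?v \<le> V\<mu> * V\<nu> * (2 * T) ^ CARD('m) * T ^ CARD('n)"
          using VV T0 by (intro mult_right_mono mult_left_mono) auto
        also have "\<dots> = ?V * T ^ ?d" by (simp add: power_mult_distrib power_add)
        finally have "?v * \<theta> \<le> ?V * T ^ ?d * \<theta>" using \<theta> by (intro mult_right_mono) auto
        moreover have "?P * (?R ^ ?d * \<theta>) = ?P * ?C2 ^ ?d * \<theta> * T ^ ?d" by (simp only: power_mult_distrib mult_ac)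
        moreover have "(?V + ?P * ?C2 ^ ?d) * \<theta> * T ^ ?d = ?V * T ^ ?d * \<theta> + ?P * ?C2 ^ ?d * \<theta> * T ^ ?d"
          by (simp only: distrib_right distrib_left mult_ac)
        ultimately have "?P * (?R ^ ?d * \<theta>) + ?v * \<theta> \<le> (?V + ?P * ?C2 ^ ?d) * \<theta> * T ^ ?d" by linarith
        moreover have "w * (\<epsilon> / (4 * w)) = \<epsilon> / 4" if "0 < w" for w using that by simp
        from this[OF den] have "(?V + ?P * ?C2 ^ ?d) * \<theta> = \<epsilon> / 4" unfolding \<theta>_def .
        ultimately show ?thesis by (simp only:)
      qed
      moreover have "Z2 * (1 / Z * T ^ ?d) + Z3 * (1 / Z * T ^ ?d) \<le> \<epsilon> / 4 * T ^ ?d"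
      proof -
        have "(Z2 + Z3) * (1 / Z) \<le> \<epsilon> / 4" using Z(1,3) \<epsilon> by (simp add: field_simps)
        then have "(Z2 + Z3) * (1 / Z) * T ^ ?d \<le> \<epsilon> / 4 * T ^ ?d" using T0 by (intro mult_right_mono) auto
        then show ?thesis by (simp add: algebra_simps add_divide_distrib)
      qed
      moreover have "0 \<le> \<epsilon> * T ^ ?d" using \<epsilon> T0 by simp
      ultimately show ?thesis unfolding distrib_left[of ?P] by linarith
    qed
    finally show "\<bar>real (card {r \<in> region A \<rho> T. primitive r}) - ?v / zeta_nat ?d\<bar> \<le> \<epsilon> * T ^ ?d" .
  qed
qed

end

subsection \<open>Measures of single resonant sets\<close>

text \<open>The product of the column \<open>e\<close> and the row \<open>x\<close>, normalised by
  |x|^2: it sends \<open>x\<close> to \<open>e\<close> and vanishes on the orthogonal complement of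
  \<open>x\<close>.\<close>

definition rank_one :: "real ^ 'm \<Rightarrow> real ^ 'n \<Rightarrow> real ^ 'n ^ 'm" where
  "rank_one e x = (\<chi> i j. e $ i * x $ j / (norm x)\<^sup>2)"

lemma rank_one_mult: "rank_one e x *v y = ((x \<bullet> y) / (norm x)\<^sup>2) *\<^sub>R e"
  by (simp add: vec_eq_iff rank_one_def matrix_vector_mult_def inner_vec_def sum_distrib_left sum_distrib_right
      divide_inverse mult_ac)

lemma rank_one_mult_self: "x \<bullet> y = (norm x)\<^sup>2 \<Longrightarrow> x \<noteq> 0 \<Longrightarrow> rank_one e x *v y = e"
  by (simp add: rank_one_mult)

lemma rank_one_component_le: "\<bar>rank_one e x $ i $ j\<bar> \<le> norm e / norm x"
proof -
  have "\<bar>e $ i\<bar> * \<bar>x $ j\<bar> \<le> norm e * norm x" by (intro mult_mono component_le_norm_cart) auto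
  then have "\<bar>e $ i\<bar> * \<bar>x $ j\<bar> / (norm x)\<^sup>2 \<le> norm e * norm x / (norm x)\<^sup>2" by (intro divide_right_mono) auto
  also have "\<dots> = norm e / norm x" by (simp add: power2_eq_square)
  finally show ?thesis by (simp add: rank_one_def abs_mult)
qed

lemma continuous_on_rank_one: "continuous_on S (\<lambda>z. rank_one (f z) x)" if "continuous_on S f"
  unfolding rank_one_def divide_inverse
  by (intro continuous_on_vec_lambda continuous_on_mult that continuous_on_const continuous_on_component)

context two_norms
begin

text \<open>Fubini's theorem for the pairs \<open>(e, A)\<close>: for fixed \<open>e\<close> the
  section is a translate of \<open>X\<close>.\<close>

lemma rank_one_average:
  fixes x :: "real ^ 'n" and X :: "(real ^ 'n ^ 'm) set"
  assumes X: "X \<in> sets borel" and \<rho>: "0 \<le> \<rho>"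
  shows "ennreal (V\<mu> * \<rho> ^ CARD('m)) * emeasure lborel X =
     (\<integral>\<^sup>+A. emeasure lborel {e. N\<mu> e \<le> \<rho> \<and> A - rank_one e x \<in> X} \<partial>lborel)"
proof -
  let ?S = "{(e, A). N\<mu> e \<le> \<rho> \<and> A - rank_one e x \<in> X}"
  have "?S = ((\<lambda>z. N\<mu> (fst z)) -` {..\<rho>}) \<inter> ((\<lambda>z. snd z - rank_one (fst z) x) -` X)" by auto
  moreover have "(\<lambda>z :: (real ^ 'm) \<times> (real ^ 'n ^ 'm). N\<mu> (fst z)) \<in> borel_measurable borel"
    by (intro borel_measurable_continuous_onI continuous_on_compose2[OF is_norm_continuous[OF N\<mu>, of UNIV]] continuous_intros) auto
  moreover have "(\<lambda>z :: (real ^ 'm) \<times> (real ^ 'n ^ 'm). snd z - rank_one (fst z) x) \<in> borel_measurable borel"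
    by (intro borel_measurable_continuous_onI continuous_on_diff continuous_on_rank_one continuous_intros)
  ultimately have "?S \<in> sets borel"
    using X measurable_sets[of "\<lambda>z :: (real ^ 'm) \<times> (real ^ 'n ^ 'm). N\<mu> (fst z)" borel borel "{..\<rho>}"]
      measurable_sets[of "\<lambda>z :: (real ^ 'm) \<times> (real ^ 'n ^ 'm). snd z - rank_one (fst z) x" borel borel X]
    by (simp add: sets.Int)
  then have S: "?S \<in> sets (lborel \<Otimes>\<^sub>M lborel)" by (simp only: lborel_prod sets_lborel)
  have tr: "emeasure lborel {A. A - c \<in> X} = emeasure lborel X" for c :: "real ^ 'n ^ 'm"
  proof -
    have "{A. A - c \<in> X} = (\<lambda>A. A - c) -` X \<inter> space borel" by auto
    also have "\<dots> \<in> sets borel" by (intro measurable_sets[OF _ X]) simp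
    finally have b: "{A. A - c \<in> X} \<in> sets borel" .
    have "{A. A - c \<in> X} = (\<lambda>A. 1 *\<^sub>R A + c) ` X" by (auto simp: image_iff intro!: bexI[where x = "_ - c"])
    then have "emeasure lebesgue {A. A - c \<in> X} = emeasure lebesgue X"
      using emeasure_lebesgue_affine[of 1 c X] by simp
    then show ?thesis using b X by simp
  qed
  have "(\<integral>\<^sup>+A. emeasure lborel {e. N\<mu> e \<le> \<rho> \<and> A - rank_one e x \<in> X} \<partial>lborel)
     = (\<integral>\<^sup>+A. emeasure lborel ((\<lambda>e. (e, A)) -` ?S) \<partial>lborel)"
    by (intro nn_integral_cong arg_cong2[where f = emeasure] refl) auto
  also have "\<dots> = emeasure (lborel \<Otimes>\<^sub>M lborel) ?S"
    by (rule lborel_pair.emeasure_pair_measure_alt2[OF S, symmetric])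
  also have "\<dots> = (\<integral>\<^sup>+e. emeasure lborel (Pair e -` ?S) \<partial>lborel)"
    by (rule lborel.emeasure_pair_measure_alt[OF S])
  also have "\<dots> = (\<integral>\<^sup>+e. emeasure lborel X * indicator {e. N\<mu> (e - 0) \<le> \<rho>} e \<partial>lborel)"
  proof (rule nn_integral_cong)
    fix e :: "real ^ 'm"
    have "Pair e -` ?S = (if N\<mu> e \<le> \<rho> then {A. A - rank_one e x \<in> X} else {})" by auto
    then show "emeasure lborel (Pair e -` ?S) = emeasure lborel X * indicator {e. N\<mu> (e - 0) \<le> \<rho>} e"
      by (simp add: tr)
  qed
  also have "\<dots> = emeasure lborel X * emeasure lborel {e. N\<mu> (e - 0) \<le> \<rho>}"
    using is_norm_closed_ball(1)[OF N\<mu>, of 0 \<rho>] by (intro nn_integral_cmult_indicator) simp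
  also have "\<dots> = emeasure lborel X * ennreal (V\<mu> * \<rho> ^ CARD('m))"
    by (subst emeasure_norm_ball[OF N\<mu> \<rho>]) simp
  finally show ?thesis by (simp add: mult.commute)
qed

text \<open>As \<open>rank_one e x\<close> maps \<open>y\<close> to \<open>e\<close>, averaging over \<open>e\<close> compares the measure at a small scale
  \<open>c\<close> with the measure at a much larger scale \<open>\<rho>\<close>, where lattice points can be counted for each
  single matrix.\<close>

lemma measure_le_rank_one_average:
  fixes x :: "real ^ 'n" and X :: "(real ^ 'n ^ 'm) set"
  assumes X: "X \<in> sets borel" "X \<in> lmeasurable" and X': "X' \<in> sets borel" "X' \<in> lmeasurable"
    and \<rho>: "0 \<le> \<rho>" and c: "0 \<le> c" and x: "x \<noteq> 0" "x \<bullet> y = (norm x)\<^sup>2"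
    and Xc: "\<And>A. A \<in> X \<Longrightarrow> N\<mu> (A *v y - p) \<le> c"
    and XX': "\<And>A e. A \<in> X \<Longrightarrow> N\<mu> e \<le> \<rho> \<Longrightarrow> A + rank_one e x \<in> X'"
  shows "\<rho> ^ CARD('m) * measure lebesgue X \<le> c ^ CARD('m) * measure lebesgue X'"
proof -
  \<comment> \<open>\<open>x\<close> and \<open>y\<close> may differ. The pair estimate takes for
    \<open>x\<close> the part of \<open>y\<close> orthogonal to a second vector, so that the
    perturbation leaves the value of the matrix at that vector unchanged.\<close>
  have "ennreal (V\<mu> * \<rho> ^ CARD('m)) * emeasure lborel X =
     (\<integral>\<^sup>+A. emeasure lborel {e. N\<mu> e \<le> \<rho> \<and> A - rank_one e x \<in> X} \<partial>lborel)"
    by (rule rank_one_average[OF X(1) \<rho>])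
  also have "\<dots> \<le> (\<integral>\<^sup>+A. ennreal (V\<mu> * c ^ CARD('m)) * indicator X' A \<partial>lborel)"
  proof (rule nn_integral_mono)
    fix A :: "real ^ 'n ^ 'm"
    let ?Z = "{e. N\<mu> e \<le> \<rho> \<and> A - rank_one e x \<in> X}"
    show "emeasure lborel ?Z \<le> ennreal (V\<mu> * c ^ CARD('m)) * indicator X' A"
    proof (cases "?Z = {}")
      case False
      then obtain e where "N\<mu> e \<le> \<rho>" "A - rank_one e x \<in> X" by auto
      then have "A \<in> X'" using XX'[of "A - rank_one e x" e] by simp
      moreover have "?Z \<subseteq> {e. N\<mu> (e - (A *v y - p)) \<le> c}"
      proof
        fix e assume "e \<in> ?Z"
        then have "N\<mu> ((A - rank_one e x) *v y - p) \<le> c" using Xc by auto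
        moreover have "(A - rank_one e x) *v y - p = (A *v y - p) - e"
          using rank_one_mult_self[OF x(2,1), of e] by (simp add: matrix_vector_mult_diff_rdistrib)
        ultimately show "e \<in> {e. N\<mu> (e - (A *v y - p)) \<le> c}"
          by (simp add: is_norm_diff_commute[OF N\<mu>, of e])
      qed
      then have "emeasure lborel ?Z \<le> emeasure lborel {e. N\<mu> (e - (A *v y - p)) \<le> c}"
        by (intro emeasure_mono) (simp_all add: is_norm_closed_ball[OF N\<mu>])
      ultimately show ?thesis by (simp add: emeasure_norm_ball[OF N\<mu> c])
    qed (simp only: emeasure_empty zero_le)
  qed
  also have "\<dots> = ennreal (V\<mu> * c ^ CARD('m)) * emeasure lborel X'"
    using X'(1) by (intro nn_integral_cmult_indicator) simp
  finally have "ennreal (V\<mu> * \<rho> ^ CARD('m)) * emeasure lebesgue X \<le> ennreal (V\<mu> * c ^ CARD('m)) * emeasure lebesgue X'"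
    using X(1) X'(1) by simp
  then have "V\<mu> * \<rho> ^ CARD('m) * measure lebesgue X \<le> V\<mu> * c ^ CARD('m) * measure lebesgue X'"
    using \<rho> c volumes_pos X(2) X'(2) by (simp add: emeasure_eq_measure2 ennreal_mult[symmetric])
  then show ?thesis using volumes_pos by (simp add: mult.assoc)
qed

text \<open>The converse comparison: over each \<open>A\<close> in \<open>X'\<close> the admissible
  \<open>e\<close> contain a full ball of radius \<open>c\<close>.\<close>

lemma rank_one_average_le_measure:
  fixes x :: "real ^ 'n" and X :: "(real ^ 'n ^ 'm) set"
  assumes X: "X \<in> sets borel" "X \<in> lmeasurable" and X': "X' \<in> sets borel" "X' \<in> lmeasurable"
    and \<rho>: "0 \<le> \<rho>" and c: "0 \<le> c" 
    and XX': "\<And>A e. A \<in> X' \<Longrightarrow> N\<mu> (e - (A *v y - p)) \<le> c \<Longrightarrow> N\<mu> e \<le> \<rho> \<and> A - rank_one e x \<in> X"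
  shows "c ^ CARD('m) * measure lebesgue X' \<le> \<rho> ^ CARD('m) * measure lebesgue X"
proof -
  have "ennreal (V\<mu> * c ^ CARD('m)) * emeasure lborel X' = (\<integral>\<^sup>+A. ennreal (V\<mu> * c ^ CARD('m)) * indicator X' A \<partial>lborel)"
    using X'(1) by (intro nn_integral_cmult_indicator[symmetric]) simp
  also have "\<dots> \<le> (\<integral>\<^sup>+A. emeasure lborel {e. N\<mu> e \<le> \<rho> \<and> A - rank_one e x \<in> X} \<partial>lborel)"
  proof (rule nn_integral_mono)
    fix A :: "real ^ 'n ^ 'm"
    let ?Z = "{e. N\<mu> e \<le> \<rho> \<and> A - rank_one e x \<in> X}"
    show "ennreal (V\<mu> * c ^ CARD('m)) * indicator X' A \<le> emeasure lborel ?Z"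
    proof (cases "A \<in> X'")
      case True
      have "(\<lambda>e. A - rank_one e x) \<in> borel_measurable borel"
        by (intro borel_measurable_continuous_onI continuous_on_diff continuous_on_rank_one continuous_intros)
      then have "(\<lambda>e. A - rank_one e x) -` X \<inter> space borel \<in> sets borel" using X(1) by (rule measurable_sets)
      moreover have "?Z = {e. N\<mu> (e - 0) \<le> \<rho>} \<inter> ((\<lambda>e. A - rank_one e x) -` X \<inter> space borel)" by auto
      ultimately have "?Z \<in> sets borel"
        using is_norm_closed_ball(1)[OF N\<mu>, of 0 \<rho>] by (simp only: sets.Int borel_closed)
      moreover have "{e. N\<mu> (e - (A *v y - p)) \<le> c} \<subseteq> ?Z" using XX'[OF True] by auto
      ultimately have "emeasure lborel {e. N\<mu> (e - (A *v y - p)) \<le> c} \<le> emeasure lborel ?Z"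
        by (intro emeasure_mono) simp_all
      then show ?thesis using True by (simp add: emeasure_norm_ball[OF N\<mu> c])
    qed simp
  qed
  also have "\<dots> = ennreal (V\<mu> * \<rho> ^ CARD('m)) * emeasure lborel X"
    by (rule rank_one_average[OF X(1) \<rho>, symmetric])
  finally have "ennreal (V\<mu> * c ^ CARD('m)) * emeasure lebesgue X' \<le> ennreal (V\<mu> * \<rho> ^ CARD('m)) * emeasure lebesgue X"
    using X(1) X'(1) by simp
  then have "V\<mu> * c ^ CARD('m) * measure lebesgue X' \<le> V\<mu> * \<rho> ^ CARD('m) * measure lebesgue X"
    using \<rho> c volumes_pos X(2) X'(2) by (simp add: emeasure_eq_measure2 ennreal_mult[symmetric])
  then show ?thesis using volumes_pos by (simp add: mult.assoc)
qed

text \<open>The resonant set of \<open>r\<close> in the unit cube enlarged by \<open>s\<close> on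
  every side, or shrunk if \<open>s\<close> is negative. The margin compensates for the averaging,
  which moves matrices across the boundary of the cube.\<close>

definition near :: "real \<Rightarrow> real \<Rightarrow> (real ^ 'm) \<times> (real ^ 'n) \<Rightarrow> (real ^ 'n ^ 'm) set" where
  "near s c r = {A \<in> box_matrices s. N\<mu> (A *v snd r - fst r) \<le> c}"

lemma closed_near: "closed (near s c r)"
proof -
  have "continuous_on UNIV (\<lambda>A :: real ^ 'n ^ 'm. A *v snd r)"
    unfolding matrix_vector_mult_def by (intro continuous_intros)
  then have "continuous_on UNIV (\<lambda>A :: real ^ 'n ^ 'm. N\<mu> (A *v snd r - fst r))"
    by (intro continuous_on_compose2[OF is_norm_continuous[OF N\<mu>, of UNIV]] continuous_on_diff continuous_on_const) auto
  then have "closed {A. N\<mu> (A *v snd r - fst r) \<le> c}" by (intro closed_Collect_le continuous_on_const)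
  moreover have "near s c r = box_matrices s \<inter> {A. N\<mu> (A *v snd r - fst r) \<le> c}" by (auto simp: near_def)
  ultimately show ?thesis by (simp only: box_matrices_cbox closed_Int closed_cbox)
qed

lemma near_borel [simp]: "near s c r \<in> sets borel"
  using closed_near by (rule borel_closed)

lemma near_lmeasurable [simp]: "near s c r \<in> lmeasurable"
proof -
  have "near s c r \<subseteq> cbox (\<chi> i j. - s) (\<chi> i j. 1 + s)" by (auto simp: near_def simp flip: box_matrices_cbox)
  then have "bounded (near s c r)" by (rule bounded_subset[OF bounded_cbox])
  then show ?thesis using closed_near by (simp add: lmeasurable_compact compact_eq_bounded_closed)
qed

lemma box_add_rank_one:
  assumes A: "A \<in> box_matrices s" and e: "N\<mu> e \<le> \<rho>" and x: "T \<le> N\<nu> x" "0 < T"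
  shows "A + rank_one e x \<in> box_matrices (s + nconst\<^sup>2 * (\<rho> / T))"
    "A - rank_one e x \<in> box_matrices (s + nconst\<^sup>2 * (\<rho> / T))"
proof -
  have c0: "0 < nconst" using nconst(1) by simp
  have \<rho>0: "0 \<le> \<rho>" using e is_norm_nonneg[OF N\<mu>, of e] by simp
  have "norm e \<le> nconst * \<rho>" using nconst(3)[of e] mult_left_mono[OF e less_imp_le[OF c0]] by linarith
  moreover have "T / nconst \<le> norm x" using nconst(4)[of x] x c0 by (simp add: pos_divide_le_eq mult.commute)
  ultimately have "norm e / norm x \<le> nconst * \<rho> / (T / nconst)"
    using x c0 \<rho>0 by (intro frac_le) auto
  also have "\<dots> = nconst\<^sup>2 * (\<rho> / T)" by (simp add: power2_eq_square)
  finally have *: "\<bar>rank_one e x $ i $ j\<bar> \<le> nconst\<^sup>2 * (\<rho> / T)" for i j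
    using rank_one_component_le order_trans by blast
  have "- (s + nconst\<^sup>2 * (\<rho> / T)) \<le> (A + rank_one e x) $ i $ j \<and> (A + rank_one e x) $ i $ j \<le> 1 + (s + nconst\<^sup>2 * (\<rho> / T)) \<and>
      - (s + nconst\<^sup>2 * (\<rho> / T)) \<le> (A - rank_one e x) $ i $ j \<and> (A - rank_one e x) $ i $ j \<le> 1 + (s + nconst\<^sup>2 * (\<rho> / T))" for i j
  proof -
    have "- s \<le> A $ i $ j" "A $ i $ j \<le> 1 + s" using A by (auto simp: box_matrices_def)
    then show ?thesis using *[of i j] by (simp add: abs_le_iff)
  qed
  then show "A + rank_one e x \<in> box_matrices (s + nconst\<^sup>2 * (\<rho> / T))"
    "A - rank_one e x \<in> box_matrices (s + nconst\<^sup>2 * (\<rho> / T))"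
    unfolding box_matrices_def by blast+
qed

lemma measure_near_thicken:
  assumes T: "0 < T" "T \<le> N\<nu> (snd r)" and \<rho>: "0 \<le> \<rho>" and c: "0 \<le> c"
  shows "\<rho> ^ CARD('m) * measure lebesgue (near s c r) \<le> c ^ CARD('m) * measure lebesgue (near (s + nconst\<^sup>2 * (\<rho> / T)) (\<rho> + c) r)"
proof (rule measure_le_rank_one_average[OF near_borel near_lmeasurable near_borel near_lmeasurable \<rho> c])
  let ?x = "snd r"
  show x0: "?x \<noteq> 0" using T is_norm_zero[OF N\<nu>] by auto
  show "?x \<bullet> ?x = (norm ?x)\<^sup>2" by (simp add: power2_norm_eq_inner)
  show "N\<mu> (A *v ?x - fst r) \<le> c" if "A \<in> near s c r" for A using that by (simp add: near_def)
  fix A e assume A: "A \<in> near s c r" and e: "N\<mu> e \<le> \<rho>"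
  have eq: "(A + rank_one e ?x) *v ?x - fst r = (A *v ?x - fst r) + e"
    using rank_one_mult_self[OF _ x0, of ?x e] by (simp add: matrix_vector_mult_add_rdistrib power2_norm_eq_inner)
  have "N\<mu> (A *v ?x - fst r) \<le> c" using A by (simp add: near_def)
  then have "N\<mu> ((A + rank_one e ?x) *v ?x - fst r) \<le> \<rho> + c"
    unfolding eq using is_norm_triangle[OF N\<mu>, of "A *v ?x - fst r" e] e by linarith
  then show "A + rank_one e ?x \<in> near (s + nconst\<^sup>2 * (\<rho> / T)) (\<rho> + c) r"
    using box_add_rank_one(1)[OF _ e T(2,1)] A by (simp add: near_def)
qed

lemma measure_near_thin:
  assumes T: "0 < T" "T \<le> N\<nu> (snd r)" and c: "0 \<le> c" "c \<le> \<rho>"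
  shows "c ^ CARD('m) * measure lebesgue (near (s - nconst\<^sup>2 * (\<rho> / T)) (\<rho> - c) r) \<le> \<rho> ^ CARD('m) * measure lebesgue (near s c r)"
proof (rule rank_one_average_le_measure[OF near_borel near_lmeasurable near_borel near_lmeasurable _ c(1)])
  let ?x = "snd r"
  show "0 \<le> \<rho>" using c by simp
  have x0: "?x \<noteq> 0" using T is_norm_zero[OF N\<nu>] by auto
  fix A e assume A: "A \<in> near (s - nconst\<^sup>2 * (\<rho> / T)) (\<rho> - c) r" and e: "N\<mu> (e - (A *v ?x - fst r)) \<le> c"
  have "N\<mu> e \<le> N\<mu> (e - (A *v ?x - fst r)) + N\<mu> (A *v ?x - fst r)"
    using is_norm_triangle[OF N\<mu>, of "e - (A *v ?x - fst r)" "A *v ?x - fst r"] by simp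
  then have e\<rho>: "N\<mu> e \<le> \<rho>" using A e by (simp add: near_def)
  have eq: "(A - rank_one e ?x) *v ?x - fst r = (A *v ?x - fst r) - e"
    using rank_one_mult_self[OF _ x0, of ?x e] by (simp add: matrix_vector_mult_diff_rdistrib power2_norm_eq_inner)
  have "N\<mu> ((A - rank_one e ?x) *v ?x - fst r) \<le> c"
    unfolding eq using e by (simp only: is_norm_diff_commute[OF N\<mu>, of e])
  then show "N\<mu> e \<le> \<rho> \<and> A - rank_one e ?x \<in> near s c r"
    using e\<rho> box_add_rank_one(2)[OF _ e\<rho> T(2,1), of A "s - nconst\<^sup>2 * (\<rho> / T)"] A by (simp add: near_def)
qed

definition "near_const = (1 + 2 * (1 + nconst\<^sup>2)) ^ (CARD('m) * CARD('n))"

lemma near_const_pos: "0 < near_const"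
  unfolding near_const_def by (intro zero_less_power add_pos_nonneg) auto

text \<open>Thickening up to the scale \<rho> = T leaves on the right no more than an enlarged
  cube.\<close>

lemma measure_near_le:
  assumes q: "0 < T" "T \<le> N\<nu> (snd r)" and c: "0 \<le> c" and s: "0 \<le> s" "s \<le> 1"
  shows "measure lebesgue (near s c r) \<le> near_const * (c / T) ^ CARD('m)"
proof -
  have "T ^ CARD('m) * measure lebesgue (near s c r) \<le> c ^ CARD('m) * measure lebesgue (near (s + nconst\<^sup>2 * (T / T)) (T + c) r)"
    using q c by (intro measure_near_thicken) auto
  also have "\<dots> \<le> c ^ CARD('m) * measure lebesgue (box_matrices (1 + nconst\<^sup>2) :: (real ^ 'n ^ 'm) set)"
  proof (intro mult_left_mono measure_mono_fmeasurable)
    have "box_matrices (s + nconst\<^sup>2 * (T / T)) \<subseteq> (box_matrices (1 + nconst\<^sup>2) :: (real ^ 'n ^ 'm) set)"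
      using s q by (intro box_matrices_mono) simp
    then show "near (s + nconst\<^sup>2 * (T / T)) (T + c) r \<subseteq> box_matrices (1 + nconst\<^sup>2)"
      unfolding near_def by blast
  qed (use c in auto)
  also have "\<dots> = c ^ CARD('m) * near_const"
    by (subst measure_box_matrices) (auto simp: near_const_def intro: order_trans[of _ 0])
  finally show ?thesis using q by (simp add: power_divide field_simps)
qed

text \<open>Interchanging sum and integral turns the sum of measures into the integral over the cube
  of a count for each single matrix.\<close>

lemma sum_measure_near_le:
  assumes R: "finite R" and s: "- 1 / 2 \<le> s"
    and N: "\<And>A. A \<in> box_matrices s \<Longrightarrow> real (card {r \<in> R. N\<mu> (A *v snd r - fst r) \<le> c}) \<le> N"
  shows "(\<Sum>r\<in>R. measure lebesgue (near s c r)) \<le> (1 + 2 * s) ^ (CARD('m) * CARD('n)) * N"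
proof -
  have eq: "(\<Sum>r\<in>R. indicat_real (near s c r) A) = indicat_real (box_matrices s) A * real (card {r \<in> R. N\<mu> (A *v snd r - fst r) \<le> c})" for A
  proof -
    have "(\<Sum>r\<in>R. indicat_real (near s c r) A) = (\<Sum>r\<in>R. indicat_real (box_matrices s) A * (if N\<mu> (A *v snd r - fst r) \<le> c then 1 else 0))"
      by (intro sum.cong) (auto simp: near_def indicator_def)
    also have "\<dots> = indicat_real (box_matrices s) A * (\<Sum>r\<in>R. if N\<mu> (A *v snd r - fst r) \<le> c then 1 else 0)"
      by (simp only: sum_distrib_left)
    also have "(\<Sum>r\<in>R. if N\<mu> (A *v snd r - fst r) \<le> c then 1 else 0) = (\<Sum>r\<in>{r \<in> R. N\<mu> (A *v snd r - fst r) \<le> c}. (1::real))"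
      by (rule sum.inter_filter[OF R, symmetric])
    finally show ?thesis by simp
  qed
  have int: "integrable lebesgue (indicat_real (near s c r))" for r
    using near_lmeasurable[of s c r] by (simp only: lmeasurable_iff_integrable)
  have "(\<Sum>r\<in>R. measure lebesgue (near s c r)) = (LINT A|lebesgue. (\<Sum>r\<in>R. indicat_real (near s c r) A))"
    by (subst Bochner_Integration.integral_sum[OF int]) simp
  also have "\<dots> \<le> (LINT A|lebesgue. N * indicat_real (box_matrices s :: (real ^ 'n ^ 'm) set) A)"
  proof (rule integral_mono)
    show "integrable lebesgue (\<lambda>A. \<Sum>r\<in>R. indicat_real (near s c r) A)"
      by (intro Bochner_Integration.integrable_sum int)
    show "integrable lebesgue (\<lambda>A. N * indicat_real (box_matrices s :: (real ^ 'n ^ 'm) set) A)"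
      using lmeasurable_box_matrices[of s] by (intro integrable_mult_right) (simp only: lmeasurable_iff_integrable)
    show "(\<Sum>r\<in>R. indicat_real (near s c r) A) \<le> N * indicat_real (box_matrices s) A" for A
      unfolding eq using N[of A] by (auto simp: indicator_def)
  qed
  also have "\<dots> = N * measure lebesgue (box_matrices s :: (real ^ 'n ^ 'm) set)" by simp
  finally show ?thesis by (simp add: measure_box_matrices[OF s] mult.commute)
qed

lemma sum_measure_near_ge:
  assumes R: "finite R" and s: "- 1 / 2 \<le> s"
    and N: "\<And>A. A \<in> box_matrices s \<Longrightarrow> N \<le> real (card {r \<in> R. N\<mu> (A *v snd r - fst r) \<le> c})"
  shows "(1 + 2 * s) ^ (CARD('m) * CARD('n)) * N \<le> (\<Sum>r\<in>R. measure lebesgue (near s c r))"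
proof -
  have eq: "(\<Sum>r\<in>R. indicat_real (near s c r) A) = indicat_real (box_matrices s) A * real (card {r \<in> R. N\<mu> (A *v snd r - fst r) \<le> c})" for A
  proof -
    have "(\<Sum>r\<in>R. indicat_real (near s c r) A) = (\<Sum>r\<in>R. indicat_real (box_matrices s) A * (if N\<mu> (A *v snd r - fst r) \<le> c then 1 else 0))"
      by (intro sum.cong) (auto simp: near_def indicator_def)
    also have "\<dots> = indicat_real (box_matrices s) A * (\<Sum>r\<in>R. if N\<mu> (A *v snd r - fst r) \<le> c then 1 else 0)"
      by (simp only: sum_distrib_left)
    also have "(\<Sum>r\<in>R. if N\<mu> (A *v snd r - fst r) \<le> c then 1 else 0) = (\<Sum>r\<in>{r \<in> R. N\<mu> (A *v snd r - fst r) \<le> c}. (1::real))"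
      by (rule sum.inter_filter[OF R, symmetric])
    finally show ?thesis by simp
  qed
  have int: "integrable lebesgue (indicat_real (near s c r))" for r
    using near_lmeasurable[of s c r] by (simp only: lmeasurable_iff_integrable)
  have "(1 + 2 * s) ^ (CARD('m) * CARD('n)) * N = (LINT A|lebesgue. N * indicat_real (box_matrices s :: (real ^ 'n ^ 'm) set) A)"
    by (simp add: measure_box_matrices[OF s])
  also have "\<dots> \<le> (LINT A|lebesgue. (\<Sum>r\<in>R. indicat_real (near s c r) A))"
  proof (rule integral_mono)
    show "integrable lebesgue (\<lambda>A. \<Sum>r\<in>R. indicat_real (near s c r) A)"
      by (intro Bochner_Integration.integrable_sum int)
    show "integrable lebesgue (\<lambda>A. N * indicat_real (box_matrices s :: (real ^ 'n ^ 'm) set) A)"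
      using lmeasurable_box_matrices[of s] by (intro integrable_mult_right) (simp only: lmeasurable_iff_integrable)
    show "N * indicat_real (box_matrices s) A \<le> (\<Sum>r\<in>R. indicat_real (near s c r) A)" for A
      unfolding eq using N[of A] by (auto simp: indicator_def)
  qed
  also have "\<dots> = (\<Sum>r\<in>R. measure lebesgue (near s c r))"
    by (subst Bochner_Integration.integral_sum[OF int]) simp
  finally show ?thesis .
qed

end

subsection \<open>Sums over shells\<close>

text \<open>At \<xi> = 0 both expressions equal v, so continuity suffices. The factor with 2 \<xi>
  is the volume of the enlarged or shrunk cube, the factor with exponent k is the effect of
  replacing \<rho> by (1 + \<xi>) \<rho> or (1 - \<xi>) \<rho>, and the additional \<xi> is the
  counting error.\<close>

lemma perturbation_radius:
  fixes v e :: real and j k :: nat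
  assumes "0 < e"
  obtains \<xi> where "0 < \<xi>" "\<xi> \<le> 1 / 4" "(1 + 2 * \<xi>) ^ j * (v * (1 + \<xi>) ^ k + \<xi>) \<le> v + e"
    "v - e \<le> (1 - 2 * \<xi>) ^ j * (v * (1 - \<xi>) ^ k - \<xi>)"
proof -
  have "((\<lambda>\<xi>. (1 + 2 * \<xi>) ^ j * (v * (1 + \<xi>) ^ k + \<xi>)) \<longlongrightarrow> (1 + 2 * 0) ^ j * (v * (1 + 0) ^ k + 0)) (at_right 0)"
    by (intro tendsto_intros)
  then have 1: "\<forall>\<^sub>F \<xi> in at_right 0. (1 + 2 * \<xi>) ^ j * (v * (1 + \<xi>) ^ k + \<xi>) < v + e"
    using assms by (intro order_tendstoD(2)) auto
  have "((\<lambda>\<xi>. (1 - 2 * \<xi>) ^ j * (v * (1 - \<xi>) ^ k - \<xi>)) \<longlongrightarrow> (1 - 2 * 0) ^ j * (v * (1 - 0) ^ k - 0)) (at_right 0)"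
    by (intro tendsto_intros)
  then have 2: "\<forall>\<^sub>F \<xi> in at_right 0. v - e < (1 - 2 * \<xi>) ^ j * (v * (1 - \<xi>) ^ k - \<xi>)"
    using assms by (intro order_tendstoD(1)) auto
  have 3: "\<forall>\<^sub>F \<xi> in at_right 0. (0::real) < \<xi> \<and> \<xi> < 1 / 4"
    using eventually_at_right_real[of 0 "1 / 4 :: real"] by simp
  from eventually_conj[OF 3 eventually_conj[OF 1 2]]
  obtain \<xi> where "(0 < \<xi> \<and> \<xi> < 1 / 4) \<and> (1 + 2 * \<xi>) ^ j * (v * (1 + \<xi>) ^ k + \<xi>) < v + e \<and>
      v - e < (1 - 2 * \<xi>) ^ j * (v * (1 - \<xi>) ^ k - \<xi>)"
    using eventually_happens'[OF trivial_limit_at_right_real] by blast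
  then show ?thesis using that[of \<xi>] by simp
qed

context two_norms
begin

definition "reach = nconst * (2 * CARD('m) * CARD('n) + 3)"

lemma reach_ge_1: "1 \<le> reach"
proof -
  have "1 * 1 \<le> nconst * (2 * CARD('m) * CARD('n) + 3)" using nconst(1) by (intro mult_mono) auto
  then show ?thesis by (simp add: reach_def)
qed

lemma near_norm_le:
  assumes "A \<in> near s c r" "s \<le> 1" "c \<le> 2 * T" "N\<nu> (snd r) \<le> T"
  shows "norm r \<le> reach * T"
proof -
  have "A \<in> box_matrices 1" using assms(1,2) box_matrices_mono[of s 1] by (auto simp: near_def)
  moreover have "r \<in> region A c T" using assms by (auto simp: near_def region_def)
  ultimately show ?thesis using region_subset_cball[of A c T] assms(3) by (auto simp: reach_def)
qed

text \<open>The ball makes the shell finite. By \<open>near_norm_le\<close>, the vectors that it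
  excludes have empty resonant sets in the unit cube for radii up to 2 T'.\<close>

definition shell :: "((real ^ 'm) \<times> (real ^ 'n)) set \<Rightarrow> real \<Rightarrow> real \<Rightarrow> ((real ^ 'm) \<times> (real ^ 'n)) set" where
  "shell \<Lambda> T T' = {r \<in> cball 0 (reach * T'). unimodular.primitive \<Lambda> r \<and> T < N\<nu> (snd r) \<and> N\<nu> (snd r) \<le> T'}"

lemma finite_shell:
  assumes "unimodular \<Lambda>" shows "finite (shell \<Lambda> T T')"
proof -
  interpret unimodular \<Lambda> by fact
  have "shell \<Lambda> T T' \<subseteq> \<Lambda> \<inter> cball 0 (reach * T')" by (auto simp: shell_def primitive_def)
  then show ?thesis using finite_bounded[OF bounded_cball] finite_subset by blast
qed

lemma card_shell_region:
  assumes L: "unimodular \<Lambda>" and A: "A \<in> box_matrices 1" and \<rho>: "\<rho> \<le> 2 * T'" and T: "T \<le> T'"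
  shows "real (card {r \<in> shell \<Lambda> T T'. N\<mu> (A *v snd r - fst r) \<le> \<rho>}) =
     real (card {r \<in> region A \<rho> T'. unimodular.primitive \<Lambda> r}) - real (card {r \<in> region A \<rho> T. unimodular.primitive \<Lambda> r})"
proof -
  interpret unimodular \<Lambda> by fact
  let ?P = "\<lambda>T. {r \<in> region A \<rho> T. primitive r}"
  have "{r \<in> shell \<Lambda> T T'. N\<mu> (A *v snd r - fst r) \<le> \<rho>} = ?P T' - ?P T"
    using region_subset_cball[OF A \<rho>] unfolding shell_def region_def reach_def by auto
  moreover have "?P T \<subseteq> ?P T'" using T by (auto simp: region_def)
  moreover have "finite (?P T')"
    by (rule finite_subset[OF _ finite_bounded[OF lmeasurable_region(2)[OF A, of \<rho> T']]]) (auto simp: primitive_def)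
  ultimately show ?thesis by (simp add: card_Diff_subset card_mono finite_subset of_nat_diff)
qed

text \<open>Three scales are involved: c <= \<xi> \<rho> and \<rho> = \<eta> T. Averaging compares
  the radius c with \<rho> + c and \<rho> - c on a cube whose margin changes by
  \<open>nconst\<^sup>2 * (\<rho> / T)\<close> = \<xi>. At the radius \<rho>, a fixed fraction of T,
  an error proportional to T^d in the count is small relative to \<rho>^m T^n.\<close>

lemma sum_shell_measure:
  assumes \<epsilon>: "0 < (\<epsilon>::real)" and \<tau>: "0 < \<tau>" "\<tau> \<le> (1::real)"
  shows "\<exists>B\<ge>1. \<exists>c0>0. \<forall>\<Lambda> a T c. lattice_min \<Lambda> a \<longrightarrow> 1 \<le> T \<longrightarrow> B \<le> T * a ^ (2 * (CARD('m) + CARD('n)) - 1) \<longrightarrow>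
     0 < c \<longrightarrow> c \<le> c0 \<longrightarrow>
     \<bar>(\<Sum>r\<in>shell \<Lambda> T ((1 + \<tau>) * T). measure lebesgue (near 0 c r))
       - V\<mu> * V\<nu> / zeta_nat (CARD('m) + CARD('n)) * ((1 + \<tau>) ^ CARD('n) - 1) * (c ^ CARD('m) * T ^ CARD('n))\<bar>
     \<le> \<epsilon> * (c ^ CARD('m) * T ^ CARD('n))"
proof -
  let ?d = "CARD('m) + CARD('n)" and ?m = "CARD('m)" and ?n = "CARD('n)"
  let ?Z = "V\<mu> * V\<nu> / zeta_nat ?d"
  let ?w = "?Z * ((1 + \<tau>) ^ ?n - 1)"
  have Z0: "0 < ?Z" using volumes_pos zeta_nat_ge_1[OF two_le_CARD_sum[where 'm='m and 'n='n]] by (intro divide_pos_pos mult_pos_pos) auto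
  have w0: "0 \<le> ?w" using Z0 \<tau> by (intro mult_nonneg_nonneg) auto
  obtain \<xi> where \<xi>: "0 < \<xi>" "\<xi> \<le> 1 / 4"
    "(1 + 2 * \<xi>) ^ (?m * ?n) * (?w * (1 + \<xi>) ^ ?m + \<xi>) \<le> ?w + \<epsilon>"
    "?w - \<epsilon> \<le> (1 - 2 * \<xi>) ^ (?m * ?n) * (?w * (1 - \<xi>) ^ ?m - \<xi>)"
    using perturbation_radius[OF \<epsilon>] by metis
  have nc: "1 \<le> nconst\<^sup>2" using nconst(1) by (rule one_le_power)
  define \<eta> where "\<eta> = \<xi> / nconst\<^sup>2"
  have \<eta>: "0 < \<eta>" "\<eta> \<le> \<xi>" "nconst\<^sup>2 * \<eta> = \<xi>"
  proof -
    have nc0: "0 < nconst\<^sup>2" using nc by linarith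
    show "0 < \<eta>" using \<xi>(1) nc0 by (simp only: \<eta>_def divide_pos_pos)
    have "\<xi> * 1 \<le> \<xi> * nconst\<^sup>2" using \<xi>(1) nc by (intro mult_left_mono) auto
    then show "\<eta> \<le> \<xi>" using nc0 by (simp only: \<eta>_def pos_divide_le_eq mult_1_right)
    show "nconst\<^sup>2 * \<eta> = \<xi>" using nc0 by (simp add: \<eta>_def)
  qed
  \<comment> \<open>The denominator collects the counting errors at the two ends of the shell, whose
    outer end is at most 2 T.\<close>
  define \<epsilon>1 where "\<epsilon>1 = \<xi> * \<eta> ^ ?m / (2 ^ ?d + 1)"
  have pos2: "(0::real) < 2 ^ ?d + 1" by (intro add_pos_pos) auto
  have \<epsilon>1: "0 < \<epsilon>1" "\<epsilon>1 * (2 ^ ?d + 1) = \<xi> * \<eta> ^ ?m"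
    using \<xi> \<eta> pos2 by (simp_all add: \<epsilon>1_def)
  obtain B where B: "1 \<le> B" "\<And>\<Lambda> a A \<rho> T. lattice_min \<Lambda> a \<Longrightarrow> A \<in> box_matrices 1 \<Longrightarrow> 1 \<le> T \<Longrightarrow>
     B \<le> T * a ^ (2 * ?d - 1) \<Longrightarrow> 0 \<le> \<rho> \<Longrightarrow> \<rho> \<le> 2 * T \<Longrightarrow>
     \<bar>real (card {r \<in> region A \<rho> T. unimodular.primitive \<Lambda> r}) - V\<mu> * V\<nu> * \<rho> ^ ?m * T ^ ?n / zeta_nat ?d\<bar>
       \<le> \<epsilon>1 * T ^ ?d"
    using card_primitive_region[OF \<epsilon>1(1)] by blast
  show ?thesis
  proof (rule exI[of _ B], rule conjI[OF B(1)], rule exI[of _ "\<xi> * \<eta>"], intro conjI allI impI)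
    show "0 < \<xi> * \<eta>" using \<xi> \<eta> by simp
    fix \<Lambda> :: "((real ^ 'm) \<times> (real ^ 'n)) set" and a T c :: real
    assume L: "lattice_min \<Lambda> a" and T: "1 \<le> T" and BT: "B \<le> T * a ^ (2 * ?d - 1)" and c: "0 < c" "c \<le> \<xi> * \<eta>"
    let ?T' = "(1 + \<tau>) * T"
    let ?R = "shell \<Lambda> T ?T'"
    interpret lattice_min \<Lambda> a by fact
    have UL: "unimodular \<Lambda>" by unfold_locales
    have fin: "finite ?R" by (rule finite_shell[OF UL])
    have T0: "0 < T" using T by simp
    have T': "T \<le> ?T'" "?T' \<le> 2 * T" using \<tau> T0 by (auto simp: mult_le_cancel_right)
    have BT': "B \<le> ?T' * a ^ (2 * ?d - 1)"
      using BT mult_right_mono[OF T'(1), of "a ^ (2 * ?d - 1)"] a_pos by simp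
    define \<rho> where "\<rho> = \<eta> * T"
    have \<rho>: "0 < \<rho>" "\<rho> \<le> T / 4" "c \<le> \<xi> * \<rho>" "c \<le> \<rho>" "\<rho> / T = \<eta>"
    proof -
      show "0 < \<rho>" using \<eta> T0 by (simp add: \<rho>_def)
      have "\<eta> * T \<le> 1 / 4 * T" using \<eta> \<xi> T0 by (intro mult_right_mono) auto
      then show "\<rho> \<le> T / 4" by (simp add: \<rho>_def)
      have "\<xi> * \<eta> * 1 \<le> \<xi> * \<eta> * T" using \<xi> \<eta> T by (intro mult_left_mono) auto
      then show c\<rho>: "c \<le> \<xi> * \<rho>" using c by (simp add: \<rho>_def mult.assoc)
      have "\<xi> * \<rho> \<le> 1 * \<rho>" using \<xi> \<open>0 < \<rho>\<close> by (intro mult_right_mono) auto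
      then show "c \<le> \<rho>" using c\<rho> by simp
      show "\<rho> / T = \<eta>" using T0 by (simp add: \<rho>_def)
    qed
    have \<sigma>: "nconst\<^sup>2 * (\<rho> / T) = \<xi>" using \<eta>(3) \<rho>(5) by simp
    have Td: "T ^ ?d = T ^ ?m * T ^ ?n" by (simp add: power_add)
    have \<rho>m: "\<rho> ^ ?m = \<eta> ^ ?m * T ^ ?m" by (simp add: \<rho>_def power_mult_distrib)
    have cnt: "\<bar>real (card {r \<in> ?R. N\<mu> (A *v snd r - fst r) \<le> \<rho>'}) - ?w * \<rho>' ^ ?m * T ^ ?n\<bar> \<le> \<xi> * \<rho> ^ ?m * T ^ ?n"
      if A: "A \<in> box_matrices 1" and \<rho>': "0 \<le> \<rho>'" "\<rho>' \<le> 2 * T" for A \<rho>'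
    proof -
      have e: "real (card {r \<in> ?R. N\<mu> (A *v snd r - fst r) \<le> \<rho>'}) =
        real (card {r \<in> region A \<rho>' ?T'. primitive r}) - real (card {r \<in> region A \<rho>' T. primitive r})"
        using T' \<rho>' by (intro card_shell_region[OF UL A]) auto
      have 1: "\<bar>real (card {r \<in> region A \<rho>' ?T'. primitive r}) - V\<mu> * V\<nu> * \<rho>' ^ ?m * ?T' ^ ?n / zeta_nat ?d\<bar> \<le> \<epsilon>1 * ?T' ^ ?d"
      proof (rule B(2)[OF L A _ BT' \<rho>'(1)])
        show "1 \<le> ?T'" by (rule order_trans[OF T T'(1)])
        show "\<rho>' \<le> 2 * ?T'" using \<rho>'(2) T'(1) by linarith
      qed
      have 2: "\<bar>real (card {r \<in> region A \<rho>' T. primitive r}) - V\<mu> * V\<nu> * \<rho>' ^ ?m * T ^ ?n / zeta_nat ?d\<bar> \<le> \<epsilon>1 * T ^ ?d"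
        using T \<rho>' by (intro B(2)[OF L A _ BT]) auto
      have "V\<mu> * V\<nu> * \<rho>' ^ ?m * ?T' ^ ?n / zeta_nat ?d - V\<mu> * V\<nu> * \<rho>' ^ ?m * T ^ ?n / zeta_nat ?d = ?w * \<rho>' ^ ?m * T ^ ?n"
        unfolding power_mult_distrib by (simp add: right_diff_distrib left_diff_distrib diff_divide_distrib mult_ac)
      moreover have "\<epsilon>1 * ?T' ^ ?d + \<epsilon>1 * T ^ ?d \<le> \<xi> * \<rho> ^ ?m * T ^ ?n"
      proof -
        have "?T' ^ ?d \<le> (2 * T) ^ ?d" using T' T0 \<tau> by (intro power_mono) auto
        then have "\<epsilon>1 * ?T' ^ ?d + \<epsilon>1 * T ^ ?d \<le> \<epsilon>1 * (2 * T) ^ ?d + \<epsilon>1 * T ^ ?d"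
          using \<epsilon>1(1) by (intro add_right_mono mult_left_mono) auto
        also have "\<dots> = (\<epsilon>1 * (2 ^ ?d + 1)) * T ^ ?d" unfolding power_mult_distrib by (simp add: algebra_simps)
        also have "\<dots> = \<xi> * \<rho> ^ ?m * T ^ ?n" unfolding \<epsilon>1(2) Td \<rho>m by simp
        finally show ?thesis .
      qed
      moreover have "\<bar>x - y - w\<bar> \<le> e" if "\<bar>x - x'\<bar> \<le> e1" "\<bar>y - y'\<bar> \<le> e2" "x' - y' = w" "e1 + e2 \<le> e"
        for x y w x' y' e e1 e2 :: real using that by linarith
      ultimately show ?thesis unfolding e using 1 2 by blast
    qed
    have inv: "T \<le> N\<nu> (snd r)" if "r \<in> ?R" for r using that by (auto simp: shell_def)
    let ?cT = "c ^ ?m * T ^ ?n"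
    have cT: "0 < ?cT" using c T0 by simp
    have "\<rho> ^ ?m * (\<Sum>r\<in>?R. measure lebesgue (near 0 c r)) = (\<Sum>r\<in>?R. \<rho> ^ ?m * measure lebesgue (near 0 c r))"
      by (rule sum_distrib_left)
    also have "\<dots> \<le> (\<Sum>r\<in>?R. c ^ ?m * measure lebesgue (near (0 + \<xi>) (\<rho> + c) r))"
      using measure_near_thicken[OF T0 inv, of _ \<rho> c 0] \<rho> c unfolding \<sigma> by (intro sum_mono) auto
    also have "\<dots> = c ^ ?m * (\<Sum>r\<in>?R. measure lebesgue (near \<xi> (\<rho> + c) r))" by (simp add: sum_distrib_left)
    also have "\<dots> \<le> c ^ ?m * ((1 + 2 * \<xi>) ^ (?m * ?n) * (?w * (\<rho> + c) ^ ?m * T ^ ?n + \<xi> * \<rho> ^ ?m * T ^ ?n))"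
    proof (intro mult_left_mono sum_measure_near_le[OF fin])
      fix A :: "real ^ 'n ^ 'm" assume "A \<in> box_matrices \<xi>"
      then have "A \<in> box_matrices 1" using box_matrices_mono[of \<xi> 1] \<xi> by auto
      from cnt[OF this, of "\<rho> + c"] show "real (card {r \<in> ?R. N\<mu> (A *v snd r - fst r) \<le> \<rho> + c}) \<le> ?w * (\<rho> + c) ^ ?m * T ^ ?n + \<xi> * \<rho> ^ ?m * T ^ ?n"
        using \<rho> c T0 by auto
    qed (use c \<xi> in auto)
    also have "\<dots> \<le> c ^ ?m * ((1 + 2 * \<xi>) ^ (?m * ?n) * (?w * (\<rho> * (1 + \<xi>)) ^ ?m * T ^ ?n + \<xi> * \<rho> ^ ?m * T ^ ?n))"
      using c \<xi> w0 \<rho> T0 by (intro mult_left_mono add_right_mono mult_right_mono power_mono) (auto simp: algebra_simps)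
    also have "\<dots> = \<rho> ^ ?m * (?cT * ((1 + 2 * \<xi>) ^ (?m * ?n) * (?w * (1 + \<xi>) ^ ?m + \<xi>)))"
      unfolding power_mult_distrib by (simp only: distrib_left mult_ac)
    also have "\<dots> \<le> \<rho> ^ ?m * (?cT * (?w + \<epsilon>))"
      using \<rho> cT by (intro mult_left_mono \<xi>(3)) auto
    finally have up: "(\<Sum>r\<in>?R. measure lebesgue (near 0 c r)) \<le> ?cT * (?w + \<epsilon>)"
      using \<rho>(1) by (simp only: mult_le_cancel_left_pos zero_less_power)
    have "\<rho> ^ ?m * (?cT * (?w - \<epsilon>)) \<le> \<rho> ^ ?m * (?cT * ((1 - 2 * \<xi>) ^ (?m * ?n) * (?w * (1 - \<xi>) ^ ?m - \<xi>)))"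
      using \<rho> cT by (intro mult_left_mono \<xi>(4)) auto
    also have "\<dots> = c ^ ?m * ((1 - 2 * \<xi>) ^ (?m * ?n) * (?w * (\<rho> * (1 - \<xi>)) ^ ?m * T ^ ?n - \<xi> * \<rho> ^ ?m * T ^ ?n))"
      unfolding power_mult_distrib by (simp only: right_diff_distrib mult_ac)
    also have "\<dots> \<le> c ^ ?m * ((1 - 2 * \<xi>) ^ (?m * ?n) * (?w * (\<rho> - c) ^ ?m * T ^ ?n - \<xi> * \<rho> ^ ?m * T ^ ?n))"
      using c \<xi> w0 \<rho> T0 by (intro mult_left_mono diff_right_mono mult_right_mono power_mono) (auto simp: algebra_simps)
    also have "\<dots> \<le> c ^ ?m * (\<Sum>r\<in>?R. measure lebesgue (near (- \<xi>) (\<rho> - c) r))"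
    proof (intro mult_left_mono)
      have "(1 + 2 * (- \<xi>)) ^ (?m * ?n) * (?w * (\<rho> - c) ^ ?m * T ^ ?n - \<xi> * \<rho> ^ ?m * T ^ ?n) \<le> (\<Sum>r\<in>?R. measure lebesgue (near (- \<xi>) (\<rho> - c) r))"
      proof (rule sum_measure_near_ge[OF fin])
        fix A :: "real ^ 'n ^ 'm" assume "A \<in> box_matrices (- \<xi>)"
        then have "A \<in> box_matrices 1" using box_matrices_mono[of "- \<xi>" 1] \<xi> by auto
        from cnt[OF this, of "\<rho> - c"] show "?w * (\<rho> - c) ^ ?m * T ^ ?n - \<xi> * \<rho> ^ ?m * T ^ ?n \<le> real (card {r \<in> ?R. N\<mu> (A *v snd r - fst r) \<le> \<rho> - c})"
          using \<rho> c T0 by auto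
      qed (use \<xi> in auto)
      then show "(1 - 2 * \<xi>) ^ (?m * ?n) * (?w * (\<rho> - c) ^ ?m * T ^ ?n - \<xi> * \<rho> ^ ?m * T ^ ?n) \<le> (\<Sum>r\<in>?R. measure lebesgue (near (- \<xi>) (\<rho> - c) r))"
        by simp
    qed (use c in auto)
    also have "\<dots> = (\<Sum>r\<in>?R. c ^ ?m * measure lebesgue (near (0 - \<xi>) (\<rho> - c) r))" by (simp add: sum_distrib_left)
    also have "\<dots> \<le> (\<Sum>r\<in>?R. \<rho> ^ ?m * measure lebesgue (near 0 c r))"
      using measure_near_thin[OF T0 inv _ \<rho>(4), of _ 0] c unfolding \<sigma> by (intro sum_mono) auto
    also have "\<dots> = \<rho> ^ ?m * (\<Sum>r\<in>?R. measure lebesgue (near 0 c r))" by (simp add: sum_distrib_left)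
    finally have low: "?cT * (?w - \<epsilon>) \<le> (\<Sum>r\<in>?R. measure lebesgue (near 0 c r))"
      using \<rho>(1) by (simp only: mult_le_cancel_left_pos zero_less_power)
    have "\<bar>x - w * y\<bar> \<le> \<epsilon> * y" if "x \<le> y * (w + \<epsilon>)" "y * (w - \<epsilon>) \<le> x" for x y w :: real
      using that by (simp add: abs_le_iff algebra_simps)
    from this[OF up low] show "\<bar>(\<Sum>r\<in>?R. measure lebesgue (near 0 c r)) - ?w * ?cT\<bar> \<le> \<epsilon> * ?cT" .
  qed
qed

lemma card_cball_reach_le:
  fixes \<Lambda> :: "((real ^ 'm) \<times> (real ^ 'n)) set" and T :: real
  defines "d \<equiv> CARD('m) + CARD('n)"
  assumes "lattice_min \<Lambda> a" and BT: "last_min_const d ^ (d * d + 2 * d) \<le> T * a ^ (2 * d - 1)"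
  shows "0 < T" "real (card (\<Lambda> \<inter> cball 0 (reach * (2 * T)))) \<le> plane_const d * (reach * 2) ^ d * T ^ d"
proof -
  interpret lattice_min \<Lambda> a by fact
  let ?B = "last_min_const d ^ (d * d + 2 * d)"
  have B1: "1 \<le> ?B" using last_min_const_ge_1 by (rule one_le_power)
  note sb = scale_bounds[unfolded DIM_pair_cart, folded d_def, OF two_le_CARD_sum[where ?'m = 'm and ?'n = 'n, folded d_def] B1 BT]
  show T0: "0 < T" by (rule sb(5))
  have "?B \<noteq> 0" using B1 by linarith
  then have "?B / ?B = 1" by (rule divide_self)
  then have M: "last_min \<le> 1 * T" using sb(1) by (simp only:)
  also have "\<dots> \<le> reach * 2 * T" using reach_ge_1 T0 by (intro mult_right_mono) auto
  finally have MT: "last_min \<le> reach * (2 * T)" by simp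
  show "real (card (\<Lambda> \<inter> cball 0 (reach * (2 * T)))) \<le> plane_const d * (reach * 2) ^ d * T ^ d"
    using card_cball_le[OF MT] unfolding plane_const_def d_def DIM_pair_cart by (simp add: power_mult_distrib mult_ac add_ac)
qed

text \<open>A bound of the right order without asymptotics. With T = Q1 and c = \<psi>(Q1) it is
  O(phi(Q1)) and disposes of the multiples of primitive vectors near Q1.\<close>

lemma sum_measure_near_rough:
  "\<exists>B\<ge>1. \<exists>C\<ge>0. \<forall>\<Lambda> a T c. lattice_min \<Lambda> a \<longrightarrow> B \<le> T * a ^ (2 * (CARD('m) + CARD('n)) - 1) \<longrightarrow> 0 \<le> c \<longrightarrow>
     (\<Sum>r\<in>{r \<in> \<Lambda> \<inter> cball 0 (reach * (2 * T)). T \<le> N\<nu> (snd r)}. measure lebesgue (near 0 c r)) \<le> C * (c ^ CARD('m) * T ^ CARD('n))"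
proof -
  let ?d = "CARD('m) + CARD('n)"
  let ?B = "last_min_const ?d ^ (?d * ?d + 2 * ?d)"
  let ?C = "near_const * (plane_const ?d * (reach * 2) ^ ?d)"
  have B1: "1 \<le> ?B" using last_min_const_ge_1 by (rule one_le_power)
  have C0: "0 \<le> ?C" using near_const_pos plane_const_pos[of ?d] reach_ge_1 by (intro mult_nonneg_nonneg) auto
  show ?thesis
  proof (rule exI[of _ ?B], rule conjI[OF B1], rule exI[of _ ?C], rule conjI[OF C0], intro allI impI)
    fix \<Lambda> :: "((real ^ 'm) \<times> (real ^ 'n)) set" and a T c :: real
    assume L: "lattice_min \<Lambda> a" and BT: "?B \<le> T * a ^ (2 * ?d - 1)" and c: "0 \<le> c"
    interpret lattice_min \<Lambda> a by (rule L)
    note T0 = card_cball_reach_le(1)[OF L BT] and cnt = card_cball_reach_le(2)[OF L BT]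
    let ?R = "{r \<in> \<Lambda> \<inter> cball 0 (reach * (2 * T)). T \<le> N\<nu> (snd r)}"
    have "(\<Sum>r\<in>?R. measure lebesgue (near 0 c r)) \<le> (\<Sum>r\<in>?R. near_const * (c / T) ^ CARD('m))"
      using T0 c by (intro sum_mono measure_near_le) auto
    also have "\<dots> = real (card ?R) * (near_const * (c / T) ^ CARD('m))" by simp
    also have "\<dots> \<le> (plane_const ?d * (reach * 2) ^ ?d * T ^ ?d) * (near_const * (c / T) ^ CARD('m))"
    proof (rule mult_right_mono)
      have "card ?R \<le> card (\<Lambda> \<inter> cball 0 (reach * (2 * T)))" by (intro card_mono finite_bounded) auto
      then show "real (card ?R) \<le> plane_const ?d * (reach * 2) ^ ?d * T ^ ?d" using cnt by linarith
    qed (use near_const_pos c T0 in auto)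
    also have "\<dots> = ?C * (c ^ CARD('m) * T ^ CARD('n))"
      using T0 by (simp add: power_mult_distrib power_divide power_add)
    finally show "(\<Sum>r\<in>?R. measure lebesgue (near 0 c r)) \<le> ?C * (c ^ CARD('m) * T ^ CARD('n))" .
  qed
qed

text \<open>The equation for \<open>D\<close> balances two demands. By \<open>bad_card_le\<close>
  the number of discarded vectors is of order T^2 D^(d - 1) = \<kappa> T^d, up to a term that is
  negligible for large \<open>B\<close>; and the factor |s|^(d - 2) / D^(d - 1) in
  \<open>tube_packing\<close> stays O(1 / \<kappa>).\<close>

lemma card_bad_shell:
  assumes \<epsilon>: "0 < (\<epsilon>::real)"
  shows "\<exists>\<kappa>>0. \<kappa> \<le> 1 \<and> (\<exists>B\<ge>1. \<forall>\<Lambda> a T D. lattice_min \<Lambda> a \<longrightarrow> 1 \<le> T \<longrightarrow> B \<le> T * a ^ (2 * (CARD('m) + CARD('n)) - 1) \<longrightarrow>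
     0 < D \<longrightarrow> D ^ (CARD('m) + CARD('n) - 1) = \<kappa> * T ^ (CARD('m) + CARD('n) - 2) \<longrightarrow>
     real (card {r \<in> shell \<Lambda> T (2 * T). \<exists>x\<in>\<Lambda>. 0 < gram x r \<and> gram x r \<le> D\<^sup>2}) \<le> \<epsilon> * T ^ (CARD('m) + CARD('n)))"
proof -
  let ?d = "CARD('m) + CARD('n)"
  let ?K = "last_min_const ?d"
  let ?K1 = "?K ^ (?d * ?d + 2 * ?d)"
  let ?P = "plane_const ?d"
  have d: "2 \<le> ?d" by (rule two_le_CARD_sum)
  have K: "1 \<le> ?K" by (rule last_min_const_ge_1)
  have K1: "1 \<le> ?K1" using K by (rule one_le_power)
  have P: "0 < ?P" by (rule plane_const_pos)
  have re: "1 \<le> reach" by (rule reach_ge_1)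
  have nc: "1 \<le> nconst\<^sup>2" using nconst(1) by (rule one_le_power)
  define \<kappa> where "\<kappa> = min 1 (min (1 / (4 * ?P)) (\<epsilon> / (2 * (bad_const ?d * (reach * 2)\<^sup>2 + 1))))"
  have den: "0 < bad_const ?d * (reach * 2)\<^sup>2 + 1" using bad_const_nonneg[of ?d] by (intro add_nonneg_pos mult_nonneg_nonneg) auto
  have \<kappa>: "0 < \<kappa>" "\<kappa> \<le> 1" "\<kappa> \<le> 1 / (4 * ?P)" "\<kappa> \<le> \<epsilon> / (2 * (bad_const ?d * (reach * 2)\<^sup>2 + 1))"
    using \<epsilon> den P by (auto simp: \<kappa>_def)
  let ?C = "(4 * real ?d * (reach * 2)) ^ (?d - 1)"
  have C0: "0 \<le> ?C" using re by simp
  \<comment> \<open>The summands after 1 ensure, in this order, that 2 D < |r|^2 in the shell, that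
    D a^(d - 1) >= 1 when d >= 3, and that the points in the exceptional subspace are few.\<close>
  define Z where "Z = 1 + 4 * nconst\<^sup>2 + 1 / \<kappa> + 2 * ?C / \<epsilon>"
  have Z: "1 \<le> Z" "4 * nconst\<^sup>2 \<le> Z" "1 / \<kappa> \<le> Z" "2 * ?C / \<epsilon> \<le> Z"
    using \<kappa>(1) \<epsilon> C0 nc divide_nonneg_pos[of "2 * ?C" \<epsilon>] zero_less_divide_1_iff[of \<kappa>] unfolding Z_def by linarith+
  define B where "B = ?K1 * Z"
  have B1: "1 \<le> B" unfolding B_def using mult_mono[OF K1 Z(1)] K1 by simp
  have KB: "?K1 / B = 1 / Z" unfolding B_def using K1 by (intro nonzero_divide_mult_cancel_left) linarith
  show ?thesis
  proof (rule exI[of _ \<kappa>], rule conjI[OF \<kappa>(1)], rule conjI[OF \<kappa>(2)], rule exI[of _ B], rule conjI[OF B1], intro allI impI)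
    fix \<Lambda> :: "((real ^ 'm) \<times> (real ^ 'n)) set" and a T D :: real
    assume "lattice_min \<Lambda> a" and T1: "1 \<le> T" and BT: "B \<le> T * a ^ (2 * ?d - 1)"
      and D: "0 < D" "D ^ (?d - 1) = \<kappa> * T ^ (?d - 2)"
    interpret lattice_min \<Lambda> a by fact
    note sb = scale_bounds[unfolded DIM_pair_cart, OF d B1 BT, unfolded KB]
    have T0: "0 < T" using T1 by simp
    have ZT: "Z \<le> T" using sb(3) Z(1) by (simp add: pos_le_divide_eq)
    obtain k where k: "?d = 2 + k" using le_Suc_ex[OF d] by blast
    have Dd: "D ^ Suc k = \<kappa> * T ^ k" using D(2) by (simp add: k)
    have aK: "a \<le> ?K" using a_le_const by (simp only: DIM_pair_cart)
    have DT: "D \<le> T"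
    proof (rule power_le_imp_le_base)
      have "\<kappa> * T ^ k \<le> 1 * T ^ Suc k" using \<kappa> T1 by (intro mult_mono power_increasing) auto
      then show "D ^ Suc k \<le> T ^ Suc k" unfolding Dd by simp
    qed (use T0 in simp)
    have BTk: "B \<le> T * a ^ (2 * k + 3)" using BT by (simp add: k numeral_3_eq_3)
    \<comment> \<open>The inequality is proved for the power d - 1, where the equation for
      \<open>D\<close> can be substituted. With d = j + 3 the comparison leaves the surplus power
      j^2 + 3 j + 1 of \<open>a\<close>, which is bounded by the same power of the constant in
      \<open>a_le_const\<close>.\<close>
    have D2: "1 \<le> D * a ^ (?d - 1)" if d3: "3 \<le> ?d"
    proof -
      obtain j where j: "k = Suc j" using d3 k by (cases k) auto
      have K0: "0 < ?K ^ (j * j + 3 * j + 1)" using K by (intro zero_less_power) linarith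
      have "(1::real) \<le> \<kappa> * Z" using Z(3) \<kappa>(1) by (simp add: field_simps)
      then have "1 * ?K ^ (j * j + 3 * j + 1) \<le> \<kappa> * Z * ?K ^ (j * j + 3 * j + 1)"
        using K0 by (intro mult_right_mono) auto
      also have "\<dots> \<le> \<kappa> * B"
      proof -
        have "?K ^ (j * j + 3 * j + 1) \<le> ?K1"
          by (rule power_increasing[OF _ K]) (simp add: k j algebra_simps)
        then have "\<kappa> * Z * ?K ^ (j * j + 3 * j + 1) \<le> \<kappa> * Z * ?K1"
          using \<kappa> Z(1) by (intro mult_left_mono) auto
        then show ?thesis by (simp add: B_def mult_ac)
      qed
      also have "\<kappa> * B \<le> \<kappa> * B ^ k" using \<kappa> B1 j by (intro mult_left_mono self_le_power) auto
      also have "\<dots> \<le> \<kappa> * (T * a ^ (2 * k + 3)) ^ k" using \<kappa> B1 BTk by (intro mult_left_mono power_mono) auto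
      also have "\<dots> = \<kappa> * T ^ k * (a ^ (k + 1)) ^ Suc k * a ^ (j * j + 3 * j + 1)"
      proof -
        have "(a ^ (2 * k + 3)) ^ k = (a ^ (k + 1)) ^ Suc k * a ^ (j * j + 3 * j + 1)"
          unfolding power_mult[symmetric] power_add[symmetric]
          by (rule arg_cong[where f = "\<lambda>i. a ^ i"]) (simp add: j algebra_simps)
        then show ?thesis by (simp add: power_mult_distrib)
      qed
      also have "\<dots> = (D * a ^ (k + 1)) ^ Suc k * a ^ (j * j + 3 * j + 1)"
        unfolding power_mult_distrib Dd by simp
      also have "\<dots> \<le> (D * a ^ (k + 1)) ^ Suc k * ?K ^ (j * j + 3 * j + 1)"
        using aK a_pos D by (intro mult_left_mono power_mono) auto
      finally have "1 \<le> (D * a ^ (k + 1)) ^ Suc k" by (simp only: mult_le_cancel_right_pos[OF K0])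
      then have "1 ^ Suc k \<le> (D * a ^ (k + 1)) ^ Suc k" by (simp only: power_one)
      then have "1 \<le> D * a ^ (k + 1)" by (rule power_le_imp_le_base) (use D a_pos in auto)
      then show ?thesis by (simp add: k)
    qed
    have small: "3 \<le> ?d \<or> 2 * ?P * D < 1"
    proof (cases "3 \<le> ?d")
      case False
      then have "k = 0" using k by simp
      then have "D = \<kappa>" using Dd by simp
      then have "2 * ?P * D \<le> 2 * ?P * (1 / (4 * ?P))" using \<kappa>(3) P by (intro mult_left_mono) auto
      also have "\<dots> = 1 / 2" using P by simp
      finally show ?thesis by linarith
    qed simp
    let ?S = "reach * (2 * T)"
    have aS: "a \<le> ?S"
    proof -
      have "a \<le> 1 / Z * T" by (rule sb(4))
      also have "\<dots> \<le> 1 * T" using Z(1) T0 by (intro mult_right_mono) auto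
      also have "\<dots> \<le> reach * 2 * T" using re T0 by (intro mult_right_mono) auto
      finally show ?thesis by simp
    qed
    let ?bad = "{s. primitive s \<and> norm s \<le> ?S \<and> 2 * D < (norm s)\<^sup>2 \<and> (\<exists>r\<in>\<Lambda>. 0 < gram r s \<and> gram r s \<le> D\<^sup>2)}"
    have "{r \<in> shell \<Lambda> T (2 * T). \<exists>x\<in>\<Lambda>. 0 < gram x r \<and> gram x r \<le> D\<^sup>2} \<subseteq> ?bad"
    proof
      fix r assume r: "r \<in> {r \<in> shell \<Lambda> T (2 * T). \<exists>x\<in>\<Lambda>. 0 < gram x r \<and> gram x r \<le> D\<^sup>2}"
      then have T': "T < N\<nu> (snd r)" by (auto simp: shell_def)
      have "norm (snd r) \<le> norm r" using norm_snd_le[of "snd r" "fst r"] by simp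
      then have "nconst * norm (snd r) \<le> nconst * norm r" using nconst(1) by (intro mult_left_mono) auto
      then have "T < nconst * norm r" using T' nconst(4)[of "snd r"] by linarith
      then have "T\<^sup>2 < (nconst * norm r)\<^sup>2" using T0 by (intro power_strict_mono) auto
      moreover have "2 * D * nconst\<^sup>2 < T\<^sup>2"
      proof -
        have "4 * nconst\<^sup>2 \<le> T" using Z(2) ZT by simp
        then have "T * (4 * nconst\<^sup>2) \<le> T * T" using T0 by (intro mult_left_mono) auto
        moreover have "D * nconst\<^sup>2 \<le> T * nconst\<^sup>2" using DT by (intro mult_right_mono) auto
        moreover have "0 < T * nconst\<^sup>2" by (intro mult_pos_pos T0) (use nc in linarith)
        ultimately show ?thesis unfolding power2_eq_square[of T] by linarith
      qed
      ultimately have "nconst\<^sup>2 * (2 * D) < nconst\<^sup>2 * (norm r)\<^sup>2" by (simp add: power_mult_distrib mult_ac)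
      then have "2 * D < (norm r)\<^sup>2" using nc by (simp add: mult_less_cancel_left)
      then show "r \<in> ?bad" using r by (auto simp: shell_def)
    qed
    moreover have "finite ?bad"
      by (rule finite_subset[OF _ finite_bounded[OF bounded_cball[of 0 ?S]]]) (auto simp: primitive_def)
    ultimately have "card {r \<in> shell \<Lambda> T (2 * T). \<exists>x\<in>\<Lambda>. 0 < gram x r \<and> gram x r \<le> D\<^sup>2} \<le> card ?bad"
      by (intro card_mono)
    also have "real (card ?bad) \<le> (4 * real ?d * ?S / a) ^ (?d - 1) + bad_const ?d * ?S\<^sup>2 * D ^ (?d - 1)"
      using bad_card_le[unfolded DIM_pair_cart, OF d D(1) D2 small aS] by simp
    also have "(4 * real ?d * ?S / a) ^ (?d - 1) \<le> \<epsilon> / 2 * T ^ ?d"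
    proof -
      have "1 / a ^ (?d - 1) \<le> 1 / Z * T"
      proof -
        have "?K ^ (k + 2) \<le> ?K1" by (rule power_increasing[OF _ K]) (simp add: k)
        then have "?K ^ (k + 2) * Z \<le> B" unfolding B_def using Z(1) by (intro mult_right_mono) auto
        also have "\<dots> \<le> T * (a ^ (k + 1) * a ^ (k + 2))"
        proof -
          have "a ^ (2 * k + 3) = a ^ (k + 1) * a ^ (k + 2)"
            unfolding power_add[symmetric] by (rule arg_cong[where f = "\<lambda>i. a ^ i"]) simp
          then show ?thesis using BTk by (simp only:)
        qed
        also have "\<dots> \<le> T * (a ^ (k + 1) * ?K ^ (k + 2))"
          using aK a_pos T0 by (intro mult_left_mono power_mono) auto
        finally have "?K ^ (k + 2) * Z \<le> ?K ^ (k + 2) * (T * a ^ (k + 1))" by (simp add: mult_ac)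
        then have "Z \<le> T * a ^ (k + 1)" using K by (simp add: mult_le_cancel_left)
        then show ?thesis using a_pos Z(1) by (simp add: k field_simps)
      qed
      then have "?C * T ^ (?d - 1) * (1 / a ^ (?d - 1)) \<le> ?C * T ^ (?d - 1) * (1 / Z * T)"
        using C0 T0 by (intro mult_left_mono) auto
      also have "\<dots> = ?C / Z * T ^ ?d" by (simp add: k)
      also have "\<dots> \<le> \<epsilon> / 2 * T ^ ?d"
        using Z(1,4) \<epsilon> T0 by (intro mult_right_mono) (auto simp: field_simps)
      also have "?C * T ^ (?d - 1) * (1 / a ^ (?d - 1)) = (4 * real ?d * ?S / a) ^ (?d - 1)"
        unfolding power_mult_distrib power_divide by simp
      finally show ?thesis .
    qed
    also have "bad_const ?d * ?S\<^sup>2 * D ^ (?d - 1) \<le> \<epsilon> / 2 * T ^ ?d"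
    proof -
      have "bad_const ?d * ?S\<^sup>2 * D ^ (?d - 1) = bad_const ?d * (reach * 2)\<^sup>2 * \<kappa> * T ^ ?d"
        unfolding D(2) by (simp add: k power_mult_distrib power2_eq_square)
      also have "\<dots> \<le> \<epsilon> / 2 * T ^ ?d"
      proof (intro mult_right_mono)
        have "bad_const ?d * (reach * 2)\<^sup>2 * \<kappa> \<le> (bad_const ?d * (reach * 2)\<^sup>2 + 1) * (\<epsilon> / (2 * (bad_const ?d * (reach * 2)\<^sup>2 + 1)))"
          using \<kappa> den bad_const_nonneg[of ?d] by (intro mult_mono) auto
        also have "\<dots> = \<epsilon> / 2"
        proof -
          have "w * (\<epsilon> / (2 * w)) = \<epsilon> / 2" if "0 < w" for w using that by simp
          from this[OF den] show ?thesis .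
        qed
        finally show "bad_const ?d * (reach * 2)\<^sup>2 * \<kappa> \<le> \<epsilon> / 2" .
      qed (use T0 in auto)
      finally show ?thesis .
    qed
    finally show "real (card {r \<in> shell \<Lambda> T (2 * T). \<exists>x\<in>\<Lambda>. 0 < gram x r \<and> gram x r \<le> D\<^sup>2}) \<le> \<epsilon> * T ^ ?d" by simp
  qed
qed

end

subsection \<open>Overlaps of resonant sets\<close>

definition perp :: "'a::real_inner \<Rightarrow> 'a \<Rightarrow> 'a" where
  "perp q x = x - ((x \<bullet> q) / (q \<bullet> q)) *\<^sub>R q"

lemma perp_inner: "perp q x \<bullet> q = 0"
  by (simp add: perp_def inner_diff_left)

lemma perp_add: "perp q (x + y) = perp q x + perp q y"
  by (simp add: perp_def inner_add_left add_divide_distrib scaleR_left_distrib)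

lemma perp_multiple: "perp q (t *\<^sub>R q) = 0"
  by (cases "q = 0") (simp_all add: perp_def)

lemma perp_inner_self: "perp q x \<bullet> x = (norm (perp q x))\<^sup>2"
proof -
  have "perp q x \<bullet> perp q x = perp q x \<bullet> x - ((x \<bullet> q) / (q \<bullet> q)) * (perp q x \<bullet> q)"
    by (subst (2) perp_def) (simp add: inner_diff_right)
  then show ?thesis by (simp add: perp_inner power2_norm_eq_inner)
qed

lemma norm_perp_le: "norm (perp q x) \<le> norm x"
proof (cases "perp q x = 0")
  case False
  have "norm (perp q x) * norm (perp q x) \<le> norm (perp q x) * norm x"
    using norm_cauchy_schwarz[of "perp q x" x] by (simp add: perp_inner_self power2_eq_square)
  then show ?thesis using False by simp
qed simp

text \<open>The area is |s| times the distance of \<open>x\<close> from the line of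
  \<open>s\<close>, so a lower bound on the area keeps \<open>x\<close> away from every point of
  that line.\<close>

lemma gram_le_dist: "gram x s \<le> (norm s)\<^sup>2 * (norm (x - t *\<^sub>R s))\<^sup>2"
proof -
  have "gram x s = gram s (x + (- t) *\<^sub>R s)" by (simp only: gram_add_multiple gram_commute)
  also have "\<dots> \<le> (norm s)\<^sup>2 * (norm (x + (- t) *\<^sub>R s))\<^sup>2" unfolding gram_def by simp
  finally show ?thesis by simp
qed

context unimodular
begin

lemma primitive_norm_le:
  assumes s: "primitive s" and z: "z \<in> \<Lambda>" "z \<noteq> 0" "z \<in> span {s}"
  shows "norm s \<le> norm z"
proof -
  obtain v where v: "v \<in> (\<Lambda> \<inter> span {s}) - {0}" "\<And>y. y \<in> (\<Lambda> \<inter> span {s}) - {0} \<Longrightarrow> norm v \<le> norm y"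
    using norm_minimizer[of "(\<Lambda> \<inter> span {s}) - {0}"] z by blast
  obtain c where c: "v = c *\<^sub>R s" using v(1) by (auto simp: span_singleton)
  then have "c \<noteq> 0" using v(1) by auto
  then have "s = (1 / c) *\<^sub>R v" using c by simp
  then have sv: "s \<in> span {v}" by (metis span_base span_scale insertI1)
  have "span {v} \<subseteq> span {s}" using v(1) by (intro span_minimal) auto
  then have "norm s = norm v"
    using v s sv by (intro primitive_in_span_shortest) (auto simp: primitive_def)
  then show ?thesis using v(2)[of z] z by auto
qed

end

context two_norms
begin

definition "pair_geom = 2 * CARD('m) * CARD('n) + nconst + 2 * nconst ^ 3"

lemma pair_geom_ge_1: "1 \<le> pair_geom"
proof -
  have "0 \<le> real (2 * CARD('m) * CARD('n))" by simp
  then show ?thesis unfolding pair_geom_def using nconst(1) one_le_power[OF nconst(1), of 3] by linarith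
qed

lemma snd_norm_bounds:
  assumes "S < N\<nu> (snd s)" "0 < S" shows "S / nconst < norm (snd s)" "snd s \<noteq> 0"
proof -
  have c0: "0 < nconst" using nconst(1) by simp
  have "S < nconst * norm (snd s)" using nconst(4)[of "snd s"] assms by linarith
  then show "S / nconst < norm (snd s)" using c0 by (simp add: pos_divide_less_eq mult.commute)
  show "snd s \<noteq> 0" using assms is_norm_zero[OF N\<nu>] by auto
qed

text \<open>Split \<open>snd r\<close> into \<gamma> times \<open>snd s\<close> and an orthogonal
  part u. A common matrix takes \<open>snd r\<close> close to \<open>fst r\<close> and
  \<open>snd s\<close> close to \<open>fst s\<close>, so \<open>fst r\<close> differs from \<gamma>
  times \<open>fst s\<close> by O(|u|) and the two approximation errors. As |\<gamma>| = O(T / S),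
  the error at \<open>s\<close> is magnified to O(cs T / S).\<close>

lemma near_pair_geometry:
  assumes A: "A \<in> near 0 cs s \<inter> near 0 c r" and S: "0 < S" "S < N\<nu> (snd s)" "S \<le> T"
    and r: "N\<nu> (snd r) \<le> 2 * T" and c: "0 < c" "c \<le> cs"
  shows "norm (fst r - ((snd r \<bullet> snd s) / (snd s \<bullet> snd s)) *\<^sub>R fst s)
     \<le> pair_geom * (norm (perp (snd s) (snd r)) + cs * T / S)"
proof -
  let ?q = "snd s" and ?q' = "snd r"
  let ?\<gamma> = "(?q' \<bullet> ?q) / (?q \<bullet> ?q)"
  let ?u = "perp ?q ?q'"
  have c0: "0 < nconst" using nconst(1) by simp
  have A1: "A \<in> box_matrices 1" using A box_matrices_mono[of 0 1] by (auto simp: near_def)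
  have nq: "S / nconst < norm ?q" "?q \<noteq> 0" by (rule snd_norm_bounds[OF S(2,1)])+
  have nq': "norm ?q' \<le> nconst * (2 * T)"
    by (rule order_trans[OF nconst(5) mult_left_mono[OF r]]) (use c0 in simp)
  have g: "\<bar>?\<gamma>\<bar> \<le> 2 * nconst\<^sup>2 * (T / S)"
  proof -
    have "\<bar>?\<gamma>\<bar> = \<bar>?q' \<bullet> ?q\<bar> / (norm ?q * norm ?q)"
      by (simp add: dot_square_norm power2_eq_square)
    also have "\<dots> \<le> norm ?q' * norm ?q / (norm ?q * norm ?q)"
      by (intro divide_right_mono Cauchy_Schwarz_ineq2) simp
    also have "\<dots> = norm ?q' / norm ?q" using nq(2) by simp
    also have "\<dots> \<le> nconst * (2 * T) / (S / nconst)"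
      using nq nq' S c0 by (intro frac_le) auto
    also have "\<dots> = 2 * nconst\<^sup>2 * (T / S)" by (simp add: power2_eq_square)
    finally show ?thesis .
  qed
  have q': "?q' = ?\<gamma> *\<^sub>R ?q + ?u" by (simp add: perp_def)
  have Aq': "A *v ?q' = ?\<gamma> *\<^sub>R (A *v ?q) + A *v ?u"
    by (subst q') (simp only: matrix_vector_right_distrib matrix_vector_mult_scaleR)
  have "fst r - ?\<gamma> *\<^sub>R fst s = A *v ?u - (A *v ?q' - fst r) + ?\<gamma> *\<^sub>R (A *v ?q - fst s)"
    by (simp only: Aq') (simp add: algebra_simps)
  also have "norm \<dots> \<le> norm (A *v ?u) + norm (A *v ?q' - fst r) + norm (?\<gamma> *\<^sub>R (A *v ?q - fst s))"
    by (intro order_trans[OF norm_triangle_ineq] add_right_mono norm_triangle_ineq4)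
  also have "\<dots> \<le> 2 * CARD('m) * CARD('n) * norm ?u + nconst * cs + 2 * nconst\<^sup>2 * (T / S) * (nconst * cs)"
  proof (intro add_mono)
    show "norm (A *v ?u) \<le> 2 * CARD('m) * CARD('n) * norm ?u" by (rule norm_box_matrix_mult_le[OF A1])
    have "N\<mu> (A *v ?q' - fst r) \<le> cs" using A c by (auto simp: near_def)
    then show "norm (A *v ?q' - fst r) \<le> nconst * cs"
      using nconst(3)[of "A *v ?q' - fst r"] mult_left_mono[of _ cs nconst] c0 by (meson less_imp_le order_trans)
    have "N\<mu> (A *v ?q - fst s) \<le> cs" using A by (auto simp: near_def)
    then have "norm (A *v ?q - fst s) \<le> nconst * cs"
      using nconst(3)[of "A *v ?q - fst s"] mult_left_mono[of _ cs nconst] c0 by (meson less_imp_le order_trans)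
    then show "norm (?\<gamma> *\<^sub>R (A *v ?q - fst s)) \<le> 2 * nconst\<^sup>2 * (T / S) * (nconst * cs)"
      unfolding norm_scaleR using S c0 by (intro mult_mono g) auto
  qed
  also have "\<dots> \<le> 2 * CARD('m) * CARD('n) * norm ?u + (nconst + 2 * nconst ^ 3) * (cs * T / S)"
  proof -
    have "cs * 1 \<le> cs * (T / S)" using c S by (intro mult_left_mono) auto
    then have "cs \<le> cs * T / S" by simp
    then have "nconst * cs \<le> nconst * (cs * T / S)" by (rule mult_left_mono) (use c0 in simp)
    moreover have "2 * nconst\<^sup>2 * (T / S) * (nconst * cs) = 2 * nconst ^ 3 * (cs * T / S)"
      by (simp add: power2_eq_square power3_eq_cube)
    ultimately show ?thesis by (simp only: distrib_right)
  qed
  also have "\<dots> \<le> pair_geom * norm ?u + pair_geom * (cs * T / S)"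
    using c0 c S by (intro add_mono mult_right_mono) (auto simp: pair_geom_def)
  finally show ?thesis by (simp only: distrib_left)
qed

text \<open>Let u be the part of \<open>snd r\<close> orthogonal to \<open>snd s\<close>. If u is
  long, perturbing along u moves the constraint of \<open>r\<close> and leaves that of
  \<open>s\<close> alone, so the measure is of order (c / |u|)^m (cs / S)^m, as for independent
  sets. If |u| < cs T / S, dropping the constraint of \<open>s\<close> gives (c / T)^m. The
  denominator |u| + cs T / S covers both cases.\<close>

lemma measure_near_pair_le:
  assumes S: "0 < S" "S < N\<nu> (snd s)" "S \<le> T"
    and r: "T < N\<nu> (snd r)" and c: "0 < c" "c \<le> cs"
  shows "measure lebesgue (near 0 cs s \<inter> near 0 c r)
     \<le> near_const * (2 * nconst) ^ CARD('m) * (c * cs / (S * (norm (perp (snd s) (snd r)) + cs * T / S))) ^ CARD('m)"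
proof -
  let ?u = "perp (snd s) (snd r)"
  let ?m = "CARD('m)"
  let ?X = "near 0 cs s \<inter> near 0 c r"
  have c0: "1 \<le> nconst" by (rule nconst(1))
  have \<beta>: "0 < cs * T / S" using c S by simp
  have Xb: "?X \<in> sets borel" by (intro sets.Int near_borel)
  have Xm: "?X \<in> lmeasurable" by (intro fmeasurable.Int near_lmeasurable)
  show ?thesis
  proof (cases "cs * T / S \<le> norm ?u")
    case True
    then have u0: "0 < norm ?u" using \<beta> by linarith
    have "(norm ?u / nconst) ^ ?m * measure lebesgue ?X \<le> c ^ ?m * measure lebesgue (near 1 cs s)"
    proof (rule measure_le_rank_one_average[OF Xb Xm near_borel near_lmeasurable])
      show "0 \<le> norm ?u / nconst" "0 \<le> c" using c0 c by auto
      show "?u \<noteq> 0" using u0 by auto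
      show "?u \<bullet> snd r = (norm ?u)\<^sup>2" by (rule perp_inner_self)
      show "N\<mu> (A *v snd r - fst r) \<le> c" if "A \<in> ?X" for A using that by (auto simp: near_def)
      fix A e assume A: "A \<in> ?X" and e: "N\<mu> e \<le> norm ?u / nconst"
      have "norm e \<le> nconst * (norm ?u / nconst)"
        by (rule order_trans[OF nconst(3) mult_left_mono[OF e]]) (use c0 in simp)
      then have "norm e / norm ?u \<le> 1" using c0 u0 by simp
      then have comp: "\<bar>rank_one e ?u $ i $ j\<bar> \<le> 1" for i j
        using rank_one_component_le[of e ?u i j] by linarith
      have "A + rank_one e ?u \<in> box_matrices 1" unfolding box_matrices_def
      proof (intro CollectI allI)
        fix i j
        have "0 \<le> A $ i $ j" "A $ i $ j \<le> 1" using A by (auto simp: near_def box_matrices_def)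
        then show "- 1 \<le> (A + rank_one e ?u) $ i $ j \<and> (A + rank_one e ?u) $ i $ j \<le> 1 + 1"
          using comp[of i j] by (simp add: abs_le_iff)
      qed
      moreover have "(A + rank_one e ?u) *v snd s = A *v snd s"
        by (simp add: matrix_vector_mult_add_rdistrib rank_one_mult perp_inner)
      ultimately show "A + rank_one e ?u \<in> near 1 cs s" using A by (simp add: near_def)
    qed
    also have "\<dots> \<le> c ^ ?m * (near_const * (cs / S) ^ ?m)"
      using c S by (intro mult_left_mono measure_near_le) auto
    finally have "measure lebesgue ?X \<le> c ^ ?m * (near_const * (cs / S) ^ ?m) / (norm ?u / nconst) ^ ?m"
      using u0 c0 by (simp add: pos_le_divide_eq mult.commute)
    also have "\<dots> = near_const * (nconst * (c * cs / (S * norm ?u))) ^ ?m"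
      by (simp add: power_mult_distrib power_divide)
    also have "\<dots> \<le> near_const * (2 * nconst * (c * cs / (S * (norm ?u + cs * T / S)))) ^ ?m"
    proof (intro mult_left_mono power_mono)
      have "S * (norm ?u + cs * T / S) \<le> 2 * (S * norm ?u)" using True S by simp
      then have "c * cs / (2 * (S * norm ?u)) \<le> c * cs / (S * (norm ?u + cs * T / S))"
        using c S u0 \<beta> by (intro divide_left_mono mult_pos_pos add_pos_pos) auto
      then have "nconst * (c * cs / (S * norm ?u) / 2) \<le> nconst * (c * cs / (S * (norm ?u + cs * T / S)))"
        using c0 by (intro mult_left_mono) (simp_all add: mult.commute)
      then show "nconst * (c * cs / (S * norm ?u)) \<le> 2 * nconst * (c * cs / (S * (norm ?u + cs * T / S)))" by simp
    qed (use near_const_pos c0 c S in auto)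
    finally show ?thesis by (simp only: power_mult_distrib mult.assoc)
  next
    case False
    have "measure lebesgue ?X \<le> measure lebesgue (near 0 c r)"
      by (intro measure_mono_fmeasurable) (use Xb in auto)
    also have "\<dots> \<le> near_const * (c / T) ^ ?m" using S r c by (intro measure_near_le) auto
    also have "\<dots> \<le> near_const * (2 * nconst * (c * cs / (S * (norm ?u + cs * T / S)))) ^ ?m"
    proof (intro mult_left_mono power_mono)
      have T0: "0 < T" using S by simp
      have "S * (norm ?u + cs * T / S) \<le> 2 * (cs * T)"
      proof -
        have "S * norm ?u \<le> S * (cs * T / S)" using False S by (intro mult_left_mono) auto
        then show ?thesis using S by (simp add: distrib_left mult.commute)
      qed
      then have "c * cs / (2 * (cs * T)) \<le> c * cs / (S * (norm ?u + cs * T / S))"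
        using c S T0 \<beta> by (intro divide_left_mono mult_pos_pos add_nonneg_pos) auto
      moreover have "c * cs / (2 * (cs * T)) = c / T / 2" using c by simp
      ultimately have "c / T / 2 \<le> c * cs / (S * (norm ?u + cs * T / S))" by simp
      moreover have "x \<le> 2 * y" if "x / 2 \<le> y" for x y :: real using that by simp
      ultimately have "c / T \<le> 2 * (c * cs / (S * (norm ?u + cs * T / S)))" by blast
      also have "\<dots> \<le> (2 * nconst) * (c * cs / (S * (norm ?u + cs * T / S)))"
        using c0 c S \<beta> by (intro mult_right_mono divide_nonneg_nonneg mult_nonneg_nonneg) auto
      finally show "c / T \<le> 2 * nconst * (c * cs / (S * (norm ?u + cs * T / S)))" .
    qed (use near_const_pos c S in auto)
    finally show ?thesis by (simp only: power_mult_distrib mult.assoc)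
  qed
qed

text \<open>The fibre over each point of the second factor is a ball whose radius is K times
  \<open>w\<close> there, and its volume cancels the weight. Hence the integral depends neither on
  \<open>w\<close> nor on the centre curve.\<close>

lemma tube_integral:
  fixes p0 :: "real ^ 'm" and q :: "real ^ 'n" and \<gamma> :: "real ^ 'n \<Rightarrow> real"
  assumes w: "continuous_on UNIV w" "\<And>x. 0 < w x" and \<gamma>: "continuous_on UNIV \<gamma>" and K: "0 \<le> K" "0 \<le> L"
  defines "G \<equiv> {x. norm (snd x) \<le> L \<and> norm (fst x - \<gamma> (snd x) *\<^sub>R p0) \<le> K * w (snd x)}"
  shows "G \<in> sets borel"
    "(\<integral>\<^sup>+x. ennreal (1 / w (snd x) ^ CARD('m)) * indicator G x \<partial>lborel)
      = ennreal (unit_ball_vol CARD('m) * K ^ CARD('m) * (unit_ball_vol CARD('n) * L ^ CARD('n)))"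
proof -
  let ?m = "CARD('m)"
  have ws: "continuous_on UNIV (\<lambda>x :: (real ^ 'm) \<times> (real ^ 'n). w (snd x))"
    by (intro continuous_on_compose2[OF w(1)] continuous_intros) auto
  have \<gamma>s: "continuous_on UNIV (\<lambda>x :: (real ^ 'm) \<times> (real ^ 'n). \<gamma> (snd x))"
    by (intro continuous_on_compose2[OF \<gamma>] continuous_intros) auto
  have "closed G" unfolding G_def
    by (intro closed_Collect_conj closed_Collect_le continuous_intros ws \<gamma>s)
  then show G: "G \<in> sets borel" by (rule borel_closed)
  let ?h = "\<lambda>x :: (real ^ 'm) \<times> (real ^ 'n). ennreal (1 / w (snd x) ^ ?m) * indicator G x"
  have "(\<lambda>x :: (real ^ 'm) \<times> (real ^ 'n). 1 / w (snd x) ^ ?m) \<in> borel_measurable borel"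
    using w(2) by (intro borel_measurable_continuous_onI continuous_intros ws) (auto simp: less_imp_neq[symmetric])
  then have "?h \<in> borel_measurable borel"
    using G by (intro borel_measurable_times_ennreal measurable_compose[OF _ measurable_ennreal] borel_measurable_indicator)
  then have hm: "?h \<in> borel_measurable (lborel \<Otimes>\<^sub>M lborel)" unfolding lborel_prod by simp
  have "(\<integral>\<^sup>+x. ?h x \<partial>lborel) = (\<integral>\<^sup>+x. ?h x \<partial>(lborel \<Otimes>\<^sub>M lborel))" by (simp only: lborel_prod)
  also have "\<dots> = (\<integral>\<^sup>+q. \<integral>\<^sup>+p. ?h (p, q) \<partial>lborel \<partial>lborel)"
    by (rule lborel_pair.nn_integral_snd[OF hm, symmetric])
  also have "\<dots> = (\<integral>\<^sup>+q. ennreal (unit_ball_vol ?m * K ^ ?m) * indicator (cball (0 :: real ^ 'n) L) q \<partial>lborel)"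
  proof (rule nn_integral_cong)
    fix q :: "real ^ 'n"
    have "(\<integral>\<^sup>+p. ?h (p, q) \<partial>lborel) = (\<integral>\<^sup>+p. (ennreal (1 / w q ^ ?m) * indicator (cball 0 L) q) * indicator (cball (\<gamma> q *\<^sub>R p0) (K * w q)) p \<partial>lborel)"
      by (intro nn_integral_cong) (auto simp: G_def indicator_def dist_norm norm_minus_commute)
    also have "\<dots> = (ennreal (1 / w q ^ ?m) * indicator (cball 0 L) q) * emeasure lborel (cball (\<gamma> q *\<^sub>R p0) (K * w q))"
      by (intro nn_integral_cmult_indicator) simp
    also have "emeasure lborel (cball (\<gamma> q *\<^sub>R p0) (K * w q)) = ennreal (unit_ball_vol ?m * (K * w q) ^ ?m)"
      using K w(2)[of q] by (subst emeasure_cball) auto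
    also have "(ennreal (1 / w q ^ ?m) * indicator (cball 0 L) q) * ennreal (unit_ball_vol ?m * (K * w q) ^ ?m)
       = ennreal (1 / w q ^ ?m * (unit_ball_vol ?m * (K * w q) ^ ?m)) * indicator (cball 0 L) q"
      using w(2)[of q] K by (subst ennreal_mult) (auto simp: mult_ac)
    also have "1 / w q ^ ?m * (unit_ball_vol ?m * (K * w q) ^ ?m) = unit_ball_vol ?m * K ^ ?m"
      using w(2)[of q] by (simp add: power_mult_distrib)
    finally show "(\<integral>\<^sup>+p. ?h (p, q) \<partial>lborel) = ennreal (unit_ball_vol ?m * K ^ ?m) * indicator (cball 0 L) q" .
  qed
  also have "\<dots> = ennreal (unit_ball_vol ?m * K ^ ?m) * emeasure lborel (cball (0 :: real ^ 'n) L)"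
    by (intro nn_integral_cmult_indicator) simp
  also have "emeasure lborel (cball (0 :: real ^ 'n) L) = ennreal (unit_ball_vol CARD('n) * L ^ CARD('n))"
    using K by (subst emeasure_cball) auto
  also have "ennreal (unit_ball_vol ?m * K ^ ?m) * ennreal (unit_ball_vol CARD('n) * L ^ CARD('n))
     = ennreal (unit_ball_vol ?m * K ^ ?m * (unit_ball_vol CARD('n) * L ^ CARD('n)))"
    using K by (subst ennreal_mult) auto
  finally show "(\<integral>\<^sup>+x. ?h x \<partial>lborel) = ennreal (unit_ball_vol ?m * K ^ ?m * (unit_ball_vol CARD('n) * L ^ CARD('n)))" .
qed

end

lemma sum_weights_le_integral:
  fixes b :: "'i \<Rightarrow> 'a::euclidean_space set" and h :: "'a \<Rightarrow> ennreal"
  assumes I: "finite I" and h: "h \<in> borel_measurable borel" and b: "\<And>i. i \<in> I \<Longrightarrow> b i \<in> sets borel"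
    and disj: "\<And>i j. i \<in> I \<Longrightarrow> j \<in> I \<Longrightarrow> i \<noteq> j \<Longrightarrow> b i \<inter> b j = {}"
    and g: "\<And>i x. i \<in> I \<Longrightarrow> x \<in> b i \<Longrightarrow> g i \<le> h x"
  shows "(\<Sum>i\<in>I. g i * emeasure lborel (b i)) \<le> (\<integral>\<^sup>+x. h x \<partial>lborel)"
proof -
  have "(\<Sum>i\<in>I. g i * emeasure lborel (b i)) = (\<Sum>i\<in>I. \<integral>\<^sup>+x. g i * indicator (b i) x \<partial>lborel)"
    using b by (intro sum.cong refl nn_integral_cmult_indicator[symmetric]) auto
  also have "\<dots> \<le> (\<Sum>i\<in>I. \<integral>\<^sup>+x. h x * indicator (b i) x \<partial>lborel)"
    using g by (intro sum_mono nn_integral_mono) (auto simp: indicator_def)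
  also have "\<dots> = (\<integral>\<^sup>+x. (\<Sum>i\<in>I. h x * indicator (b i) x) \<partial>lborel)"
    using b h by (intro nn_integral_sum[symmetric]) auto
  also have "\<dots> \<le> (\<integral>\<^sup>+x. h x \<partial>lborel)"
  proof (rule nn_integral_mono)
    fix x
    show "(\<Sum>i\<in>I. h x * indicator (b i) x) \<le> h x"
    proof (cases "\<exists>i\<in>I. x \<in> b i")
      case True
      then obtain i where i: "i \<in> I" "x \<in> b i" by auto
      have "(\<Sum>j\<in>I. h x * indicator (b j) x) = (\<Sum>j\<in>{i}. h x * indicator (b j) x)"
        by (rule sum.mono_neutral_right) (use I i disj in \<open>auto simp: indicator_def\<close>)
      then show ?thesis using i by simp
    next
      case False
      then have "(\<Sum>i\<in>I. h x * indicator (b i) x) = 0" by (intro sum.neutral) (auto simp: indicator_def)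
      then show ?thesis by simp
    qed
  qed
  finally show ?thesis .
qed

section \<open>Packing a tube about the line of a lattice vector\<close>

context two_norms
begin

definition "tube_width = 2 * pair_geom + 1 + 2 * reach * nconst"

definition "tube_length = 2 * nconst + 3 * reach"

text \<open>The factors stem, in turn, from the comparison of the given weight with
  \<open>w\<close>, from the variation of \<open>w\<close> over a ball, from
  \<open>tube_integral\<close>, and from the total volume of the balls that belong to one lattice
  point.\<close>

definition "tube_const = (2 + pair_geom) ^ CARD('m) * (3 / 2) ^ CARD('m) *
   (unit_ball_vol CARD('m) * tube_width ^ CARD('m) * (unit_ball_vol CARD('n) * tube_length ^ CARD('n))) *
   2 ^ (CARD('m) + CARD('n) + 1) / unit_ball_vol (CARD('m) + CARD('n))"

definition "pair_const = near_const * (2 * nconst) ^ CARD('m) * tube_const * (2 * reach) ^ (CARD('m) + CARD('n) - 2)"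

lemma tube_consts_pos: "0 < tube_width" "0 < tube_length" "0 < tube_const" "0 < pair_const"
proof -
  show 1: "0 < tube_width" "0 < tube_length"
    using pair_geom_ge_1 reach_ge_1 nconst(1) unfolding tube_width_def tube_length_def
    by (intro add_pos_nonneg mult_nonneg_nonneg; simp)+
  have "0 < 2 + pair_geom" using pair_geom_ge_1 by simp
  then show 2: "0 < tube_const" unfolding tube_const_def using 1 by (intro divide_pos_pos mult_pos_pos zero_less_power) auto
  have "0 < 2 * nconst" "0 < 2 * reach" using nconst(1) reach_ge_1 by auto
  then show "0 < pair_const" unfolding pair_const_def using 2 near_const_pos by (intro mult_pos_pos zero_less_power) auto
qed

text \<open>No lattice vector off the line of \<open>s\<close> comes within \<open>w0 = D / norm s\<close> of that line, so the balls
  of radius \<open>w0 / 2\<close> about the points \<open>r + (j * w0 / norm s) *\<^sub>R s\<close> are disjoint. They fill a tube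
  about a graph over the second factor, on which the weight integrates to \<open>O (T ^ n)\<close>.\<close>

lemma tube_packing:
  fixes \<Lambda> :: "((real ^ 'm) \<times> (real ^ 'n)) set"
  assumes "lattice_min \<Lambda> a" and s: "unimodular.primitive \<Lambda> s"
    and S: "0 < S" "S < N\<nu> (snd s)" "norm s \<le> reach * (2 * S)" "S \<le> T"
    and D: "0 < D" "D \<le> (norm s)\<^sup>2" and good: "\<And>x. x \<in> \<Lambda> \<Longrightarrow> 0 < gram x s \<Longrightarrow> D\<^sup>2 < gram x s"
    and b: "0 < b" and R: "finite R" "R \<subseteq> \<Lambda>" "\<And>r. r \<in> R \<Longrightarrow> r \<notin> span {s}" "\<And>r. r \<in> R \<Longrightarrow> N\<nu> (snd r) \<le> 2 * T"
    and geom: "\<And>r. r \<in> R \<Longrightarrow> norm (fst r - ((snd r \<bullet> snd s) / (snd s \<bullet> snd s)) *\<^sub>R fst s)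
         \<le> pair_geom * (norm (perp (snd s) (snd r)) + b)"
  shows "(\<Sum>r\<in>R. 1 / (norm (perp (snd s) (snd r)) + b) ^ CARD('m))
     \<le> tube_const * T ^ CARD('n) * (norm s ^ (CARD('m) + CARD('n) - 2) / D ^ (CARD('m) + CARD('n) - 1))"
proof -
  interpret lattice_min \<Lambda> a by fact
  let ?m = "CARD('m)" and ?n = "CARD('n)" and ?d = "CARD('m) + CARD('n)" and ?q = "snd s"
  let ?\<gamma> = "\<lambda>x. (x \<bullet> ?q) / (?q \<bullet> ?q)"
  let ?v = "\<lambda>r. norm (perp ?q (snd r)) + b"
  have d: "2 \<le> ?d" by (rule two_le_CARD_sum)
  have nc: "1 \<le> nconst" and re: "1 \<le> reach" and pg: "1 \<le> pair_geom"
    by (rule nconst(1) reach_ge_1 pair_geom_ge_1)+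
  have nq: "S / nconst < norm ?q" "?q \<noteq> 0" by (rule snd_norm_bounds[OF S(2,1)])+
  have s0: "s \<noteq> 0" "s \<in> \<Lambda>" using s by (auto simp: primitive_def)
  have ns: "0 < norm s" using s0 by simp
  have T0: "0 < T" using S by simp
  define w0 where "w0 = D / norm s"
  have w0: "0 < w0" "w0 \<le> norm s" using D ns by (auto simp: w0_def divide_le_eq power2_eq_square)
  \<comment> \<open>The summand \<open>w0\<close> makes the weight vary by a bounded factor only
    over a ball of radius w0 / 2. At the points of \<open>R\<close> it changes the weight by no more
    than a constant factor, as \<open>wv\<close> shows.\<close>
  define w where "w x = norm (perp ?q x) + b + w0" for x
  have w_pos: "0 < w x" for x using b w0 by (simp add: w_def add_nonneg_pos)
  have w_cont: "continuous_on UNIV w"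
    unfolding w_def perp_def using nq(2) by (intro continuous_intros) auto
  have \<gamma>_cont: "continuous_on UNIV ?\<gamma>" using nq(2) by (intro continuous_intros) auto
  have far: "w0 < norm (x - t *\<^sub>R s)" if x: "x \<in> \<Lambda>" "x \<notin> span {s}" for x t
  proof -
    have "0 < gram x s" using gram_pos[OF s0(1) x(2)] by (simp add: gram_commute)
    then have "D\<^sup>2 < (norm s)\<^sup>2 * (norm (x - t *\<^sub>R s))\<^sup>2" using good[OF x(1)] gram_le_dist[of x s t] by linarith
    then have "D\<^sup>2 < (norm s * norm (x - t *\<^sub>R s))\<^sup>2" by (simp add: power_mult_distrib)
    then have "D < norm s * norm (x - t *\<^sub>R s)" by (rule power_less_imp_less_base) simp
    then show ?thesis using ns by (simp add: w0_def pos_divide_less_eq mult.commute)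
  qed
  have wv: "w (snd r) \<le> (2 + pair_geom) * ?v r" if r: "r \<in> R" for r
  proof -
    let ?t = "?\<gamma> (snd r)"
    have "w0 < norm (r - ?t *\<^sub>R s)" using r R by (intro far) auto
    also have "\<dots> \<le> norm (fst r - ?t *\<^sub>R fst s) + norm (snd r - ?t *\<^sub>R snd s)"
    proof -
      have "norm z \<le> norm (fst z) + norm (snd z)" for z :: "(real ^ 'm) \<times> (real ^ 'n)"
        using norm_Pair_le[of "fst z" "snd z"] by simp
      from this[of "r - ?t *\<^sub>R s"] show ?thesis by simp
    qed
    also have "snd r - ?t *\<^sub>R snd s = perp ?q (snd r)" by (simp add: perp_def)
    also have "norm (fst r - ?t *\<^sub>R fst s) + norm (perp ?q (snd r)) \<le> pair_geom * ?v r + ?v r"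
      using geom[OF r] b by (intro add_mono) auto
    finally have "w0 \<le> (1 + pair_geom) * ?v r" by (simp add: algebra_simps)
    then show ?thesis by (simp add: w_def algebra_simps)
  qed
  define J where "J = nat \<lfloor>norm s / w0\<rfloor>"
  have J: "real J * w0 \<le> norm s" "norm s \<le> 2 * (real J * w0)"
  proof -
    have "1 \<le> norm s / w0" using w0 by simp
    then have "1 \<le> \<lfloor>norm s / w0\<rfloor>" by simp
    then have "real J \<le> norm s / w0" "norm s / w0 < real J + 1" "1 \<le> real J" unfolding J_def by linarith+
    then have "real J \<le> norm s / w0" "norm s / w0 \<le> 2 * real J" by linarith+
    then show "real J * w0 \<le> norm s" "norm s \<le> 2 * (real J * w0)" using w0(1) by (auto simp: field_simps)
  qed
  have J0: "0 < real J" using J(2) ns w0(1) by (cases "J = 0") auto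
  let ?I = "R \<times> {..<J}"
  define cen where "cen = (\<lambda>(r, j :: nat). r + (real j * w0 / norm s) *\<^sub>R s)"
  define bb where "bb i = ball (cen i) (w0 / 2)" for i
  have disj: "bb i \<inter> bb i' = {}" if i: "i \<in> ?I" "i' \<in> ?I" "i \<noteq> i'" for i i'
  proof -
    obtain r j r' j' where ij: "i = (r, j)" "i' = (r', j')" by (cases i, cases i') auto
    have rj: "r \<in> R" "r' \<in> R" "j < J" "j' < J" using i ij by auto
    let ?t = "real j * w0 / norm s - real j' * w0 / norm s"
    have z: "cen i - cen i' = (r - r') + ?t *\<^sub>R s" by (simp add: cen_def ij algebra_simps)
    have nt: "norm (?t *\<^sub>R s) = \<bar>real j - real j'\<bar> * w0"
    proof -
      have "?t = (real j - real j') * w0 / norm s" by (simp add: diff_divide_distrib left_diff_distrib)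
      then show ?thesis using ns w0(1) by (simp add: abs_mult)
    qed
    \<comment> \<open>A difference r - r' off the line of \<open>s\<close> is kept away by
      \<open>far\<close>. If r = r', the centres are distinct multiples of w0 along the line.
      Otherwise r - r' is a nonzero lattice vector on the line of the primitive \<open>s\<close>,
      hence at least |s| long, while the shifts use up at most |s| - w0.\<close>
    have "w0 \<le> norm (cen i - cen i')"
    proof (cases "r - r' \<in> span {s}")
      case False
      have "w0 < norm ((r - r') - (- ?t) *\<^sub>R s)" using False rj R(2) by (intro far diff_mem) auto
      moreover have "(r - r') - (- ?t) *\<^sub>R s = cen i - cen i'" unfolding z by (simp only: scaleR_minus_left diff_minus_eq_add)
      ultimately show ?thesis by simp
    next
      case True
      show ?thesis
      proof (cases "r = r'")
        case True
        then have "j \<noteq> j'" using i ij by auto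
        then have "1 \<le> \<bar>real j - real j'\<bar>" by linarith
        then have "1 * w0 \<le> \<bar>real j - real j'\<bar> * w0" using w0 by (intro mult_right_mono) auto
        then show ?thesis using True nt by (simp add: z)
      next
        case False
        then have "norm s \<le> norm (r - r')" using True rj R(2) by (intro primitive_norm_le[OF s] diff_mem) auto
        moreover have "\<bar>real j - real j'\<bar> + 1 \<le> real J" using rj by linarith
        then have "(\<bar>real j - real j'\<bar> + 1) * w0 \<le> real J * w0" using w0 by (intro mult_right_mono) auto
        then have "norm (?t *\<^sub>R s) + w0 \<le> norm s" unfolding nt using J(1) by (simp add: algebra_simps)
        moreover have "norm (r - r') \<le> norm (cen i - cen i') + norm (?t *\<^sub>R s)"
          using norm_triangle_ineq4[of "cen i - cen i'" "?t *\<^sub>R s"] by (simp add: z)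
        ultimately show ?thesis by linarith
      qed
    qed
    then show ?thesis unfolding bb_def by (intro disjoint_ballI) (simp add: dist_norm)
  qed
  let ?G = "{x. norm (snd x) \<le> tube_length * T \<and> norm (fst x - ?\<gamma> (snd x) *\<^sub>R fst s) \<le> tube_width * w (snd x)}"
  have TL: "0 \<le> tube_width" "0 \<le> tube_length * T" using tube_consts_pos T0 by auto
  have inG: "x \<in> ?G" "w (snd x) \<le> 3 / 2 * w (snd r)" if x: "x \<in> bb (r, j)" and rj: "r \<in> R" "j < J" for x r j
  proof -
    let ?t = "real j * w0 / norm s"
    define y where "y = x - cen (r, j)"
    have y: "norm y < w0 / 2" using x by (simp add: bb_def y_def dist_norm norm_minus_commute)
    have x': "x = r + ?t *\<^sub>R s + y" by (simp add: y_def cen_def)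
    have yy: "norm (fst y) \<le> w0 / 2" "norm (snd y) \<le> w0 / 2"
      using y norm_fst_le[of "fst y" "snd y"] norm_snd_le[of "snd y" "fst y"] by auto
    have px: "perp ?q (snd x) = perp ?q (snd r) + perp ?q (snd y)"
      by (simp add: x' perp_add perp_multiple)
    have py: "norm (perp ?q (snd y)) \<le> w0 / 2" using norm_perp_le[of ?q "snd y"] yy by linarith
    have wx: "w (snd x) \<le> w (snd r) + w0 / 2" unfolding w_def px
      using norm_triangle_ineq[of "perp ?q (snd r)" "perp ?q (snd y)"] py by linarith
    have wr: "w (snd r) \<le> w (snd x) + w0 / 2"
      unfolding w_def px using norm_triangle_ineq4[of "perp ?q (snd r) + perp ?q (snd y)" "perp ?q (snd y)"] py by simp
    have wge: "w0 \<le> w z" for z using b by (simp add: w_def)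
    show "w (snd x) \<le> 3 / 2 * w (snd r)" using wx wge[of "snd r"] by linarith
    have wr2: "w (snd r) \<le> 2 * w (snd x)" using wr wge[of "snd x"] w_pos[of "snd x"] by linarith
    have t1: "\<bar>?t\<bar> \<le> 1"
    proof -
      have "real j * w0 \<le> real J * w0" using rj w0 by (intro mult_right_mono) auto
      then have "real j * w0 \<le> norm s" using J(1) by linarith
      then show ?thesis using ns w0 by simp
    qed
    have "norm (snd x) \<le> norm (snd r) + norm (?t *\<^sub>R snd s) + norm (snd y)"
      unfolding x' snd_add snd_scaleR by (intro order_trans[OF norm_triangle_ineq] add_right_mono norm_triangle_ineq)
    also have "\<dots> \<le> nconst * (2 * T) + norm s + norm s / 2"
    proof (intro add_mono)
      show "norm (snd r) \<le> nconst * (2 * T)"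
        by (rule order_trans[OF nconst(5) mult_left_mono[OF R(4)[OF rj(1)]]]) (use nc in simp)
      have "norm (?t *\<^sub>R snd s) \<le> 1 * norm (snd s)" unfolding norm_scaleR using t1 by (intro mult_right_mono) auto
      then show "norm (?t *\<^sub>R snd s) \<le> norm s" using norm_snd_le[of "snd s" "fst s"] by simp
      show "norm (snd y) \<le> norm s / 2" using yy(2) w0 by linarith
    qed
    also have "\<dots> \<le> tube_length * T"
    proof -
      have "reach * S \<le> reach * T" using re S by (intro mult_left_mono) auto
      then have "norm s \<le> 2 * (reach * T)" using S(3) by simp
      then show ?thesis by (simp add: tube_length_def algebra_simps)
    qed
    finally have 1: "norm (snd x) \<le> tube_length * T" .
    have g: "?\<gamma> (snd x) = ?\<gamma> (snd r) + ?t + ?\<gamma> (snd y)"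
      using nq(2) by (simp add: x' inner_add_left add_divide_distrib)
    have "fst x - ?\<gamma> (snd x) *\<^sub>R fst s = (fst r - ?\<gamma> (snd r) *\<^sub>R fst s) + fst y - ?\<gamma> (snd y) *\<^sub>R fst s"
      unfolding g by (simp add: x' algebra_simps)
    also have "norm \<dots> \<le> norm (fst r - ?\<gamma> (snd r) *\<^sub>R fst s) + norm (fst y) + norm (?\<gamma> (snd y) *\<^sub>R fst s)"
      by (intro order_trans[OF norm_triangle_ineq4] add_right_mono norm_triangle_ineq)
    also have "\<dots> \<le> pair_geom * w (snd r) + w0 / 2 + w0 / 2 * (2 * reach * nconst)"
    proof (intro add_mono yy)
      have "?v r \<le> w (snd r)" using w0 by (simp add: w_def)
      then show "norm (fst r - ?\<gamma> (snd r) *\<^sub>R fst s) \<le> pair_geom * w (snd r)"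
        using geom[OF rj(1)] pg by (meson mult_left_mono order_trans zero_le_one)
      have "\<bar>?\<gamma> (snd y)\<bar> = \<bar>snd y \<bullet> ?q\<bar> / (norm ?q * norm ?q)"
        by (simp add: dot_square_norm power2_eq_square)
      also have "\<dots> \<le> norm (snd y) * norm ?q / (norm ?q * norm ?q)"
        by (intro divide_right_mono Cauchy_Schwarz_ineq2) simp
      also have "\<dots> = norm (snd y) / norm ?q" using nq(2) by simp
      finally have "norm (?\<gamma> (snd y) *\<^sub>R fst s) \<le> norm (snd y) / norm ?q * norm (fst s)"
        unfolding norm_scaleR by (intro mult_right_mono) auto
      also have "\<dots> = norm (snd y) * (norm (fst s) / norm ?q)" by simp
      also have "\<dots> \<le> w0 / 2 * (2 * reach * nconst)"
      proof (intro mult_mono yy)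
        have "norm (fst s) \<le> norm s" using norm_fst_le[of "fst s" "snd s"] by simp
        then have "norm (fst s) / norm ?q \<le> reach * (2 * S) / (S / nconst)"
          using S nq nc re by (intro frac_le) auto
        also have "\<dots> = 2 * reach * nconst" using S by simp
        finally show "norm (fst s) / norm ?q \<le> 2 * reach * nconst" .
      qed (use w0 in auto)
      finally show "norm (?\<gamma> (snd y) *\<^sub>R fst s) \<le> w0 / 2 * (2 * reach * nconst)" .
    qed
    also have "\<dots> \<le> pair_geom * (2 * w (snd x)) + w (snd x) + w (snd x) * (2 * reach * nconst)"
    proof (intro add_mono mult_left_mono mult_right_mono wr2)
      show "w0 / 2 \<le> w (snd x)" "w0 / 2 \<le> w (snd x)" using wge[of "snd x"] w0 by linarith+
    qed (use pg re nc in auto)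
    also have "\<dots> = tube_width * w (snd x)" by (simp add: tube_width_def algebra_simps)
    finally show "x \<in> ?G" using 1 by simp
  qed
  let ?h = "\<lambda>x :: (real ^ 'm) \<times> (real ^ 'n). ennreal (1 / w (snd x) ^ ?m) * indicator ?G x"
  let ?V = "unit_ball_vol (real ?d) * (w0 / 2) ^ ?d"
  let ?Q = "unit_ball_vol ?m * tube_width ^ ?m * (unit_ball_vol ?n * (tube_length * T) ^ ?n)"
  note ti = tube_integral[OF w_cont w_pos \<gamma>_cont TL, of "fst s"]
  have hm: "?h \<in> borel_measurable borel"
  proof -
    have ws: "continuous_on UNIV (\<lambda>x :: (real ^ 'm) \<times> (real ^ 'n). w (snd x))"
      by (intro continuous_on_compose2[OF w_cont] continuous_intros) auto
    have "(\<lambda>x :: (real ^ 'm) \<times> (real ^ 'n). 1 / w (snd x) ^ ?m) \<in> borel_measurable borel"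
      using w_pos by (intro borel_measurable_continuous_onI continuous_intros ws) (auto simp: less_imp_neq[symmetric])
    then show ?thesis
      using ti(1) by (intro borel_measurable_times_ennreal measurable_compose[OF _ measurable_ennreal] borel_measurable_indicator)
  qed
  have "(\<Sum>i\<in>?I. ennreal (1 / (3 / 2 * w (snd (fst i))) ^ ?m) * emeasure lborel (bb i)) \<le> (\<integral>\<^sup>+x. ?h x \<partial>lborel)"
  proof (rule sum_weights_le_integral[OF _ hm _ disj])
    show "finite ?I" using R(1) by simp
    show "bb i \<in> sets borel" for i by (simp add: bb_def)
    fix i x assume i: "i \<in> ?I" and x: "x \<in> bb i"
    obtain r j where ij: "i = (r, j)" by (cases i)
    have "x \<in> ?G" "w (snd x) \<le> 3 / 2 * w (snd r)" using inG[of x r j] x i ij by auto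
    moreover from this(2) have "1 / (3 / 2 * w (snd r)) ^ ?m \<le> 1 / w (snd x) ^ ?m"
      using w_pos by (intro divide_left_mono power_mono mult_pos_pos zero_less_power) (auto simp: less_imp_le)
    ultimately show "ennreal (1 / (3 / 2 * w (snd (fst i))) ^ ?m) \<le> ?h x"
      by (simp add: ij ennreal_leI)
  qed auto
  also have "\<dots> = ennreal ?Q" by (rule ti(2))
  also have "(\<Sum>i\<in>?I. ennreal (1 / (3 / 2 * w (snd (fst i))) ^ ?m) * emeasure lborel (bb i))
    = ennreal (\<Sum>i\<in>?I. 1 / (3 / 2 * w (snd (fst i))) ^ ?m * ?V)"
  proof -
    have "emeasure lborel (bb i) = ennreal ?V" for i
      unfolding bb_def using w0 by (subst emeasure_ball) auto
    moreover have "0 \<le> 1 / (3 / 2 * w (snd (fst i))) ^ ?m" for i :: "((real ^ 'm) \<times> (real ^ 'n)) \<times> nat"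
      using w_pos[of "snd (fst i)"] by simp
    moreover have V0: "0 \<le> ?V" using w0 by simp
    ultimately show ?thesis
      by (subst sum_ennreal[symmetric]) (auto intro!: sum.cong mult_nonneg_nonneg simp: ennreal_mult[symmetric] simp del: power_mult_distrib)
  qed
  finally have "(\<Sum>i\<in>?I. 1 / (3 / 2 * w (snd (fst i))) ^ ?m * ?V) \<le> ?Q"
    using TL by (subst (asm) ennreal_le_iff) auto
  also have "(\<Sum>i\<in>?I. 1 / (3 / 2 * w (snd (fst i))) ^ ?m * ?V) = (\<Sum>r\<in>R. \<Sum>j<J. 1 / (3 / 2 * w (snd r)) ^ ?m * ?V)"
    by (subst sum.cartesian_product) (simp add: split_beta)
  also have "\<dots> = real J * ?V * (\<Sum>r\<in>R. 1 / (3 / 2 * w (snd r)) ^ ?m)"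
    by (simp add: sum_distrib_left mult_ac)
  finally have main: "real J * ?V * (\<Sum>r\<in>R. 1 / (3 / 2 * w (snd r)) ^ ?m) \<le> ?Q" .
  have V0: "0 < ?V" using w0 by simp
  have "(\<Sum>r\<in>R. 1 / ?v r ^ ?m) \<le> (\<Sum>r\<in>R. (2 + pair_geom) ^ ?m * (3 / 2) ^ ?m * (1 / (3 / 2 * w (snd r)) ^ ?m))"
  proof (rule sum_mono)
    fix r assume r: "r \<in> R"
    have v0: "0 < ?v r" using b by (simp add: add_nonneg_pos)
    have "1 / ?v r \<le> (2 + pair_geom) / w (snd r)" using wv[OF r] v0 w_pos[of "snd r"] by (simp add: field_simps)
    then have "(1 / ?v r) ^ ?m \<le> ((2 + pair_geom) / w (snd r)) ^ ?m" using v0 by (intro power_mono) auto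
    also have "\<dots> = (2 + pair_geom) ^ ?m * (3 / 2) ^ ?m * (1 / (3 / 2 * w (snd r)) ^ ?m)"
      by (simp add: power_mult_distrib power_divide)
    finally show "1 / ?v r ^ ?m \<le> (2 + pair_geom) ^ ?m * (3 / 2) ^ ?m * (1 / (3 / 2 * w (snd r)) ^ ?m)"
      by (simp add: power_divide)
  qed
  also have "\<dots> = (2 + pair_geom) ^ ?m * (3 / 2) ^ ?m * (\<Sum>r\<in>R. 1 / (3 / 2 * w (snd r)) ^ ?m)"
    by (simp only: sum_distrib_left)
  also have "\<dots> \<le> (2 + pair_geom) ^ ?m * (3 / 2) ^ ?m * (?Q / (real J * ?V))"
  proof (rule mult_left_mono)
    have "0 < real J * ?V" using J0 V0 by simp
    then show "(\<Sum>r\<in>R. 1 / (3 / 2 * w (snd r)) ^ ?m) \<le> ?Q / (real J * ?V)"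
      using main by (simp only: pos_le_divide_eq mult.commute)
  qed (use pg in auto)
  also have "\<dots> \<le> (2 + pair_geom) ^ ?m * (3 / 2) ^ ?m * (?Q * (2 ^ (?d + 1) / unit_ball_vol ?d * (norm s ^ (?d - 2) / D ^ (?d - 1))))"
  proof (intro mult_left_mono)
    obtain k where k: "?d = 2 + k" using le_Suc_ex[OF d] by blast
    \<comment> \<open>The J balls of one lattice point have total volume of order J w0^d, which is
      comparable to |s| w0^(d - 1). By the choice of w0 this equals D^(d - 1) / |s|^(d - 2).\<close>
    have "D ^ Suc k / norm s ^ k = norm s * w0 ^ Suc k"
      using ns by (simp add: w0_def power_divide)
    also have "\<dots> \<le> 2 * (real J * w0) * w0 ^ Suc k" using J(2) w0 by (intro mult_right_mono) auto
    finally have "D ^ Suc k / norm s ^ k \<le> 2 * real J * w0 ^ ?d" by (simp add: k)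
    then have "D ^ Suc k / norm s ^ k * (unit_ball_vol ?d / 2 ^ (?d + 1)) \<le> 2 * real J * w0 ^ ?d * (unit_ball_vol ?d / 2 ^ (?d + 1))"
      by (rule mult_right_mono) simp
    also have "\<dots> = real J * ?V" by (simp add: power_divide)
    finally have le: "D ^ Suc k / norm s ^ k * (unit_ball_vol ?d / 2 ^ (?d + 1)) \<le> real J * ?V" .
    have "1 / (real J * ?V) \<le> 1 / (D ^ Suc k / norm s ^ k * (unit_ball_vol ?d / 2 ^ (?d + 1)))"
      using D ns J0 V0 w0 by (intro divide_left_mono le mult_pos_pos divide_pos_pos zero_less_power) auto
    also have "\<dots> = 2 ^ (?d + 1) / unit_ball_vol ?d * (norm s ^ k / D ^ Suc k)" by (simp add: mult_ac)
    finally have "?Q * (1 / (real J * ?V)) \<le> ?Q * (2 ^ (?d + 1) / unit_ball_vol ?d * (norm s ^ k / D ^ Suc k))"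
      using TL by (intro mult_left_mono) auto
    then show "?Q / (real J * ?V) \<le> ?Q * (2 ^ (?d + 1) / unit_ball_vol ?d * (norm s ^ (?d - 2) / D ^ (?d - 1)))"
      by (simp add: k)
  qed (use pg in auto)
  also have "\<dots> = tube_const * T ^ ?n * (norm s ^ (?d - 2) / D ^ (?d - 1))"
    unfolding tube_const_def by (simp add: power_mult_distrib)
  finally show ?thesis .
qed

text \<open>Only those \<open>r\<close> contribute whose resonant set meets that of
  \<open>s\<close>, and these lie in the tube. The equation for \<open>D\<close> absorbs the power
  of |s|; what remains, up to 1 / \<kappa>, is the measure bound (cs / S)^m for \<open>s\<close>
  times c^m T^n, the order of the total measure of a shell, just as for independent sets.\<close>

lemma sum_near_pair_le:
  fixes \<Lambda> :: "((real ^ 'm) \<times> (real ^ 'n)) set"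
  assumes L: "lattice_min \<Lambda> a" and s: "unimodular.primitive \<Lambda> s"
    and S: "0 < S" "S < N\<nu> (snd s)" "norm s \<le> reach * (2 * S)" "S \<le> T"
    and D: "0 < D" "D \<le> (norm s)\<^sup>2" "D ^ (CARD('m) + CARD('n) - 1) = \<kappa> * S ^ (CARD('m) + CARD('n) - 2)" and \<kappa>: "0 < \<kappa>"
    and good: "\<And>x. x \<in> \<Lambda> \<Longrightarrow> 0 < gram x s \<Longrightarrow> D\<^sup>2 < gram x s"
    and c: "0 < c" "c \<le> cs" and R: "finite R" "R \<subseteq> \<Lambda>"
      "\<And>r. r \<in> R \<Longrightarrow> r \<notin> span {s} \<and> T < N\<nu> (snd r) \<and> N\<nu> (snd r) \<le> 2 * T"
  shows "(\<Sum>r\<in>R. measure lebesgue (near 0 cs s \<inter> near 0 c r))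
     \<le> pair_const / \<kappa> * (cs / S) ^ CARD('m) * (c ^ CARD('m) * T ^ CARD('n))"
proof -
  let ?m = "CARD('m)" and ?n = "CARD('n)" and ?d = "CARD('m) + CARD('n)"
  let ?v = "\<lambda>r. norm (perp (snd s) (snd r)) + cs * T / S"
  define R' where "R' = {r \<in> R. near 0 cs s \<inter> near 0 c r \<noteq> {}}"
  have T0: "0 < T" using S by simp
  have b: "0 < cs * T / S" using c S T0 by simp
  have C: "0 \<le> near_const * (2 * nconst) ^ ?m * (c * cs / S) ^ ?m"
    using near_const_pos nconst(1) c S by simp
  have "(\<Sum>r\<in>R. measure lebesgue (near 0 cs s \<inter> near 0 c r)) = (\<Sum>r\<in>R'. measure lebesgue (near 0 cs s \<inter> near 0 c r))"
    using R(1) by (intro sum.mono_neutral_right) (auto simp: R'_def)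
  also have "\<dots> \<le> (\<Sum>r\<in>R'. near_const * (2 * nconst) ^ ?m * (c * cs / S) ^ ?m * (1 / ?v r ^ ?m))"
  proof (rule sum_mono)
    fix r assume "r \<in> R'"
    then have "measure lebesgue (near 0 cs s \<inter> near 0 c r)
       \<le> near_const * (2 * nconst) ^ ?m * (c * cs / (S * ?v r)) ^ ?m"
      using R(3)[of r] by (intro measure_near_pair_le S c) (auto simp: R'_def)
    also have "\<dots> = near_const * (2 * nconst) ^ ?m * (c * cs / S) ^ ?m * (1 / ?v r ^ ?m)"
      by (simp only: power_divide power_mult_distrib divide_divide_eq_left[symmetric] times_divide_eq_right mult_1_right mult.assoc)
    finally show "measure lebesgue (near 0 cs s \<inter> near 0 c r) \<le> near_const * (2 * nconst) ^ ?m * (c * cs / S) ^ ?m * (1 / ?v r ^ ?m)" .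
  qed
  also have "\<dots> = near_const * (2 * nconst) ^ ?m * (c * cs / S) ^ ?m * (\<Sum>r\<in>R'. 1 / ?v r ^ ?m)"
    by (simp only: sum_distrib_left)
  also have "\<dots> \<le> near_const * (2 * nconst) ^ ?m * (c * cs / S) ^ ?m * (tube_const * T ^ ?n * (norm s ^ (?d - 2) / D ^ (?d - 1)))"
  proof (intro mult_left_mono C)
    show "(\<Sum>r\<in>R'. 1 / ?v r ^ ?m) \<le> tube_const * T ^ ?n * (norm s ^ (?d - 2) / D ^ (?d - 1))"
    proof (rule tube_packing[OF L s S D(1,2) good b])
      show "finite R'" "R' \<subseteq> \<Lambda>" using R by (auto simp: R'_def)
      fix r assume r: "r \<in> R'"
      then show "r \<notin> span {s}" "N\<nu> (snd r) \<le> 2 * T" using R(3) by (auto simp: R'_def)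
      obtain A where "A \<in> near 0 cs s \<inter> near 0 c r" using r by (auto simp: R'_def)
      then show "norm (fst r - ((snd r \<bullet> snd s) / (snd s \<bullet> snd s)) *\<^sub>R fst s) \<le> pair_geom * ?v r"
        using R(3)[of r] r by (intro near_pair_geometry[OF _ S(1,2,4) _ c]) (auto simp: R'_def)
    qed
  qed
  also have "\<dots> \<le> near_const * (2 * nconst) ^ ?m * (c * cs / S) ^ ?m * (tube_const * T ^ ?n * ((2 * reach) ^ (?d - 2) / \<kappa>))"
  proof (intro mult_left_mono C)
    have "norm s ^ (?d - 2) \<le> (2 * reach * S) ^ (?d - 2)" using S(3) by (intro power_mono) auto
    then have "norm s ^ (?d - 2) / D ^ (?d - 1) \<le> (2 * reach * S) ^ (?d - 2) / D ^ (?d - 1)"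
      using D(1) by (intro divide_right_mono) auto
    also have "\<dots> = (2 * reach) ^ (?d - 2) / \<kappa>"
      unfolding D(3) using S(1) by (simp add: power_mult_distrib)
    finally show "norm s ^ (?d - 2) / D ^ (?d - 1) \<le> (2 * reach) ^ (?d - 2) / \<kappa>" .
  qed (use tube_consts_pos T0 in auto)
  also have "\<dots> = pair_const / \<kappa> * (cs / S) ^ ?m * (c ^ ?m * T ^ ?n)"
    by (simp add: pair_const_def power_divide power_mult_distrib mult_ac)
  finally show ?thesis .
qed

end

subsection \<open>Inclusion-exclusion and the sum of the approximating function\<close>

text \<open>Every covered point is covered at least twice, by the sets of \<open>i\<close> and of
  \<open>neg i\<close>.\<close>

lemma measure_Union_paired_le:
  assumes fin: "finite I" and N: "\<And>i. i \<in> I \<Longrightarrow> N i \<in> fmeasurable M"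
    and neg: "\<And>i. i \<in> I \<Longrightarrow> neg i \<in> I \<and> neg i \<noteq> i \<and> N (neg i) = N i"
  shows "2 * measure M (\<Union>i\<in>I. N i) \<le> (\<Sum>i\<in>I. measure M (N i))"
proof -
  have U: "(\<Union>i\<in>I. N i) \<in> fmeasurable M" using fin N by (intro fmeasurable.finite_UN)
  have int: "integrable M (indicat_real X)" if "X \<in> fmeasurable M" for X
    using that by (simp add: fmeasurable_def)
  have sp: "X \<inter> space M = X" if "X \<in> fmeasurable M" for X
    using that fmeasurableD sets.sets_into_space by blast
  have "2 * measure M (\<Union>i\<in>I. N i) = (LINT x|M. 2 * indicat_real (\<Union>i\<in>I. N i) x)" using sp[OF U] by simp
  also have "\<dots> \<le> (LINT x|M. (\<Sum>i\<in>I. indicat_real (N i) x))"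
  proof (rule integral_mono)
    show "integrable M (\<lambda>x. 2 * indicat_real (\<Union>i\<in>I. N i) x)" using int[OF U] by simp
    show "integrable M (\<lambda>x. \<Sum>i\<in>I. indicat_real (N i) x)"
      by (intro Bochner_Integration.integrable_sum int N)
    fix x
    show "2 * indicat_real (\<Union>i\<in>I. N i) x \<le> (\<Sum>i\<in>I. indicat_real (N i) x)"
    proof (cases "x \<in> (\<Union>i\<in>I. N i)")
      case True
      then obtain i where i: "i \<in> I" "x \<in> N i" by auto
      have "(2::real) = (\<Sum>j\<in>{i, neg i}. indicat_real (N j) x)" using neg[OF i(1)] i(2) by auto
      also have "\<dots> \<le> (\<Sum>j\<in>I. indicat_real (N j) x)"
        using neg[OF i(1)] i(1) fin by (intro sum_mono2) auto
      finally show ?thesis using True by simp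
    qed (simp add: sum_nonneg)
  qed
  also have "\<dots> = (\<Sum>i\<in>I. measure M (N i))"
    by (subst Bochner_Integration.integral_sum[OF int[OF N]]) (auto intro!: sum.cong simp: sp[OF N])
  finally show ?thesis .
qed

text \<open>At a point covered by some of the sets, the pairs whose first member is a fixed covering
  set of minimal rank already account for all but two of the covering sets.\<close>

lemma sum_measure_le_paired:
  fixes rank :: "'i \<Rightarrow> nat"
  assumes fin: "finite I" and N: "\<And>i. i \<in> I \<Longrightarrow> N i \<in> fmeasurable M"
    and U: "U \<in> fmeasurable M" "\<And>i. i \<in> I \<Longrightarrow> N i \<subseteq> U"
  shows "(\<Sum>i\<in>I. measure M (N i)) \<le> 2 * measure M U +
     (\<Sum>i\<in>I. \<Sum>j\<in>{j \<in> I. rank i \<le> rank j \<and> j \<noteq> i \<and> j \<noteq> neg i}. measure M (N i \<inter> N j))"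
proof -
  let ?J = "\<lambda>i. {j \<in> I. rank i \<le> rank j \<and> j \<noteq> i \<and> j \<noteq> neg i}"
  have int: "integrable M (indicat_real X)" if "X \<in> fmeasurable M" for X
    using that by (simp add: fmeasurable_def)
  have sp: "X \<inter> space M = X" if "X \<in> fmeasurable M" for X
    using that fmeasurableD sets.sets_into_space by blast
  have NN: "N i \<inter> N j \<in> fmeasurable M" if "i \<in> I" "j \<in> ?J i" for i j
    using that N by (intro fmeasurable.Int) auto
  have i2: "integrable M (\<lambda>x. \<Sum>j\<in>?J i. indicat_real (N i \<inter> N j) x)" if "i \<in> I" for i
    using that by (intro Bochner_Integration.integrable_sum int NN)
  have i3: "integrable M (\<lambda>x. \<Sum>i\<in>I. \<Sum>j\<in>?J i. indicat_real (N i \<inter> N j) x)"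
    by (intro Bochner_Integration.integrable_sum i2)
  have "(\<Sum>i\<in>I. measure M (N i)) = (LINT x|M. (\<Sum>i\<in>I. indicat_real (N i) x))"
    by (subst Bochner_Integration.integral_sum[OF int[OF N]]) (auto intro!: sum.cong simp: sp[OF N])
  also have "\<dots> \<le> (LINT x|M. 2 * indicat_real U x + (\<Sum>i\<in>I. \<Sum>j\<in>?J i. indicat_real (N i \<inter> N j) x))"
  proof (rule integral_mono)
    show "integrable M (\<lambda>x. \<Sum>i\<in>I. indicat_real (N i) x)"
      by (intro Bochner_Integration.integrable_sum int N)
    show "integrable M (\<lambda>x. 2 * indicat_real U x + (\<Sum>i\<in>I. \<Sum>j\<in>?J i. indicat_real (N i \<inter> N j) x))"
      using int[OF U(1)] i3 by simp
    fix x
    have nn: "0 \<le> (\<Sum>j\<in>?J i. indicat_real (N i \<inter> N j) x)" for i by (intro sum_nonneg) auto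
    let ?A = "{i \<in> I. x \<in> N i}"
    have cnt: "(\<Sum>i\<in>I. indicat_real (N i) x) = real (card ?A)"
      using fin by (simp add: indicator_def sum.If_cases Int_def)
    show "(\<Sum>i\<in>I. indicat_real (N i) x) \<le> 2 * indicat_real U x + (\<Sum>i\<in>I. \<Sum>j\<in>?J i. indicat_real (N i \<inter> N j) x)"
    proof (cases "?A = {}")
      case True
      then show ?thesis unfolding cnt True using sum_nonneg[of I "\<lambda>i. \<Sum>j\<in>?J i. indicat_real (N i \<inter> N j) x"] nn
        by (simp add: add_nonneg_nonneg)
    next
      case False
      have finA: "finite ?A" using fin by simp
      obtain i where i: "i \<in> ?A" "\<And>j. j \<in> ?A \<Longrightarrow> rank i \<le> rank j"
        using arg_min_if_finite(1)[OF finA False, of rank] arg_min_least[OF finA False, of _ rank] by blast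
      have "?A \<subseteq> {i, neg i} \<union> {j \<in> ?J i. x \<in> N j}" using i by auto
      then have "card ?A \<le> card ({i, neg i} \<union> {j \<in> ?J i. x \<in> N j})" using fin by (intro card_mono) auto
      also have "\<dots> \<le> card {i, neg i} + card {j \<in> ?J i. x \<in> N j}" by (rule card_Un_le)
      also have "card {i, neg i} \<le> 2" by (simp add: card_insert_if)
      finally have "real (card ?A) \<le> 2 + real (card {j \<in> ?J i. x \<in> N j})" by simp
      also have "real (card {j \<in> ?J i. x \<in> N j}) = (\<Sum>j\<in>?J i. indicat_real (N j) x)"
        using fin by (simp add: indicator_def sum.If_cases Int_def)
      also have "\<dots> = (\<Sum>j\<in>?J i. indicat_real (N i \<inter> N j) x)"
        using i by (intro sum.cong) (auto simp: indicator_def)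
      also have "\<dots> \<le> (\<Sum>i\<in>I. \<Sum>j\<in>?J i. indicat_real (N i \<inter> N j) x)"
        using i fin nn by (intro member_le_sum[of i I "\<lambda>i. \<Sum>j\<in>?J i. indicat_real (N i \<inter> N j) x"]) auto
      finally have "real (card ?A) \<le> 2 + (\<Sum>i\<in>I. \<Sum>j\<in>?J i. indicat_real (N i \<inter> N j) x)" by simp
      moreover have "x \<in> U" using i U(2) by auto
      ultimately show ?thesis unfolding cnt by simp
    qed
  qed
  also have "\<dots> = 2 * measure M U + (\<Sum>i\<in>I. \<Sum>j\<in>?J i. measure M (N i \<inter> N j))"
  proof -
    have "(LINT x|M. (\<Sum>i\<in>I. \<Sum>j\<in>?J i. indicat_real (N i \<inter> N j) x)) = (\<Sum>i\<in>I. LINT x|M. (\<Sum>j\<in>?J i. indicat_real (N i \<inter> N j) x))"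
      by (rule Bochner_Integration.integral_sum[OF i2])
    also have "\<dots> = (\<Sum>i\<in>I. \<Sum>j\<in>?J i. measure M (N i \<inter> N j))"
    proof (rule sum.cong[OF refl])
      fix i assume i: "i \<in> I"
      show "(LINT x|M. (\<Sum>j\<in>?J i. indicat_real (N i \<inter> N j) x)) = (\<Sum>j\<in>?J i. measure M (N i \<inter> N j))"
        by (subst Bochner_Integration.integral_sum[OF int[OF NN[OF i]]]) (auto intro!: sum.cong simp: sp[OF NN[OF i]])
    qed
    finally show ?thesis using int[OF U(1)] i3 sp[OF U(1)] by simp
  qed
  finally show ?thesis .
qed

context unimodular
begin

lemma primitive_minus: "primitive r \<Longrightarrow> primitive (- r)"
  unfolding primitive_def using minus_mem[of "(1 / real k) *\<^sub>R - r" for k] minus_mem[of r] by auto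

lemma primitive_in_span_eq:
  assumes r: "primitive r" and s: "primitive s" and rs: "r \<in> span {s}"
  shows "r = s \<or> r = - s"
proof -
  obtain c where c: "r = c *\<^sub>R s" using rs by (auto simp: span_singleton)
  have r0: "r \<noteq> 0" "r \<in> \<Lambda>" and s0: "s \<noteq> 0" "s \<in> \<Lambda>" using r s by (auto simp: primitive_def)
  then have c0: "c \<noteq> 0" using c by auto
  have "s = (1 / c) *\<^sub>R r" using c c0 by simp
  then have "s \<in> span {r}" by (metis span_base span_scale singletonI)
  then have "norm r = norm s"
    using primitive_norm_le[OF r s0(2,1)] primitive_norm_le[OF s r0(2,1) rs] by simp
  then have "\<bar>c\<bar> = 1" using s0 by (simp add: c)
  then show ?thesis using c by (auto simp: abs_if split: if_splits)
qed

text \<open>A shortest nonzero lattice vector on the line of \<open>r\<close> is primitive and has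
  \<open>r\<close> as an integer multiple; changing its sign if necessary makes the multiplier
  positive.\<close>

lemma primitive_divisor:
  assumes r: "r \<in> \<Lambda>" "r \<noteq> 0"
  obtains k s where "1 \<le> (k::nat)" "primitive s" "r = real k *\<^sub>R s"
proof -
  let ?S = "(\<Lambda> \<inter> span {r}) - {0}"
  have "r \<in> ?S" using r by (simp add: span_base)
  then obtain v where v: "v \<in> ?S" "\<And>y. y \<in> ?S \<Longrightarrow> norm v \<le> norm y"
    using norm_minimizer[of ?S] by blast
  obtain b where b: "v = b *\<^sub>R r" using v(1) by (auto simp: span_singleton)
  have b0: "b \<noteq> 0" using b v(1) by auto
  define c where "c = 1 / b"
  have c: "r = c *\<^sub>R v" using b b0 by (simp add: c_def)
  have "r - of_int \<lfloor>c\<rfloor> *\<^sub>R v \<in> \<Lambda>" using r v(1) of_int_scale_mem diff_mem by auto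
  moreover have fr: "r - of_int \<lfloor>c\<rfloor> *\<^sub>R v = frac c *\<^sub>R v" by (simp add: c frac_def algebra_simps)
  moreover have "frac c *\<^sub>R v \<in> span {r}" unfolding b by (intro span_scale span_base) simp
  moreover have "norm (frac c *\<^sub>R v) < norm v" using frac_lt_1[of c] frac_ge_0[of c] v(1) by simp
  ultimately have "frac c *\<^sub>R v = 0" using v(2)[of "frac c *\<^sub>R v"] by fastforce
  then have "frac c = 0" using v(1) by simp
  then have ci: "c = of_int \<lfloor>c\<rfloor>" by (simp add: frac_def)
  have pv: "primitive v" unfolding primitive_def
  proof (intro conjI allI impI notI)
    show "v \<in> \<Lambda>" "v = 0 \<Longrightarrow> False" using v(1) by auto
    fix k :: nat assume k: "2 \<le> k" and m: "(1 / real k) *\<^sub>R v \<in> \<Lambda>"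
    have "(1 / real k) *\<^sub>R v \<in> span {r}" unfolding b by (intro span_scale span_base) simp
    then have "norm v \<le> norm ((1 / real k) *\<^sub>R v)" using k m v(1) by (intro v(2)) auto
    then have "norm v * real k \<le> norm v * 1" using k by (simp add: field_simps)
    moreover have "norm v * 1 < norm v * real k" using k v(1) by (intro mult_strict_left_mono) auto
    ultimately show False by simp
  qed
  have n0: "\<lfloor>c\<rfloor> \<noteq> 0" using ci c r(2) by auto
  show ?thesis
  proof (cases "0 < \<lfloor>c\<rfloor>")
    case True
    then have "1 \<le> nat \<lfloor>c\<rfloor>" "r = real (nat \<lfloor>c\<rfloor>) *\<^sub>R v" using ci c by auto
    then show ?thesis using pv that by blast
  next
    case False
    then have "1 \<le> nat (- \<lfloor>c\<rfloor>)" "r = real (nat (- \<lfloor>c\<rfloor>)) *\<^sub>R (- v)" using n0 ci c by auto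
    then show ?thesis using primitive_minus[OF pv] that by blast
  qed
qed

end

section \<open>Riemann sums along geometric progressions and monotonicity of the integrand\<close>

lemma integral_power_antimono:
  fixes g :: "real \<Rightarrow> real"
  assumes ab: "0 \<le> a" "a \<le> b" and g: "antimono_on {a..b} g" and n: "1 \<le> n"
    and int: "(\<lambda>q. q ^ (n - 1) * g q) integrable_on {a..b}"
  shows "integral {a..b} (\<lambda>q. q ^ (n - 1) * g q) \<le> g a * ((b ^ n - a ^ n) / n)"
    "g b * ((b ^ n - a ^ n) / n) \<le> integral {a..b} (\<lambda>q. q ^ (n - 1) * g q)"
proof -
  have "((\<lambda>q. q ^ (n - 1)) has_integral (b ^ n / n - a ^ n / n)) {a..b}"
    by (rule fundamental_theorem_of_calculus[OF ab(2)])
      (use n in \<open>auto intro!: derivative_eq_intros simp flip: has_real_derivative_iff_has_vector_derivative\<close>)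
  then have h: "((\<lambda>q. c * q ^ (n - 1)) has_integral (c * ((b ^ n - a ^ n) / n))) {a..b}" for c
    using has_integral_mult_right[of "\<lambda>q. q ^ (n - 1)" "(b ^ n - a ^ n) / n" "{a..b}" c] by (simp add: diff_divide_distrib)
  have le: "g b \<le> g q" "g q \<le> g a" if "q \<in> {a..b}" for q
    using that ab monotone_onD[OF g, of q b] monotone_onD[OF g, of a q] by auto
  show "integral {a..b} (\<lambda>q. q ^ (n - 1) * g q) \<le> g a * ((b ^ n - a ^ n) / n)"
    using le ab by (intro has_integral_le[OF integrable_integral[OF int] h]) (auto simp: mult.commute intro!: mult_right_mono)
  show "g b * ((b ^ n - a ^ n) / n) \<le> integral {a..b} (\<lambda>q. q ^ (n - 1) * g q)"
    using le ab by (intro has_integral_le[OF h integrable_integral[OF int]]) (auto simp: mult.commute intro!: mult_right_mono)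
qed

text \<open>Between consecutive terms of a geometric progression q^n grows by the fixed multiple
  \<beta>^n - 1 of its value at the left end, so all cells share the weight \<open>V\<close>. The
  upper sum treats the incomplete last cell as a full one, and the lower sum drops it.\<close>

lemma geometric_integral_bounds:
  fixes g :: "real \<Rightarrow> real" and n N :: nat
  assumes Q: "0 < Q1" and b: "1 < \<beta>" and n: "1 \<le> n" and g: "antimono_on {Q1..Q2} g" "\<And>q. q \<in> {Q1..Q2} \<Longrightarrow> 0 \<le> g q"
    and int: "(\<lambda>q. q ^ (n - 1) * g q) integrable_on {Q1..Q2}"
    and N: "Q1 * \<beta> ^ N \<le> Q2" "Q2 < Q1 * \<beta> ^ Suc N"
  defines "V \<equiv> (\<beta> ^ n - 1) / n"
  shows "integral {Q1..Q2} (\<lambda>q. q ^ (n - 1) * g q) \<le> V * (\<Sum>j\<le>N. g (Q1 * \<beta> ^ j) * (Q1 * \<beta> ^ j) ^ n)"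
    "V * (\<Sum>j<N. g (Q1 * \<beta> ^ Suc j) * (Q1 * \<beta> ^ j) ^ n) \<le> integral {Q1..Q2} (\<lambda>q. q ^ (n - 1) * g q)"
proof -
  let ?f = "\<lambda>q. q ^ (n - 1) * g q"
  let ?T = "\<lambda>j. Q1 * \<beta> ^ j"
  have T_pos: "0 < ?T j" for j using Q b by simp
  have T_mono: "?T i \<le> ?T j" if "i \<le> j" for i j
    using Q b power_increasing[OF that, of \<beta>] by simp
  have T_N: "?T j \<le> Q2" if "j \<le> N" for j using T_mono[OF that] N(1) by simp
  have T_1: "Q1 \<le> ?T j" for j using T_mono[of 0 j] by simp
  have sub: "?f integrable_on {x..y}" "antimono_on {x..y} g" if "Q1 \<le> x" "y \<le> Q2" for x y
    using that integrable_on_subinterval[OF int, of x y] monotone_on_subset[OF g(1), of "{x..y}"] by auto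
  have diff: "(?T (Suc j) ^ n - ?T j ^ n) / n = V * ?T j ^ n" for j
    by (simp add: V_def field_simps power_mult_distrib)
  have step: "integral {Q1..?T k} ?f \<le> V * (\<Sum>j<k. g (?T j) * ?T j ^ n) \<and>
      V * (\<Sum>j<k. g (?T (Suc j)) * ?T j ^ n) \<le> integral {Q1..?T k} ?f" if "k \<le> N" for k
    using that
  proof (induction k)
    case (Suc k)
    have k: "?T k \<le> ?T (Suc k)" "?T (Suc k) \<le> Q2" by (rule T_mono, simp, rule T_N[OF Suc.prems])
    have "integral {Q1..?T (Suc k)} ?f = integral {Q1..?T k} ?f + integral {?T k..?T (Suc k)} ?f"
      by (rule Henstock_Kurzweil_Integration.integral_combine[symmetric, OF T_1 k(1) sub(1)[OF order_refl k(2)]])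
    moreover note integral_power_antimono[OF less_imp_le[OF T_pos] k(1) sub(2)[OF T_1 k(2)] n sub(1)[OF T_1 k(2)], unfolded diff]
    ultimately show ?case using Suc by (simp add: algebra_simps)
  qed simp
  have N0: "?T N \<le> Q2" by (rule N(1))
  have split: "integral {Q1..Q2} ?f = integral {Q1..?T N} ?f + integral {?T N..Q2} ?f"
    by (rule Henstock_Kurzweil_Integration.integral_combine[symmetric, OF T_1 N0 int])
  note last = integral_power_antimono[OF less_imp_le[OF T_pos] N0 sub(2)[OF T_1 order_refl] n sub(1)[OF T_1 order_refl]]
  have gN: "0 \<le> g (?T N)" "0 \<le> g Q2" using T_1[of N] N0 by (auto intro: g(2))
  have "g (?T N) * ((Q2 ^ n - ?T N ^ n) / n) \<le> g (?T N) * ((?T (Suc N) ^ n - ?T N ^ n) / n)"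
    using gN N T_pos[of N] by (intro mult_left_mono divide_right_mono diff_right_mono power_mono) auto
  then have "integral {?T N..Q2} ?f \<le> V * (g (?T N) * ?T N ^ n)"
    using last(1) unfolding diff by (simp add: mult_ac)
  then show "integral {Q1..Q2} ?f \<le> V * (\<Sum>j\<le>N. g (?T j) * ?T j ^ n)"
    using step[of N] split by (simp add: algebra_simps flip: lessThan_Suc_atMost)
  have "0 \<le> g Q2 * ((Q2 ^ n - ?T N ^ n) / n)"
    using gN N0 T_pos[of N] by (intro mult_nonneg_nonneg divide_nonneg_nonneg) (auto intro: power_mono)
  then show "V * (\<Sum>j<N. g (?T (Suc j)) * ?T j ^ n) \<le> integral {Q1..Q2} ?f"
    using step[of N] split last(2) by simp
qed

text \<open>Let h(q) = \<psi>(q) q^(n / m), which is nonincreasing by hypothesis. Then so are \<psi>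
  = h q^(-n / m), phi = h^m and the integrand phi / q, and the last is integrable because it is
  monotone.\<close>

lemma approximating_function_facts:
  fixes \<psi> :: "real \<Rightarrow> real"
  assumes Q: "1 \<le> Q1" and pos: "\<And>q. q \<in> {Q1..Q2} \<Longrightarrow> 0 < \<psi> q" and m: "1 \<le> m" and n: "1 \<le> n"
    and anti: "antimono_on {Q1..Q2} (\<lambda>q. \<psi> q / q powr (- (real n / real m)))"
  shows "antimono_on {Q1..Q2} \<psi>" "antimono_on {Q1..Q2} (phi m n \<psi>)"
    "(\<lambda>q. q ^ (n - 1) * \<psi> q ^ m) integrable_on {Q1..Q2}"
proof -
  let ?h = "\<lambda>q. \<psi> q * q powr (real n / real m)"
  have h: "?h y \<le> ?h x" if "x \<in> {Q1..Q2}" "y \<in> {Q1..Q2}" "x \<le> y" for x y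
    using monotone_onD[OF anti that] by (simp add: powr_minus divide_inverse)
  show psi: "antimono_on {Q1..Q2} \<psi>"
  proof (rule monotone_onI)
    fix x y assume xy: "x \<in> {Q1..Q2}" "y \<in> {Q1..Q2}" "x \<le> y"
    have x0: "0 < x" using xy Q by auto
    have "\<psi> y * x powr (real n / real m) \<le> ?h y"
      using pos[OF xy(2)] xy x0 by (intro mult_left_mono powr_mono2) auto
    also have "\<dots> \<le> ?h x" by (rule h[OF xy])
    finally show "\<psi> y \<le> \<psi> x" using x0 by simp
  qed
  have ph: "phi m n \<psi> q = ?h q ^ m" if "q \<in> {Q1..Q2}" for q
  proof -
    have "(q powr (real n / real m)) ^ m = q ^ n"
      using that Q m by (simp add: powr_realpow[symmetric] powr_powr)
    then show ?thesis by (simp add: phi_def power_mult_distrib)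
  qed
  have phi_le: "phi m n \<psi> y \<le> phi m n \<psi> x" if "x \<in> {Q1..Q2}" "y \<in> {Q1..Q2}" "x \<le> y" for x y
    unfolding ph[OF that(1)] ph[OF that(2)] using h[OF that] pos[OF that(2)] by (intro power_mono) auto
  then show "antimono_on {Q1..Q2} (phi m n \<psi>)" by (intro monotone_onI) auto
  have "mono_on {Q1..Q2} (\<lambda>q. - (q ^ (n - 1) * \<psi> q ^ m))"
  proof (rule mono_onI)
    fix x y assume xy: "x \<in> {Q1..Q2}" "y \<in> {Q1..Q2}" "x \<le> y"
    have e: "q ^ (n - 1) * \<psi> q ^ m = phi m n \<psi> q / q" if "q \<in> {Q1..Q2}" for q
    proof -
      obtain l where "n = Suc l" using n by (cases n) auto
      then show ?thesis using that Q by (simp add: phi_def)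
    qed
    have "phi m n \<psi> y / y \<le> phi m n \<psi> x / x"
      using phi_le[OF xy] xy Q pos[OF xy(1)] by (intro frac_le) (auto simp: phi_def)
    then show "- (x ^ (n - 1) * \<psi> x ^ m) \<le> - (y ^ (n - 1) * \<psi> y ^ m)" using e xy by simp
  qed
  then have "(\<lambda>q. - (q ^ (n - 1) * \<psi> q ^ m)) integrable_on {Q1..Q2}" by (rule integrable_on_mono_on)
  from integrable_neg[OF this] show "(\<lambda>q. q ^ (n - 1) * \<psi> q ^ m) integrable_on {Q1..Q2}" by simp
qed

section \<open>Unions over all shells\<close>

context two_norms
begin

lemma near_minus: "near s c (- r) = near s c r"
proof -
  have "N\<mu> (A *v snd (- r) - fst (- r)) = N\<mu> (A *v snd r - fst r)" for A
    using is_norm_minus[OF N\<mu>, of "A *v snd r - fst r"]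
    by (simp add: linear_neg[OF matrix_vector_mul_linear])
  then show ?thesis by (simp add: near_def)
qed

lemma shell_minus: "unimodular \<Lambda> \<Longrightarrow> r \<in> shell \<Lambda> T T' \<Longrightarrow> - r \<in> shell \<Lambda> T T'"
  using unimodular.primitive_minus[of \<Lambda> r] is_norm_minus[OF N\<nu>, of "snd r"] by (simp add: shell_def)

lemma shell_neq_minus:
  assumes "unimodular \<Lambda>" "r \<in> shell \<Lambda> T T'" shows "- r \<noteq> r"
proof
  assume "- r = r"
  then have "r + r = 0" by (simp add: neg_eq_iff_add_eq_0)
  then have "(2 :: real) *\<^sub>R r = 0" by (simp only: scaleR_2)
  then show False using assms by (simp add: shell_def unimodular.primitive_def)
qed

lemma card_shell_le:
  "\<exists>B\<ge>1. \<exists>C\<ge>0. \<forall>\<Lambda> a T. lattice_min \<Lambda> a \<longrightarrow> B \<le> T * a ^ (2 * (CARD('m) + CARD('n)) - 1) \<longrightarrow>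
     real (card (shell \<Lambda> T (2 * T))) \<le> C * T ^ (CARD('m) + CARD('n))"
proof -
  let ?d = "CARD('m) + CARD('n)"
  let ?B = "last_min_const ?d ^ (?d * ?d + 2 * ?d)"
  let ?C = "plane_const ?d * (reach * 2) ^ ?d"
  have B1: "1 \<le> ?B" using last_min_const_ge_1 by (rule one_le_power)
  have C0: "0 \<le> ?C" using plane_const_pos[of ?d] reach_ge_1 by (intro mult_nonneg_nonneg) auto
  show ?thesis
  proof (rule exI[of _ ?B], rule conjI[OF B1], rule exI[of _ ?C], rule conjI[OF C0], intro allI impI)
    fix \<Lambda> :: "((real ^ 'm) \<times> (real ^ 'n)) set" and a T :: real
    assume L: "lattice_min \<Lambda> a" and BT: "?B \<le> T * a ^ (2 * ?d - 1)"
    interpret lattice_min \<Lambda> a by (rule L)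
    have "shell \<Lambda> T (2 * T) \<subseteq> \<Lambda> \<inter> cball 0 (reach * (2 * T))" by (auto simp: shell_def primitive_def)
    then have "card (shell \<Lambda> T (2 * T)) \<le> card (\<Lambda> \<inter> cball 0 (reach * (2 * T)))" by (intro card_mono finite_bounded) auto
    also have "real (card (\<Lambda> \<inter> cball 0 (reach * (2 * T)))) \<le> ?C * T ^ ?d" by (rule card_cball_reach_le(2)[OF L BT])
    finally show "real (card (shell \<Lambda> T (2 * T))) \<le> ?C * T ^ ?d" by simp
  qed
qed

lemma shells_upper:
  assumes \<epsilon>: "0 < (\<epsilon>::real)" and \<tau>: "0 < \<tau>" "\<tau> \<le> (1::real)"
  shows "\<exists>B\<ge>1. \<exists>c0>0. \<forall>\<Lambda> a Q1 c N. lattice_min \<Lambda> a \<longrightarrow> 1 \<le> Q1 \<longrightarrow> B \<le> Q1 * a ^ (2 * (CARD('m) + CARD('n)) - 1) \<longrightarrow>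
     (\<forall>j\<le>N. 0 < c j \<and> c j \<le> c0) \<longrightarrow>
     2 * measure lebesgue (\<Union>j\<le>N. \<Union>r\<in>shell \<Lambda> (Q1 * (1 + \<tau>) ^ j) (Q1 * (1 + \<tau>) ^ Suc j). near 0 (c j) r)
       \<le> (V\<mu> * V\<nu> / zeta_nat (CARD('m) + CARD('n)) * ((1 + \<tau>) ^ CARD('n) - 1) + \<epsilon>)
         * (\<Sum>j\<le>N. c j ^ CARD('m) * (Q1 * (1 + \<tau>) ^ j) ^ CARD('n))"
proof -
  let ?d = "CARD('m) + CARD('n)" and ?w = "V\<mu> * V\<nu> / zeta_nat (CARD('m) + CARD('n)) * ((1 + \<tau>) ^ CARD('n) - 1)"
  obtain B c0 where B: "1 \<le> B" and c0: "0 < c0" and main: "\<And>\<Lambda> a T c. lattice_min \<Lambda> a \<Longrightarrow> 1 \<le> T \<Longrightarrow> B \<le> T * a ^ (2 * ?d - 1) \<Longrightarrow>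
     0 < c \<Longrightarrow> c \<le> c0 \<Longrightarrow>
     \<bar>(\<Sum>r\<in>shell \<Lambda> T ((1 + \<tau>) * T). measure lebesgue (near 0 c r)) - ?w * (c ^ CARD('m) * T ^ CARD('n))\<bar> \<le> \<epsilon> * (c ^ CARD('m) * T ^ CARD('n))"
    using sum_shell_measure[OF \<epsilon> \<tau>] by blast
  show ?thesis
  proof (rule exI[of _ B], rule conjI[OF B], rule exI[of _ c0], rule conjI[OF c0], intro allI impI)
    fix \<Lambda> :: "((real ^ 'm) \<times> (real ^ 'n)) set" and a Q1 :: real and c :: "nat \<Rightarrow> real" and N
    assume L: "lattice_min \<Lambda> a" and Q1: "1 \<le> Q1" and BQ: "B \<le> Q1 * a ^ (2 * ?d - 1)" and c: "\<forall>j\<le>N. 0 < c j \<and> c j \<le> c0"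
    interpret lattice_min \<Lambda> a by fact
    have uL: "unimodular \<Lambda>" by unfold_locales
    let ?T = "\<lambda>j. Q1 * (1 + \<tau>) ^ j"
    let ?S = "\<lambda>j. shell \<Lambda> (?T j) (?T (Suc j))"
    let ?I = "Sigma {..N} ?S"
    have T: "1 \<le> ?T j" "B \<le> ?T j * a ^ (2 * ?d - 1)" for j
    proof -
      have "Q1 * 1 \<le> ?T j" using Q1 \<tau> by (intro mult_left_mono one_le_power) auto
      then have 1: "Q1 \<le> ?T j" by simp
      then show "1 \<le> ?T j" using Q1 by linarith
      have "Q1 * a ^ (2 * ?d - 1) \<le> ?T j * a ^ (2 * ?d - 1)" using 1 a_pos by (intro mult_right_mono) auto
      then show "B \<le> ?T j * a ^ (2 * ?d - 1)" using BQ by linarith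
    qed
    have U: "(\<Union>j\<le>N. \<Union>r\<in>?S j. near 0 (c j) r) = (\<Union>(j, r)\<in>?I. near 0 (c j) r)" by auto
    have "2 * measure lebesgue (\<Union>(j, r)\<in>?I. near 0 (c j) r) \<le> (\<Sum>(j, r)\<in>?I. measure lebesgue (near 0 (c j) r))"
    proof -
      let ?N = "\<lambda>(j, r). near 0 (c j) r" and ?neg = "\<lambda>(j :: nat, r). (j, - r)"
      have "2 * measure lebesgue (\<Union>i\<in>?I. ?N i) \<le> (\<Sum>i\<in>?I. measure lebesgue (?N i))"
      proof (rule measure_Union_paired_le)
        show "finite ?I" using finite_shell[OF uL] by auto
        fix i assume i: "i \<in> ?I"
        show "?N i \<in> lmeasurable" by (auto simp: split_beta)
        show "?neg i \<in> ?I \<and> ?neg i \<noteq> i \<and> ?N (?neg i) = ?N i"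
          using i shell_minus[OF uL] shell_neq_minus[OF uL] by (auto simp only: mem_Sigma_iff split_paired_all prod.case near_minus prod.inject)
      qed
      then show ?thesis by (simp add: split_beta)
    qed
    also have "\<dots> = (\<Sum>j\<le>N. \<Sum>r\<in>?S j. measure lebesgue (near 0 (c j) r))"
      using finite_shell[OF uL] by (intro sum.Sigma[symmetric]) auto
    also have "\<dots> \<le> (\<Sum>j\<le>N. (?w + \<epsilon>) * (c j ^ CARD('m) * ?T j ^ CARD('n)))"
    proof (rule sum_mono)
      fix j assume "j \<in> {..N}"
      then have j: "0 < c j" "c j \<le> c0" using c by auto
      have "(1 + \<tau>) * ?T j = ?T (Suc j)" by simp
      then show "(\<Sum>r\<in>?S j. measure lebesgue (near 0 (c j) r)) \<le> (?w + \<epsilon>) * (c j ^ CARD('m) * ?T j ^ CARD('n))"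
        using main[OF L T[of j] j] unfolding distrib_right by (simp only: abs_le_iff) linarith
    qed
    finally show "2 * measure lebesgue (\<Union>j\<le>N. \<Union>r\<in>?S j. near 0 (c j) r) \<le> (?w + \<epsilon>) * (\<Sum>j\<le>N. c j ^ CARD('m) * ?T j ^ CARD('n))"
      unfolding U by (simp only: sum_distrib_left)
  qed
qed

text \<open>The rank in \<open>sum_measure_le_paired\<close> is the shell index, so in each pair the
  vector \<open>s\<close> of the earlier shell, which has the larger radius, is the axis of the
  tube. For a fixed axis in shell j the overlaps sum to O((c_j / T_j)^m) times the total sum;
  multiplied by the O(T_j^d) axes in that shell this is again c_j^m T_j^n times the total, whence
  the square.\<close>

lemma shells_lower:
  assumes \<epsilon>: "0 < (\<epsilon>::real)" and \<tau>: "0 < \<tau>" "\<tau> \<le> (1::real)"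
  shows "\<exists>B\<ge>1. \<exists>c0>0. \<exists>C\<ge>0. \<forall>\<Lambda> a Q1 c N U. lattice_min \<Lambda> a \<longrightarrow> 1 \<le> Q1 \<longrightarrow> B \<le> Q1 * a ^ (2 * (CARD('m) + CARD('n)) - 1) \<longrightarrow>
     (\<forall>j<N. 0 < c j \<and> c j \<le> c0) \<longrightarrow> (\<forall>i j. i \<le> j \<longrightarrow> j < N \<longrightarrow> c j \<le> c i) \<longrightarrow> U \<in> lmeasurable \<longrightarrow>
     (\<forall>j<N. \<forall>r\<in>shell \<Lambda> (Q1 * (1 + \<tau>) ^ j) (Q1 * (1 + \<tau>) ^ Suc j). near 0 (c j) r \<subseteq> U) \<longrightarrow>
     (V\<mu> * V\<nu> / zeta_nat (CARD('m) + CARD('n)) * ((1 + \<tau>) ^ CARD('n) - 1) - \<epsilon>)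
         * (\<Sum>j<N. c j ^ CARD('m) * (Q1 * (1 + \<tau>) ^ j) ^ CARD('n))
       - C * (\<Sum>j<N. c j ^ CARD('m) * (Q1 * (1 + \<tau>) ^ j) ^ CARD('n))\<^sup>2 \<le> 2 * measure lebesgue U"
proof -
  let ?m = "CARD('m)" and ?n = "CARD('n)" and ?d = "CARD('m) + CARD('n)"
  let ?w = "V\<mu> * V\<nu> / zeta_nat (CARD('m) + CARD('n)) * ((1 + \<tau>) ^ CARD('n) - 1)"
  have e2: "0 < \<epsilon> / 2" "0 < \<epsilon> / (2 * near_const)" using \<epsilon> near_const_pos by auto
  have d: "2 \<le> ?d" by (rule two_le_CARD_sum)
  obtain B1 c0 where B1: "1 \<le> B1" and c0: "0 < c0" and main: "\<And>\<Lambda> a T c. lattice_min \<Lambda> a \<Longrightarrow> 1 \<le> T \<Longrightarrow> B1 \<le> T * a ^ (2 * ?d - 1) \<Longrightarrow>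
     0 < c \<Longrightarrow> c \<le> c0 \<Longrightarrow>
     \<bar>(\<Sum>r\<in>shell \<Lambda> T ((1 + \<tau>) * T). measure lebesgue (near 0 c r)) - ?w * (c ^ ?m * T ^ ?n)\<bar> \<le> \<epsilon> / 2 * (c ^ ?m * T ^ ?n)"
    using sum_shell_measure[OF e2(1) \<tau>] by blast
  obtain \<kappa> B2 where \<kappa>: "0 < \<kappa>" "\<kappa> \<le> 1" and B2: "1 \<le> B2" and bad: "\<And>\<Lambda> a T D. lattice_min \<Lambda> a \<Longrightarrow> 1 \<le> T \<Longrightarrow> B2 \<le> T * a ^ (2 * ?d - 1) \<Longrightarrow>
     0 < D \<Longrightarrow> D ^ (?d - 1) = \<kappa> * T ^ (?d - 2) \<Longrightarrow>
     real (card {r \<in> shell \<Lambda> T (2 * T). \<exists>x\<in>\<Lambda>. 0 < gram x r \<and> gram x r \<le> D\<^sup>2}) \<le> \<epsilon> / (2 * near_const) * T ^ ?d"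
    using card_bad_shell[OF e2(2)] by blast
  obtain B3 C where B3: "1 \<le> B3" and C: "0 \<le> C" and cnt: "\<And>\<Lambda> a T. lattice_min \<Lambda> a \<Longrightarrow> B3 \<le> T * a ^ (2 * ?d - 1) \<Longrightarrow>
     real (card (shell \<Lambda> T (2 * T))) \<le> C * T ^ ?d"
    using card_shell_le by blast
  \<comment> \<open>The last summand forces T_j >= \<open>nconst\<^sup>2\<close>, so that D_j <= T_j
    <= |s|^2 for \<open>s\<close> in shell j, as \<open>sum_near_pair_le\<close> requires.\<close>
  define B where "B = B1 + B2 + B3 + last_min_const ?d ^ (2 * ?d - 1) * nconst\<^sup>2"
  have K: "0 < last_min_const ?d ^ (2 * ?d - 1)" using last_min_const_ge_1[of ?d] by (intro zero_less_power) linarith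
  have BB: "1 \<le> B" "B1 \<le> B" "B2 \<le> B" "B3 \<le> B" "last_min_const ?d ^ (2 * ?d - 1) * nconst\<^sup>2 \<le> B"
    using B1 B2 B3 mult_nonneg_nonneg[OF less_imp_le[OF K] zero_le_power2[of nconst]] by (auto simp: B_def)
  define C' where "C' = C * (pair_const / \<kappa>)"
  have C'0: "0 \<le> C'" using C \<kappa> tube_consts_pos(4) by (auto simp: C'_def)
  show ?thesis
  proof (rule exI[of _ B], rule conjI[OF BB(1)], rule exI[of _ c0], rule conjI[OF c0], rule exI[of _ C'], rule conjI[OF C'0], intro allI impI)
    fix \<Lambda> :: "((real ^ 'm) \<times> (real ^ 'n)) set" and a Q1 :: real and c :: "nat \<Rightarrow> real" and N and U :: "(real ^ 'n ^ 'm) set"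
    assume L: "lattice_min \<Lambda> a" and Q1: "1 \<le> Q1" and BQ: "B \<le> Q1 * a ^ (2 * ?d - 1)" and c: "\<forall>j<N. 0 < c j \<and> c j \<le> c0"
      and c_anti: "\<forall>i j. i \<le> j \<longrightarrow> j < N \<longrightarrow> c j \<le> c i" and U: "U \<in> lmeasurable"
      and sub: "\<forall>j<N. \<forall>r\<in>shell \<Lambda> (Q1 * (1 + \<tau>) ^ j) (Q1 * (1 + \<tau>) ^ Suc j). near 0 (c j) r \<subseteq> U"
    interpret lattice_min \<Lambda> a by fact
    have uL: "unimodular \<Lambda>" by unfold_locales
    define T where "T j = Q1 * (1 + \<tau>) ^ j" for j
    have T_Suc: "T (Suc j) = (1 + \<tau>) * T j" for j by (simp add: T_def)
    let ?S = "\<lambda>j. shell \<Lambda> (T j) (T (Suc j))"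
    have T_mono: "T i \<le> T j" if "i \<le> j" for i j
      unfolding T_def using Q1 \<tau> that by (intro mult_left_mono power_increasing) auto
    have TQ: "Q1 \<le> T j" "1 \<le> T j" "0 < T j" for j
    proof -
      show "Q1 \<le> T j" using T_mono[of 0 j] by (simp add: T_def)
      then show "1 \<le> T j" "0 < T j" using Q1 by linarith+
    qed
    have BT: "B \<le> T j * a ^ (2 * ?d - 1)" for j
    proof -
      have "Q1 * a ^ (2 * ?d - 1) \<le> T j * a ^ (2 * ?d - 1)" using TQ a_pos by (intro mult_right_mono) auto
      then show ?thesis using BQ by linarith
    qed
    have T_large: "nconst\<^sup>2 \<le> T j" for j
    proof -
      have "a ^ (2 * ?d - 1) \<le> last_min_const ?d ^ (2 * ?d - 1)"
        using a_le_const a_pos by (intro power_mono) (auto simp only: DIM_pair_cart)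
      then have "T j * a ^ (2 * ?d - 1) \<le> T j * last_min_const ?d ^ (2 * ?d - 1)"
        using TQ(3)[of j] by (intro mult_left_mono) auto
      then have "last_min_const ?d ^ (2 * ?d - 1) * nconst\<^sup>2 \<le> last_min_const ?d ^ (2 * ?d - 1) * T j"
        using BT[of j] BB(5) by (simp add: mult.commute)
      then show ?thesis using K by simp
    qed
    have S2: "r \<in> shell \<Lambda> (T j) (2 * T j)" if "r \<in> ?S j" for r j
    proof -
      have "T (Suc j) \<le> 2 * T j" unfolding T_Suc using \<tau> TQ(3)[of j] by (intro mult_right_mono) auto
      moreover from this have "reach * T (Suc j) \<le> reach * (2 * T j)" using reach_ge_1 by (intro mult_left_mono) auto
      ultimately show ?thesis using that by (auto simp: shell_def)
    qed
    define D where "D j = root (?d - 1) (\<kappa> * T j ^ (?d - 2))" for j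
    have D0: "0 < D j" and Dd: "D j ^ (?d - 1) = \<kappa> * T j ^ (?d - 2)" for j
    proof -
      have "0 < \<kappa> * T j ^ (?d - 2)" using \<kappa> TQ by simp
      then show "0 < D j" "D j ^ (?d - 1) = \<kappa> * T j ^ (?d - 2)" using d by (auto simp: D_def)
    qed
    have DT: "D j \<le> T j" for j
    proof (rule power_le_imp_le_base)
      have "\<kappa> * T j ^ (?d - 2) \<le> 1 * T j ^ (?d - 1)" using \<kappa> TQ(2,3)[of j] by (intro mult_mono power_increasing) auto
      then have "D j ^ (?d - 1) \<le> T j ^ (?d - 1)" unfolding Dd by simp
      then show "D j ^ Suc (?d - 2) \<le> T j ^ Suc (?d - 2)" using d by (simp only: Suc_diff_le[symmetric] numeral_2_eq_2 diff_Suc_Suc One_nat_def)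
    qed (use TQ(3)[of j] in simp)
    let ?bad = "\<lambda>j r. \<exists>x\<in>\<Lambda>. 0 < gram x r \<and> gram x r \<le> (D j)\<^sup>2"
    define G where "G j = {r \<in> ?S j. \<not> ?bad j r}" for j
    have GS: "G j \<subseteq> ?S j" for j by (auto simp: G_def)
    have finG: "finite (G j)" for j using finite_subset[OF GS finite_shell[OF uL]] .
    let ?Y = "\<lambda>j. c j ^ ?m * T j ^ ?n"
    have Y0: "0 \<le> ?Y j" if "j < N" for j using c TQ(3)[of j] that by (intro mult_nonneg_nonneg) (auto simp: less_imp_le)
    have good_sum: "(?w - \<epsilon>) * ?Y j \<le> (\<Sum>r\<in>G j. measure lebesgue (near 0 (c j) r))" if j: "j < N" for j
    proof -
      have cj: "0 < c j" "c j \<le> c0" using c j by auto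
      have "B1 \<le> T j * a ^ (2 * ?d - 1)" "B2 \<le> T j * a ^ (2 * ?d - 1)" using BT[of j] BB by auto
      note mj = main[OF L TQ(2) this(1) cj, folded T_Suc] and bj = bad[OF L TQ(2) this(2) D0 Dd]
      let ?Bd = "{r \<in> ?S j. ?bad j r}"
      have "(\<Sum>r\<in>?Bd. measure lebesgue (near 0 (c j) r)) \<le> (\<Sum>r\<in>?Bd. near_const * (c j / T j) ^ ?m)"
        using TQ(3)[of j] cj by (intro sum_mono measure_near_le) (auto simp: shell_def)
      also have "\<dots> = real (card ?Bd) * (near_const * (c j / T j) ^ ?m)" by simp
      also have "\<dots> \<le> (\<epsilon> / (2 * near_const) * T j ^ ?d) * (near_const * (c j / T j) ^ ?m)"
      proof (rule mult_right_mono)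
        have "card ?Bd \<le> card {r \<in> shell \<Lambda> (T j) (2 * T j). ?bad j r}"
          using S2 finite_shell[OF uL] by (intro card_mono) auto
        then show "real (card ?Bd) \<le> \<epsilon> / (2 * near_const) * T j ^ ?d" using bj by linarith
      qed (use near_const_pos cj TQ(3)[of j] in simp)
      also have "\<dots> = \<epsilon> / 2 * ?Y j"
        using near_const_pos TQ(3)[of j] by (simp add: power_divide power_add)
      finally have "(\<Sum>r\<in>?Bd. measure lebesgue (near 0 (c j) r)) \<le> \<epsilon> / 2 * ?Y j" .
      moreover have "(\<Sum>r\<in>?S j. measure lebesgue (near 0 (c j) r)) =
          (\<Sum>r\<in>?Bd. measure lebesgue (near 0 (c j) r)) + (\<Sum>r\<in>G j. measure lebesgue (near 0 (c j) r))"
        unfolding G_def by (subst sum.union_disjoint[symmetric]) (auto intro!: sum.cong finite_subset[OF _ finite_shell[OF uL]])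
      moreover have "?w * ?Y j - \<epsilon> / 2 * ?Y j \<le> (\<Sum>r\<in>?S j. measure lebesgue (near 0 (c j) r))"
        using mj by (simp only: abs_le_iff) linarith
      moreover have "(w - \<epsilon>) * y \<le> g" if "b \<le> \<epsilon> / 2 * y" "x = b + g" "w * y - \<epsilon> / 2 * y \<le> x" for w y b x g :: real
      proof -
        have "(w - \<epsilon>) * y = w * y - \<epsilon> / 2 * y - \<epsilon> / 2 * y" by (simp add: algebra_simps)
        then show ?thesis using that by linarith
      qed
      ultimately show ?thesis by blast
    qed
    let ?P = "\<Sum>j<N. ?Y j"
    let ?I = "Sigma {..<N} G"
    let ?N = "\<lambda>(j, r). near 0 (c j) r"
    let ?J = "\<lambda>i. {j \<in> ?I. fst i \<le> fst j \<and> j \<noteq> i \<and> j \<noteq> (\<lambda>(j, r). (j, - r)) i}"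
    have finI: "finite ?I" using finG by auto
    have P0: "0 \<le> ?P" using Y0 by (intro sum_nonneg) auto
    have pair: "(\<Sum>l\<in>?J i. measure lebesgue (?N i \<inter> ?N l)) \<le> pair_const / \<kappa> * (c (fst i) / T (fst i)) ^ ?m * ?P" if i: "i \<in> ?I" for i
    proof -
      obtain k s where ks: "i = (k, s)" by (cases i)
      have k: "k < N" and sG: "s \<in> G k" using i ks by auto
      have sp: "primitive s" and sS: "s \<in> shell \<Lambda> (T k) (2 * T k)" using GS[of k] sG S2[of s k] by (auto simp: shell_def)
      define R where "R j = {r \<in> G j. r \<notin> span {s}}" for j
      have "?J i \<subseteq> Sigma {k..<N} R"
      proof
        fix l assume l: "l \<in> ?J i"
        obtain j r where jr: "l = (j, r)" by (cases l)
        have j: "j < N" "r \<in> G j" "k \<le> j" "(j, r) \<noteq> (k, s)" "(j, r) \<noteq> (k, - s)" using l ks jr by auto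
        have rS: "r \<in> ?S j" and sS': "s \<in> ?S k" using j GS[of j] GS[of k] sG by auto
        \<comment> \<open>The only primitive vectors on the line of \<open>s\<close> are
          \<open>s\<close> and \<open>- s\<close>. They have the same denominator and hence belong
          to one shell, where both are excluded from the pairs.\<close>
        have "r \<notin> span {s}"
        proof
          assume "r \<in> span {s}"
          then have "r = s \<or> r = - s" using rS sp by (intro primitive_in_span_eq) (auto simp: shell_def)
          then have "j \<noteq> k" "N\<nu> (snd r) = N\<nu> (snd s)" using j is_norm_minus[OF N\<nu>, of "snd s"] by auto
          moreover from this have "T (Suc k) \<le> T j" using j by (intro T_mono) auto
          ultimately show False using rS sS' by (auto simp: shell_def)
        qed
        then show "l \<in> Sigma {k..<N} R" using j jr by (auto simp: R_def)
      qed
      moreover have finR: "finite (R j)" for j using finG by (auto simp: R_def)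
      ultimately have "(\<Sum>l\<in>?J i. measure lebesgue (?N i \<inter> ?N l)) \<le> (\<Sum>l\<in>Sigma {k..<N} R. measure lebesgue (?N i \<inter> ?N l))"
        by (intro sum_mono2) auto
      also have "\<dots> = (\<Sum>j\<in>{k..<N}. \<Sum>r\<in>R j. measure lebesgue (near 0 (c k) s \<inter> near 0 (c j) r))"
        using finR by (subst sum.Sigma) (auto simp: ks split_beta)
      also have "\<dots> \<le> (\<Sum>j\<in>{k..<N}. pair_const / \<kappa> * (c k / T k) ^ ?m * ?Y j)"
      proof (rule sum_mono)
        fix j assume "j \<in> {k..<N}"
        then have j: "k \<le> j" "j < N" by auto
        show "(\<Sum>r\<in>R j. measure lebesgue (near 0 (c k) s \<inter> near 0 (c j) r)) \<le> pair_const / \<kappa> * (c k / T k) ^ ?m * ?Y j"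
        proof (rule sum_near_pair_le[OF L sp TQ(3) _ _ T_mono[OF j(1)] D0 _ Dd \<kappa>(1)])
          show Ts: "T k < N\<nu> (snd s)" "norm s \<le> reach * (2 * T k)" using sS by (auto simp: shell_def)
          show "D k \<le> (norm s)\<^sup>2"
          proof -
            have nc: "0 < nconst" using nconst(1) by linarith
            have "T k \<le> nconst * norm (snd s)" using Ts(1) nconst(4)[of "snd s"] by linarith
            also have "\<dots> \<le> nconst * norm s" using nc norm_snd_le[of "snd s" "fst s"] by (intro mult_left_mono) auto
            finally have "(T k)\<^sup>2 \<le> (nconst * norm s)\<^sup>2" using TQ(3)[of k] by (intro power_mono) auto
            moreover have "nconst\<^sup>2 * T k \<le> T k * T k" using T_large[of k] TQ(3)[of k] by (intro mult_right_mono) auto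
            ultimately have "nconst\<^sup>2 * T k \<le> nconst\<^sup>2 * (norm s)\<^sup>2" by (simp add: power2_eq_square mult_ac)
            then have "T k \<le> (norm s)\<^sup>2" using nc by simp
            then show ?thesis using DT[of k] by linarith
          qed
          show "(D k)\<^sup>2 < gram x s" if "x \<in> \<Lambda>" "0 < gram x s" for x using sG that by (force simp: G_def)
          show "0 < c j" using c j by auto
          show "c j \<le> c k" using c_anti j by auto
          show "finite (R j)" by (rule finR)
          have RS: "r \<in> shell \<Lambda> (T j) (2 * T j)" if "r \<in> R j" for r using that S2[of r j] GS[of j] by (auto simp: R_def)
          show "R j \<subseteq> \<Lambda>" using RS by (auto simp: shell_def primitive_def)
          show "r \<notin> span {s} \<and> T j < N\<nu> (snd r) \<and> N\<nu> (snd r) \<le> 2 * T j" if "r \<in> R j" for r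
            using RS[OF that] that by (auto simp: R_def shell_def)
        qed
      qed
      also have "\<dots> \<le> (\<Sum>j<N. pair_const / \<kappa> * (c k / T k) ^ ?m * ?Y j)"
      proof (intro sum_mono2)
        have "0 \<le> pair_const / \<kappa> * (c k / T k) ^ ?m" using c k TQ(3)[of k] \<kappa> tube_consts_pos(4) by (simp add: less_imp_le)
        moreover have "0 \<le> ?Y j" if "j \<in> {..<N} - {k..<N}" for j using that by (intro Y0) simp
        ultimately show "0 \<le> pair_const / \<kappa> * (c k / T k) ^ ?m * ?Y j" if "j \<in> {..<N} - {k..<N}" for j
          using that by (blast intro: mult_nonneg_nonneg)
      qed auto
      finally show ?thesis by (simp add: ks sum_distrib_left)
    qed
    have "(?w - \<epsilon>) * ?P = (\<Sum>j<N. (?w - \<epsilon>) * ?Y j)" by (simp only: sum_distrib_left)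
    also have "\<dots> \<le> (\<Sum>j<N. \<Sum>r\<in>G j. measure lebesgue (near 0 (c j) r))" by (intro sum_mono good_sum) auto
    also have "\<dots> = (\<Sum>i\<in>?I. measure lebesgue (?N i))" using finG by (subst sum.Sigma) (auto simp: split_beta)
    also have "\<dots> \<le> 2 * measure lebesgue U + (\<Sum>i\<in>?I. \<Sum>l\<in>?J i. measure lebesgue (?N i \<inter> ?N l))"
    proof (rule sum_measure_le_paired[OF finI _ U])
      show "?N i \<in> lmeasurable" for i by (auto simp: split_beta)
      show "?N i \<subseteq> U" if "i \<in> ?I" for i using that sub GS by (fastforce simp: T_def)
    qed
    also have "(\<Sum>i\<in>?I. \<Sum>l\<in>?J i. measure lebesgue (?N i \<inter> ?N l)) \<le> (\<Sum>i\<in>?I. pair_const / \<kappa> * (c (fst i) / T (fst i)) ^ ?m * ?P)"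
      by (intro sum_mono pair)
    also have "\<dots> = (\<Sum>j<N. \<Sum>r\<in>G j. pair_const / \<kappa> * (c j / T j) ^ ?m * ?P)"
      using finG by (subst sum.Sigma) (auto simp: split_beta)
    also have "\<dots> \<le> (\<Sum>j<N. C' * ?P * ?Y j)"
    proof (rule sum_mono)
      fix j assume "j \<in> {..<N}"
      then have j: "j < N" by simp
      have "card (G j) \<le> card (shell \<Lambda> (T j) (2 * T j))" using S2 GS[of j] finite_shell[OF uL] by (intro card_mono) auto
      moreover have "real (card (shell \<Lambda> (T j) (2 * T j))) \<le> C * T j ^ ?d" using BT[of j] BB by (intro cnt[OF L]) auto
      ultimately have cG: "real (card (G j)) \<le> C * T j ^ ?d" by linarith
      have "(\<Sum>r\<in>G j. pair_const / \<kappa> * (c j / T j) ^ ?m * ?P) = real (card (G j)) * (pair_const / \<kappa> * (c j / T j) ^ ?m * ?P)" by simp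
      also have "\<dots> \<le> (C * T j ^ ?d) * (pair_const / \<kappa> * (c j / T j) ^ ?m * ?P)"
        using c j TQ(3)[of j] \<kappa> tube_consts_pos(4) P0 by (intro mult_right_mono cG mult_nonneg_nonneg) (auto simp: less_imp_le)
      also have "\<dots> = C' * ?P * (T j ^ ?d * (c j / T j) ^ ?m)" by (simp only: C'_def mult_ac)
      also have "T j ^ ?d * (c j / T j) ^ ?m = ?Y j" using TQ(3)[of j] by (simp add: power_divide power_add)
      finally show "(\<Sum>r\<in>G j. pair_const / \<kappa> * (c j / T j) ^ ?m * ?P) \<le> C' * ?P * ?Y j" .
    qed
    also have "\<dots> = C' * ?P\<^sup>2" by (simp only: sum_distrib_left[symmetric] power2_eq_square mult.assoc)
    finally have "(?w - \<epsilon>) * ?P - C' * ?P\<^sup>2 \<le> 2 * measure lebesgue U" by linarith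
    then show "(?w - \<epsilon>) * (\<Sum>j<N. c j ^ ?m * (Q1 * (1 + \<tau>) ^ j) ^ ?n)
       - C' * (\<Sum>j<N. c j ^ ?m * (Q1 * (1 + \<tau>) ^ j) ^ ?n)\<^sup>2 \<le> 2 * measure lebesgue U"
      by (simp only: T_def)
  qed
qed

end

subsection \<open>Multiples of primitive vectors and the final estimate\<close>

context two_norms
begin

text \<open>\<open>lambda1\<close> is defined as an infimum, so its positivity is read off from a
  nonzero lattice vector that is shortest in the Euclidean norm. Such a vector exists since a
  bounded set meeting every coset cannot be the whole space.\<close>

lemma lattice_min_lambda1:
  fixes \<Lambda> :: "((real ^ 'm) \<times> (real ^ 'n)) set"
  assumes "unimodular_lattice \<Lambda>"
  shows "0 < lambda1 (max_norm N\<mu> N\<nu>) \<Lambda>" "lattice_min \<Lambda> (lambda1 (max_norm N\<mu> N\<nu>) \<Lambda> / nconst)"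
proof -
  let ?N = "max_norm N\<mu> N\<nu>"
  interpret unimodular \<Lambda> by (unfold_locales) fact
  have nc: "0 < nconst" using nconst(1) by linarith
  obtain D where D: "bounded D" "\<And>x. \<exists>r\<in>\<Lambda>. x - r \<in> D" by (rule fundamental_domain) blast
  obtain R where R: "\<And>x. x \<in> D \<Longrightarrow> norm x \<le> R" using D(1) by (auto simp: bounded_iff)
  have "0 \<le> \<bar>R\<bar> + 1" by simp
  then obtain x :: "(real ^ 'm) \<times> (real ^ 'n)" where x: "norm x = \<bar>R\<bar> + 1"
    by (rule vector_choose_size)
  obtain r0 where "r0 \<in> \<Lambda>" "x - r0 \<in> D" using D(2) by blast
  then have ne: "\<Lambda> - {0} \<noteq> {}" using R[of x] x by auto
  obtain z where z: "z \<in> \<Lambda> - {0}" "\<And>y. y \<in> \<Lambda> - {0} \<Longrightarrow> norm z \<le> norm y"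
    using norm_minimizer[of "\<Lambda> - {0}"] ne by blast
  have lower: "norm z / (2 * nconst) \<le> ?N r" if r: "r \<in> \<Lambda> - {0}" for r
  proof -
    have "norm r \<le> norm (fst r) + norm (snd r)" using norm_Pair_le[of "fst r" "snd r"] by simp
    also have "\<dots> \<le> nconst * N\<mu> (fst r) + nconst * N\<nu> (snd r)" by (intro add_mono nconst)
    also have "\<dots> \<le> nconst * ?N r + nconst * ?N r"
      using nc by (intro add_mono mult_left_mono) (auto simp: max_norm_def)
    finally show ?thesis using z(2)[OF r] nc by (simp add: field_simps)
  qed
  have "norm z / (2 * nconst) \<le> lambda1 ?N \<Lambda>"
    unfolding lambda1_def by (rule cINF_greatest[OF ne lower])
  moreover have "0 < norm z / (2 * nconst)" using z(1) nc by simp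
  ultimately show pos: "0 < lambda1 ?N \<Lambda>" by linarith
  show "lattice_min \<Lambda> (lambda1 ?N \<Lambda> / nconst)"
  proof unfold_locales
    show "0 < lambda1 ?N \<Lambda> / nconst" using pos nc by simp
    fix r assume r: "r \<in> \<Lambda>" "r \<noteq> 0"
    have "lambda1 ?N \<Lambda> \<le> ?N r" unfolding lambda1_def
      using r lower by (intro cINF_lower) (auto intro!: bdd_belowI2)
    also have "\<dots> \<le> nconst * norm r"
    proof -
      have "N\<mu> (fst r) \<le> nconst * norm r"
        using norm_fst_le[of "fst r" "snd r"] nc by (intro order_trans[OF nconst(2)] mult_left_mono) auto
      moreover have "N\<nu> (snd r) \<le> nconst * norm r"
        using norm_snd_le[of "snd r" "fst r"] nc by (intro order_trans[OF nconst(4)] mult_left_mono) auto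
      ultimately show ?thesis by (simp add: max_norm_def)
    qed
    finally show "lambda1 ?N \<Lambda> / nconst \<le> norm r" using nc by (simp add: field_simps)
  qed
qed

lemma unit_matrices_Delta: "unit_matrices \<inter> Delta N\<mu> N\<nu> \<psi> r = near 0 (\<psi> (N\<nu> (snd r))) r"
  by (auto simp: unit_matrices_eq Delta_def near_def)

text \<open>The union defining \<open>W\<close> may run over infinitely many lattice vectors, but
  when \<psi> <= 1 only those in a fixed ball have resonant sets that meet the cube.\<close>

lemma unit_matrices_W_lmeasurable:
  assumes L: "unimodular \<Lambda>" and \<psi>: "\<And>q. q \<in> {Q1..Q2} \<Longrightarrow> \<psi> q \<le> 1" and Q: "1 \<le> Q1"
  shows "unit_matrices \<inter> W N\<mu> N\<nu> \<psi> \<Lambda> Q1 Q2 \<in> lmeasurable"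
proof -
  interpret unimodular \<Lambda> by fact
  let ?R = "{r \<in> \<Lambda>. Q1 \<le> N\<nu> (snd r) \<and> N\<nu> (snd r) \<le> Q2}" and ?N = "\<lambda>r. near 0 (\<psi> (N\<nu> (snd r))) r"
  have "unit_matrices \<inter> W N\<mu> N\<nu> \<psi> \<Lambda> Q1 Q2 = (\<Union>r\<in>?R. ?N r)"
    unfolding W_def by (simp only: Int_UN_distrib unit_matrices_Delta)
  also have "\<dots> = (\<Union>r\<in>?R \<inter> cball 0 (reach * Q2). ?N r)"
  proof -
    have "r \<in> cball 0 (reach * Q2)" if "r \<in> ?R" "A \<in> ?N r" for r A
      using that \<psi>[of "N\<nu> (snd r)"] Q near_norm_le[OF that(2), of Q2] by auto
    then show ?thesis by blast
  qed
  also have "\<dots> \<in> lmeasurable"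
    by (intro fmeasurable.finite_UN) (auto intro: finite_subset[OF _ finite_bounded[OF bounded_cball]])
  finally show ?thesis .
qed

text \<open>Used with \<open>T\<close> the outer end of a shell: the radius there is the smallest
  one in the shell, and it serves all vectors of the shell at once.\<close>

lemma near_subset_W:
  assumes "r \<in> \<Lambda>" "Q1 \<le> N\<nu> (snd r)" "N\<nu> (snd r) \<le> T" "T \<le> Q2" and \<psi>: "antimono_on {Q1..Q2} \<psi>"
  shows "near 0 (\<psi> T) r \<subseteq> unit_matrices \<inter> W N\<mu> N\<nu> \<psi> \<Lambda> Q1 Q2"
proof -
  have "\<psi> T \<le> \<psi> (N\<nu> (snd r))" using assms monotone_onD[OF \<psi>, of "N\<nu> (snd r)" T] by simp
  then have "near 0 (\<psi> T) r \<subseteq> unit_matrices \<inter> Delta N\<mu> N\<nu> \<psi> r"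
    unfolding unit_matrices_Delta by (auto simp: near_def)
  then show ?thesis using assms by (auto simp: W_def)
qed

text \<open>An approximation by a multiple of a primitive vector \<open>s\<close> is passed on to \<open>s\<close> itself unless
  the denominator of \<open>s\<close> falls below \<open>Q1\<close>; in that case some multiple of \<open>s\<close> has its denominator
  between \<open>Q1\<close> and \<open>2 Q1\<close>.\<close>

lemma unit_matrices_W_subset:
  assumes L: "unimodular \<Lambda>" and Q: "1 \<le> Q1" and \<tau>: "0 < \<tau>" and N: "Q2 < Q1 * (1 + \<tau>) ^ Suc N"
    and \<psi>: "antimono_on {Q1..Q2} \<psi>" "\<And>q. q \<in> {Q1..Q2} \<Longrightarrow> 0 < \<psi> q \<and> \<psi> q \<le> 1"
  shows "unit_matrices \<inter> W N\<mu> N\<nu> \<psi> \<Lambda> Q1 Q2 \<subseteq>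
     (\<Union>j\<le>N. \<Union>r\<in>shell \<Lambda> (Q1 * (1 + \<tau>) ^ j) (Q1 * (1 + \<tau>) ^ Suc j). near 0 (\<psi> (Q1 * (1 + \<tau>) ^ j)) r) \<union>
     (\<Union>r\<in>{r \<in> \<Lambda> \<inter> cball 0 (reach * (2 * Q1)). Q1 \<le> N\<nu> (snd r)}. near 0 (\<psi> Q1) r)"
proof
  interpret unimodular \<Lambda> by fact
  let ?T = "\<lambda>j. Q1 * (1 + \<tau>) ^ j"
  fix A assume "A \<in> unit_matrices \<inter> W N\<mu> N\<nu> \<psi> \<Lambda> Q1 Q2"
  then obtain r where r: "r \<in> \<Lambda>" "Q1 \<le> N\<nu> (snd r)" "N\<nu> (snd r) \<le> Q2" and A: "A \<in> near 0 (\<psi> (N\<nu> (snd r))) r"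
    unfolding W_def by (auto simp flip: unit_matrices_Delta)
  have "r \<noteq> 0" using r(2) Q is_norm_zero[OF N\<nu>] by auto
  then obtain k s where k: "1 \<le> (k::nat)" and s: "primitive s" and rs: "r = real k *\<^sub>R s"
    by (rule primitive_divisor[OF r(1)])
  let ?q = "N\<nu> (snd s)" and ?e = "N\<mu> (A *v snd s - fst s)"
  have mult: "N\<nu> (snd (real i *\<^sub>R s)) = real i * ?q" "N\<mu> (A *v snd (real i *\<^sub>R s) - fst (real i *\<^sub>R s)) = real i * ?e" for i
  proof -
    show "N\<nu> (snd (real i *\<^sub>R s)) = real i * ?q" by (simp add: is_norm_scale[OF N\<nu>])
    have "A *v snd (real i *\<^sub>R s) - fst (real i *\<^sub>R s) = real i *\<^sub>R (A *v snd s - fst s)"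
      by (simp add: linear_scale[OF matrix_vector_mul_linear] scaleR_diff_right)
    then show "N\<mu> (A *v snd (real i *\<^sub>R s) - fst (real i *\<^sub>R s)) = real i * ?e" by (simp only: is_norm_scale[OF N\<mu>] abs_of_nat)
  qed
  have Ab: "A \<in> box_matrices 0" using A by (simp add: near_def)
  have rk: "N\<nu> (snd r) = real k * ?q" and err: "real k * ?e \<le> \<psi> (real k * ?q)"
    using A mult[of k] by (auto simp: near_def rs)
  have q0: "0 < ?q" using r(2) Q rk k is_norm_nonneg[OF N\<nu>, of "snd s"]
    by (cases "?q = 0") auto
  have qr: "?q \<le> real k * ?q" using q0 k by simp
  have e0: "0 \<le> ?e" by (rule is_norm_nonneg[OF N\<mu>])
  have rQ: "real k * ?q \<in> {Q1..Q2}" using r rk by simp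
  show "A \<in> (\<Union>j\<le>N. \<Union>r\<in>shell \<Lambda> (?T j) (?T (Suc j)). near 0 (\<psi> (?T j)) r) \<union>
     (\<Union>r\<in>{r \<in> \<Lambda> \<inter> cball 0 (reach * (2 * Q1)). Q1 \<le> N\<nu> (snd r)}. near 0 (\<psi> Q1) r)"
  proof (cases "Q1 < ?q")
    case True
    let ?j = "(LEAST j. ?q \<le> ?T (Suc j))"
    have qT: "?q \<le> ?T (Suc N)" using qr rQ N by auto
    have j1: "?q \<le> ?T (Suc ?j)" by (rule LeastI[of "\<lambda>j. ?q \<le> ?T (Suc j)", OF qT])
    have jN: "?j \<le> N" by (rule Least_le[of "\<lambda>j. ?q \<le> ?T (Suc j)", OF qT])
    have j2: "?T ?j < ?q"
    proof (cases ?j)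
      case (Suc i)
      then have "\<not> ?q \<le> ?T (Suc i)" using not_less_Least[of i "\<lambda>j. ?q \<le> ?T (Suc j)"] by simp
      then show ?thesis unfolding Suc by simp
    qed (use True in simp)
    have TQ: "Q1 \<le> ?T i" for i using Q \<tau> by simp
    have "?e \<le> real k * ?e" using e0 k by (simp add: mult_le_cancel_right1)
    also have "\<dots> \<le> \<psi> (?T ?j)"
      using rQ TQ[of ?j] j2 qr by (intro order_trans[OF err monotone_onD[OF \<psi>(1)]]) auto
    finally have An: "A \<in> near 0 (\<psi> (?T ?j)) s" using Ab by (simp add: near_def)
    have "\<psi> (?T ?j) \<le> 1" using \<psi>(2)[of "?T ?j"] TQ[of ?j] j2 qr rQ by auto
    then have "\<psi> (?T ?j) \<le> 2 * ?T (Suc ?j)" using TQ[of "Suc ?j"] Q by linarith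
    then have "norm s \<le> reach * ?T (Suc ?j)" by (intro near_norm_le[OF An _ _ j1]) simp
    then have "s \<in> shell \<Lambda> (?T ?j) (?T (Suc ?j))" using s j1 j2 by (simp add: shell_def)
    then show ?thesis using An jN by blast
  next
    case False
    let ?i = "(LEAST i. Q1 \<le> real i * ?q)"
    have kQ: "Q1 \<le> real k * ?q" using rQ by simp
    have i1: "Q1 \<le> real ?i * ?q" by (rule LeastI[of "\<lambda>i. Q1 \<le> real i * ?q", OF kQ])
    have ik: "?i \<le> k" by (rule Least_le[of "\<lambda>i. Q1 \<le> real i * ?q", OF kQ])
    have i2: "real ?i * ?q \<le> 2 * Q1"
    proof (cases ?i)
      case (Suc l)
      then have "\<not> Q1 \<le> real l * ?q" using not_less_Least[of l "\<lambda>i. Q1 \<le> real i * ?q"] by simp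
      then show ?thesis unfolding Suc using False by (simp add: algebra_simps)
    qed (use Q in simp)
    let ?r = "real ?i *\<^sub>R s"
    have "real ?i * ?e \<le> real k * ?e" using ik e0 by (intro mult_right_mono) auto
    also have "\<dots> \<le> \<psi> Q1" using rQ by (intro order_trans[OF err monotone_onD[OF \<psi>(1)]]) auto
    finally have An: "A \<in> near 0 (\<psi> Q1) ?r" using Ab mult(2)[of ?i] by (simp only: near_def mem_Collect_eq)
    have "\<psi> Q1 \<le> 1" using \<psi>(2)[of Q1] rQ by auto
    then have "norm ?r \<le> reach * (2 * Q1)"
      using i2 Q mult(1)[of ?i] by (intro near_norm_le[OF An]) auto
    moreover have "?r \<in> \<Lambda>" using s by (intro of_nat_scale_mem) (simp add: primitive_def)
    ultimately have "?r \<in> {r \<in> \<Lambda> \<inter> cball 0 (reach * (2 * Q1)). Q1 \<le> N\<nu> (snd r)}" using i1 mult(1)[of ?i] by simp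
    then show ?thesis using An by blast
  qed
qed

end

text \<open>\<open>S\<close> and \<open>S'\<close> stand for the Riemann sums with the radii at the
  inner and at the outer ends of the shells, \<open>I\<close> for the integral F, and
  \<open>f\<close> for phi(Q1). From V S' <= I <= V S and S = b S' + f, with b close to 1 and f at
  most \<delta> I, both V S and V S' are within O(\<epsilon>) I of I. The quadratic term is
  negligible because V S' <= I <= \<delta>.\<close>

lemma relative_error_bound:
  fixes \<eta> V \<epsilon> b I f \<delta> S S' C C' x :: real
  assumes pos: "0 < \<eta>" "0 < V" "0 < \<epsilon>" "\<epsilon> \<le> 1" "0 \<le> C" "0 \<le> C'" "0 \<le> S'" and b: "1 \<le> b" "b \<le> 1 + \<epsilon> / 8"
    and sums: "I \<le> V * S" "V * S' \<le> I" "S = b * S' + f"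
    and \<delta>: "f \<le> \<delta> * I" "I \<le> \<delta>" "V * \<delta> \<le> \<epsilon> / 8" "C * \<delta> \<le> \<eta> * \<epsilon> / 8" "C' * \<delta> \<le> \<eta> * V\<^sup>2 * \<epsilon> / 4"
    and upper: "2 * x \<le> (2 * \<eta> * V + \<eta> * V * \<epsilon> / 4) * S + 2 * (C * f)"
    and lower: "(2 * \<eta> * V - \<eta> * V * \<epsilon> / 4) * S' - C' * S'\<^sup>2 \<le> 2 * x"
  shows "\<bar>x - \<eta> * I\<bar> \<le> \<epsilon> * \<eta> * I"
proof -
  have I0: "0 \<le> I" using sums(2) mult_nonneg_nonneg[of V S'] pos by linarith
  have Vf: "V * f \<le> \<epsilon> / 8 * I"
  proof -
    have "V * f \<le> V * (\<delta> * I)" using \<delta>(1) pos(2) by (intro mult_left_mono) auto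
    also have "\<dots> = (V * \<delta>) * I" by simp
    also have "\<dots> \<le> \<epsilon> / 8 * I" by (rule mult_right_mono[OF \<delta>(3) I0])
    finally show ?thesis .
  qed
  have Cf: "C * f \<le> \<eta> * \<epsilon> / 8 * I"
    using mult_left_mono[OF \<delta>(1) pos(5)] mult_right_mono[OF \<delta>(4) I0] by (simp add: mult_ac)
  have bI: "b * (V * S') \<le> (1 + \<epsilon> / 8) * I"
    using mult_mono[OF b(2) sums(2)] b(1) pos by simp
  have VS: "V * S = b * (V * S') + V * f" by (simp add: sums(3) algebra_simps)
  have VSu: "V * S \<le> (1 + \<epsilon> / 4) * I" using VS bI Vf by (simp add: algebra_simps)
  have "2 * x \<le> 2 * \<eta> * (1 + \<epsilon> / 8) * (V * S) + 2 * (C * f)" using upper by (simp add: algebra_simps)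
  also have "\<dots> \<le> 2 * \<eta> * (1 + \<epsilon> / 8) * ((1 + \<epsilon> / 4) * I) + 2 * (\<eta> * \<epsilon> / 8 * I)"
    using VSu Cf pos by (intro add_mono mult_left_mono) auto
  also have "\<dots> = 2 * (\<eta> * I) * (1 + \<epsilon> / 2 + \<epsilon> * \<epsilon> / 32)" by (simp add: field_simps)
  also have "\<dots> \<le> 2 * (\<eta> * I) * (1 + \<epsilon>)"
  proof (rule mult_left_mono)
    have "\<epsilon> * \<epsilon> \<le> 1 * \<epsilon>" using pos by (intro mult_right_mono) auto
    then show "1 + \<epsilon> / 2 + \<epsilon> * \<epsilon> / 32 \<le> 1 + \<epsilon>" using pos by linarith
  qed (use pos I0 in simp)
  finally have up: "x \<le> \<eta> * I + \<epsilon> * \<eta> * I" by (simp add: algebra_simps)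
  have low': "(1 - \<epsilon> / 4) * I \<le> V * S'"
  proof -
    have "(1 - \<epsilon> / 8) * I \<le> b * (V * S')" using sums(1) VS Vf by (simp add: algebra_simps)
    also have "\<dots> \<le> (1 + \<epsilon> / 8) * (V * S')" using b(2) pos by (intro mult_right_mono) auto
    finally have 1: "(1 - \<epsilon> / 8) * I \<le> (1 + \<epsilon> / 8) * (V * S')" .
    have "(1 + \<epsilon> / 8) * ((1 - \<epsilon> / 4) * I) = (1 - \<epsilon> / 8 - \<epsilon> * \<epsilon> / 32) * I" by (simp add: field_simps)
    also have "\<dots> \<le> (1 - \<epsilon> / 8) * I" using I0 by (intro mult_right_mono) auto
    also note 1
    finally show ?thesis using pos by simp
  qed
  have "C' * S' * V \<le> \<eta> * V\<^sup>2 * \<epsilon> / 4"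
  proof -
    have "C' * (V * S') \<le> C' * \<delta>" using sums(2) \<delta>(2) pos(6) by (intro mult_left_mono) auto
    then show ?thesis using \<delta>(5) by (simp add: mult_ac)
  qed
  then have "C' * S' * V \<le> (\<eta> * V * \<epsilon> / 4) * V" by (simp add: power2_eq_square mult_ac)
  then have CS: "C' * S' \<le> \<eta> * V * \<epsilon> / 4" using pos(2) by (simp only: mult_le_cancel_right_pos)
  have "C' * S' * S' \<le> \<eta> * V * \<epsilon> / 4 * S'" using CS pos by (intro mult_right_mono) auto
  then have "2 * (\<eta> * (1 - \<epsilon> / 4)) * (V * S') \<le> 2 * x" using lower by (simp add: algebra_simps power2_eq_square)
  moreover have "2 * (\<eta> * (1 - \<epsilon> / 4)) * ((1 - \<epsilon> / 4) * I) \<le> 2 * (\<eta> * (1 - \<epsilon> / 4)) * (V * S')"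
    using low' pos by (intro mult_left_mono) auto
  moreover have "2 * (\<eta> * (1 - \<epsilon> / 4)) * ((1 - \<epsilon> / 4) * I) = 2 * (\<eta> * I) * (1 - \<epsilon> / 2 + \<epsilon> * \<epsilon> / 16)" by (simp add: field_simps)
  moreover have "2 * (\<eta> * I) * (1 - \<epsilon>) \<le> 2 * (\<eta> * I) * (1 - \<epsilon> / 2 + \<epsilon> * \<epsilon> / 16)"
    using pos I0 by (intro mult_left_mono) (auto simp: add_increasing2)
  ultimately have "2 * (\<eta> * I) * (1 - \<epsilon>) \<le> 2 * x" by linarith
  then have "\<eta> * I - \<epsilon> * \<eta> * I \<le> x" by (simp add: algebra_simps)
  then show ?thesis using up by (simp only: abs_le_iff) linarith
qed

theorem theorem5p1:
  fixes N\<mu> :: "real ^ 'm \<Rightarrow> real" and N\<nu> :: "real ^ 'n \<Rightarrow> real" and \<epsilon> :: real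
  assumes "is_norm N\<mu>" and "is_norm N\<nu>" and "\<epsilon> > 0"
  shows "\<exists>\<delta>>0.
    \<forall>(\<Lambda> :: ((real ^ 'm) \<times> (real ^ 'n)) set) (Q1 :: real) (Q2 :: real) (\<psi> :: real \<Rightarrow> real).
      unimodular_lattice \<Lambda> \<longrightarrow>
      1 \<le> Q1 \<longrightarrow> Q1 \<le> Q2 \<longrightarrow>
      (\<forall>q\<in>{Q1..Q2}. \<psi> q > 0) \<longrightarrow>
      antimono_on {Q1..Q2} (\<lambda>q. \<psi> q / q powr (- (real CARD('n) / real CARD('m)))) \<longrightarrow>
      Q1 \<ge> Irr (max_norm N\<mu> N\<nu>) \<Lambda> / \<delta> \<longrightarrow>
      phi CARD('m) CARD('n) \<psi> Q1 \<le> \<delta> * F CARD('m) CARD('n) \<psi> Q1 Q2 \<longrightarrow>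
      F CARD('m) CARD('n) \<psi> Q1 Q2 \<le> \<delta> \<longrightarrow>
      \<bar>measure lebesgue (unit_matrices \<inter> W N\<mu> N\<nu> \<psi> \<Lambda> Q1 Q2)
          - eta N\<mu> N\<nu> * F CARD('m) CARD('n) \<psi> Q1 Q2\<bar>
        \<le> \<epsilon> * eta N\<mu> N\<nu> * F CARD('m) CARD('n) \<psi> Q1 Q2"
proof -
  interpret two_norms N\<mu> N\<nu> using assms(1,2) by unfold_locales
  let ?m = "CARD('m)" and ?n = "CARD('n)" and ?d = "CARD('m) + CARD('n)"
  let ?\<eta> = "eta N\<mu> N\<nu>"
  \<comment> \<open>With accuracy at most 1, quadratic terms in it are dominated by linear
    ones.\<close>
  define \<epsilon>' where "\<epsilon>' = min \<epsilon> 1"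
  have \<epsilon>': "0 < \<epsilon>'" "\<epsilon>' \<le> 1" "\<epsilon>' \<le> \<epsilon>" using assms(3) by (auto simp: \<epsilon>'_def)
  have mn: "1 \<le> ?m" "1 \<le> ?n" by (simp_all add: Suc_le_eq)
  have d: "2 \<le> ?d" by (rule two_le_CARD_sum)
  have zeta: "1 \<le> zeta_nat ?d" by (rule zeta_nat_ge_1[OF d])
  have \<eta>0: "0 < ?\<eta>" unfolding eta_def using volumes_pos zeta mn by (intro divide_pos_pos mult_pos_pos) auto
  obtain \<tau> where \<tau>: "0 < \<tau>" "\<tau> \<le> 1" "(1 + \<tau>) ^ ?n \<le> 1 + \<epsilon>' / 8"
  proof -
    have "((\<lambda>\<tau>. (1 + \<tau>) ^ ?n) \<longlongrightarrow> (1 + 0) ^ ?n) (at_right (0 :: real))" by (intro tendsto_intros)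
    then have 1: "\<forall>\<^sub>F \<tau> in at_right 0. (1 + \<tau>) ^ ?n < 1 + \<epsilon>' / 8" using \<epsilon>' by (intro order_tendstoD(2)) auto
    have 2: "\<forall>\<^sub>F \<tau> in at_right 0. (0::real) < \<tau> \<and> \<tau> < 1" using eventually_at_right_real[of 0 "1 :: real"] by simp
    from eventually_conj[OF 1 2] obtain \<tau> :: real where "(1 + \<tau>) ^ ?n < 1 + \<epsilon>' / 8 \<and> 0 < \<tau> \<and> \<tau> < 1"
      using eventually_happens'[OF trivial_limit_at_right_real] by blast
    then show ?thesis using that[of \<tau>] by simp
  qed
  let ?b = "(1 + \<tau>) ^ ?n"
  define V where "V = (?b - 1) / ?n"
  have b1: "1 < ?b" using \<tau> mn by (simp add: one_less_power)
  have V0: "0 < V" unfolding V_def using b1 mn by (intro divide_pos_pos) auto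
  \<comment> \<open>The 2 in the denominator of \<open>eta\<close> reflects the identification of r
    with - r, and its factor n cancels the 1 / n in \<open>V\<close>.\<close>
  have w: "V\<mu> * V\<nu> / zeta_nat ?d * (?b - 1) = 2 * ?\<eta> * V" using zeta mn by (simp add: eta_def V_def field_simps)
  define e where "e = ?\<eta> * V * \<epsilon>' / 4"
  have e0: "0 < e" using \<eta>0 V0 \<epsilon>' by (simp add: e_def)
  obtain B1 c1 where B1: "1 \<le> B1" and c1: "0 < c1" and upper:
    "\<And>\<Lambda> a Q1 c N. lattice_min \<Lambda> a \<Longrightarrow> 1 \<le> Q1 \<Longrightarrow> B1 \<le> Q1 * a ^ (2 * ?d - 1) \<Longrightarrow> (\<forall>j\<le>N. 0 < c j \<and> c j \<le> c1) \<Longrightarrow>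
     2 * measure lebesgue (\<Union>j\<le>N. \<Union>r\<in>shell \<Lambda> (Q1 * (1 + \<tau>) ^ j) (Q1 * (1 + \<tau>) ^ Suc j). near 0 (c j) r)
       \<le> (2 * ?\<eta> * V + e) * (\<Sum>j\<le>N. c j ^ ?m * (Q1 * (1 + \<tau>) ^ j) ^ ?n)"
    using shells_upper[OF e0 \<tau>(1,2), unfolded w] by blast
  obtain B2 c2 C' where B2: "1 \<le> B2" and c2: "0 < c2" and C': "0 \<le> C'" and lower:
    "\<And>\<Lambda> a Q1 c N U. lattice_min \<Lambda> a \<Longrightarrow> 1 \<le> Q1 \<Longrightarrow> B2 \<le> Q1 * a ^ (2 * ?d - 1) \<Longrightarrow>
     (\<forall>j<N. 0 < c j \<and> c j \<le> c2) \<Longrightarrow> (\<forall>i j. i \<le> j \<longrightarrow> j < N \<longrightarrow> c j \<le> c i) \<Longrightarrow> U \<in> lmeasurable \<Longrightarrow>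
     (\<forall>j<N. \<forall>r\<in>shell \<Lambda> (Q1 * (1 + \<tau>) ^ j) (Q1 * (1 + \<tau>) ^ Suc j). near 0 (c j) r \<subseteq> U) \<Longrightarrow>
     (2 * ?\<eta> * V - e) * (\<Sum>j<N. c j ^ ?m * (Q1 * (1 + \<tau>) ^ j) ^ ?n)
       - C' * (\<Sum>j<N. c j ^ ?m * (Q1 * (1 + \<tau>) ^ j) ^ ?n)\<^sup>2 \<le> 2 * measure lebesgue U"
    using shells_lower[OF e0 \<tau>(1,2), unfolded w] by blast
  obtain B3 C where B3: "1 \<le> B3" and C: "0 \<le> C" and rough:
    "\<And>\<Lambda> a T c. lattice_min \<Lambda> a \<Longrightarrow> B3 \<le> T * a ^ (2 * ?d - 1) \<Longrightarrow> 0 \<le> c \<Longrightarrow>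
     (\<Sum>r\<in>{r \<in> \<Lambda> \<inter> cball 0 (reach * (2 * T)). T \<le> N\<nu> (snd r)}. measure lebesgue (near 0 c r)) \<le> C * (c ^ ?m * T ^ ?n)"
    using sum_measure_near_rough by blast
  define B where "B = B1 + B2 + B3"
  have B: "B1 \<le> B" "B2 \<le> B" "B3 \<le> B" "0 < B" using B1 B2 B3 by (auto simp: B_def)
  define c0 where "c0 = min 1 (min c1 c2)"
  have c0: "0 < c0" "c0 \<le> 1" "c0 \<le> c1" "c0 \<le> c2" using c1 c2 by (auto simp: c0_def)
  have nc: "0 < nconst" using nconst(1) by linarith
  \<comment> \<open>One summand for each requirement on \<delta> = 1 / K. The power of
    \<open>nconst\<close> accounts for passing from \<open>lambda1\<close> to the Euclidean bound
    lambda1 / nconst.\<close>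
  define K where "K = 1 + 1 / c0 ^ ?m + B * nconst ^ (2 * ?d - 1) + 8 * V / \<epsilon>' + 8 * C / (?\<eta> * \<epsilon>') + 4 * C' / (?\<eta> * V\<^sup>2 * \<epsilon>')"
  have Ks: "1 \<le> K" "1 / c0 ^ ?m \<le> K" "B * nconst ^ (2 * ?d - 1) \<le> K" "8 * V / \<epsilon>' \<le> K" "8 * C / (?\<eta> * \<epsilon>') \<le> K"
    "4 * C' / (?\<eta> * V\<^sup>2 * \<epsilon>') \<le> K"
  proof -
    have "0 \<le> 1 / c0 ^ ?m" "0 \<le> B * nconst ^ (2 * ?d - 1)" "0 \<le> 8 * V / \<epsilon>'" "0 \<le> 8 * C / (?\<eta> * \<epsilon>')" "0 \<le> 4 * C' / (?\<eta> * V\<^sup>2 * \<epsilon>')"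
      using c0 B nc V0 \<epsilon>' C C' \<eta>0 by simp_all
    then show "1 \<le> K" "1 / c0 ^ ?m \<le> K" "B * nconst ^ (2 * ?d - 1) \<le> K" "8 * V / \<epsilon>' \<le> K" "8 * C / (?\<eta> * \<epsilon>') \<le> K"
      "4 * C' / (?\<eta> * V\<^sup>2 * \<epsilon>') \<le> K" unfolding K_def by linarith+
  qed
  define \<delta> where "\<delta> = 1 / K"
  have \<delta>0: "0 < \<delta>" using Ks(1) by (simp add: \<delta>_def)
  have inv: "x * \<delta> \<le> y" if "x / y \<le> K" "0 < y" for x y
    using that Ks(1) by (simp add: \<delta>_def field_simps)
  have \<delta>: "\<delta> \<le> 1" "\<delta> \<le> c0 ^ ?m" "V * \<delta> \<le> \<epsilon>' / 8" "C * \<delta> \<le> ?\<eta> * \<epsilon>' / 8" "C' * \<delta> \<le> ?\<eta> * V\<^sup>2 * \<epsilon>' / 4"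
    using inv[of 1 1] inv[of 1 "c0 ^ ?m"] inv[of V "\<epsilon>' / 8"] inv[of C "?\<eta> * \<epsilon>' / 8"] inv[of C' "?\<eta> * V\<^sup>2 * \<epsilon>' / 4"]
      Ks c0 \<epsilon>' \<eta>0 V0 by (simp_all add: mult.commute)
  show ?thesis
  proof (rule exI[of _ \<delta>], rule conjI[OF \<delta>0], intro allI impI)
    fix \<Lambda> :: "((real ^ 'm) \<times> (real ^ 'n)) set" and Q1 Q2 :: real and \<psi> :: "real \<Rightarrow> real"
    assume \<Lambda>: "unimodular_lattice \<Lambda>" and Q1: "1 \<le> Q1" and Q12: "Q1 \<le> Q2" and pos: "\<forall>q\<in>{Q1..Q2}. \<psi> q > 0"
      and anti: "antimono_on {Q1..Q2} (\<lambda>q. \<psi> q / q powr (- (real ?n / real ?m)))"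
      and irr: "Q1 \<ge> Irr (max_norm N\<mu> N\<nu>) \<Lambda> / \<delta>"
      and ph: "phi ?m ?n \<psi> Q1 \<le> \<delta> * F ?m ?n \<psi> Q1 Q2" and F\<delta>: "F ?m ?n \<psi> Q1 Q2 \<le> \<delta>"
    let ?l = "lambda1 (max_norm N\<mu> N\<nu>) \<Lambda>" and ?I = "F ?m ?n \<psi> Q1 Q2" and ?X = "unit_matrices \<inter> W N\<mu> N\<nu> \<psi> \<Lambda> Q1 Q2"
    let ?a = "?l / nconst"
    let ?T = "\<lambda>j. Q1 * (1 + \<tau>) ^ j"
    have l0: "0 < ?l" and lm: "lattice_min \<Lambda> ?a" by (rule lattice_min_lambda1[OF \<Lambda>])+
    interpret lattice_min \<Lambda> ?a by (rule lm)
    have uL: "unimodular \<Lambda>" by unfold_locales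
    have BQ: "B \<le> Q1 * ?a ^ (2 * ?d - 1)"
    proof -
      have "K / ?l ^ (2 * ?d - 1) \<le> Q1" using irr by (simp only: Irr_def DIM_pair_cart \<delta>_def) simp
      then have "K \<le> Q1 * ?l ^ (2 * ?d - 1)" using l0 by (simp only: pos_divide_le_eq zero_less_power)
      then have "B * nconst ^ (2 * ?d - 1) \<le> Q1 * ?l ^ (2 * ?d - 1)" using Ks(3) by linarith
      then show ?thesis using nc by (simp only: power_divide times_divide_eq_right pos_le_divide_eq zero_less_power)
    qed
    note \<psi> = approximating_function_facts[OF Q1 _ mn anti]
    have anti\<psi>: "antimono_on {Q1..Q2} \<psi>" and anti\<phi>: "antimono_on {Q1..Q2} (phi ?m ?n \<psi>)"
      and int: "(\<lambda>q. q ^ (?n - 1) * \<psi> q ^ ?m) integrable_on {Q1..Q2}"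
      by (rule \<psi>, use pos in blast)+
    obtain N where N: "?T N \<le> Q2" "Q2 < ?T (Suc N)"
    proof -
      obtain k where "Q2 / Q1 < (1 + \<tau>) ^ k" using real_arch_pow[of "1 + \<tau>"] \<tau> by auto
      then have k: "Q2 < ?T k" using Q1 by (simp add: field_simps)
      let ?M = "LEAST k. Q2 < ?T k"
      have M: "Q2 < ?T ?M" by (rule LeastI[of "\<lambda>k. Q2 < ?T k", OF k])
      then have "?M \<noteq> 0" using Q12 by (cases "?M = 0") auto
      then obtain N where MN: "?M = Suc N" by (cases ?M) auto
      then have "\<not> Q2 < ?T N" using not_less_Least[of N "\<lambda>k. Q2 < ?T k"] by simp
      then show ?thesis using M unfolding MN by (intro that[of N]) auto
    qed
    have T_mono: "?T i \<le> ?T j" if "i \<le> j" for i j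
      using Q1 \<tau> that by (intro mult_left_mono power_increasing) auto
    have T_in: "?T j \<in> {Q1..Q2}" if "j \<le> N" for j
      using T_mono[of 0 j] T_mono[OF that] N(1) by simp
    let ?g = "\<lambda>q. \<psi> q ^ ?m"
    let ?S = "\<Sum>j\<le>N. \<psi> (?T j) ^ ?m * ?T j ^ ?n" and ?S' = "\<Sum>j<N. \<psi> (?T (Suc j)) ^ ?m * ?T j ^ ?n"
    have sums: "?I \<le> V * ?S" "V * ?S' \<le> ?I"
    proof -
      have "antimono_on {Q1..Q2} ?g"
      proof (rule monotone_onI)
        fix x y assume "x \<in> {Q1..Q2}" "y \<in> {Q1..Q2}" "x \<le> y"
        then show "?g y \<le> ?g x" using monotone_onD[OF anti\<psi>, of x y] pos by (intro power_mono) (auto simp: less_imp_le)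
      qed
      moreover have "0 \<le> ?g q" if "q \<in> {Q1..Q2}" for q using pos that by (simp add: less_imp_le)
      moreover have "0 < Q1" "1 < 1 + \<tau>" using Q1 \<tau> by auto
      ultimately show "?I \<le> V * ?S" "V * ?S' \<le> ?I"
        using geometric_integral_bounds[of Q1 "1 + \<tau>" ?n Q2 ?g N] mn(2) int N unfolding F_def V_def by blast+
    qed
    \<comment> \<open>The term j = 0 of the upper sum is phi(Q1); each later one is the preceding
      term of the lower sum multiplied by the growth factor of q^n.\<close>
    have S_eq: "?S = ?b * ?S' + phi ?m ?n \<psi> Q1"
    proof -
      have "?S = \<psi> (?T 0) ^ ?m * ?T 0 ^ ?n + (\<Sum>j<N. \<psi> (?T (Suc j)) ^ ?m * ?T (Suc j) ^ ?n)"
        by (rule sum.atMost_shift)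
      also have "(\<Sum>j<N. \<psi> (?T (Suc j)) ^ ?m * ?T (Suc j) ^ ?n) = ?b * ?S'"
        unfolding sum_distrib_left by (intro sum.cong refl) (simp add: power_mult_distrib mult_ac)
      finally show ?thesis by (simp add: phi_def mult_ac)
    qed
    have S'0: "0 \<le> ?S'"
    proof (intro sum_nonneg mult_nonneg_nonneg zero_le_power)
      fix j assume "j \<in> {..<N}"
      then have "?T (Suc j) \<in> {Q1..Q2}" by (intro T_in) simp
      then show "0 \<le> \<psi> (?T (Suc j))" using pos by (simp only: less_imp_le)
      show "0 \<le> Q1" "0 \<le> 1 + \<tau>" using Q1 \<tau> by auto
    qed
    have I0: "0 \<le> ?I" using sums(2) mult_nonneg_nonneg[OF less_imp_le[OF V0] S'0] by linarith
    \<comment> \<open>Since q >= 1, \<psi>(q)^m <= phi(q) <= phi(Q1) <= \<delta> F <= \<delta>,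
      using F <= \<delta> <= 1. The smallness of the radii thus comes from the hypotheses on phi(Q1)
      and F.\<close>
    have small: "\<psi> q \<le> c0" if q: "q \<in> {Q1..Q2}" for q
    proof (rule power_le_imp_le_base)
      have "1 * \<psi> q ^ ?m \<le> q ^ ?n * \<psi> q ^ ?m"
        using q Q1 pos by (intro mult_right_mono one_le_power zero_le_power) (auto simp: less_imp_le)
      also have "\<dots> \<le> phi ?m ?n \<psi> Q1" using monotone_onD[OF anti\<phi>, of Q1 q] q by (simp add: phi_def)
      also have "\<dots> \<le> \<delta> * ?I" by (rule ph)
      also have "\<dots> \<le> \<delta> * 1" using F\<delta> \<delta> \<delta>0 by (intro mult_left_mono) auto
      also have "\<dots> \<le> c0 ^ ?m" using \<delta> by simp
      finally show "\<psi> q ^ Suc (?m - 1) \<le> c0 ^ Suc (?m - 1)" using mn by simp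
    qed (use c0 in simp)
    have \<psi>1: "0 < \<psi> q \<and> \<psi> q \<le> 1" if "q \<in> {Q1..Q2}" for q using small[OF that] pos that c0 by auto
    have Xm: "?X \<in> lmeasurable" by (rule unit_matrices_W_lmeasurable[OF uL _ Q1]) (use \<psi>1 in blast)
    let ?Y = "\<Union>j\<le>N. \<Union>r\<in>shell \<Lambda> (?T j) (?T (Suc j)). near 0 (\<psi> (?T j)) r"
    let ?R = "{r \<in> \<Lambda> \<inter> cball 0 (reach * (2 * Q1)). Q1 \<le> N\<nu> (snd r)}"
    let ?Z = "\<Union>r\<in>?R. near 0 (\<psi> Q1) r"
    have up: "2 * measure lebesgue ?X \<le> (2 * ?\<eta> * V + ?\<eta> * V * \<epsilon>' / 4) * ?S + 2 * (C * phi ?m ?n \<psi> Q1)"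
    proof -
      have finR: "finite ?R" by (rule finite_subset[OF _ finite_bounded[OF bounded_cball[of 0 "reach * (2 * Q1)"]]]) auto
      have Ym: "?Y \<in> lmeasurable" using finite_shell[OF uL] by (intro fmeasurable.finite_UN) auto
      have Zm: "?Z \<in> lmeasurable" using finR by (intro fmeasurable.finite_UN) auto
      have "?X \<subseteq> ?Y \<union> ?Z" by (rule unit_matrices_W_subset[OF uL Q1 \<tau>(1) N(2) anti\<psi> \<psi>1])
      then have "measure lebesgue ?X \<le> measure lebesgue (?Y \<union> ?Z)"
        using Xm Ym Zm by (intro measure_mono_fmeasurable fmeasurable.Un) auto
      also have "\<dots> \<le> measure lebesgue ?Y + measure lebesgue ?Z"
        using Ym Zm by (intro measure_Un_le) auto
      also have "measure lebesgue ?Z \<le> (\<Sum>r\<in>?R. measure lebesgue (near 0 (\<psi> Q1) r))"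
        using finR by (intro measure_UNION_le) auto
      also have "\<dots> \<le> C * (\<psi> Q1 ^ ?m * Q1 ^ ?n)"
        using BQ B \<psi>1[of Q1] Q12 by (intro rough[OF lm]) auto
      finally have "measure lebesgue ?X \<le> measure lebesgue ?Y + C * phi ?m ?n \<psi> Q1" by (simp add: phi_def mult_ac)
      moreover have "2 * measure lebesgue ?Y \<le> (2 * ?\<eta> * V + e) * ?S"
      proof (rule upper[OF lm Q1])
        show "B1 \<le> Q1 * ?a ^ (2 * ?d - 1)" using BQ B by linarith
        show "\<forall>j\<le>N. 0 < \<psi> (?T j) \<and> \<psi> (?T j) \<le> c1"
          using small[OF T_in] \<psi>1[OF T_in] c0 by force
      qed
      ultimately show ?thesis unfolding e_def by linarith
    qed
    have low: "(2 * ?\<eta> * V - ?\<eta> * V * \<epsilon>' / 4) * ?S' - C' * ?S'\<^sup>2 \<le> 2 * measure lebesgue ?X"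
      unfolding e_def[symmetric]
    proof (rule lower[OF lm Q1 _ _ _ Xm])
      show "B2 \<le> Q1 * ?a ^ (2 * ?d - 1)" using BQ B by linarith
      show "\<forall>j<N. 0 < \<psi> (?T (Suc j)) \<and> \<psi> (?T (Suc j)) \<le> c2"
      proof (intro allI impI)
        fix j assume "j < N"
        then have "?T (Suc j) \<in> {Q1..Q2}" by (intro T_in) simp
        then show "0 < \<psi> (?T (Suc j)) \<and> \<psi> (?T (Suc j)) \<le> c2" using small \<psi>1 c0 by force
      qed
      show "\<forall>i j. i \<le> j \<longrightarrow> j < N \<longrightarrow> \<psi> (?T (Suc j)) \<le> \<psi> (?T (Suc i))"
      proof (intro allI impI)
        fix i j assume ij: "i \<le> j" "j < N"
        show "\<psi> (?T (Suc j)) \<le> \<psi> (?T (Suc i))"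
          by (rule monotone_onD[OF anti\<psi> T_in T_in T_mono]) (use ij in auto)
      qed
      show "\<forall>j<N. \<forall>r\<in>shell \<Lambda> (?T j) (?T (Suc j)). near 0 (\<psi> (?T (Suc j))) r \<subseteq> ?X"
      proof (intro allI impI ballI)
        fix j r assume j: "j < N" and r: "r \<in> shell \<Lambda> (?T j) (?T (Suc j))"
        have "?T j \<in> {Q1..Q2}" "?T (Suc j) \<in> {Q1..Q2}" by (rule T_in, use j in simp)+
        then show "near 0 (\<psi> (?T (Suc j))) r \<subseteq> ?X"
          using r by (intro near_subset_W anti\<psi>) (auto simp: shell_def primitive_def)
      qed
    qed
    have "\<bar>measure lebesgue ?X - ?\<eta> * ?I\<bar> \<le> \<epsilon>' * ?\<eta> * ?I"
      by (rule relative_error_bound[OF \<eta>0 V0 \<epsilon>'(1,2) C C' S'0 less_imp_le[OF b1] \<tau>(3) sums S_eq ph F\<delta> \<delta>(3,4,5) up low])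
    also have "\<dots> \<le> \<epsilon> * ?\<eta> * ?I" using \<epsilon>' \<eta>0 I0 by (intro mult_right_mono) auto
    finally show "\<bar>measure lebesgue ?X - ?\<eta> * ?I\<bar> \<le> \<epsilon> * ?\<eta> * ?I" .
  qed
qed

end
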